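(* For all integers $N\ge 1$, $p\ge 2$, $k\in\{0,\dots,N-1\}$, and all Borel sets $B\subset\mathbb R$, $$\mathbb E[\mathrm{Crt}_{N,k}(B)] = 2\sqrt{\frac 2p}\,(p-1)^{\frac N2}\;\mathbb E^N_{\mathrm{GOE}}\bigg[ e^{-N\frac{p-2}{2p}(\lambda^N_k)^2}\,\mathbf 1\Big\{\lambda^N_k\in \sqrt{\tfrac{p}{2(p-1)}}\,B\Big\}\bigg].$$
   Context: Let $S^{N-1}(\sqrt N)\subset\mathbb R^N$ be the Euclidean sphere of radius $\sqrt N$ centered at $0$. The Hamiltonian of the $p$-spin spherical spin glass is the random function on $S^{N-1}(\sqrt N)$ $$H_{N,p}(\boldsymbol\sigma)=\frac{1}{N^{(p-1)/2}}\sum_{i_1,\dots,i_p=1}^N J_{i_1,\dots,i_p}\,\sigma_{i_1}\cdots\sigma_{i_p},$$ where the $J_{i_1,\dots,i_p}$ are independent standard Gaussian random variables. For a Borel set $B\subset\mathbb R$ and an integer $0\le k<N$, $\mathrm{Crt}_{N,k}(B)$ is the (random) number of points $\boldsymbol\sigma\in S^{N-1}(\sqrt N)$ with $\nabla H_{N,p}(\boldsymbol\sigma)=0$, $H_{N,p}(\boldsymbol\sigma)\in NB=\{Nx:x\in B\}$ and $i(\nabla^2H_{N,p}(\boldsymbol\sigma))=k$. Here $\nabla,\nabla^2$ are the gradient and (covariant) Hessian on the sphere, and $i(\cdot)$ is the number of negative eigenvalues. (For $N=1$ both points of the sphere count as critical points of index $0$.) GOE: $\mathbb E^N_{\mathrm{GOE}}$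 is the expectation for the $N\times N$ real symmetric random matrix $M^N$ whose entries $(M_{ij})_{i\le j}$ are independent centered Gaussians with $\mathbb E M_{ij}^2=\frac{1+\delta_{ij}}{2N}$; its ordered eigenvalues are $\lambda_0^N\le\lambda_1^N\le\dots\le\lambda^N_{N-1}$. For $c>0$, $cB=\{cx:x\in B\}$. *)

theory Defs
  imports "HOL-Probability.Probability"
begin

section \<open>The Hamiltonian\<close>

text \<open>The dimension is \<open>N = CARD('n)\<close>. A multi-index \<open>(i\<^sub>1, \<dots>, i\<^sub>p)\<close> is a list of length \<open>p\<close>.
  The defining formula is taken on all of \<open>real ^ 'n\<close>; only its values on the sphere of radius
  \<open>\<surd>N\<close> matter, see below.\<close>

definition spin_hamiltonian :: "nat \<Rightarrow> ('n list \<Rightarrow> real) \<Rightarrow> real ^ 'n \<Rightarrow> real" where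
  "spin_hamiltonian p J \<sigma> =
     1 / real CARD('n) powr ((real p - 1) / 2) *
     (\<Sum>is | length is = p. J is * (\<Prod>i\<leftarrow>is. \<sigma> $ i))"


section \<open>Gradient and covariant Hessian on a centered sphere\<close>

text \<open>For a smooth \<open>f\<close> defined near a sphere centered at \<open>0\<close>, the Riemannian gradient of the
  restriction of \<open>f\<close> is the tangential part of the Euclidean gradient. The Levi-Civita connection
  of the sphere is the tangential part of the ambient derivative, so the covariant Hessian at \<open>x\<close>,
  as an endomorphism of the tangent space, sends \<open>v\<close> to the covariant derivative of the gradient
  field in direction \<open>v\<close>. At points of the sphere, and for tangent \<open>v\<close>, both depend only on the
  restriction of \<open>f\<close> to the sphere through \<open>x\<close>.\<close>

definition tangent_space :: "'a::euclidean_space \<Rightarrow> 'a set" where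
  "tangent_space x = {v. x \<bullet> v = 0}"

definition tangent_proj :: "'a::euclidean_space \<Rightarrow> 'a \<Rightarrow> 'a" where
  "tangent_proj x u = u - ((x \<bullet> u) / (x \<bullet> x)) *\<^sub>R x"

definition sphere_grad :: "('a::euclidean_space \<Rightarrow> real) \<Rightarrow> 'a \<Rightarrow> 'a" where
  "sphere_grad f x = tangent_proj x (THE D. GDERIV f x :> D)"

definition sphere_hess :: "('a::euclidean_space \<Rightarrow> real) \<Rightarrow> 'a \<Rightarrow> 'a \<Rightarrow> 'a" where
  "sphere_hess f x v = tangent_proj x (frechet_derivative (sphere_grad f) (at x) v)"


section \<open>Ordered eigenvalues\<close>

text \<open>The eigenvalues of an endomorphism \<open>A\<close> of a subspace \<open>V\<close>, in increasing order and repeated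
  according to the dimension of the eigenspace. This is used only for self-adjoint \<open>A\<close>, where
  geometric and algebraic multiplicities agree and the list has length \<open>dim V\<close>.\<close>

definition eigenspace_on :: "'a::euclidean_space set \<Rightarrow> ('a \<Rightarrow> 'a) \<Rightarrow> real \<Rightarrow> 'a set" where
  "eigenspace_on V A c = {v \<in> V. A v = c *\<^sub>R v}"

definition eigenvalues_on :: "'a::euclidean_space set \<Rightarrow> ('a \<Rightarrow> 'a) \<Rightarrow> real list" where
  "eigenvalues_on V A =
     concat (map (\<lambda>c. replicate (dim (eigenspace_on V A c)) c)
       (sorted_list_of_set {c. \<exists>v \<in> eigenspace_on V A c. v \<noteq> 0}))"

definition index_on :: "'a::euclidean_space set \<Rightarrow> ('a \<Rightarrow> 'a) \<Rightarrow> nat" where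
  "index_on V A = length (filter (\<lambda>c. c < 0) (eigenvalues_on V A))"

definition ordered_eigenvalue :: "real ^ 'n ^ 'n \<Rightarrow> nat \<Rightarrow> real" where
  "ordered_eigenvalue A k = eigenvalues_on UNIV (\<lambda>v. A *v v) ! k"


section \<open>Critical points of index \<open>k\<close>\<close>

definition crit_points ::
    "(real ^ 'n \<Rightarrow> real) \<Rightarrow> nat \<Rightarrow> real set \<Rightarrow> (real ^ 'n) set" where
  "crit_points H k B =
     {\<sigma> \<in> sphere 0 (sqrt (real CARD('n))).
        sphere_grad H \<sigma> = 0 \<and>
        H \<sigma> \<in> (\<lambda>x. real CARD('n) * x) ` B \<and>
        index_on (tangent_space \<sigma>) (sphere_hess H \<sigma>) = k}"

text \<open>Valued in \<open>ennreal\<close>, so that an infinite set of critical points counts as \<open>\<infinity>\<close>.\<close>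

definition crt :: "(real ^ 'n \<Rightarrow> real) \<Rightarrow> nat \<Rightarrow> real set \<Rightarrow> ennreal" where
  "crt H k B = emeasure (count_space UNIV) (crit_points H k B)"


section \<open>The Gaussian orthogonal ensemble\<close>

text \<open>The independent entries \<open>M\<^sub>i\<^sub>j\<close>, \<open>i \<le> j\<close>, are indexed by the unordered pairs \<open>{i, j}\<close> (singletons
  on the diagonal), which avoids choosing an order on the index type and makes \<open>M\<close> symmetric.\<close>

definition goe :: "(real ^ 'n ^ 'n) measure" where
  "goe = distr
     (\<Pi>\<^sub>M e \<in> {{i, j} | i j :: 'n. True}.
        density lborel
          (normal_density 0 (sqrt ((1 + of_bool (is_singleton e)) / (2 * real CARD('n))))))
     borel (\<lambda>g. \<chi> i j. g {i, j})"

end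

theory Submission
  imports Defs
begin

text \<open>The point \<open>\<sigma>\<close> and its energy are encoded in \<open>y = r \<sigma> / |\<sigma>|\<close>, with \<open>ln r\<close> proportional to the energy. The
  critical points become the zeros of a Gaussian vector field on \<open>N\<close>-space. Some \<open>N\<close> of its coefficients
  determine its value at \<open>y\<close> bijectively and linearly; integrating these out first and changing variables
  gives a Kac--Rice formula without any regularity theory. By rotation invariance the resulting density is
  \<open>c(p) r\<^sup>-\<^sup>N exp (- (p - 1) / (2 p) (ln r)\<^sup>2) \<Psi>(ln r)\<close>, where \<open>\<Psi>\<close> does not depend on \<open>p\<close>. Hence the general
  case follows from \<open>p = 2\<close> by comparing the explicit factors. For \<open>p = 2\<close> the Hamiltonian is the
  quadratic form of a multiple of a matrix from the Gaussian orthogonal ensemble, whose eigenvalues are almost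
  surely simple: the critical points of index \<open>k\<close> are the two multiples of an eigenvector for \<open>\<lambda>\<^sub>k\<close>.\<close>

section \<open>Homogeneous forms by recursion on the degree, with Euler's identities\<close>

section \<open>Homogeneous forms\<close>

text \<open>A critical point on the sphere satisfies N - 1 tangential equations; in the full
  Lagrange equation the multiplier is an extra unknown, and storing it in the radius restores N
  equations in N unknowns. The logarithm makes the radial entry of the Jacobian constant, and the
  unit sqrt(p (p - 1)) is the standard deviation of an off-diagonal tangential Hessian entry;
  together they remove p from \<Psi>. Three obstacles shape the proof. The block of coefficients
  works only where one coordinate of y is nonzero, so zeros elsewhere must be excluded almost
  surely. The density read off from that block is hard to evaluate; equality in law with a rotated
  model identifies it only almost everywhere, and continuity in the prescribed value of the gradient
  fixes it pointwise. Counts are directly seen to be measurable only for closed energy sets and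
  indices at most k, so the remaining cases need differences of finite counts. The expected absolute
  determinant of a shifted random matrix is never evaluated: degree 2, where the count is known,
  supplies its integrals.\<close>

primrec pform :: "nat \<Rightarrow> ('n::finite list \<Rightarrow> real) \<Rightarrow> real ^ 'n \<Rightarrow> real" where
  "pform 0 J y = J []"
| "pform (Suc p) J y = (\<Sum>i\<in>UNIV. y $ i * pform p (\<lambda>l. J (i # l)) y)"

text \<open>Splitting off the first index reduces differentiation to one product rule per degree.
  Coefficients are not assumed symmetric, so in \<open>phess\<close> the two orders of a mixed
  derivative appear as separate terms.\<close>

primrec pgrad :: "nat \<Rightarrow> ('n::finite list \<Rightarrow> real) \<Rightarrow> real ^ 'n \<Rightarrow> real ^ 'n" where
  "pgrad 0 J y = 0"
| "pgrad (Suc p) J y =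
     (\<chi> j. pform p (\<lambda>l. J (j # l)) y + (\<Sum>i\<in>UNIV. y $ i * pgrad p (\<lambda>l. J (i # l)) y $ j))"

primrec phess :: "nat \<Rightarrow> ('n::finite list \<Rightarrow> real) \<Rightarrow> real ^ 'n \<Rightarrow> real ^ 'n ^ 'n" where
  "phess 0 J y = 0"
| "phess (Suc p) J y =
     (\<chi> j k. pgrad p (\<lambda>l. J (j # l)) y $ k + pgrad p (\<lambda>l. J (k # l)) y $ j +
       (\<Sum>i\<in>UNIV. y $ i * phess p (\<lambda>l. J (i # l)) y $ j $ k))"

lemma lists_length_Suc: "{is :: 'n list. length is = Suc p} = (\<lambda>(i, l). i # l) ` (UNIV \<times> {l. length l = p})"
  by (auto simp: length_Suc_conv image_iff)

lemma finite_lists_length [simp]: "finite {is :: 'n::finite list. length is = p}"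
  using finite_lists_length_eq[of "UNIV :: 'n set" p] by simp

lemma pform_eq_sum: "pform p J y = (\<Sum>is | length is = p. J is * (\<Prod>i\<leftarrow>is. y $ i))"
proof (induction p arbitrary: J)
  case (Suc p)
  have "(\<Sum>is | length is = Suc p. J is * (\<Prod>i\<leftarrow>is. y $ i)) =
      (\<Sum>(i,l)\<in>UNIV \<times> {l. length l = p}. J (i # l) * (\<Prod>i\<leftarrow>i#l. y $ i))"
    unfolding lists_length_Suc by (subst sum.reindex) (auto simp: inj_on_def split_def)
  also have "\<dots> = (\<Sum>i\<in>UNIV. y $ i * (\<Sum>l | length l = p. J (i # l) * (\<Prod>i\<leftarrow>l. y $ i)))"
    by (simp add: sum.cartesian_product[symmetric] sum_distrib_left mult_ac)
  finally show ?case by (simp add: Suc)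
qed simp

text \<open>The Gaussian measure will live on lists of every length, whereas the hypotheses of the
  theorem concern length \<open>p\<close>; this and the next two lemmas bridge the two.\<close>

lemma pform_cong: "(\<And>l. length l = p \<Longrightarrow> J l = K l) \<Longrightarrow> pform p J y = pform p K y"
  by (simp add: pform_eq_sum)

lemma pgrad_cong: "(\<And>l. length l = p \<Longrightarrow> J l = K l) \<Longrightarrow> pgrad p J y = pgrad p K y"
proof (induction p arbitrary: J K)
  case (Suc p)
  have "pform p (\<lambda>l. J (j # l)) y = pform p (\<lambda>l. K (j # l)) y"
       "pgrad p (\<lambda>l. J (j # l)) y = pgrad p (\<lambda>l. K (j # l)) y" for j
    using Suc.prems by (auto intro!: pform_cong Suc.IH)
  then show ?case by simp
qed simp

lemma phess_cong: "(\<And>l. length l = p \<Longrightarrow> J l = K l) \<Longrightarrow> phess p J y = phess p K y"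
proof (induction p arbitrary: J K)
  case (Suc p)
  have "pgrad p (\<lambda>l. J (j # l)) y = pgrad p (\<lambda>l. K (j # l)) y"
       "phess p (\<lambda>l. J (j # l)) y = phess p (\<lambda>l. K (j # l)) y" for j
    using Suc.prems by (auto intro!: pgrad_cong Suc.IH)
  then show ?case by simp
qed simp

lemma pform_add: "pform p (\<lambda>l. J l + K l) y = pform p J y + pform p K y"
  by (simp add: pform_eq_sum distrib_right sum.distrib)

lemma pgrad_add: "pgrad p (\<lambda>l. J l + K l) y = pgrad p J y + pgrad p K y"
proof (induction p arbitrary: J K)
  case (Suc p)
  show ?case by (simp add: vec_eq_iff pform_add Suc sum.distrib distrib_left)
qed simp

lemma has_derivative_vec_lambda:
  fixes f :: "'a::real_normed_vector \<Rightarrow> 'n::finite \<Rightarrow> real"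
  assumes "\<And>j. ((\<lambda>x. f x j) has_derivative (\<lambda>v. f' v j)) (at y)"
  shows "((\<lambda>x. \<chi> j. f x j) has_derivative (\<lambda>v. \<chi> j. f' v j)) (at y)"
  using assms
  by (subst has_derivative_componentwise_within) (auto simp: inner_axis Basis_vec_def)

lemma pform_has_derivative:
  "(pform p J has_derivative (\<lambda>v. pgrad p J y \<bullet> v)) (at y)"
proof (induction p arbitrary: J)
  case (Suc p)
  have eq: "pform (Suc p) J = (\<lambda>y. \<Sum>i\<in>UNIV. y $ i * pform p (\<lambda>l. J (i # l)) y)"
    by (simp add: fun_eq_iff)
  have "((\<lambda>y. \<Sum>i\<in>UNIV. y $ i * pform p (\<lambda>l. J (i # l)) y) has_derivative
     (\<lambda>v. \<Sum>i\<in>UNIV. y $ i * (pgrad p (\<lambda>l. J (i # l)) y \<bullet> v) + v $ i * pform p (\<lambda>l. J (i # l)) y)) (at y)"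
    by (intro has_derivative_sum has_derivative_mult Suc bounded_linear_imp_has_derivative bounded_linear_vec_nth)
  also have "(\<lambda>v. \<Sum>i\<in>UNIV. y $ i * (pgrad p (\<lambda>l. J (i # l)) y \<bullet> v) + v $ i * pform p (\<lambda>l. J (i # l)) y) =
     (\<lambda>v. pgrad (Suc p) J y \<bullet> v)"
  proof
    fix v
    have "(\<Sum>i\<in>UNIV. y $ i * (pgrad p (\<lambda>l. J (i # l)) y \<bullet> v)) =
      (\<Sum>j\<in>UNIV. (\<Sum>i\<in>UNIV. y $ i * pgrad p (\<lambda>l. J (i # l)) y $ j) * v $ j)"
      unfolding inner_vec_def sum_distrib_left sum_distrib_right
      by (subst sum.swap) (simp add: mult_ac)
    then show "(\<Sum>i\<in>UNIV. y $ i * (pgrad p (\<lambda>l. J (i # l)) y \<bullet> v) + v $ i * pform p (\<lambda>l. J (i # l)) y) =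
      pgrad (Suc p) J y \<bullet> v"
      by (simp add: sum.distrib inner_vec_def[of "vec_lambda _"] distrib_right distrib_left mult_ac)
  qed
  finally show ?case unfolding eq .
next
  case 0
  have "pform 0 J = (\<lambda>y. J [])" "(\<bullet>) 0 = (\<lambda>v::real^'a. 0)" for J :: "'a list \<Rightarrow> real" by (auto simp: fun_eq_iff)
  then show ?case by simp
qed

lemma pgrad_has_derivative:
  "(pgrad p J has_derivative (\<lambda>v. phess p J y *v v)) (at y)"
proof (induction p arbitrary: J)
  case 0
  have "pgrad 0 J = (\<lambda>y. 0)" by (simp add: fun_eq_iff)
  then show ?case by simp
next
  case (Suc p)
  have eq: "pgrad (Suc p) J = (\<lambda>y. \<chi> j. pform p (\<lambda>l. J (j # l)) y + (\<Sum>i\<in>UNIV. y $ i * pgrad p (\<lambda>l. J (i # l)) y $ j))"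
    by (simp add: fun_eq_iff)
  have c: "((\<lambda>y. pgrad p J y $ j) has_derivative (\<lambda>v. (phess p J y *v v) $ j)) (at y)" for J j
    by (intro bounded_linear.has_derivative[OF bounded_linear_vec_nth] Suc)
  have "((\<lambda>y. \<chi> j. pform p (\<lambda>l. J (j # l)) y + (\<Sum>i\<in>UNIV. y $ i * pgrad p (\<lambda>l. J (i # l)) y $ j))
    has_derivative (\<lambda>v. \<chi> j. pgrad p (\<lambda>l. J (j # l)) y \<bullet> v +
       (\<Sum>i\<in>UNIV. y $ i * (phess p (\<lambda>l. J (i # l)) y *v v) $ j + v $ i * pgrad p (\<lambda>l. J (i # l)) y $ j))) (at y)"
    by (intro has_derivative_vec_lambda has_derivative_add has_derivative_sum has_derivative_mult c
       pform_has_derivative bounded_linear_imp_has_derivative bounded_linear_vec_nth)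
  also have "(\<lambda>v. \<chi> j. pgrad p (\<lambda>l. J (j # l)) y \<bullet> v +
       (\<Sum>i\<in>UNIV. y $ i * (phess p (\<lambda>l. J (i # l)) y *v v) $ j + v $ i * pgrad p (\<lambda>l. J (i # l)) y $ j)) =
      (\<lambda>v. phess (Suc p) J y *v v)"
  proof (intro ext, simp add: vec_eq_iff, intro allI)
    fix v :: "real ^ 'a" and j
    have "(\<Sum>i\<in>UNIV. y $ i * (phess p (\<lambda>l. J (i # l)) y *v v) $ j) =
       (\<Sum>k\<in>UNIV. (\<Sum>i\<in>UNIV. y $ i * phess p (\<lambda>l. J (i # l)) y $ j $ k) * v $ k)"
      unfolding matrix_vector_mult_def sum_distrib_left sum_distrib_right vec_lambda_beta
      by (subst sum.swap) (simp add: mult_ac)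
    then show "pgrad p (\<lambda>l. J (j # l)) y \<bullet> v +
       (\<Sum>i\<in>UNIV. y $ i * (phess p (\<lambda>l. J (i # l)) y *v v) $ j + v $ i * pgrad p (\<lambda>l. J (i # l)) y $ j) =
        ((\<chi> j k. pgrad p (\<lambda>l. J (j # l)) y $ k + pgrad p (\<lambda>l. J (k # l)) y $ j +
            (\<Sum>i\<in>UNIV. y $ i * phess p (\<lambda>l. J (i # l)) y $ j $ k)) *v v) $ j"
      by (simp add: matrix_vector_mult_def[of "\<chi> j k. _ j k"] sum.distrib inner_vec_def distrib_right distrib_left mult_ac)
  qed
  finally show ?case unfolding eq .
qed

lemma transpose_phess: "transpose (phess p J y) = phess p J y"
proof -
  have "phess p J y $ j $ k = phess p J y $ k $ j" for j k
  proof (induction p arbitrary: J)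
    case (Suc p)
    show ?case by (simp add: Suc[of "\<lambda>l. J (_ # l)"])
  qed simp
  then show ?thesis by (simp add: transpose_def vec_eq_iff)
qed

text \<open>Euler's identity in degree \<open>p\<close>. It yields both the multiplier and the
  energy of a critical point.\<close>

lemma pgrad_inner_self: "pgrad p J y \<bullet> y = real p * pform p J y"
proof (induction p arbitrary: J)
  case (Suc p)
  have "pgrad (Suc p) J y \<bullet> y = (\<Sum>j\<in>UNIV. pform p (\<lambda>l. J (j # l)) y * y $ j) +
     (\<Sum>j\<in>UNIV. \<Sum>i\<in>UNIV. y $ i * pgrad p (\<lambda>l. J (i # l)) y $ j * y $ j)"
    by (simp add: inner_vec_def distrib_right sum.distrib sum_distrib_right)
  also have "(\<Sum>j\<in>UNIV. \<Sum>i\<in>UNIV. y $ i * pgrad p (\<lambda>l. J (i # l)) y $ j * y $ j) =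
     (\<Sum>i\<in>UNIV. y $ i * (pgrad p (\<lambda>l. J (i # l)) y \<bullet> y))"
    by (subst sum.swap) (simp add: inner_vec_def sum_distrib_left mult_ac)
  finally show ?case by (simp add: Suc distrib_right distrib_left sum.distrib sum_distrib_left mult_ac)
qed simp

text \<open>Euler's identity for the gradient, which has degree \<open>p - 1\<close>. For
  \<open>p \<ge> 2\<close> it recovers the gradient at \<open>y\<close> from the Hessian at
  \<open>y\<close>, so the law of the Hessian determines their joint law.\<close>

lemma phess_mult_self: "phess p J y *v y = (real p - 1) *\<^sub>R pgrad p J y"
proof (induction p arbitrary: J)
  case (Suc p)
  show ?case
  proof (simp add: vec_eq_iff, intro allI)
    fix j
    have "(phess (Suc p) J y *v y) $ j = (\<Sum>k\<in>UNIV. pgrad p (\<lambda>l. J (j # l)) y $ k * y $ k) +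
      (\<Sum>k\<in>UNIV. pgrad p (\<lambda>l. J (k # l)) y $ j * y $ k) +
      (\<Sum>k\<in>UNIV. \<Sum>i\<in>UNIV. y $ i * phess p (\<lambda>l. J (i # l)) y $ j $ k * y $ k)"
      by (simp add: matrix_vector_mult_def distrib_right sum.distrib sum_distrib_right)
    also have "(\<Sum>k\<in>UNIV. \<Sum>i\<in>UNIV. y $ i * phess p (\<lambda>l. J (i # l)) y $ j $ k * y $ k) =
      (\<Sum>i\<in>UNIV. y $ i * (phess p (\<lambda>l. J (i # l)) y *v y) $ j)"
      by (subst sum.swap) (simp add: matrix_vector_mult_def sum_distrib_left mult_ac)
    also have "(\<Sum>k\<in>UNIV. pgrad p (\<lambda>l. J (j # l)) y $ k * y $ k) = real p * pform p (\<lambda>l. J (j # l)) y"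
      using pgrad_inner_self[of p "\<lambda>l. J (j # l)" y] by (simp add: inner_vec_def)
    finally show "((\<chi> j k. pgrad p (\<lambda>l. J (j # l)) y $ k + pgrad p (\<lambda>l. J (k # l)) y $ j +
        (\<Sum>i\<in>UNIV. y $ i * phess p (\<lambda>l. J (i # l)) y $ j $ k)) *v y) $ j =
      real p * (pform p (\<lambda>l. J (j # l)) y + (\<Sum>i\<in>UNIV. y $ i * pgrad p (\<lambda>l. J (i # l)) y $ j))"
      by (simp add: Suc algebra_simps sum.distrib sum_subtractf sum_distrib_left)
  qed
qed simp

lemma pform_scale: "pform p J (c *\<^sub>R y) = c ^ p * pform p J y"
  by (induction p arbitrary: J) (simp_all add: sum_distrib_left mult_ac)

lemma pgrad_scale: "pgrad p J (c *\<^sub>R y) = c ^ (p - 1) *\<^sub>R pgrad p J y"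
proof (induction p arbitrary: J)
  case (Suc p)
  have eq: "c * (x * (c ^ (p - Suc 0) * pgrad p (\<lambda>l. J (i # l)) y $ j)) = x * (c ^ p * pgrad p (\<lambda>l. J (i # l)) y $ j)" for i j x
    by (cases p) simp_all
  show ?case
    by (simp add: vec_eq_iff pform_scale Suc sum_distrib_left distrib_left mult.left_commute mult.assoc eq)
qed simp

lemma phess_scale: "phess p J (c *\<^sub>R y) = c ^ (p - 2) *\<^sub>R phess p J y"
proof (induction p arbitrary: J)
  case (Suc p)
  have eq: "c * (x * (c ^ (p - 2) * phess p (\<lambda>l. J (i # l)) y $ j $ k)) = x * (c ^ (p - Suc 0) * phess p (\<lambda>l. J (i # l)) y $ j $ k)" for i j k x
  proof (cases "p \<ge> 2")
    case True
    then have "p - 1 = Suc (p - 2)" by simp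
    then show ?thesis by (simp add: numeral_2_eq_2)
  next
    case False
    \<comment> \<open>Here the truncated exponents disagree, but the Hessian of a form of degree 0
      or 1 vanishes.\<close>
    then have "p = 0 \<or> p = 1" by auto
    then show ?thesis by auto
  qed
  show ?case
    by (simp add: vec_eq_iff pgrad_scale Suc sum_distrib_left distrib_left mult.left_commute mult.assoc eq)
qed simp

lemma continuous_on_pform [continuous_intros]:
  fixes J :: "'a::topological_space \<Rightarrow> 'n::finite list \<Rightarrow> real"
  shows "continuous_on A f \<Longrightarrow> (\<And>l. continuous_on A (\<lambda>x. J x l)) \<Longrightarrow> continuous_on A (\<lambda>x. pform p (J x) (f x))"
proof (induction p arbitrary: J)
  case (Suc p)
  show ?case unfolding pform.simps
    by (intro continuous_intros Suc)
qed simp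

lemma continuous_on_pgrad [continuous_intros]:
  fixes J :: "'a::topological_space \<Rightarrow> 'n::finite list \<Rightarrow> real"
  shows "continuous_on A f \<Longrightarrow> (\<And>l. continuous_on A (\<lambda>x. J x l)) \<Longrightarrow> continuous_on A (\<lambda>x. pgrad p (J x) (f x))"
proof (induction p arbitrary: J)
  case (Suc p)
  show ?case unfolding pgrad.simps
    by (intro continuous_intros Suc)
qed simp

lemma continuous_on_phess [continuous_intros]:
  fixes J :: "'a::topological_space \<Rightarrow> 'n::finite list \<Rightarrow> real"
  shows "continuous_on A f \<Longrightarrow> (\<And>l. continuous_on A (\<lambda>x. J x l)) \<Longrightarrow> continuous_on A (\<lambda>x. phess p (J x) (f x))"
proof (induction p arbitrary: J)
  case (Suc p)
  show ?case unfolding phess.simps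
    by (intro continuous_intros Suc)
qed simp

section \<open>Change of variables for Lebesgue measure over an arbitrary finite index type\<close>

section \<open>Linear changes of variables\<close>

declare emeasure_completion [simp del]

text \<open>The injection \<open>to_nat\<close> of a finite type is pulled back to an order on a
  copy, so that no order has to be imposed on \<open>'n\<close> itself.\<close>

typedef ('n::finite) wo = "UNIV :: 'n set" by simp

instance wo :: (finite) finite
proof
  have "(UNIV :: 'a wo set) = Abs_wo ` (UNIV :: 'a set)"
    by (metis Rep_wo_inverse surj_def)
  then show "finite (UNIV :: 'a wo set)" by (metis finite_code finite_imageI)
qed

instantiation wo :: (finite) wellorder
begin

definition "x \<le> y \<longleftrightarrow> to_nat (Rep_wo x) \<le> to_nat (Rep_wo y)"
definition "x < y \<longleftrightarrow> to_nat (Rep_wo x) < to_nat (Rep_wo y)"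

instance
proof
  fix P :: "'a wo \<Rightarrow> bool" and a :: "'a wo"
  assume step: "\<And>x. (\<And>y. y < x \<Longrightarrow> P y) \<Longrightarrow> P x"
  show "P a"
    by (induction "to_nat (Rep_wo a)" arbitrary: a rule: less_induct)
       (use step less_wo_def in blast)
qed (auto simp: less_eq_wo_def less_wo_def Rep_wo_inject)

end

definition to_wo :: "real ^ 'n::finite \<Rightarrow> real ^ 'n wo" where
  "to_wo x = (\<chi> j. x $ Rep_wo j)"

definition of_wo :: "real ^ 'n::finite wo \<Rightarrow> real ^ 'n" where
  "of_wo x = (\<chi> i. x $ Abs_wo i)"

lemma Abs_Rep_wo [simp]: "Abs_wo (Rep_wo j) = j" "Rep_wo (Abs_wo i) = i"
  by (simp_all add: Rep_wo_inverse Abs_wo_inverse)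

lemma of_to_wo [simp]: "of_wo (to_wo x) = x" "to_wo (of_wo y) = y"
  by (simp_all add: to_wo_def of_wo_def vec_eq_iff)

lemma bij_Rep_wo: "bij Rep_wo" by (metis Abs_Rep_wo bijI')
lemma sum_wo: "(\<Sum>j\<in>UNIV. f (Rep_wo j)) = (\<Sum>i\<in>UNIV. f i)"
  by (rule sum.reindex_bij_betw) (rule bij_Rep_wo)

lemma prod_wo: "(\<Prod>j\<in>UNIV. f (Rep_wo j)) = (\<Prod>i\<in>UNIV. f i)"
  by (rule prod.reindex_bij_betw) (rule bij_Rep_wo)

lemma bounded_linear_to_wo: "bounded_linear to_wo"
  unfolding to_wo_def linear_conv_bounded_linear[symmetric]
  by (rule linearI) (simp_all add: vec_eq_iff)

lemma bounded_linear_of_wo: "bounded_linear of_wo"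
  unfolding of_wo_def linear_conv_bounded_linear[symmetric]
  by (rule linearI) (simp_all add: vec_eq_iff)

lemma continuous_on_to_wo: "continuous_on S to_wo"
  by (simp add: linear_continuous_on bounded_linear_to_wo)

lemma continuous_on_of_wo: "continuous_on S of_wo"
  by (simp add: linear_continuous_on bounded_linear_of_wo)

lemma to_wo_measurable [measurable]: "to_wo \<in> borel_measurable borel"
  and of_wo_measurable [measurable]: "of_wo \<in> borel_measurable borel"
  by (auto intro!: borel_measurable_continuous_onI continuous_on_to_wo continuous_on_of_wo)

definition mat_wo :: "real ^ 'n ^ 'n \<Rightarrow> real ^ 'n wo ^ 'n::finite wo" where
  "mat_wo A = (\<chi> j k. A $ Rep_wo j $ Rep_wo k)"

lemma mat_wo_mult_vec: "mat_wo A *v to_wo x = to_wo (A *v x)"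
  by (simp add: mat_wo_def to_wo_def matrix_vector_mult_def vec_eq_iff sum_wo[where f="\<lambda>i. A $ _ $ i * x $ i"])

lemma mat_wo_mult: "mat_wo (A ** B) = mat_wo A ** mat_wo B"
  by (simp add: mat_wo_def matrix_matrix_mult_def vec_eq_iff sum_wo[where f="\<lambda>i. A $ _ $ i * B $ i $ _"])

lemma mat_wo_one: "mat_wo (mat 1) = mat 1"
  by (simp add: mat_wo_def mat_def vec_eq_iff Rep_wo_inject)

lemma mat_wo_transpose: "mat_wo (transpose A) = transpose (mat_wo A)"
  by (simp add: mat_wo_def transpose_def)

lemma mat_wo_scale: "mat_wo (c *\<^sub>R A) = c *\<^sub>R mat_wo A"
  by (simp add: mat_wo_def vec_eq_iff)

lemma CARD_wo [simp]: "CARD('n::finite wo) = CARD('n)"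
  using bij_betw_same_card[OF bij_Rep_wo] by simp

text \<open>The library's change of variables requires a well-ordered index type, hence the detour
  through \<open>'n wo\<close>; only the absolute value of the determinant is ever needed.\<close>

definition absdet :: "real ^ 'n ^ 'n::finite \<Rightarrow> real" where
  "absdet A = \<bar>det (mat_wo A)\<bar>"

lemma absdet_nonneg [simp]: "absdet A \<ge> 0" by (simp add: absdet_def)

lemma absdet_mult: "absdet (A ** B) = absdet A * absdet B"
  by (simp add: absdet_def mat_wo_mult det_mul abs_mult)

lemma absdet_one [simp]: "absdet (mat 1) = 1"
  by (simp add: absdet_def mat_wo_one)

lemma absdet_orthogonal:
  assumes "orthogonal_matrix A" shows "absdet A = 1"
proof -
  have "orthogonal_matrix (mat_wo A)"
    using assms by (simp add: orthogonal_matrix_def mat_wo_mult[symmetric] mat_wo_transpose[symmetric] mat_wo_one)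
  then show ?thesis using det_orthogonal_matrix[of "mat_wo A"] by (auto simp: absdet_def)
qed

lemma absdet_scale: "absdet (c *\<^sub>R A :: real^'n::finite^'n) = \<bar>c\<bar> ^ CARD('n) * absdet A"
proof -
  have "c *\<^sub>R mat_wo A = (\<chi> i. c *s (mat_wo A) $ i)"
    by (simp add: vec_eq_iff)
  then have "det (c *\<^sub>R mat_wo A) = c ^ CARD('n wo) * det (mat_wo A)"
    by (simp add: det_rows_mul del: CARD_wo)
  then show ?thesis by (simp add: absdet_def mat_wo_scale abs_mult power_abs)
qed

lemma absdet_eq_0_iff: "absdet A = 0 \<longleftrightarrow> (\<exists>x. x \<noteq> 0 \<and> A *v x = 0)"
proof -
  have "absdet A = 0 \<longleftrightarrow> \<not> invertible (mat_wo A)"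
    by (simp add: absdet_def invertible_det_nz)
  also have "\<dots> \<longleftrightarrow> (\<exists>y. y \<noteq> 0 \<and> mat_wo A *v y = 0)"
    using matrix_left_invertible_ker[of "mat_wo A"] invertible_left_inverse[of "mat_wo A"] by auto
  also have "\<dots> \<longleftrightarrow> (\<exists>x. x \<noteq> 0 \<and> A *v x = 0)"
  proof safe
    fix y assume "y \<noteq> 0" "mat_wo A *v y = 0"
    then have "to_wo (A *v of_wo y) = 0" "to_wo (of_wo y) \<noteq> 0"
      using mat_wo_mult_vec[of A "of_wo y"] by auto
    then have "A *v of_wo y = 0" "of_wo y \<noteq> 0"
      using of_to_wo(1)[of "A *v of_wo y"] bounded_linear_of_wo[THEN bounded_linear.linear, THEN linear_0]
        bounded_linear_to_wo[THEN bounded_linear.linear, THEN linear_0] by metis+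
    then show "\<exists>x. x \<noteq> 0 \<and> A *v x = 0" by blast
  next
    fix x assume "x \<noteq> 0" "A *v x = 0"
    then have "mat_wo A *v to_wo x = 0" "to_wo x \<noteq> 0"
      using mat_wo_mult_vec[of A x] of_to_wo(1)[of x] bounded_linear_of_wo[THEN bounded_linear.linear, THEN linear_0]
        bounded_linear_to_wo[THEN bounded_linear.linear, THEN linear_0] by metis+
    then show "\<exists>y. y \<noteq> 0 \<and> mat_wo A *v y = 0" by blast
  qed
  finally show ?thesis .
qed

lemma continuous_on_absdet [continuous_intros]:
  "continuous_on S f \<Longrightarrow> continuous_on S (\<lambda>x. absdet (f x))"
  unfolding absdet_def det_def mat_wo_def
  by (intro continuous_intros) auto

lemma absdet_measurable [measurable]: "absdet \<in> borel_measurable borel"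
  by (intro borel_measurable_continuous_onI continuous_intros)

lemma prod_Basis_vec:
  fixes x :: "real^'n::finite"
  shows "(\<Prod>b\<in>Basis. x \<bullet> b) = (\<Prod>i\<in>UNIV. x $ i)"
proof -
  have B: "Basis = (\<lambda>i. axis i (1::real)) ` (UNIV :: 'n set)" by (auto simp: Basis_vec_def)
  have "inj (\<lambda>i::'n. axis i (1::real))" by (auto simp: inj_on_def axis_eq_axis)
  then show ?thesis unfolding B by (subst prod.reindex) (simp_all add: inner_axis)
qed

lemma distr_lborel_to_wo: "distr lborel borel to_wo = (lborel :: (real^'n::finite wo) measure)"
proof (rule lborel_eqI[symmetric])
  fix l u :: "real^'n wo" assume lu: "\<And>b. b \<in> Basis \<Longrightarrow> l \<bullet> b \<le> u \<bullet> b"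
  have lu': "l $ i \<le> u $ i" for i
    using lu[of "axis i 1"] by (simp add: inner_axis)
  have "to_wo -` box l u = box (of_wo l) (of_wo u)"
    by (auto simp: mem_box_cart to_wo_def of_wo_def) (metis Abs_Rep_wo)+
  then have "emeasure (distr lborel borel to_wo) (box l u) = emeasure lborel (box (of_wo l) (of_wo u))"
    by (simp add: emeasure_distr)
  also have "\<dots> = (\<Prod>b\<in>Basis. (of_wo u - of_wo l) \<bullet> b)"
    using lu' by (intro emeasure_lborel_box) (auto simp: of_wo_def inner_axis Basis_vec_def)
  also have "\<dots> = (\<Prod>b\<in>Basis. (u - l) \<bullet> b)"
    unfolding prod_Basis_vec by (simp add: of_wo_def prod_wo[symmetric, where f="\<lambda>i. u $ Abs_wo i - l $ Abs_wo i"])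
  finally show "emeasure (distr lborel borel to_wo) (box l u) = (\<Prod>b\<in>Basis. (u - l) \<bullet> b)" .
qed simp

lemma distr_lborel_of_wo: "distr lborel borel of_wo = (lborel :: (real^'n::finite) measure)"
proof -
  have "distr lborel borel of_wo = distr (distr lborel borel (to_wo :: real^'n \<Rightarrow> _)) borel of_wo"
    by (simp add: distr_lborel_to_wo)
  also have "\<dots> = distr lborel borel (\<lambda>x. x)"
    by (subst distr_distr) (auto simp: o_def)
  finally show ?thesis by (simp add: distr_id2)
qed

lemma to_wo_image: "to_wo ` S = of_wo -` S"
  by (auto simp: image_iff) (metis of_to_wo)

lemma of_wo_image: "of_wo ` S = to_wo -` S"
  by (auto simp: image_iff) (metis of_to_wo)

text \<open>The relabelling preserves \<open>lborel\<close>, so preimages of null sets are null and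
  Borel measurability extends to the completion.\<close>

lemma to_wo_lebesgue [measurable]: "to_wo \<in> lebesgue \<rightarrow>\<^sub>M lebesgue"
  and of_wo_lebesgue [measurable]: "of_wo \<in> lebesgue \<rightarrow>\<^sub>M lebesgue"
proof -
  have "distr lebesgue lborel to_wo = lborel"
    by (subst distr_completion) (simp_all add: distr_lborel_to_wo cong: distr_cong)
  then have "null_sets lborel \<subseteq> null_sets (distr lebesgue lborel to_wo)"
    by (metis order_refl)
  then show "to_wo \<in> lebesgue \<rightarrow>\<^sub>M lebesgue"
    by (intro completion.measurable_completion2) (simp_all add: measurable_completion)
  have "distr lebesgue lborel of_wo = lborel"
    by (subst distr_completion) (simp_all add: distr_lborel_of_wo cong: distr_cong)
  then have "null_sets lborel \<subseteq> null_sets (distr lebesgue lborel of_wo)"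
    by (metis order_refl)
  then show "of_wo \<in> lebesgue \<rightarrow>\<^sub>M lebesgue"
    by (intro completion.measurable_completion2) (simp_all add: measurable_completion)
qed

lemma distr_lebesgue_to_wo: "distr lebesgue lebesgue to_wo = lebesgue"
proof -
  have eq: "distr lebesgue lborel to_wo = lborel"
    by (subst distr_completion) (simp_all add: distr_lborel_to_wo cong: distr_cong)
  have "completion (distr lebesgue lborel to_wo) = distr lebesgue lebesgue to_wo"
    by (rule completion.completion_distr_eq) (simp_all add: measurable_completion eq)
  then show ?thesis unfolding eq by (rule sym)
qed

lemma nn_integral_to_wo:
  "f \<in> borel_measurable lebesgue \<Longrightarrow> (\<integral>\<^sup>+x. f (to_wo x) \<partial>lebesgue) = (\<integral>\<^sup>+x. f x \<partial>lebesgue)"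
  using nn_integral_distr[OF to_wo_lebesgue, of f] by (simp add: distr_lebesgue_to_wo)

lemma emeasure_to_wo_image:
  assumes S: "S \<in> sets lebesgue"
  shows "to_wo ` S \<in> sets lebesgue" "emeasure lebesgue (to_wo ` S) = emeasure lebesgue S"
proof -
  show *: "to_wo ` S \<in> sets lebesgue"
    using measurable_sets[OF of_wo_lebesgue S] by (simp add: to_wo_image)
  have "emeasure lebesgue (to_wo ` S) = emeasure (distr lebesgue lebesgue to_wo) (to_wo ` S)"
    by (simp add: distr_lebesgue_to_wo)
  also have "\<dots> = emeasure lebesgue (to_wo -` (to_wo ` S))"
    using * by (subst emeasure_distr) auto
  also have "to_wo -` (to_wo ` S) = S"
    by (auto simp: image_iff) (metis of_to_wo(1))
  finally show "emeasure lebesgue (to_wo ` S) = emeasure lebesgue S" .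
qed

lemma of_wo_image_sets: "S \<in> sets lebesgue \<Longrightarrow> of_wo ` S \<in> sets lebesgue"
  using measurable_sets[OF to_wo_lebesgue] by (simp add: of_wo_image)

lemma emeasure_orthogonal_image:
  fixes R :: "real^'n::finite^'n"
  assumes R: "orthogonal_matrix R" and S: "S \<in> lmeasurable"
  shows "emeasure lebesgue ((*v) R ` S) = emeasure lebesgue S"
proof -
  have "orthogonal_matrix (mat_wo R)"
    using R by (simp add: orthogonal_matrix_def mat_wo_mult[symmetric] mat_wo_transpose[symmetric] mat_wo_one)
  then have o: "orthogonal_transformation ((*v) (mat_wo R))"
    by (simp add: orthogonal_transformation_matrix)
  have tS: "to_wo ` S \<in> lmeasurable"
    using S emeasure_to_wo_image[of S] by (simp add: fmeasurable_def)
  have m: "(*v) (mat_wo R) ` to_wo ` S \<in> lmeasurable"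
    by (rule measurable_orthogonal_image[OF o tS])
  have eq: "(*v) R ` S = of_wo ` (*v) (mat_wo R) ` to_wo ` S"
    by (simp add: image_image mat_wo_mult_vec)
  have sets: "(*v) R ` S \<in> sets lebesgue"
    unfolding eq using m by (intro of_wo_image_sets) (simp add: fmeasurable_def)
  have "emeasure lebesgue ((*v) R ` S) = emeasure lebesgue (to_wo ` (*v) R ` S)"
    using emeasure_to_wo_image(2)[OF sets] by simp
  also have "to_wo ` (*v) R ` S = (*v) (mat_wo R) ` to_wo ` S"
    by (simp add: image_image mat_wo_mult_vec)
  also have "emeasure lebesgue \<dots> = emeasure lebesgue (to_wo ` S)"
    using measure_orthogonal_image[OF o tS] m tS by (simp add: emeasure_eq_measure2)
  finally show ?thesis
    using emeasure_to_wo_image(2)[of S] S by (simp add: fmeasurable_def)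
qed

text \<open>The change of variables formula with infinite values allowed: if the image has infinite
  measure, a finite integral would make the Jacobian integrable over \<open>S\<close> and thereby
  force the image to have finite measure.\<close>

lemma emeasure_injective_image:
  fixes f :: "real^'m::{finite,wellorder} \<Rightarrow> real^'m::_"
  assumes S: "S \<in> sets lebesgue"
    and der: "\<And>x. x \<in> S \<Longrightarrow> (f has_derivative f' x) (at x within S)"
    and inj: "inj_on f S"
  shows "f ` S \<in> sets lebesgue"
    and "emeasure lebesgue (f ` S) = (\<integral>\<^sup>+x. ennreal \<bar>det (matrix (f' x))\<bar> * indicator S x \<partial>lebesgue)"
proof -
  have "f differentiable_on S"
    using der by (auto simp: differentiable_on_def differentiable_def)
  then show sets: "f ` S \<in> sets lebesgue"
    by (intro differentiable_image_in_sets_lebesgue S) auto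
  show "emeasure lebesgue (f ` S) = (\<integral>\<^sup>+x. ennreal \<bar>det (matrix (f' x))\<bar> * indicator S x \<partial>lebesgue)"
  proof (cases "f ` S \<in> lmeasurable")
    case True
    then have "((\<lambda>x. \<bar>det (matrix (f' x))\<bar>) has_integral measure lebesgue (f ` S)) S"
      using has_measure_differentiable_image[OF S der inj] by blast
    then have "(\<integral>\<^sup>+x. ennreal \<bar>det (matrix (f' x))\<bar> * indicator S x \<partial>lborel) = ennreal (measure lebesgue (f ` S))"
      by (intro nn_integral_has_integral_lebesgue') auto
    then show ?thesis using True by (simp add: nn_integral_completion emeasure_eq_measure2)
  next
    case False
    then have inf: "emeasure lebesgue (f ` S) = \<infinity>"
      using sets by (simp add: fmeasurable_def less_top[symmetric])
    have "(\<integral>\<^sup>+x. ennreal \<bar>det (matrix (f' x))\<bar> * indicator S x \<partial>lebesgue) = \<infinity>"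
    proof (rule ccontr)
      assume fin: "(\<integral>\<^sup>+x. ennreal \<bar>det (matrix (f' x))\<bar> * indicator S x \<partial>lebesgue) \<noteq> \<infinity>"
      have "(\<lambda>x. \<bar>det (matrix (f' x))\<bar>) \<in> borel_measurable (lebesgue_on S)"
        using borel_measurable_det_Jacobian[OF S der] by simp
      then have m: "(\<lambda>x. indicator S x *\<^sub>R \<bar>det (matrix (f' x))\<bar>) \<in> borel_measurable lebesgue"
        using S by (simp add: borel_measurable_restrict_space_iff)
      have "integrable lebesgue (\<lambda>x. indicator S x *\<^sub>R \<bar>det (matrix (f' x))\<bar>)"
      proof (rule integrableI_nonneg[OF m])
        have "(\<lambda>x. ennreal (indicator S x *\<^sub>R \<bar>det (matrix (f' x))\<bar>)) =
            (\<lambda>x. ennreal \<bar>det (matrix (f' x))\<bar> * indicator S x)"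
          by (auto simp: indicator_def fun_eq_iff)
        then show "(\<integral>\<^sup>+x. ennreal (indicator S x *\<^sub>R \<bar>det (matrix (f' x))\<bar>) \<partial>lebesgue) < \<infinity>"
          using fin by (simp add: less_top)
      qed auto
      then have "(\<lambda>x. \<bar>det (matrix (f' x))\<bar>) integrable_on S"
        by (intro set_lebesgue_integral_eq_integral(1)) (simp add: set_integrable_def)
      then show False
        using False measurable_differentiable_image_eq[OF S der inj] by blast
    qed
    then show ?thesis using inf by simp
  qed
qed

lemma conj_wo_has_derivative:
  fixes f :: "real^'n::finite \<Rightarrow> real^'n"
  assumes "(f has_derivative (\<lambda>v. A *v v)) (at (of_wo z) within S)"
  shows "((\<lambda>z. to_wo (f (of_wo z))) has_derivative (\<lambda>v. mat_wo A *v v)) (at z within to_wo ` S)"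
proof -
  have S: "of_wo ` to_wo ` S = S" by (simp add: image_image)
  have "((\<lambda>z. f (of_wo z)) has_derivative (\<lambda>v. A *v of_wo v)) (at z within to_wo ` S)"
    by (rule has_derivative_in_compose[OF bounded_linear_imp_has_derivative[OF bounded_linear_of_wo]])
       (use assms S in simp)
  then have "((\<lambda>z. to_wo (f (of_wo z))) has_derivative (\<lambda>v. to_wo (A *v of_wo v))) (at z within to_wo ` S)"
    by (rule bounded_linear.has_derivative[OF bounded_linear_to_wo])
  then show ?thesis
    by (simp add: mat_wo_mult_vec[symmetric])
qed

lemma emeasure_inj_image:
  fixes f :: "real^'n::finite \<Rightarrow> real^'n"
  assumes S: "S \<in> sets lebesgue"
    and der: "\<And>x. x \<in> S \<Longrightarrow> (f has_derivative (\<lambda>v. A x *v v)) (at x within S)"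
    and inj: "inj_on f S"
  shows "f ` S \<in> sets lebesgue"
    and "emeasure lebesgue (f ` S) = (\<integral>\<^sup>+x. ennreal (absdet (A x)) * indicator S x \<partial>lebesgue)"
proof -
  let ?g = "\<lambda>z. to_wo (f (of_wo z))" and ?T = "to_wo ` S"
  have T: "?T \<in> sets lebesgue" using emeasure_to_wo_image(1)[OF S] .
  have d: "(?g has_derivative (\<lambda>v. mat_wo (A (of_wo z)) *v v)) (at z within ?T)" if "z \<in> ?T" for z
    using that der by (intro conj_wo_has_derivative) auto
  have i: "inj_on ?g ?T"
    using inj by (auto simp: inj_on_def) (metis of_to_wo(1))
  have im: "?g ` ?T = to_wo ` f ` S" by (simp add: image_image)
  note E = emeasure_injective_image[OF T d i]
  have "f ` S = of_wo ` (?g ` ?T)" by (simp add: image_image)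
  then show sets: "f ` S \<in> sets lebesgue" using E(1) of_wo_image_sets by metis
  have m: "(\<lambda>z. ennreal \<bar>det (mat_wo (A (of_wo z)))\<bar> * indicator ?T z) \<in> borel_measurable lebesgue"
  proof -
    have "(\<lambda>x. det (matrix (\<lambda>v. mat_wo (A (of_wo x)) *v v))) \<in> borel_measurable (lebesgue_on ?T)"
      by (rule borel_measurable_det_Jacobian[OF T d])
    then have "(\<lambda>z. \<bar>det (mat_wo (A (of_wo z)))\<bar>) \<in> borel_measurable (lebesgue_on ?T)"
      by simp
    then have "(\<lambda>z. indicator ?T z *\<^sub>R \<bar>det (mat_wo (A (of_wo z)))\<bar>) \<in> borel_measurable lebesgue"
      using T by (simp add: borel_measurable_restrict_space_iff)
    then have "(\<lambda>z. ennreal (indicator ?T z *\<^sub>R \<bar>det (mat_wo (A (of_wo z)))\<bar>)) \<in> borel_measurable lebesgue"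
      by simp
    also have "(\<lambda>z. ennreal (indicator ?T z *\<^sub>R \<bar>det (mat_wo (A (of_wo z)))\<bar>)) =
        (\<lambda>z. ennreal \<bar>det (mat_wo (A (of_wo z)))\<bar> * indicator ?T z)"
      by (auto simp: fun_eq_iff indicator_def)
    finally show ?thesis .
  qed
  have "emeasure lebesgue (f ` S) = emeasure lebesgue (to_wo ` f ` S)"
    using emeasure_to_wo_image(2)[OF sets] by simp
  also have "\<dots> = (\<integral>\<^sup>+z. ennreal \<bar>det (mat_wo (A (of_wo z)))\<bar> * indicator ?T z \<partial>lebesgue)"
    using E(2) by (simp add: im)
  also have "\<dots> = (\<integral>\<^sup>+x. ennreal \<bar>det (mat_wo (A (of_wo (to_wo x))))\<bar> * indicator ?T (to_wo x) \<partial>lebesgue)"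
    using nn_integral_to_wo[OF m] by simp
  also have "\<dots> = (\<integral>\<^sup>+x. ennreal (absdet (A x)) * indicator S x \<partial>lebesgue)"
    by (intro nn_integral_cong) (auto simp: absdet_def indicator_def, metis of_to_wo(1))
  finally show "emeasure lebesgue (f ` S) = (\<integral>\<^sup>+x. ennreal (absdet (A x)) * indicator S x \<partial>lebesgue)" .
qed

text \<open>Sard's theorem in equal dimensions, where differentiability suffices. It lets the area
  formula discard the points with singular derivative.\<close>

lemma negligible_critical_values:
  fixes f :: "real^'n::finite \<Rightarrow> real^'n"
  assumes der: "\<And>x. x \<in> S \<Longrightarrow> (f has_derivative (\<lambda>v. A x *v v)) (at x within S)"
    and sing: "\<And>x. x \<in> S \<Longrightarrow> absdet (A x) = 0"
  shows "negligible (f ` S)"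
proof -
  let ?g = "\<lambda>z. to_wo (f (of_wo z))" and ?T = "to_wo ` S"
  have "negligible (?g ` ?T)"
  proof (rule baby_Sard)
    fix z assume z: "z \<in> ?T"
    then show "(?g has_derivative (\<lambda>v. mat_wo (A (of_wo z)) *v v)) (at z within ?T)"
      using der by (intro conj_wo_has_derivative) auto
    have "det (mat_wo (A (of_wo z))) = 0"
      using z sing by (auto simp: absdet_def)
    then have "\<not> inj ((*v) (mat_wo (A (of_wo z))))"
      using det_nz_iff_inj[of "(*v) (mat_wo (A (of_wo z)))"] by simp
    then show "rank (matrix (\<lambda>v. mat_wo (A (of_wo z)) *v v)) < CARD('n wo)"
      using less_rank_noninjective[of "mat_wo (A (of_wo z))"] by simp
  qed simp
  then have "?g ` ?T \<in> null_sets lebesgue" by (simp add: negligible_iff_null_sets)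
  moreover have "?g ` ?T = to_wo ` f ` S" by (simp add: image_image)
  ultimately have n: "to_wo ` f ` S \<in> null_sets lebesgue" by simp
  have "f ` S = of_wo ` (to_wo ` f ` S)" by (simp add: image_image)
  then have sets: "f ` S \<in> sets lebesgue" using n of_wo_image_sets by (metis null_setsD2)
  then have "emeasure lebesgue (f ` S) = 0"
    using emeasure_to_wo_image(2)[OF sets] n by auto
  then show ?thesis using sets by (simp add: negligible_iff_null_sets null_sets_def)
qed

section \<open>Standard Gaussian families\<close>

definition gauss :: "real measure" where
  "gauss = density lborel (\<lambda>x. ennreal (std_normal_density x))"

lemma sets_gauss [measurable_cong, simp]: "sets gauss = sets borel"
  and space_gauss [simp]: "space gauss = UNIV"
  by (simp_all add: gauss_def)

interpretation gauss: prob_space gauss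
  unfolding gauss_def by (rule prob_space_normal_density) simp

text \<open>One construction for every countable index type: coefficients are indexed by lists, the
  entries of a symmetric matrix by sets of one or two indices.\<close>

definition gam :: "('i::countable \<Rightarrow> real) measure" where
  "gam = PiM UNIV (\<lambda>_. gauss)"

lemma sets_gam [measurable_cong, simp]: "sets gam = sets borel"
proof -
  have "sets (gam :: ('a \<Rightarrow> real) measure) = sets (PiM UNIV (\<lambda>_. borel))"
    unfolding gam_def by (intro sets_PiM_cong) auto
  then show ?thesis by (simp add: sets_PiM_equal_borel)
qed

lemma space_gam [simp]: "space gam = UNIV"
  by (simp add: gam_def space_PiM)

interpretation gam: prob_space gam
  unfolding gam_def by (intro prob_space_PiM gauss.prob_space_axioms)

lemma borel_measurable_component [measurable]: "(\<lambda>J::'i::countable \<Rightarrow> real. J l) \<in> borel_measurable borel"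
  by (rule measurable_product_coordinates)

lemma borel_measurable_funI:
  fixes f :: "'a \<Rightarrow> 'i::countable \<Rightarrow> real"
  shows "(\<And>i. (\<lambda>x. f x i) \<in> borel_measurable M) \<Longrightarrow> f \<in> borel_measurable M"
  by (rule measurable_coordinatewise_then_product)

lemma emeasure_gam_box:
  assumes "finite K" "\<And>l. l \<in> K \<Longrightarrow> A l \<in> sets borel"
  shows "emeasure gam {J. \<forall>l\<in>K. J l \<in> A l} = (\<Prod>l\<in>K. emeasure gauss (A l))"
proof -
  interpret product_prob_space "\<lambda>_. gauss" UNIV by unfold_locales
  show ?thesis
    using emeasure_PiM_Collect[of K A] assms by (simp add: gam_def[symmetric])
qed

lemma gam_eqI:
  fixes P :: "('i::countable \<Rightarrow> real) measure"
  assumes P: "sets P = sets borel"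
    and eq: "\<And>K A. finite K \<Longrightarrow> (\<And>l. A l \<in> sets borel) \<Longrightarrow>
      emeasure P {J. \<forall>l\<in>K. J l \<in> A l} = (\<Prod>l\<in>K. emeasure gauss (A l))"
  shows "P = gam"
  unfolding gam_def
proof (rule product_prob_space.PiM_eq)
  show "product_prob_space (\<lambda>_. gauss)" by unfold_locales
  show "sets P = sets (PiM UNIV (\<lambda>_. gauss))"
    using P by (simp add: gam_def[symmetric])
  fix J :: "'i set" and F :: "'i \<Rightarrow> real set" assume J: "finite J" "\<And>j. j \<in> J \<Longrightarrow> F j \<in> sets gauss"
  have "prod_emb UNIV (\<lambda>_. gauss) J (Pi\<^sub>E J F) = {x. \<forall>l\<in>J. x l \<in> (if l \<in> J then F l else UNIV)}"
    by (auto simp: prod_emb_def PiE_iff)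
  also have "emeasure P \<dots> = (\<Prod>l\<in>J. emeasure gauss (if l \<in> J then F l else UNIV))"
    using J by (intro eq) auto
  finally show "emeasure P (prod_emb UNIV (\<lambda>_. gauss) J (Pi\<^sub>E J F)) = (\<Prod>j\<in>J. emeasure gauss (F j))"
    by simp
qed

definition gvec :: "(real ^ 'n::finite) measure" where
  "gvec = distr gam borel vec_lambda"

lemma borel_measurable_vec_nth [measurable]: "(\<lambda>x::real^'n::finite. x $ i) \<in> borel_measurable borel"
  by (intro borel_measurable_continuous_onI continuous_intros)

lemma borel_measurable_vec_iff:
  fixes f :: "'a \<Rightarrow> real^'n::finite"
  shows "f \<in> borel_measurable M \<longleftrightarrow> (\<forall>i. (\<lambda>x. f x $ i) \<in> borel_measurable M)"
  by (subst borel_measurable_euclidean_space) (auto simp: Basis_vec_def inner_axis)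

lemma vec_lambda_borel_measurable [measurable]:
  "vec_lambda \<in> borel_measurable (borel :: ('n::finite \<Rightarrow> real) measure)"
  by (subst borel_measurable_vec_iff) (auto intro: borel_measurable_component)

lemma sets_gvec [measurable_cong, simp]: "sets gvec = sets borel"
  and space_gvec [simp]: "space gvec = UNIV"
  by (simp_all add: gvec_def)

interpretation gvec: prob_space gvec
  unfolding gvec_def by (rule gam.prob_space_distr) measurable

definition updb :: "('n \<Rightarrow> 'i) \<Rightarrow> ('i \<Rightarrow> real) \<Rightarrow> real ^ 'n \<Rightarrow> 'i \<Rightarrow> real" where
  "updb b J u l = (if l \<in> range b then u $ inv b l else J l)"

lemma updb_block: "inj b \<Longrightarrow> updb b J u (b i) = u $ i"
  by (simp add: updb_def)

lemma updb_other: "l \<notin> range b \<Longrightarrow> updb b J u l = J l"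
  by (simp add: updb_def)

lemma updb_measurable [measurable]:
  fixes b :: "'n::finite \<Rightarrow> 'i::countable"
  shows "(\<lambda>(J, u). updb b J u) \<in> borel_measurable (borel \<Otimes>\<^sub>M borel)"
proof -
  have "(\<lambda>x. updb b (fst x) (snd x) l) \<in> borel_measurable (borel \<Otimes>\<^sub>M borel)" for l
    by (cases "l \<in> range b") (simp_all add: updb_def)
  then show ?thesis
    unfolding split_def by (intro borel_measurable_funI) auto
qed

text \<open>By independence, overwriting a block with fresh standard normals does not change the
  law. Expectations can therefore be taken over the block first, with all other coefficients
  frozen.\<close>

lemma resample:
  fixes b :: "'n::finite \<Rightarrow> 'i::countable"
  assumes b: "inj b"
  shows "distr (gam \<Otimes>\<^sub>M gvec) borel (\<lambda>(J, u). updb b J u) = gam"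
proof (rule gam_eqI)
  fix K :: "'i set" and A :: "'i \<Rightarrow> real set" assume K: "finite K" "\<And>l. A l \<in> sets borel"
  let ?K = "{i. b i \<in> K}"
  have [measurable]: "A l \<in> sets borel" for l by (rule K)
  have sG: "{u::real^'n. \<forall>i\<in>?K. u $ i \<in> A (b i)} \<in> sets borel" by measurable
  have sJ: "{J. \<forall>l\<in>K - range b. J l \<in> A l} \<in> sets (borel :: ('i \<Rightarrow> real) measure)"
    using K by measurable
  have sK: "{J. \<forall>l\<in>K. J l \<in> A l} \<in> sets (borel :: ('i \<Rightarrow> real) measure)"
    using K by measurable
  have "emeasure (distr (gam \<Otimes>\<^sub>M gvec) borel (\<lambda>(J, u). updb b J u)) {J. \<forall>l\<in>K. J l \<in> A l} =
     emeasure (gam \<Otimes>\<^sub>M gvec) ((\<lambda>(J, u). updb b J u) -` {J. \<forall>l\<in>K. J l \<in> A l} \<inter> space (gam \<Otimes>\<^sub>M gvec))"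
    using sK by (intro emeasure_distr) auto
  also have "(\<lambda>(J, u). updb b J u) -` {J. \<forall>l\<in>K. J l \<in> A l} \<inter> space (gam \<Otimes>\<^sub>M gvec) =
     {J. \<forall>l\<in>K - range b. J l \<in> A l} \<times> {u. \<forall>i\<in>?K. u $ i \<in> A (b i)}"
    using b by (auto simp: space_pair_measure updb_def split: if_splits)
  also have "emeasure (gam \<Otimes>\<^sub>M gvec) \<dots> =
     emeasure gam {J. \<forall>l\<in>K - range b. J l \<in> A l} * emeasure gvec {u. \<forall>i\<in>?K. u $ i \<in> A (b i)}"
    using sG sJ by (intro gvec.emeasure_pair_measure_Times) auto
  also have "emeasure gvec {u. \<forall>i\<in>?K. u $ i \<in> A (b i)} =
     emeasure gam {x. \<forall>i\<in>?K. x i \<in> A (b i)}"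
    unfolding gvec_def using sG by (subst emeasure_distr) (auto intro!: arg_cong2[where f=emeasure])
  also have "\<dots> = (\<Prod>i\<in>?K. emeasure gauss (A (b i)))"
    by (intro emeasure_gam_box) auto
  also have "\<dots> = (\<Prod>l\<in>K \<inter> range b. emeasure gauss (A l))"
    using b by (intro prod.reindex_cong[of b, symmetric]) (auto intro: inj_on_subset)
  also have "emeasure gam {J. \<forall>l\<in>K - range b. J l \<in> A l} = (\<Prod>l\<in>K - range b. emeasure gauss (A l))"
    using K by (intro emeasure_gam_box) auto
  also have "\<dots> * (\<Prod>l\<in>K \<inter> range b. emeasure gauss (A l)) = (\<Prod>l\<in>K. emeasure gauss (A l))"
    using K by (subst prod.union_disjoint[symmetric]) (auto intro!: prod.cong)
  finally show "emeasure (distr (gam \<Otimes>\<^sub>M gvec) borel (\<lambda>(J, u). updb b J u)) {J. \<forall>l\<in>K. J l \<in> A l} =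
     (\<Prod>l\<in>K. emeasure gauss (A l))" .
qed simp

lemma nn_integral_resample:
  fixes b :: "'n::finite \<Rightarrow> 'i::countable"
  assumes b: "inj b" and [measurable]: "F \<in> borel_measurable borel"
  shows "(\<integral>\<^sup>+J. F J \<partial>gam) = (\<integral>\<^sup>+J. \<integral>\<^sup>+u. F (updb b J u) \<partial>gvec \<partial>gam)"
proof -
  have "(\<integral>\<^sup>+J. F J \<partial>gam) = (\<integral>\<^sup>+x. F (case x of (J, u) \<Rightarrow> updb b J u) \<partial>(gam \<Otimes>\<^sub>M gvec))"
    by (subst resample[OF b, symmetric], rule nn_integral_distr) measurable
  also have "\<dots> = (\<integral>\<^sup>+J. \<integral>\<^sup>+u. F (updb b J u) \<partial>gvec \<partial>gam)"
    by (subst gvec.nn_integral_fst[symmetric]) (simp_all, measurable)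
  finally show ?thesis .
qed

definition gdens :: "real ^ 'n::finite \<Rightarrow> real" where
  "gdens u = exp (- (norm u)\<^sup>2 / 2) / sqrt (2 * pi) ^ CARD('n)"

lemma gdens_prod: "gdens (u :: real ^ 'n::finite) = (\<Prod>i\<in>UNIV. std_normal_density (u $ i))"
proof -
  have "(norm u)\<^sup>2 = (\<Sum>i\<in>UNIV. (u $ i)\<^sup>2)"
    by (simp add: norm_vec_def L2_set_def sum_nonneg)
  then have "exp (- (norm u)\<^sup>2 / 2) = (\<Prod>i\<in>UNIV. exp (- (u $ i)\<^sup>2 / 2))"
    by (simp add: exp_sum[symmetric] sum_negf sum_divide_distrib)
  then show ?thesis
    by (simp only: gdens_def std_normal_density_def prod.distrib prod_constant power_one_over)
      (simp add: field_simps)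
qed

lemma gdens_pos: "gdens u > 0" by (simp add: gdens_def)

lemma sets_PiM_lborel: "sets (PiM UNIV (\<lambda>_::'i::countable. lborel :: real measure)) = sets borel"
proof -
  have "sets (PiM UNIV (\<lambda>_::'i. lborel :: real measure)) = sets (PiM UNIV (\<lambda>_. borel))"
    by (intro sets_PiM_cong) auto
  then show ?thesis by (simp add: sets_PiM_equal_borel)
qed

lemma vec_lambda_measurable_PiM: "vec_lambda \<in> borel_measurable (PiM UNIV (\<lambda>_::'n::finite. lborel :: real measure))"
  using vec_lambda_borel_measurable by (simp cong: measurable_cong_sets add: sets_PiM_lborel)

lemma lborel_vec: "distr (PiM UNIV (\<lambda>_::'n::finite. lborel)) borel vec_lambda = (lborel :: (real ^ 'n) measure)"
proof (rule lborel_eqI[symmetric])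
  note m = vec_lambda_measurable_PiM[where 'n='n]
  fix l u :: "real ^ 'n" assume lu: "\<And>b. b \<in> Basis \<Longrightarrow> l \<bullet> b \<le> u \<bullet> b"
  then have lu': "l $ i \<le> u $ i" for i
    by (metis axis_in_Basis_iff inner_axis real_inner_1_right Basis_real_def singletonI)
  have "emeasure (distr (PiM UNIV (\<lambda>_::'n. lborel)) borel vec_lambda) (box l u) =
     emeasure (PiM UNIV (\<lambda>_::'n. lborel)) (PiE UNIV (\<lambda>i. {l $ i <..< u $ i}))"
    using m by (subst emeasure_distr) (auto intro!: arg_cong2[where f=emeasure] simp: space_PiM mem_box_cart PiE_iff)
  also have "\<dots> = (\<Prod>i\<in>UNIV. ennreal (u $ i - l $ i))"
    by (subst product_sigma_finite.emeasure_PiM) (auto intro: product_sigma_finite.intro sigma_finite_lborel simp: lu')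
  also have "\<dots> = ennreal (\<Prod>i\<in>UNIV. (u $ i - l $ i))"
    by (rule prod_ennreal) (simp add: lu')
  also have "(\<Prod>i\<in>UNIV. (u $ i - l $ i)) = (\<Prod>b\<in>Basis. (u - l) \<bullet> b)"
    by (simp add: prod_Basis_vec)
  finally show "emeasure (distr (PiM UNIV (\<lambda>_::'n. lborel)) borel vec_lambda) (box l u) = ennreal (\<Prod>b\<in>Basis. (u - l) \<bullet> b)" .
qed simp

lemma gvec_eq_density: "gvec = density lborel (\<lambda>u::real^'n::finite. ennreal (gdens u))"
proof -
  interpret L: product_sigma_finite "\<lambda>_::'n. lborel :: real measure"
    by (intro product_sigma_finite.intro sigma_finite_lborel)
  interpret G: product_sigma_finite "\<lambda>_::'n. gauss"
    by (intro product_sigma_finite.intro gauss.sigma_finite_measure)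
  let ?d = "\<lambda>x::'n \<Rightarrow> real. \<Prod>i\<in>UNIV. ennreal (std_normal_density (x i))"
  have [measurable]: "?d \<in> borel_measurable (PiM UNIV (\<lambda>_::'n. lborel))"
  proof -
    have "?d \<in> borel_measurable borel" by measurable
    then show ?thesis by (simp cong: measurable_cong_sets add: sets_PiM_lborel)
  qed
  have g: "gam = density (PiM UNIV (\<lambda>_::'n. lborel)) ?d"
    unfolding gam_def
  proof (rule G.PiM_eqI[symmetric])
    show "sets (density (PiM UNIV (\<lambda>_::'n. lborel)) ?d) = sets (PiM UNIV (\<lambda>_::'n. gauss))"
      by (auto intro!: sets_PiM_cong)
    fix A :: "'n \<Rightarrow> real set" assume "\<And>i. i \<in> UNIV \<Longrightarrow> A i \<in> sets gauss"
    then have A [measurable]: "A i \<in> sets borel" for i by simp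
    have "emeasure (density (PiM UNIV (\<lambda>_::'n. lborel)) ?d) (Pi\<^sub>E UNIV A) =
       (\<integral>\<^sup>+x. (\<Prod>i\<in>UNIV. ennreal (std_normal_density (x i)) * indicator (A i) (x i)) \<partial>(PiM UNIV (\<lambda>_::'n. lborel)))"
      by (subst emeasure_density)
         (auto intro!: nn_integral_cong simp: prod.distrib indicator_def PiE_iff prod_zero_iff prod.neutral)
    also have "\<dots> = (\<Prod>i\<in>UNIV. \<integral>\<^sup>+x. ennreal (std_normal_density x) * indicator (A i) x \<partial>lborel)"
      by (rule L.product_nn_integral_prod) auto
    also have "\<dots> = (\<Prod>i\<in>UNIV. emeasure gauss (A i))"
      by (simp add: gauss_def emeasure_density)
    finally show "emeasure (density (PiM UNIV (\<lambda>_::'n. lborel)) ?d) (Pi\<^sub>E UNIV A) = (\<Prod>i\<in>UNIV. emeasure gauss (A i))" .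
  qed simp
  note m = vec_lambda_measurable_PiM[where 'n='n]
  have "density (distr (PiM UNIV (\<lambda>_::'n. lborel)) borel vec_lambda) (\<lambda>u::real^'n::finite. ennreal (gdens u)) =
     distr (density (PiM UNIV (\<lambda>_::'n. lborel)) (\<lambda>x. ennreal (gdens (vec_lambda x)))) borel vec_lambda"
    using m by (intro density_distr) (auto simp: gdens_def)
  also have "(\<lambda>x. ennreal (gdens (vec_lambda x :: real^'n))) = ?d"
    by (simp add: gdens_prod prod_ennreal)
  finally show ?thesis
    unfolding gvec_def g lborel_vec by simp
qed

lemma distr_lborel_orthogonal:
  assumes R: "orthogonal_matrix (R :: real^'n::finite^'n)"
  shows "distr lborel borel ((*v) R) = lborel"
proof (rule lborel_eqI[symmetric])
  fix l u :: "real^'n" assume lu: "\<And>b. b \<in> Basis \<Longrightarrow> l \<bullet> b \<le> u \<bullet> b"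
  have T: "orthogonal_matrix (transpose R)" using R by (simp add: orthogonal_matrix_transpose)
  have inv: "transpose R ** R = mat 1" "R ** transpose R = mat 1"
    using R by (auto simp: orthogonal_matrix_def)
  have eq: "(*v) R -` box l u = (*v) (transpose R) ` box l u"
  proof (intro set_eqI iffI)
    fix x assume "x \<in> (*v) R -` box l u"
    moreover have "x = transpose R *v (R *v x)" by (simp only: matrix_vector_mul_assoc inv matrix_vector_mul_lid)
    ultimately show "x \<in> (*v) (transpose R) ` box l u" by auto
  next
    fix x assume "x \<in> (*v) (transpose R) ` box l u"
    then obtain z where "z \<in> box l u" "x = transpose R *v z" by blast
    moreover have "R *v (transpose R *v z) = z" by (simp only: matrix_vector_mul_assoc inv matrix_vector_mul_lid)
    ultimately show "x \<in> (*v) R -` box l u" by simp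
  qed
  have "emeasure (distr lborel borel ((*v) R)) (box l u) = emeasure lborel ((*v) R -` box l u)"
    by (subst emeasure_distr) (auto intro!: borel_measurable_continuous_onI continuous_intros)
  also have "\<dots> = emeasure lebesgue ((*v) (transpose R) ` box l u)"
  proof -
    have "open ((*v) R -` box l u)"
      by (intro open_vimage open_box continuous_intros)
    then have "(*v) R -` box l u \<in> sets lborel" by simp
    then show ?thesis unfolding eq[symmetric] by (simp add: emeasure_completion)
  qed
  also have "\<dots> = emeasure lebesgue (box l u)"
    by (rule emeasure_orthogonal_image[OF T]) simp
  also have "\<dots> = (\<Prod>b\<in>Basis. (u - l) \<bullet> b)"
    using lu by (simp add: emeasure_completion emeasure_lborel_box)
  finally show "emeasure (distr lborel borel ((*v) R)) (box l u) = (\<Prod>b\<in>Basis. (u - l) \<bullet> b)" .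
qed simp

lemma matrix_vector_mult_borel_measurable [measurable]:
  "(*v) (R :: real^'n::finite^'m::finite) \<in> borel_measurable borel"
  by (intro borel_measurable_continuous_onI continuous_intros)

text \<open>Lebesgue measure is invariant under rotations and the density depends on the norm
  only.\<close>

lemma gvec_orthogonal:
  assumes R: "orthogonal_matrix (R :: real^'n::finite^'n)"
  shows "distr gvec borel ((*v) R) = gvec"
proof -
  have n: "norm (R *v u) = norm u" for u
    using R by (metis orthogonal_transformation_matrix orthogonal_transformation_norm matrix_of_matrix_vector_mul matrix_vector_mul_linear)
  have "density (distr lborel borel ((*v) R)) (\<lambda>u. ennreal (gdens u)) =
     distr (density lborel (\<lambda>x. ennreal (gdens (R *v x)))) borel ((*v) R)"
    by (intro density_distr) (auto simp: gdens_def)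
  then show ?thesis
    by (simp add: distr_lborel_orthogonal[OF R] gvec_eq_density gdens_def n)
qed

section \<open>The area formula\<close>

lemma inj_area_formula:
  fixes f :: "real^'n::finite \<Rightarrow> real^'n"
  assumes D: "D \<in> sets borel"
    and der: "\<And>x. x \<in> D \<Longrightarrow> (f has_derivative (\<lambda>v. A x *v v)) (at x within D)"
    and A: "(\<lambda>x. ennreal (absdet (A x)) * indicator D x) \<in> borel_measurable borel"
    and inj: "inj_on f D" and g: "g \<in> borel_measurable borel"
  shows "(\<lambda>u. \<integral>\<^sup>+x. g x \<partial>count_space (D \<inter> f -` {u})) \<in> borel_measurable lebesgue \<and>
    (\<integral>\<^sup>+u. (\<integral>\<^sup>+x. g x \<partial>count_space (D \<inter> f -` {u})) \<partial>lebesgue) =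
      (\<integral>\<^sup>+x. ennreal (absdet (A x)) * indicator D x * g x \<partial>lborel)"
  using g
proof (induction g rule: borel_measurable_induct)
  case (cong g h)
  then show ?case by simp
next
  case (set S)
  let ?T = "f ` (D \<inter> S)"
  have S: "D \<inter> S \<in> sets lebesgue" using D set by auto
  have d: "(f has_derivative (\<lambda>v. A x *v v)) (at x within D \<inter> S)" if "x \<in> D \<inter> S" for x
    using der that by (auto intro: has_derivative_subset)
  have i: "inj_on f (D \<inter> S)" using inj by (auto intro: inj_on_subset)
  have eq: "(\<integral>\<^sup>+x. indicator S x \<partial>count_space (D \<inter> f -` {u})) = indicator ?T u" for u
  proof (cases "u \<in> ?T")
    case True
    then obtain x where x: "x \<in> D" "x \<in> S" "u = f x" by auto
    then have "D \<inter> f -` {u} = {x}" using inj by (auto simp: inj_on_def)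
    then show ?thesis using x True by (simp add: nn_integral_count_space_finite)
  next
    case False
    then have "(\<integral>\<^sup>+x. indicator S x \<partial>count_space (D \<inter> f -` {u})) = (\<integral>\<^sup>+x. 0 \<partial>count_space (D \<inter> f -` {u}))"
      by (intro nn_integral_cong) (auto simp: indicator_def)
    then show ?thesis using False by simp
  qed
  note E = emeasure_inj_image[OF S d i]
  have "(\<integral>\<^sup>+u. indicator ?T u \<partial>lebesgue) = emeasure lebesgue ?T"
    using E(1) by simp
  also have "\<dots> = (\<integral>\<^sup>+x. ennreal (absdet (A x)) * indicator (D \<inter> S) x \<partial>lebesgue)"
    by (rule E(2))
  also have "\<dots> = (\<integral>\<^sup>+x. ennreal (absdet (A x)) * indicator D x * indicator S x \<partial>lebesgue)"
    by (intro nn_integral_cong) (auto simp: indicator_def)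
  finally show ?case unfolding eq using E(1) by (simp add: nn_integral_completion)
next
  case (mult g c)
  then have "(\<integral>\<^sup>+x. c * g x \<partial>count_space (D \<inter> f -` {u})) = c * (\<integral>\<^sup>+x. g x \<partial>count_space (D \<inter> f -` {u}))" for u
    by (intro nn_integral_cmult) auto
  moreover have "(\<integral>\<^sup>+x. ennreal (absdet (A x)) * indicator D x * (c * g x) \<partial>lborel) =
      c * (\<integral>\<^sup>+x. ennreal (absdet (A x)) * indicator D x * g x \<partial>lborel)"
    using A mult by (subst nn_integral_cmult[symmetric]) (auto simp: mult_ac intro!: nn_integral_cong)
  moreover from mult have [measurable]: "(\<lambda>u. \<integral>\<^sup>+x. g x \<partial>count_space (D \<inter> f -` {u})) \<in> borel_measurable lebesgue"
    by blast
  then have "(\<lambda>u. c * (\<integral>\<^sup>+x. g x \<partial>count_space (D \<inter> f -` {u}))) \<in> borel_measurable lebesgue"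
    by measurable
  ultimately show ?case using mult by (simp add: nn_integral_cmult)
next
  case (add g h)
  then have "(\<integral>\<^sup>+x. h x + g x \<partial>count_space (D \<inter> f -` {u})) =
     (\<integral>\<^sup>+x. h x \<partial>count_space (D \<inter> f -` {u})) + (\<integral>\<^sup>+x. g x \<partial>count_space (D \<inter> f -` {u}))" for u
    by (intro nn_integral_add) auto
  moreover have "(\<integral>\<^sup>+x. ennreal (absdet (A x)) * indicator D x * (h x + g x) \<partial>lborel) =
      (\<integral>\<^sup>+x. ennreal (absdet (A x)) * indicator D x * h x \<partial>lborel) +
      (\<integral>\<^sup>+x. ennreal (absdet (A x)) * indicator D x * g x \<partial>lborel)"
    using A add by (subst nn_integral_add[symmetric]) (auto simp: distrib_left intro!: nn_integral_cong)
  moreover from add have [measurable]: "(\<lambda>u. \<integral>\<^sup>+x. g x \<partial>count_space (D \<inter> f -` {u})) \<in> borel_measurable lebesgue"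
      "(\<lambda>u. \<integral>\<^sup>+x. h x \<partial>count_space (D \<inter> f -` {u})) \<in> borel_measurable lebesgue"
    by blast+
  then have "(\<lambda>u. (\<integral>\<^sup>+x. h x \<partial>count_space (D \<inter> f -` {u})) + (\<integral>\<^sup>+x. g x \<partial>count_space (D \<inter> f -` {u}))) \<in> borel_measurable lebesgue"
    by measurable
  ultimately show ?case using add by (simp add: nn_integral_add)
next
  case (seq G)
  have "(\<integral>\<^sup>+x. (SUP i. G i) x \<partial>count_space (D \<inter> f -` {u})) =
     (SUP i. \<integral>\<^sup>+x. G i x \<partial>count_space (D \<inter> f -` {u}))" for u
    unfolding SUP_apply using seq by (intro nn_integral_monotone_convergence_SUP) auto
  moreover have "(\<integral>\<^sup>+x. ennreal (absdet (A x)) * indicator D x * (SUP i. G i) x \<partial>lborel) =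
     (SUP i. \<integral>\<^sup>+x. ennreal (absdet (A x)) * indicator D x * G i x \<partial>lborel)"
  proof -
    have "(\<integral>\<^sup>+x. ennreal (absdet (A x)) * indicator D x * (SUP i. G i) x \<partial>lborel) =
       (\<integral>\<^sup>+x. (SUP i. ennreal (absdet (A x)) * indicator D x * G i x) \<partial>lborel)"
      by (simp only: SUP_apply SUP_mult_left_ennreal)
    also have "\<dots> = (SUP i. \<integral>\<^sup>+x. ennreal (absdet (A x)) * indicator D x * G i x \<partial>lborel)"
      using A seq by (intro nn_integral_monotone_convergence_SUP) (auto simp: incseq_def le_fun_def mult_left_mono)
    finally show ?thesis .
  qed
  moreover have "(\<integral>\<^sup>+u. (SUP i. \<integral>\<^sup>+x. G i x \<partial>count_space (D \<inter> f -` {u})) \<partial>lebesgue) =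
     (SUP i. \<integral>\<^sup>+u. (\<integral>\<^sup>+x. G i x \<partial>count_space (D \<inter> f -` {u})) \<partial>lebesgue)"
    using seq by (intro nn_integral_monotone_convergence_SUP) (auto simp: incseq_def le_fun_def intro!: nn_integral_mono)
  moreover from seq have [measurable]: "(\<lambda>u. \<integral>\<^sup>+x. G i x \<partial>count_space (D \<inter> f -` {u})) \<in> borel_measurable lebesgue" for i
    by blast
  then have "(\<lambda>u. SUP i. \<integral>\<^sup>+x. G i x \<partial>count_space (D \<inter> f -` {u})) \<in> borel_measurable lebesgue"
    by measurable
  ultimately show ?case using seq by simp
qed

text \<open>The injectivity half of the inverse function theorem. The sum of the absolute entries
  dominates the operator norm, so continuity of the derivative at \<open>a\<close> can be checked
  entrywise.\<close>

lemma locally_inj: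
  fixes f :: "real^'n::finite \<Rightarrow> real^'n"
  assumes U: "open U" "a \<in> U" and der: "\<And>x. x \<in> U \<Longrightarrow> (f has_derivative (\<lambda>v. A x *v v)) (at x)"
    and A: "continuous_on U A" and a: "absdet (A a) \<noteq> 0"
  shows "\<exists>r>0. ball a r \<subseteq> U \<and> inj_on f (ball a r)"
proof -
  have "\<not> (\<exists>x. x \<noteq> 0 \<and> A a *v x = 0)" using a absdet_eq_0_iff by blast
  then obtain B where B: "B ** A a = mat 1"
    using matrix_left_invertible_ker[of "A a"] by auto
  have cA: "isCont A a" using A U by (simp add: continuous_on_eq_continuous_at)
  show ?thesis
  proof (rule has_derivative_locally_injective[of a U "(*v) B" "\<lambda>x v. A x *v v" f])
    show "(*v) B \<circ> (*v) (A a) = id"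
      using B by (simp add: fun_eq_iff matrix_vector_mul_assoc)
    fix e :: real assume e: "e > 0"
    let ?s = "\<lambda>x. \<Sum>i\<in>UNIV. \<Sum>j\<in>UNIV. \<bar>(A x - A a) $ i $ j\<bar>"
    have "isCont ?s a" using cA by (intro continuous_intros) auto
    then obtain d where d: "d > 0" "\<And>x. dist x a < d \<Longrightarrow> dist (?s x) (?s a) < e"
      using e unfolding continuous_at_eps_delta by metis
    show "\<exists>d>0. \<forall>x. dist a x < d \<longrightarrow> onorm (\<lambda>v. A x *v v - A a *v v) < e"
    proof (intro exI[of _ d] conjI allI impI d(1))
      fix x assume "dist a x < d"
      then have "dist (?s x) (?s a) < e" by (intro d(2)) (simp add: dist_commute)
      then have "?s x < e" by (simp add: dist_real_def)
      moreover have "onorm ((*v) (A x - A a)) \<le> ?s x" by (rule onorm_le_matrix_component_sum)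
      moreover have "(\<lambda>v. A x *v v - A a *v v) = (*v) (A x - A a)"
        by (simp add: fun_eq_iff matrix_vector_mult_diff_rdistrib)
      ultimately show "onorm (\<lambda>v. A x *v v - A a *v v) < e" by simp
    qed
  qed (use U der in auto)
qed

text \<open>The regular points are covered by countably many balls of injectivity, cut into disjoint
  Borel pieces. Critical points contribute to neither side: their values form a null set and their
  Jacobian is zero.\<close>

proposition area_formula:
  fixes f :: "real^'n::finite \<Rightarrow> real^'n"
  assumes U: "open U" and der: "\<And>x. x \<in> U \<Longrightarrow> (f has_derivative (\<lambda>v. A x *v v)) (at x)"
    and A: "continuous_on U A" and g [measurable]: "g \<in> borel_measurable borel"
  shows "(\<integral>\<^sup>+u. (\<integral>\<^sup>+x. g x \<partial>count_space (U \<inter> f -` {u})) \<partial>lborel) =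
      (\<integral>\<^sup>+x. ennreal (absdet (A x)) * indicator U x * g x \<partial>lborel)"
proof -
  let ?V = "{x \<in> U. absdet (A x) \<noteq> 0}"
  have "open (U \<inter> (\<lambda>x. absdet (A x)) -` (- {0}))"
    using U A by (intro continuous_open_preimage continuous_intros) auto
  also have "U \<inter> (\<lambda>x. absdet (A x)) -` (- {0}) = ?V" by auto
  finally have V: "open ?V" .
  have "\<exists>r>0. ball a r \<subseteq> ?V \<and> inj_on f (ball a r)" if "a \<in> ?V" for a
  proof (rule locally_inj[OF V that, where A=A])
    show "continuous_on ?V A" by (rule continuous_on_subset[OF A]) auto
    show "absdet (A a) \<noteq> 0" using that by simp
  qed (simp add: der)
  then have "\<forall>a\<in>?V. \<exists>r. r > 0 \<and> ball a r \<subseteq> ?V \<and> inj_on f (ball a r)" by blast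
  from bchoice[OF this] obtain r where
    "\<forall>a\<in>?V. r a > 0 \<and> ball a (r a) \<subseteq> ?V \<and> inj_on f (ball a (r a))" ..
  then have r: "r a > 0 \<and> ball a (r a) \<subseteq> ?V \<and> inj_on f (ball a (r a))" if "a \<in> ?V" for a
    using that by blast
  obtain F' where F': "F' \<subseteq> (\<lambda>a. ball a (r a)) ` ?V" "countable F'" "\<Union>F' = \<Union>((\<lambda>a. ball a (r a)) ` ?V)"
    using Lindelof[of "(\<lambda>a. ball a (r a)) ` ?V"] by auto
  have UF: "\<Union>F' = ?V" using F'(3) r by fastforce
  define B where "B n = (if F' = {} then {} else from_nat_into F' n)" for n
  have rB: "range B = (if F' = {} then {{}} else F')"
    using F'(2) by (auto simp: B_def range_from_nat_into)
  have BV: "(\<Union>n. B n) = ?V" using rB UF by (auto split: if_splits)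
  have Bopen: "open (B n)" and Binj: "inj_on f (B n)" for n
  proof -
    have "B n \<in> range B" by simp
    then have "B n = {} \<or> B n \<in> F'" unfolding rB by (auto split: if_splits)
    then have "B n = {} \<or> (\<exists>a\<in>?V. B n = ball a (r a))" using F'(1) by auto
    then show "open (B n)" "inj_on f (B n)" using r by auto
  qed
  let ?D = "disjointed B"
  have D: "?D n \<in> sets borel" for n
  proof -
    have "range B \<subseteq> sets borel" using Bopen by (auto intro: borel_open)
    then show ?thesis using sets.range_disjointed_sets[of B borel] by blast
  qed
  have DB: "?D n \<subseteq> B n" for n by (rule disjointed_subset)
  have DV: "(\<Union>n. ?D n) = ?V" using BV by (simp add: UN_disjointed_eq)
  have DU: "?D n \<subseteq> U" for n using DV by auto
  have derD: "(f has_derivative (\<lambda>v. A x *v v)) (at x within S)" if "x \<in> U" for x S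
    using der[OF that] by (rule has_derivative_at_withinI)
  have mA: "(\<lambda>x. ennreal (absdet (A x)) * indicator E x) \<in> borel_measurable borel" if E: "E \<in> sets borel" "E \<subseteq> U" for E
  proof -
    have "continuous_on E (\<lambda>x. absdet (A x))"
      using E A by (intro continuous_intros) (auto intro: continuous_on_subset)
    then have "(\<lambda>x. indicator E x *\<^sub>R absdet (A x)) \<in> borel_measurable borel"
      using E(1) by (rule borel_measurable_continuous_on_indicator[rotated])
    then have "(\<lambda>x. ennreal (indicator E x *\<^sub>R absdet (A x))) \<in> borel_measurable borel" by simp
    also have "(\<lambda>x. ennreal (indicator E x *\<^sub>R absdet (A x))) = (\<lambda>x. ennreal (absdet (A x)) * indicator E x)"
      by (auto simp: fun_eq_iff indicator_def)
    finally show ?thesis .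
  qed
  have part: "(\<lambda>u. \<integral>\<^sup>+x. g x \<partial>count_space (?D n \<inter> f -` {u})) \<in> borel_measurable lebesgue \<and>
    (\<integral>\<^sup>+u. (\<integral>\<^sup>+x. g x \<partial>count_space (?D n \<inter> f -` {u})) \<partial>lebesgue) =
      (\<integral>\<^sup>+x. ennreal (absdet (A x)) * indicator (?D n) x * g x \<partial>lborel)" for n
    using DU derD by (intro inj_area_formula D mA inj_on_subset[OF Binj DB] g) auto
  have split: "(\<integral>\<^sup>+x. g x \<partial>count_space (?V \<inter> f -` {u})) =
      (\<Sum>n. \<integral>\<^sup>+x. g x \<partial>count_space (?D n \<inter> f -` {u}))" for u
  proof -
    have dj: "disjoint_family (\<lambda>n. ?D n \<inter> f -` {u})"
      using disjoint_family_disjointed[of B] by (auto simp: disjoint_family_on_def)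
    have "?V \<inter> f -` {u} = (\<Union>n. ?D n \<inter> f -` {u})" using DV by blast
    then have "(\<integral>\<^sup>+x. g x \<partial>count_space (?V \<inter> f -` {u})) =
       (\<integral>\<^sup>+x. g x * (\<Sum>n. indicator (?D n \<inter> f -` {u}) x) \<partial>count_space UNIV)"
      by (simp add: nn_integral_count_space_indicator suminf_indicator[OF dj])
    also have "\<dots> = (\<Sum>n. \<integral>\<^sup>+x. g x * indicator (?D n \<inter> f -` {u}) x \<partial>count_space UNIV)"
      by (subst nn_integral_suminf[symmetric]) auto
    finally show ?thesis by (simp add: nn_integral_count_space_indicator)
  qed
  have "negligible (f ` (U - ?V))"
    using derD by (intro negligible_critical_values[where A=A]) auto
  then have "AE u in lebesgue. u \<notin> f ` (U - ?V)"
    by (simp add: negligible_iff_null_sets AE_not_in)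
  then have "AE u in lebesgue. (\<integral>\<^sup>+x. g x \<partial>count_space (U \<inter> f -` {u})) = (\<integral>\<^sup>+x. g x \<partial>count_space (?V \<inter> f -` {u}))"
  proof eventually_elim
    case (elim u)
    then have "U \<inter> f -` {u} = ?V \<inter> f -` {u}" by auto
    then show ?case by (rule arg_cong)
  qed
  then have "(\<integral>\<^sup>+u. (\<integral>\<^sup>+x. g x \<partial>count_space (U \<inter> f -` {u})) \<partial>lebesgue) =
     (\<integral>\<^sup>+u. (\<Sum>n. \<integral>\<^sup>+x. g x \<partial>count_space (?D n \<inter> f -` {u})) \<partial>lebesgue)"
    unfolding split[symmetric] by (rule nn_integral_cong_AE)
  also have "\<dots> = (\<Sum>n. \<integral>\<^sup>+x. ennreal (absdet (A x)) * indicator (?D n) x * g x \<partial>lborel)"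
    using part by (subst nn_integral_suminf) auto
  also have "\<dots> = (\<integral>\<^sup>+x. (\<Sum>n. ennreal (absdet (A x)) * indicator (?D n) x * g x) \<partial>lborel)"
    using mA[OF D DU] by (intro nn_integral_suminf[symmetric]) auto
  also have "\<dots> = (\<integral>\<^sup>+x. ennreal (absdet (A x)) * indicator ?V x * g x \<partial>lborel)"
  proof (intro nn_integral_cong)
    fix x
    have "(\<Sum>n. indicator (?D n) x :: ennreal) = indicator ?V x"
      using suminf_indicator[OF disjoint_family_disjointed[of B]] DV by metis
    then show "(\<Sum>n. ennreal (absdet (A x)) * indicator (?D n) x * g x) = ennreal (absdet (A x)) * indicator ?V x * g x"
      by simp
  qed
  also have "\<dots> = (\<integral>\<^sup>+x. ennreal (absdet (A x)) * indicator U x * g x \<partial>lborel)"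
    by (intro nn_integral_cong) (auto simp: indicator_def)
  finally show ?thesis by (simp add: nn_integral_completion)
qed

section \<open>Invariance of the coefficient law under rotations of space\<close>

section \<open>Rotation invariance\<close>

lemma updb_comp_measurable:
  fixes b :: "'n::finite \<Rightarrow> 'i::countable"
  assumes "f \<in> borel_measurable M" "g \<in> borel_measurable M"
  shows "(\<lambda>x. updb b (f x) (g x)) \<in> borel_measurable M"
proof -
  have "(\<lambda>x. (f x, g x)) \<in> M \<rightarrow>\<^sub>M borel \<Otimes>\<^sub>M borel" using assms by measurable
  from measurable_compose[OF this updb_measurable[of b]] show ?thesis by simp
qed

definition blockrot :: "('n \<Rightarrow> 'i) \<Rightarrow> real^'n^'n::finite \<Rightarrow> ('i \<Rightarrow> real) \<Rightarrow> 'i \<Rightarrow> real" where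
  "blockrot b R J = updb b J (R *v (\<chi> i. J (b i)))"

lemma blockrot_measurable [measurable]:
  fixes b :: "'n::finite \<Rightarrow> 'i::countable"
  shows "blockrot b R \<in> borel_measurable borel"
proof -
  have "(\<lambda>J. \<chi> i. J (b i)) \<in> borel_measurable (borel :: ('i \<Rightarrow> real) measure)"
    by (subst borel_measurable_vec_iff) simp
  then have "(\<lambda>J. R *v (\<chi> i. J (b i))) \<in> borel_measurable (borel :: ('i \<Rightarrow> real) measure)"
    by (rule measurable_compose) measurable
  then show ?thesis unfolding blockrot_def[abs_def] by (intro updb_comp_measurable) auto
qed

lemma nn_integral_blockrot:
  fixes b :: "'n::finite \<Rightarrow> 'i::countable"
  assumes b: "inj b" and R: "orthogonal_matrix R" and F [measurable]: "F \<in> borel_measurable borel"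
  shows "(\<integral>\<^sup>+J. F (blockrot b R J) \<partial>gam) = (\<integral>\<^sup>+J. F J \<partial>gam)"
proof -
  have eq: "blockrot b R (updb b J u) = updb b J (R *v u)" for J u
    by (simp add: blockrot_def updb_block[OF b]) (auto simp: updb_def)
  have "(\<integral>\<^sup>+u. F (updb b J (R *v u)) \<partial>gvec) = (\<integral>\<^sup>+u. F (updb b J u) \<partial>gvec)" for J
  proof -
    have "(\<lambda>u. F (updb b J u)) \<in> borel_measurable borel"
      by (rule measurable_compose[OF updb_comp_measurable F]) auto
    then have "(\<integral>\<^sup>+u. F (updb b J u) \<partial>distr gvec borel ((*v) R)) = (\<integral>\<^sup>+u. F (updb b J (R *v u)) \<partial>gvec)"
      by (intro nn_integral_distr) measurable
    then show ?thesis by (simp add: gvec_orthogonal[OF R])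
  qed
  moreover have "(\<integral>\<^sup>+J. F (blockrot b R J) \<partial>gam) = (\<integral>\<^sup>+J. \<integral>\<^sup>+u. F (blockrot b R (updb b J u)) \<partial>gvec \<partial>gam)"
    by (rule nn_integral_resample[OF b]) measurable
  ultimately show ?thesis by (simp add: eq nn_integral_resample[OF b F])
qed

text \<open>A rotation of space acts on a coefficient tensor in all \<open>p\<close> slots; this is
  its action in the single slot \<open>q\<close>.\<close>

definition slotrot :: "nat \<Rightarrow> real^'n^'n::finite \<Rightarrow> nat \<Rightarrow> ('n list \<Rightarrow> real) \<Rightarrow> 'n list \<Rightarrow> real" where
  "slotrot p R q J l = (if length l = p then \<Sum>i\<in>UNIV. R $ (l ! q) $ i * J (l[q := i]) else J l)"

lemma slotrot_measurable [measurable]: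
  fixes R :: "real^'n::finite^'n"
  shows "slotrot p R q \<in> borel_measurable borel"
  unfolding slotrot_def[abs_def] by (intro borel_measurable_funI) auto

text \<open>Multi-indices that differ only at position \<open>q\<close> form disjoint blocks, and
  \<open>R\<close> rotates the standard Gaussian vector of each block. The blocks are rotated one
  after the other, by induction on the set of their representatives.\<close>

lemma nn_integral_slotrot:
  fixes R :: "real^'n::finite^'n"
  assumes q: "q < p" and R: "orthogonal_matrix R" and F: "F \<in> borel_measurable borel"
  shows "(\<integral>\<^sup>+J. F (slotrot p R q J) \<partial>gam) = (\<integral>\<^sup>+J. F J \<partial>gam)"
proof -
  \<comment> \<open>Any fixed letter serves: \<open>l[q := e]\<close> names the block that contains
    \<open>l\<close>.\<close>
  define e :: 'n where "e = undefined"
  define P where "P K J l = (if length l = p \<and> l[q := e] \<in> K then \<Sum>i\<in>UNIV. R $ (l ! q) $ i * J (l[q := i]) else J l)"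
    for K :: "'n list set" and J :: "'n list \<Rightarrow> real" and l :: "'n list"
  have "P K \<in> borel_measurable borel \<and> (\<forall>F\<in>borel_measurable borel. (\<integral>\<^sup>+J. F (P K J) \<partial>gam) = (\<integral>\<^sup>+J. F J \<partial>gam))"
    if "finite K" "K \<subseteq> {k. length k = p \<and> k ! q = e}" for K
    using that
  proof (induction K)
    case empty
    have "P {} = (\<lambda>J. J)" by (auto simp: P_def fun_eq_iff)
    then show ?case by simp
  next
    case (insert k K)
    let ?b = "\<lambda>i. k[q := i]"
    have k: "length k = p" "k ! q = e" using insert by auto
    have b: "inj ?b" using k q by (auto simp: inj_on_def) (metis nth_list_update_eq)
    have ke: "k[q := e] = k" using k q by (metis list_update_id)
    have eq: "P (insert k K) J = blockrot ?b R (P K J)" for J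
    proof
      fix l
      show "P (insert k K) J l = blockrot ?b R (P K J) l"
      proof (cases "l \<in> range ?b")
        case True
        then obtain j where l: "l = k[q := j]" by auto
        have "blockrot ?b R (P K J) l = (\<Sum>i\<in>UNIV. R $ j $ i * P K J (k[q := i]))"
          unfolding blockrot_def l updb_block[OF b] by (simp add: matrix_vector_mult_def)
        also have "\<dots> = (\<Sum>i\<in>UNIV. R $ j $ i * J (k[q := i]))"
          using insert(2) by (simp add: P_def ke)
        also have "\<dots> = P (insert k K) J l"
          using k q by (simp add: P_def l ke)
        finally show ?thesis by simp
      next
        case False
        have "l[q := e] \<noteq> k" if "length l = p"
        proof
          assume "l[q := e] = k"
          then have "l = k[q := l ! q]" using that q by auto
          then show False using False by auto
        qed
        then show ?thesis using False by (auto simp: blockrot_def updb_other P_def)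
      qed
    qed
    have m: "P K \<in> borel_measurable borel" using insert by auto
    have eq': "P (insert k K) = (\<lambda>J. blockrot ?b R (P K J))" using eq by (simp add: fun_eq_iff)
    have "(\<integral>\<^sup>+J. F (P (insert k K) J) \<partial>gam) = (\<integral>\<^sup>+J. F J \<partial>gam)" if F: "F \<in> borel_measurable borel" for F
    proof -
      have "(\<lambda>J. F (blockrot ?b R J)) \<in> borel_measurable borel"
        by (rule measurable_compose[OF blockrot_measurable F])
      then have "(\<integral>\<^sup>+J. F (blockrot ?b R (P K J)) \<partial>gam) = (\<integral>\<^sup>+J. F (blockrot ?b R J) \<partial>gam)"
        using insert by auto
      then show ?thesis by (simp add: eq nn_integral_blockrot[OF b R F])
    qed
    moreover have "P (insert k K) \<in> borel_measurable borel"
      unfolding eq' by (rule measurable_compose[OF m blockrot_measurable])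
    ultimately show ?case by blast
  qed
  from this[of "{k. length k = p \<and> k ! q = e}"]
  have "(\<integral>\<^sup>+J. F (P {k. length k = p \<and> k ! q = e} J) \<partial>gam) = (\<integral>\<^sup>+J. F J \<partial>gam)"
    using F finite_subset[OF _ finite_lists_length[of p]] by auto
  moreover have "P {k. length k = p \<and> k ! q = e} = slotrot p R q"
    using q by (auto simp: P_def slotrot_def fun_eq_iff)
  ultimately show ?thesis by simp
qed

primrec rot :: "real^'n^'n::finite \<Rightarrow> 'n list \<Rightarrow> ('n list \<Rightarrow> real) \<Rightarrow> real" where
  "rot R [] J = J []"
| "rot R (j # l) J = (\<Sum>i\<in>UNIV. R $ j $ i * rot R l (\<lambda>m. J (i # m)))"

lemma slotrots_Cons:
  "foldr (slotrot (Suc p) R) (map Suc qs) J (i # l) = foldr (slotrot p R) qs (\<lambda>m. J (i # m)) l"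
  by (induction qs arbitrary: l) (simp_all add: slotrot_def)

lemma rot_eq_slotrots: "length l = p \<Longrightarrow> rot R l J = foldr (slotrot p R) [0..<p] J l"
proof (induction l arbitrary: p J)
  case (Cons j l)
  then obtain q where q: "p = Suc q" "length l = q" by (cases p) auto
  have u: "[0..<p] = 0 # map Suc [0..<q]"
    unfolding q(1) by (simp add: upt_conv_Cons map_Suc_upt del: upt_Suc)
  have "foldr (slotrot p R) [0..<p] J (j # l) =
      (\<Sum>i\<in>UNIV. R $ j $ i * foldr (slotrot p R) (map Suc [0..<q]) J (i # l))"
    unfolding u using q by (simp add: slotrot_def)
  also have "\<dots> = (\<Sum>i\<in>UNIV. R $ j $ i * rot R l (\<lambda>m. J (i # m)))"
    unfolding q(1) slotrots_Cons using q by (simp add: Cons.IH[of q])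
  finally show ?case by simp
qed simp

text \<open>The simultaneous rotation is compared with the composition of slot rotations on lists of
  length \<open>p\<close>, which is why \<open>F\<close> may read no others.\<close>

lemma nn_integral_rot:
  fixes R :: "real^'n::finite^'n"
  assumes R: "orthogonal_matrix R" and F: "F \<in> borel_measurable borel"
    and dep: "\<And>J K. (\<And>l. length l = p \<Longrightarrow> J l = K l) \<Longrightarrow> F J = F K"
  shows "(\<integral>\<^sup>+J. F (\<lambda>l. rot R l J) \<partial>gam) = (\<integral>\<^sup>+J. F J \<partial>gam)"
proof -
  have "foldr (slotrot p R) qs \<in> borel_measurable borel \<and>
      (\<forall>F\<in>borel_measurable borel. (\<integral>\<^sup>+J. F (foldr (slotrot p R) qs J) \<partial>gam) = (\<integral>\<^sup>+J. F J \<partial>gam))"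
    if "\<forall>q\<in>set qs. q < p" for qs
    using that
  proof (induction qs)
    case Nil
    have "foldr (slotrot p R) [] = (\<lambda>J. J)" by (simp add: fun_eq_iff)
    then show ?case by simp
  next
    case (Cons q qs)
    have m: "foldr (slotrot p R) qs \<in> borel_measurable borel" using Cons by auto
    have "(\<integral>\<^sup>+J. F (foldr (slotrot p R) (q # qs) J) \<partial>gam) = (\<integral>\<^sup>+J. F J \<partial>gam)" if F: "F \<in> borel_measurable borel" for F
    proof -
      have "(\<lambda>J. F (slotrot p R q J)) \<in> borel_measurable borel"
        by (rule measurable_compose[OF slotrot_measurable F])
      then have "(\<integral>\<^sup>+J. F (slotrot p R q (foldr (slotrot p R) qs J)) \<partial>gam) = (\<integral>\<^sup>+J. F (slotrot p R q J) \<partial>gam)"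
        using Cons by auto
      then show ?thesis using Cons.prems by (simp add: nn_integral_slotrot[OF _ R F])
    qed
    moreover have "foldr (slotrot p R) (q # qs) \<in> borel_measurable borel"
      using measurable_compose[OF m slotrot_measurable] by (simp add: o_def)
    ultimately show ?case by blast
  qed
  from this[of "[0..<p]"] have "(\<integral>\<^sup>+J. F (foldr (slotrot p R) [0..<p] J) \<partial>gam) = (\<integral>\<^sup>+J. F J \<partial>gam)"
    using F by auto
  moreover have "F (\<lambda>l. rot R l J) = F (foldr (slotrot p R) [0..<p] J)" for J
    by (rule dep) (rule rot_eq_slotrots)
  ultimately show ?thesis by simp
qed

lemma pform_sum: "pform p (\<lambda>l. \<Sum>i\<in>A. c i * f i l) y = (\<Sum>i\<in>A. c i * pform p (f i) y)"
  unfolding pform_eq_sum sum_distrib_left sum_distrib_right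
  by (subst sum.swap) (simp add: mult_ac)

lemma pform_rot:
  fixes R :: "real^'n::finite^'n"
  assumes R: "orthogonal_matrix R"
  shows "pform p (\<lambda>l. rot R l J) (R *v y) = pform p J y"
proof (induction p arbitrary: J)
  case (Suc p)
  have RR: "transpose R ** R = mat 1" using R by (simp add: orthogonal_matrix_def)
  have "pform (Suc p) (\<lambda>l. rot R l J) (R *v y) =
     (\<Sum>j\<in>UNIV. (R *v y) $ j * pform p (\<lambda>l. \<Sum>i\<in>UNIV. R $ j $ i * rot R l (\<lambda>m. J (i # m))) (R *v y))"
    by simp
  also have "\<dots> = (\<Sum>j\<in>UNIV. \<Sum>i\<in>UNIV. (R *v y) $ j * (R $ j $ i * pform p (\<lambda>m. J (i # m)) y))"
    unfolding pform_sum Suc.IH by (simp add: sum_distrib_left)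
  also have "\<dots> = (\<Sum>i\<in>UNIV. (\<Sum>j\<in>UNIV. transpose R $ i $ j * (R *v y) $ j) * pform p (\<lambda>m. J (i # m)) y)"
    unfolding sum_distrib_right by (subst sum.swap) (simp add: mult_ac transpose_def)
  also have "(\<lambda>i. \<Sum>j\<in>UNIV. transpose R $ i $ j * (R *v y) $ j) = (\<lambda>i. (transpose R *v (R *v y)) $ i)"
    by (simp only: matrix_vector_mult_def[of "transpose R"] vec_lambda_beta)
  also have "transpose R *v (R *v y) = y"
    by (simp only: matrix_vector_mul_assoc RR matrix_vector_mul_lid)
  finally show ?case by simp
qed simp

lemma orthogonal_matrix_cancel:
  assumes "orthogonal_matrix (R :: real^'n::finite^'n)"
  shows "transpose R *v (R *v y) = y" "R *v (transpose R *v y) = y"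
  using assms by (simp_all only: matrix_vector_mul_assoc orthogonal_matrix_def matrix_vector_mul_lid)

text \<open>Differentiating the invariance of the form along \<open>y \<mapsto> R *v y\<close>,
  instead of expanding the recursion.\<close>

lemma pgrad_rot:
  fixes R :: "real^'n::finite^'n"
  assumes R: "orthogonal_matrix R"
  shows "pgrad p (\<lambda>l. rot R l J) (R *v y) = R *v pgrad p J y"
proof -
  have "((\<lambda>y. pform p (\<lambda>l. rot R l J) (R *v y)) has_derivative (\<lambda>v. pgrad p (\<lambda>l. rot R l J) (R *v y) \<bullet> (R *v v))) (at y)"
    by (rule has_derivative_compose[OF _ pform_has_derivative])
       (intro bounded_linear_imp_has_derivative matrix_vector_mul_bounded_linear)
  then have "(pform p J has_derivative (\<lambda>v. pgrad p (\<lambda>l. rot R l J) (R *v y) \<bullet> (R *v v))) (at y)"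
    by (simp add: pform_rot[OF R])
  from has_derivative_unique[OF this pform_has_derivative]
  have "pgrad p (\<lambda>l. rot R l J) (R *v y) \<bullet> (R *v v) = pgrad p J y \<bullet> v" for v
    by metis
  then have "transpose R *v pgrad p (\<lambda>l. rot R l J) (R *v y) = pgrad p J y"
    by (subst vector_eq_ldot[symmetric]) (metis dot_lmul_matrix inner_commute vector_transpose_matrix)
  then show ?thesis using orthogonal_matrix_cancel[OF R] by metis
qed

lemma phess_rot:
  fixes R :: "real^'n::finite^'n"
  assumes R: "orthogonal_matrix R"
  shows "phess p (\<lambda>l. rot R l J) (R *v y) = R ** phess p J y ** transpose R"
proof -
  have "((\<lambda>y. pgrad p (\<lambda>l. rot R l J) (R *v y)) has_derivative (\<lambda>v. phess p (\<lambda>l. rot R l J) (R *v y) *v (R *v v))) (at y)"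
    by (rule has_derivative_compose[OF _ pgrad_has_derivative])
       (intro bounded_linear_imp_has_derivative matrix_vector_mul_bounded_linear)
  moreover have "((\<lambda>y. R *v pgrad p J y) has_derivative (\<lambda>v. R *v (phess p J y *v v))) (at y)"
    by (rule bounded_linear.has_derivative[OF matrix_vector_mul_bounded_linear pgrad_has_derivative])
  ultimately have "(\<lambda>v. phess p (\<lambda>l. rot R l J) (R *v y) *v (R *v v)) = (\<lambda>v. R *v (phess p J y *v v))"
    unfolding pgrad_rot[OF R] by (rule has_derivative_unique)
  then have "phess p (\<lambda>l. rot R l J) (R *v y) *v (R *v (transpose R *v v)) = R *v (phess p J y *v (transpose R *v v))" for v
    by metis
  then show ?thesis
    by (subst matrix_eq) (simp add: orthogonal_matrix_cancel[OF R] matrix_vector_mul_assoc[symmetric] del: transpose_matrix_vector)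
qed

section \<open>Conditional densities of Gaussian vectors, made pointwise by continuity\<close>

section \<open>Disintegration along a block of coefficients\<close>

lemma indep_gam: "gam.indep_vars (\<lambda>_. borel) (\<lambda>l J. J l) (UNIV :: 'i::countable set)"
proof (subst gam.indep_vars_iff_distr_eq_PiM)
  have m: "(\<lambda>J. J l) \<in> borel_measurable (gam :: ('i \<Rightarrow> real) measure)" for l by simp
  then show "gam.random_variable borel (\<lambda>J::'i \<Rightarrow> real. J l)" for l .
  have d: "distr gam borel (\<lambda>J. J l) = gauss" for l :: 'i
  proof -
    have "distr gam borel (\<lambda>J. J l) = distr gam gauss (\<lambda>J. J l)" by (intro distr_cong) auto
    also have "\<dots> = gauss" unfolding gam_def by (rule distr_PiM_component) (auto intro: gauss.prob_space_axioms)
    finally show ?thesis .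
  qed
  have "distr gam (PiM UNIV (\<lambda>_::'i. borel)) (\<lambda>x. \<lambda>i\<in>UNIV. x i) = distr gam gam (\<lambda>x. x)"
    by (intro distr_cong) (auto simp: sets_PiM_equal_borel)
  then show "distr gam (PiM UNIV (\<lambda>_::'i. borel)) (\<lambda>x. \<lambda>i\<in>UNIV. x i) = PiM UNIV (\<lambda>i. distr gam borel (\<lambda>J. J i))"
    unfolding d by (simp add: distr_id2 gam_def)
qed simp

lemma distributed_gam: "distributed gam lborel (\<lambda>J. J l) (\<lambda>x. ennreal (std_normal_density x))"
proof -
  have "distr gam lborel (\<lambda>J. J l) = distr gam gauss (\<lambda>J. J l)" by (intro distr_cong) auto
  also have "\<dots> = gauss" unfolding gam_def by (rule distr_PiM_component) (auto intro: gauss.prob_space_axioms)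
  finally show ?thesis by (auto simp: distributed_def gauss_def)
qed

lemma distr_eq_gauss_of_distributed:
  "distributed M lborel X (\<lambda>x. ennreal (std_normal_density x)) \<Longrightarrow> distr M borel X = gauss"
  using distr_cong[of M M borel lborel X X] unfolding distributed_def gauss_def by simp

lemma (in prob_space) nn_integral_indep_gauss_PiM:
  fixes X :: "'e::countable \<Rightarrow> 'a \<Rightarrow> real" and F :: "('e \<Rightarrow> real) \<Rightarrow> ennreal"
  assumes X: "indep_vars (\<lambda>_. borel) X E" and g: "\<And>e. e \<in> E \<Longrightarrow> distributed M lborel (X e) (\<lambda>x. ennreal (std_normal_density x))"
    and E: "E \<noteq> {}" and F: "F \<in> borel_measurable borel"
    and dep: "\<And>h k. (\<And>e. e \<in> E \<Longrightarrow> h e = k e) \<Longrightarrow> F h = F k"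
    and Y: "\<And>e x. e \<in> E \<Longrightarrow> Y x e = X e x"
  shows "(\<integral>\<^sup>+x. F (Y x) \<partial>M) = (\<integral>\<^sup>+h. F (\<lambda>e. if e \<in> E then h e else 0) \<partial>PiM E (\<lambda>_. gauss))"
proof -
  define Z :: "('e \<Rightarrow> real) \<Rightarrow> 'e \<Rightarrow> real" where "Z h e = (if e \<in> E then h e else 0)" for h e
  have Z: "Z \<in> PiM E (\<lambda>_. borel) \<rightarrow>\<^sub>M borel"
  proof (intro borel_measurable_funI)
    show "(\<lambda>h. Z h e) \<in> borel_measurable (PiM E (\<lambda>_. borel))" for e
      by (cases "e \<in> E") (simp_all add: Z_def)
  qed
  have rv: "random_variable borel (X e)" if "e \<in> E" for e
    using g[OF that] by (auto simp: distributed_def)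
  then have m: "(\<lambda>x. \<lambda>e\<in>E. X e x) \<in> M \<rightarrow>\<^sub>M PiM E (\<lambda>_. borel)" by (intro measurable_restrict)
  have "distr M (PiM E (\<lambda>_. borel)) (\<lambda>x. \<lambda>e\<in>E. X e x) = PiM E (\<lambda>e. distr M borel (X e))"
    using indep_vars_iff_distr_eq_PiM'[OF E rv] X by simp
  also have "\<dots> = PiM E (\<lambda>_. gauss)"
    by (intro PiM_cong distr_eq_gauss_of_distributed g refl)
  finally have "(\<integral>\<^sup>+h. F (Z h) \<partial>PiM E (\<lambda>_. gauss)) = (\<integral>\<^sup>+h. F (Z h) \<partial>distr M (PiM E (\<lambda>_. borel)) (\<lambda>x. \<lambda>e\<in>E. X e x))"
    by simp
  also have "\<dots> = (\<integral>\<^sup>+x. F (Z (\<lambda>e\<in>E. X e x)) \<partial>M)"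
    by (intro nn_integral_distr m) (use measurable_compose[OF Z F] in simp)
  also have "\<dots> = (\<integral>\<^sup>+x. F (Y x) \<partial>M)"
    by (intro nn_integral_cong dep) (simp add: Z_def Y)
  finally show ?thesis by (simp add: Z_def[abs_def])
qed

text \<open>Both sides equal the integral over the product of standard normals indexed by
  \<open>E\<close>. Outside \<open>E\<close> the family \<open>Y\<close> is arbitrary, since
  \<open>F\<close> reads coordinates in \<open>E\<close> only.\<close>

lemma (in prob_space) nn_integral_indep_gauss:
  fixes X :: "'e::countable \<Rightarrow> 'a \<Rightarrow> real" and F :: "('e \<Rightarrow> real) \<Rightarrow> ennreal"
  assumes X: "indep_vars (\<lambda>_. borel) X E" and g: "\<And>e. e \<in> E \<Longrightarrow> distributed M lborel (X e) (\<lambda>x. ennreal (std_normal_density x))"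
    and E: "E \<noteq> {}" and F: "F \<in> borel_measurable borel"
    and dep: "\<And>h k. (\<And>e. e \<in> E \<Longrightarrow> h e = k e) \<Longrightarrow> F h = F k"
    and Y: "\<And>e x. e \<in> E \<Longrightarrow> Y x e = X e x"
  shows "(\<integral>\<^sup>+x. F (Y x) \<partial>M) = (\<integral>\<^sup>+h. F h \<partial>gam)"
proof -
  have "gam.indep_vars (\<lambda>_. borel) (\<lambda>e h. h e) E"
    using indep_gam by (rule gam.indep_vars_subset) auto
  from gam.nn_integral_indep_gauss_PiM[OF this distributed_gam E F dep, where Y="\<lambda>h. h"]
    nn_integral_indep_gauss_PiM[OF X g E F dep, where Y=Y] Y
  show ?thesis by simp
qed

text \<open>A sum over a group of \<open>n\<close> independent standard normals has variance
  \<open>n\<close>, and disjoint groups give independent sums.\<close>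

lemma nn_integral_group_sums:
  fixes A :: "'e::countable \<Rightarrow> 'i::countable set" and F :: "('e \<Rightarrow> real) \<Rightarrow> ennreal"
  assumes A: "\<And>e. e \<in> E \<Longrightarrow> finite (A e)" "\<And>e. e \<in> E \<Longrightarrow> A e \<noteq> {}" "disjoint_family_on A E"
    and E: "E \<noteq> {}" and F: "F \<in> borel_measurable borel"
    and dep: "\<And>h k. (\<And>e. e \<in> E \<Longrightarrow> h e = k e) \<Longrightarrow> F h = F k"
    and Y: "\<And>e J. e \<in> E \<Longrightarrow> Y J e = (\<Sum>l\<in>A e. J l) / sqrt (card (A e))"
  shows "(\<integral>\<^sup>+J. F (Y J) \<partial>gam) = (\<integral>\<^sup>+h. F h \<partial>gam)"
proof (rule gam.nn_integral_indep_gauss[where X="\<lambda>e J. (\<Sum>l\<in>A e. J l) / sqrt (card (A e))"])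
  have "gam.indep_vars (\<lambda>e. PiM (A e) (\<lambda>_. borel)) (\<lambda>e J. restrict (\<lambda>l. J l) (A e)) E"
    using A(3) by (intro gam.indep_vars_restrict[OF indep_gam]) auto
  then have "gam.indep_vars (\<lambda>_. borel) (\<lambda>e J. (\<lambda>x. (\<Sum>l\<in>A e. x l) / sqrt (card (A e))) (restrict (\<lambda>l. J l) (A e))) E"
    by (rule gam.indep_vars_compose2) auto
  then show "gam.indep_vars (\<lambda>_. borel) (\<lambda>e J. (\<Sum>l\<in>A e. J l) / sqrt (card (A e))) E"
    by simp
  fix e assume e: "e \<in> E"
  have "distributed gam lborel (\<lambda>J. \<Sum>l\<in>A e. J l) (normal_density (\<Sum>l\<in>A e. 0) (sqrt (\<Sum>l\<in>A e. 1\<^sup>2)))"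
    using A e by (intro gam.sum_indep_normal gam.indep_vars_subset[OF indep_gam] distributed_gam) auto
  then have "distributed gam lborel (\<lambda>J. \<Sum>l\<in>A e. J l) (normal_density 0 (sqrt (card (A e))))"
    by simp
  moreover have "sqrt (card (A e)) > 0" using A e by (simp add: card_gt_0_iff)
  ultimately show "distributed gam lborel (\<lambda>J. (\<Sum>l\<in>A e. J l) / sqrt (card (A e))) (\<lambda>x. ennreal (std_normal_density x))"
    using gam.normal_standard_normal_convert[of "sqrt (card (A e))" "\<lambda>J. \<Sum>l\<in>A e. J l" 0] by simp
next
  show "E \<noteq> {}" by (rule E)
  show "F \<in> borel_measurable borel" by (rule F)
  show "F h = F k" if "\<And>e. e \<in> E \<Longrightarrow> h e = k e" for h k using that by (rule dep)
  show "Y J e = (\<Sum>l\<in>A e. J l) / sqrt (card (A e))" if "e \<in> E" for e J using that by (rule Y)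
qed

lemma matrix_inv_cancel:
  assumes "invertible (A :: real^'n::finite^'n)"
  shows "matrix_inv A ** A = mat 1" "A ** matrix_inv A = mat 1"
  using someI_ex[OF assms[unfolded invertible_def]] by (auto simp: matrix_inv_def)

text \<open>The area formula for a bijective affine map, whose fibres are single points.\<close>

lemma nn_integral_affine:
  fixes A :: "real^'n::finite^'n"
  assumes A: "absdet A \<noteq> 0" and f: "f \<in> borel_measurable borel"
  shows "(\<integral>\<^sup>+u. f (A *v u + c) \<partial>lborel) = (\<integral>\<^sup>+w. f w / absdet A \<partial>lborel)"
proof -
  have inv: "invertible A"
    using A absdet_eq_0_iff[of A] matrix_left_invertible_ker[of A] invertible_left_inverse[of A] by auto
  have sol: "UNIV \<inter> (\<lambda>u. A *v u + c) -` {w} = {matrix_inv A *v (w - c)}" for w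
  proof -
    have "A *v u + c = w \<longleftrightarrow> u = matrix_inv A *v (w - c)" for u
    proof
      assume "A *v u + c = w"
      then have "w - c = A *v u" by auto
      then show "u = matrix_inv A *v (w - c)" using inv by (simp add: matrix_vector_mul_assoc matrix_inv_cancel)
    next
      assume "u = matrix_inv A *v (w - c)"
      then show "A *v u + c = w" using inv by (simp add: matrix_vector_mul_assoc matrix_inv_cancel)
    qed
    then show ?thesis by auto
  qed
  have [measurable]: "(\<lambda>u. f (A *v u + c)) \<in> borel_measurable borel"
    using f by measurable
  have "(\<integral>\<^sup>+w. (\<integral>\<^sup>+u. f (A *v u + c) \<partial>count_space (UNIV \<inter> (\<lambda>u. A *v u + c) -` {w})) \<partial>lborel) =
     (\<integral>\<^sup>+u. ennreal (absdet A) * indicator UNIV u * f (A *v u + c) \<partial>lborel)"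
    by (intro area_formula) (auto intro!: derivative_eq_intros bounded_linear_imp_has_derivative matrix_vector_mul_bounded_linear)
  also have "\<dots> = ennreal (absdet A) * (\<integral>\<^sup>+u. f (A *v u + c) \<partial>lborel)"
    by (simp add: nn_integral_cmult)
  also have "(\<integral>\<^sup>+w. (\<integral>\<^sup>+u. f (A *v u + c) \<partial>count_space (UNIV \<inter> (\<lambda>u. A *v u + c) -` {w})) \<partial>lborel) = (\<integral>\<^sup>+w. f w \<partial>lborel)"
    unfolding sol using inv by (simp add: nn_integral_count_space_finite matrix_vector_mul_assoc matrix_inv_cancel)
  finally have "(\<integral>\<^sup>+w. f w \<partial>lborel) / ennreal (absdet A) = (\<integral>\<^sup>+u. f (A *v u + c) \<partial>lborel)"
    using A by (simp add: ennreal_mult_divide_eq mult.commute[of "ennreal (absdet A)"] less_le)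
  then show ?thesis using f by (simp add: nn_integral_divide)
qed

definition affine_block :: "('n::finite \<Rightarrow> 'i) \<Rightarrow> (('i \<Rightarrow> real) \<Rightarrow> real^'n) \<Rightarrow> real^'n^'n \<Rightarrow> bool" where
  "affine_block b L A \<longleftrightarrow> inj b \<and> absdet A \<noteq> 0 \<and> (\<forall>J u. L (updb b J u) = A *v u + L (updb b J 0))"

text \<open>The values of the block that solve \<open>L = w\<close>, the other coefficients being
  given.\<close>

definition bsol :: "('n::finite \<Rightarrow> 'i) \<Rightarrow> (('i \<Rightarrow> real) \<Rightarrow> real^'n) \<Rightarrow> real^'n^'n \<Rightarrow> real^'n \<Rightarrow> ('i \<Rightarrow> real) \<Rightarrow> real^'n" where
  "bsol b L A w J = matrix_inv A *v (w - L (updb b J 0))"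

text \<open>The density of \<open>L\<close> at \<open>w\<close> times the conditional expectation of \<open>\<Theta> \<circ> S\<close> given \<open>L = w\<close>; this
  product depends only on the joint law of \<open>L\<close> and \<open>S\<close>, not on the choice of the block.\<close>

definition dkern :: "('n::finite \<Rightarrow> 'i::countable) \<Rightarrow> (('i \<Rightarrow> real) \<Rightarrow> real^'n) \<Rightarrow> real^'n^'n \<Rightarrow>
    (('i \<Rightarrow> real) \<Rightarrow> 'c) \<Rightarrow> real^'n \<Rightarrow> ('c \<Rightarrow> ennreal) \<Rightarrow> ennreal" where
  "dkern b L A S w \<Theta> =
     (\<integral>\<^sup>+J. ennreal (gdens (bsol b L A w J) / absdet A) * \<Theta> (S (updb b J (bsol b L A w J))) \<partial>gam)"

lemma affine_block_solve:
  assumes "affine_block b L A"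
  shows "L (updb b J u) = w \<longleftrightarrow> u = bsol b L A w J"
proof -
  have inv: "invertible A"
    using assms absdet_eq_0_iff[of A] matrix_left_invertible_ker[of A] invertible_left_inverse[of A] by (auto simp: affine_block_def)
  have L: "L (updb b J u) = A *v u + L (updb b J 0)" for u using assms unfolding affine_block_def by blast
  show ?thesis
  proof
    assume "L (updb b J u) = w"
    then have "w - L (updb b J 0) = A *v u" using L[of u] by auto
    then show "u = bsol b L A w J" using inv by (simp add: bsol_def matrix_vector_mul_assoc matrix_inv_cancel)
  next
    assume "u = bsol b L A w J"
    then show "L (updb b J u) = w" using inv L[of u] by (simp add: bsol_def matrix_vector_mul_assoc matrix_inv_cancel)
  qed
qed

lemma continuous_on_updb:
  fixes f :: "'a::topological_space \<Rightarrow> 'i \<Rightarrow> real" and g :: "'a \<Rightarrow> real^'n::finite"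
  assumes "continuous_on S f" "continuous_on S g"
  shows "continuous_on S (\<lambda>x. updb b (f x) (g x))"
proof (rule continuous_on_coordinatewise_then_product)
  fix l show "continuous_on S (\<lambda>x. updb b (f x) (g x) l)"
    using assms continuous_on_product_then_coordinatewise[OF assms(1), of l]
    by (cases "l \<in> range b") (auto simp: updb_def intro!: continuous_intros)
qed

lemma continuous_on_bsol:
  assumes L: "continuous_on UNIV L" and "continuous_on S f" "continuous_on S g"
  shows "continuous_on S (\<lambda>x. bsol b L A (f x) (g x))"
proof -
  have "continuous_on S (\<lambda>x. L (updb b (g x) 0))"
    by (rule continuous_on_compose2[OF L continuous_on_updb[OF assms(3)]]) (auto intro: continuous_intros)
  then show ?thesis unfolding bsol_def
    by (intro continuous_intros assms matrix_vector_mult_linear_continuous_on[THEN continuous_on_compose2]) auto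
qed

lemma continuous_on_dkern_arg:
  assumes L: "continuous_on UNIV L" and S: "continuous_on UNIV S"
  shows "continuous_on UNIV (\<lambda>(w, J). S (updb b J (bsol b L A w J)))"
  unfolding split_def
  by (rule continuous_on_compose2[OF S continuous_on_updb[OF _ continuous_on_bsol[OF L]]]) (auto intro: continuous_intros)

lemma continuous_on_gdens [continuous_intros]: "continuous_on S f \<Longrightarrow> continuous_on S (\<lambda>x. gdens (f x))"
  unfolding gdens_def by (intro continuous_intros) auto

lemma gdens_measurable [measurable]: "gdens \<in> borel_measurable borel"
  by (intro borel_measurable_continuous_onI continuous_intros)

lemma gdens_le: "gdens (u :: real^'n::finite) \<le> 1 / sqrt (2 * pi) ^ CARD('n)"
  by (simp add: gdens_def divide_right_mono)

lemma borel_pair_measurable: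
  fixes f :: "'a::second_countable_topology \<times> 'b::second_countable_topology \<Rightarrow> 'c::topological_space"
  shows "continuous_on UNIV f \<Longrightarrow> f \<in> borel_measurable (borel \<Otimes>\<^sub>M borel)"
  by (simp add: borel_prod borel_measurable_continuous_onI)

text \<open>For frozen \<open>J\<close> the substitution \<open>w = A *v u + L (updb b J 0)\<close>
  replaces the block variable by the value of \<open>L\<close>; Fubini then moves the integral over
  \<open>w\<close> outside.\<close>

lemma dkern_disintegration:
  fixes b :: "'n::finite \<Rightarrow> 'i::countable" and S :: "('i \<Rightarrow> real) \<Rightarrow> 'c::second_countable_topology"
  assumes ab: "affine_block b L A" and L: "continuous_on UNIV L" and S: "continuous_on UNIV S"
    and \<phi> [measurable]: "\<phi> \<in> borel_measurable borel" and \<Theta> [measurable]: "\<Theta> \<in> borel_measurable borel"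
  shows "(\<integral>\<^sup>+J. \<phi> (L J) * \<Theta> (S J) \<partial>gam) = (\<integral>\<^sup>+w. dkern b L A S w \<Theta> * \<phi> w \<partial>lborel)"
    and "(\<lambda>w. dkern b L A S w \<Theta>) \<in> borel_measurable borel"
proof -
  have b: "inj b" and A: "absdet A \<noteq> 0" using ab by (auto simp: affine_block_def)
  have [measurable]: "L \<in> borel_measurable borel" "S \<in> borel_measurable borel"
    using L S by (auto intro: borel_measurable_continuous_onI)
  have bs [measurable]: "(\<lambda>(w, J). bsol b L A w J) \<in> borel_measurable (borel \<Otimes>\<^sub>M borel)"
    unfolding split_def by (intro borel_pair_measurable continuous_on_bsol[OF L] continuous_intros)
  have Sm [measurable]: "(\<lambda>(w, J). S (updb b J (bsol b L A w J))) \<in> borel_measurable (borel \<Otimes>\<^sub>M borel)"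
    by (intro borel_pair_measurable continuous_on_dkern_arg L S)
  have "(\<lambda>w. (\<integral>\<^sup>+J. ennreal (gdens (bsol b L A w J) / absdet A) * \<Theta> (S (updb b J (bsol b L A w J))) \<partial>gam)) \<in> borel_measurable borel"
    by measurable
  then show km: "(\<lambda>w. dkern b L A S w \<Theta>) \<in> borel_measurable borel" by (simp add: dkern_def)
  have inner: "(\<integral>\<^sup>+u. \<phi> (L (updb b J u)) * \<Theta> (S (updb b J u)) \<partial>gvec) =
      (\<integral>\<^sup>+w. ennreal (gdens (bsol b L A w J) / absdet A) * \<Theta> (S (updb b J (bsol b L A w J))) * \<phi> w \<partial>lborel)" for J
  proof -
    let ?h = "\<lambda>w. ennreal (gdens (bsol b L A w J)) * (\<phi> w * \<Theta> (S (updb b J (bsol b L A w J))))"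
    have hm: "?h \<in> borel_measurable borel" by measurable
    have u: "bsol b L A (L (updb b J u)) J = u" for u
      using affine_block_solve[OF ab, of J u] by metis
    have Lu: "L (updb b J u) = A *v u + L (updb b J 0)" for u
      using ab unfolding affine_block_def by blast
    have "(\<lambda>u. updb b J u) \<in> borel_measurable borel" by (intro updb_comp_measurable) auto
    then have "(\<integral>\<^sup>+u. \<phi> (L (updb b J u)) * \<Theta> (S (updb b J u)) \<partial>gvec) = (\<integral>\<^sup>+u. ?h (A *v u + L (updb b J 0)) \<partial>lborel)"
      unfolding gvec_eq_density Lu[symmetric] by (subst nn_integral_density) (auto simp: u)
    also have "\<dots> = (\<integral>\<^sup>+w. ?h w / absdet A \<partial>lborel)"
      by (rule nn_integral_affine[OF A hm])
    also have "\<dots> = (\<integral>\<^sup>+w. ennreal (gdens (bsol b L A w J) / absdet A) * \<Theta> (S (updb b J (bsol b L A w J))) * \<phi> w \<partial>lborel)"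
    proof (intro nn_integral_cong)
      fix w
      have "ennreal (gdens (bsol b L A w J) / absdet A) = ennreal (gdens (bsol b L A w J)) * inverse (ennreal (absdet A))"
        using A gdens_pos[of "bsol b L A w J"] absdet_nonneg[of A]
        by (subst divide_ennreal[symmetric]) (auto simp: divide_ennreal_def less_le)
      then show "?h w / absdet A = ennreal (gdens (bsol b L A w J) / absdet A) * \<Theta> (S (updb b J (bsol b L A w J))) * \<phi> w"
        by (simp add: divide_ennreal_def mult_ac)
    qed
    finally show ?thesis .
  qed
  have "(\<integral>\<^sup>+J. \<phi> (L J) * \<Theta> (S J) \<partial>gam) = (\<integral>\<^sup>+J. \<integral>\<^sup>+u. \<phi> (L (updb b J u)) * \<Theta> (S (updb b J u)) \<partial>gvec \<partial>gam)"
    by (rule nn_integral_resample[OF b]) measurable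
  also have "\<dots> = (\<integral>\<^sup>+J. \<integral>\<^sup>+w. ennreal (gdens (bsol b L A w J) / absdet A) * \<Theta> (S (updb b J (bsol b L A w J))) * \<phi> w \<partial>lborel \<partial>gam)"
    unfolding inner ..
  also have "\<dots> = (\<integral>\<^sup>+w. \<integral>\<^sup>+J. ennreal (gdens (bsol b L A w J) / absdet A) * \<Theta> (S (updb b J (bsol b L A w J))) * \<phi> w \<partial>gam \<partial>lborel)"
  proof -
    interpret pair_sigma_finite lborel "gam :: ('i \<Rightarrow> real) measure"
      by (intro pair_sigma_finite.intro sigma_finite_lborel gam.sigma_finite_measure)
    show ?thesis by (rule Fubini') measurable
  qed
  also have "\<dots> = (\<integral>\<^sup>+w. dkern b L A S w \<Theta> * \<phi> w \<partial>lborel)"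
    unfolding dkern_def by (intro nn_integral_cong nn_integral_multc) measurable
  finally show "(\<integral>\<^sup>+J. \<phi> (L J) * \<Theta> (S J) \<partial>gam) = (\<integral>\<^sup>+w. dkern b L A S w \<Theta> * \<phi> w \<partial>lborel)" .
qed

text \<open>Dominated convergence: the integrand is continuous in \<open>w\<close> and bounded,
  because \<open>gdens\<close> is bounded and \<open>gam\<close> is a probability measure.
  Continuity selects a definite version of the conditional density.\<close>

lemma dkern_continuous:
  fixes b :: "'n::finite \<Rightarrow> 'i::countable" and S :: "('i \<Rightarrow> real) \<Rightarrow> 'c::second_countable_topology"
  assumes L: "continuous_on UNIV L" and S: "continuous_on UNIV S" and A: "absdet A \<noteq> 0"
    and \<theta>: "continuous_on UNIV \<theta>" "\<And>s. 0 \<le> \<theta> s" "\<And>s. \<theta> s \<le> (1::real)"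
  obtains k where "continuous_on UNIV k" "\<And>w. dkern b L A S w (\<lambda>s. ennreal (\<theta> s)) = ennreal (k w)" "\<And>w. 0 \<le> k w"
proof
  let ?f = "\<lambda>w J. gdens (bsol b L A w J) / absdet A * \<theta> (S (updb b J (bsol b L A w J)))"
  let ?k = "\<lambda>w. \<integral>J. ?f w J \<partial>gam"
  define C where "C = 1 / sqrt (2 * pi) ^ CARD('n) / absdet A"
  have c: "continuous_on UNIV (\<lambda>(w, J). ?f w J)"
    unfolding split_def using A
    by (intro continuous_intros continuous_on_bsol[OF L] continuous_on_compose2[OF \<theta>(1) continuous_on_dkern_arg[OF L S, unfolded split_def]]) auto
  have m: "(\<lambda>(w, J). ?f w J) \<in> borel_measurable (borel \<Otimes>\<^sub>M borel)" by (rule borel_pair_measurable[OF c])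
  have m1: "?f w \<in> borel_measurable gam" for w
  proof -
    have "(\<lambda>J. case (w, J) of (w, J) \<Rightarrow> ?f w J) \<in> borel_measurable borel"
      by (rule measurable_compose[OF _ m]) measurable
    then show ?thesis by simp
  qed
  have nn: "0 \<le> ?f w J" for w J using \<theta> A gdens_pos[of "bsol b L A w J"] by (simp add: less_le)
  have bd: "norm (?f w J) \<le> C" for w J
  proof -
    have "gdens (bsol b L A w J) / absdet A * \<theta> (S (updb b J (bsol b L A w J))) \<le> C * 1"
      unfolding C_def using \<theta> by (intro mult_mono divide_right_mono gdens_le) auto
    then show ?thesis using nn[of w J] by simp
  qed
  have int: "integrable gam (?f w)" for w
    by (rule gam.integrable_const_bound[of _ C]) (use bd m1 in auto)
  show "0 \<le> ?k w" for w using nn by (intro integral_nonneg_AE) auto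
  show "dkern b L A S w (\<lambda>s. ennreal (\<theta> s)) = ennreal (?k w)" for w
  proof -
    have "dkern b L A S w (\<lambda>s. ennreal (\<theta> s)) = (\<integral>\<^sup>+J. ennreal (?f w J) \<partial>gam)"
      unfolding dkern_def using \<theta>(2)
      by (intro nn_integral_cong ennreal_mult[symmetric]) (simp_all add: less_imp_le[OF gdens_pos])
    also have "\<dots> = ennreal (?k w)"
      using int nn by (intro nn_integral_eq_integral) auto
    finally show ?thesis .
  qed
  show "continuous_on UNIV ?k"
    unfolding continuous_on_sequentially
  proof (intro ballI allI impI, elim conjE)
    fix a :: "real^'n" and w :: "nat \<Rightarrow> real^'n" assume w: "w \<longlonglongrightarrow> a"
    show "(?k \<circ> w) \<longlonglongrightarrow> ?k a"
      unfolding o_def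
    proof (rule integral_dominated_convergence[where w="\<lambda>_. C"])
      show "AE J in gam. (\<lambda>i. ?f (w i) J) \<longlonglongrightarrow> ?f a J"
      proof (rule AE_I2)
        fix J :: "'i \<Rightarrow> real"
        have "continuous_on UNIV (\<lambda>w. ?f w J)"
          using continuous_on_compose2[OF c, of UNIV "\<lambda>w. (w, J)"]
            continuous_on_Pair[OF continuous_on_id continuous_on_const, of UNIV J] by simp
        then show "(\<lambda>i. ?f (w i) J) \<longlonglongrightarrow> ?f a J"
          using w by (rule continuous_on_tendsto_compose) auto
      qed
    qed (use m1 bd in auto)
  qed
qed

lemma AE_eq_imp_eq:
  fixes f g :: "'a::euclidean_space \<Rightarrow> real"
  assumes "continuous_on UNIV f" "continuous_on UNIV g" "AE x in lborel. f x = g x"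
  shows "f = g"
proof -
  let ?D = "{x. f x \<noteq> g x}"
  have op: "open ?D" using assms(1,2) by (intro open_Collect_neq)
  have "emeasure lborel ?D = 0"
    using assms(3) op by (subst (asm) AE_iff_measurable[of ?D]) auto
  then have "negligible ?D" using op by (simp add: negligible_iff_null_sets null_sets_def emeasure_completion)
  then have "?D = {}" using op open_not_negligible by blast
  then show ?thesis by auto
qed

text \<open>The indicator of an open set is the increasing limit of truncated multiples of the
  distance to its complement, and open sets form a generator stable under intersection.\<close>

lemma nn_integral_eqI_continuous:
  fixes P Q :: "'c::metric_space measure"
  assumes P: "sets P = sets borel" "finite_measure P" and Q: "sets Q = sets borel"
    and eq: "\<And>\<theta>. continuous_on UNIV \<theta> \<Longrightarrow> (\<And>s. 0 \<le> \<theta> s) \<Longrightarrow> (\<And>s. \<theta> s \<le> (1::real)) \<Longrightarrow>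
      (\<integral>\<^sup>+s. ennreal (\<theta> s) \<partial>P) = (\<integral>\<^sup>+s. ennreal (\<theta> s) \<partial>Q)"
  shows "P = Q"
proof (rule measure_eqI_generator_eq[where E="{U. open U}" and \<Omega>=UNIV and A="\<lambda>_. UNIV"])
  show "Int_stable {U::'c set. open U}" by (auto simp: Int_stable_def)
  show "sets P = sigma_sets UNIV {U. open U}" "sets Q = sigma_sets UNIV {U. open U}"
    using P Q by (simp_all add: borel_def)
  interpret P: finite_measure P by fact
  show "emeasure P UNIV \<noteq> \<infinity>" for i :: nat by simp
  fix U :: "'c set" assume "U \<in> {U. open U}"
  then have U: "open U" by simp
  show "emeasure P U = emeasure Q U"
  \<comment> \<open>The distance to the empty set is 0 by convention, so the approximation fails for
    the whole space.\<close>
  proof (cases "U = UNIV")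
    case True
    have "(\<integral>\<^sup>+s. ennreal 1 \<partial>P) = (\<integral>\<^sup>+s. ennreal 1 \<partial>Q)" by (rule eq) auto
    then show ?thesis using True P Q by (simp add: sets_eq_imp_space_eq)
  next
    case False
    define \<theta> where "\<theta> n s = min 1 (real n * infdist s (- U))" for n s
    have c: "continuous_on UNIV (\<theta> n)" for n
      unfolding \<theta>_def by (intro continuous_intros)
    have lim: "(SUP n. ennreal (\<theta> n s)) = indicator U s" for s
    proof (cases "s \<in> U")
      case True
      have "infdist s (- U) > 0"
        using True False U by (metis Compl_iff closed_Compl compl_eq_compl_iff Compl_UNIV_eq infdist_pos_not_in_closed)
      then obtain n where "real n * infdist s (- U) > 1" using reals_Archimedean3 by blast
      then have "\<theta> n s = 1" by (simp add: \<theta>_def)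
      then have "1 \<le> (SUP n. ennreal (\<theta> n s))" by (intro SUP_upper2[of n]) auto
      moreover have "(SUP n. ennreal (\<theta> n s)) \<le> 1" by (intro SUP_least) (simp add: \<theta>_def)
      ultimately have "(SUP n. ennreal (\<theta> n s)) = 1" by (rule antisym[rotated])
      then show ?thesis using True by simp
    next
      case False
      then show ?thesis by (simp add: \<theta>_def)
    qed
    have inc: "incseq (\<lambda>n s. ennreal (\<theta> n s))"
      unfolding \<theta>_def by (auto simp: incseq_def le_fun_def intro!: ennreal_leI min.mono mult_right_mono infdist_nonneg)
    have "emeasure R U = (SUP n. \<integral>\<^sup>+s. ennreal (\<theta> n s) \<partial>R)" if R: "sets R = sets borel" for R
    proof -
      have m: "\<theta> n \<in> borel_measurable R" for n
        using borel_measurable_continuous_onI[OF c] R by (simp cong: measurable_cong_sets)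
      have "emeasure R U = (\<integral>\<^sup>+s. indicator U s \<partial>R)" using R U by (simp add: nn_integral_indicator)
      also have "\<dots> = (\<integral>\<^sup>+s. (SUP n. ennreal (\<theta> n s)) \<partial>R)" by (simp add: lim)
      also have "\<dots> = (SUP n. \<integral>\<^sup>+s. ennreal (\<theta> n s) \<partial>R)"
        using inc m by (intro nn_integral_monotone_convergence_SUP) auto
      finally show ?thesis .
    qed
    note S = this
    have "(\<integral>\<^sup>+s. ennreal (\<theta> n s) \<partial>P) = (\<integral>\<^sup>+s. ennreal (\<theta> n s) \<partial>Q)" for n
      by (rule eq[OF c]) (auto simp: \<theta>_def infdist_nonneg)
    then show ?thesis using S[OF P(1)] S[OF Q] by simp
  qed
qed auto

text \<open>Equal laws of \<open>(L, S)\<close> give equal kernels only for almost every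
  \<open>w\<close>. For continuous \<open>\<Theta>\<close> both are continuous in \<open>w\<close>,
  hence equal everywhere, and for fixed \<open>w\<close> a finite measure is determined by its
  continuous integrands. The result is applied at one prescribed \<open>w\<close>, so almost
  everywhere would not suffice.\<close>

proposition dkern_unique:
  fixes b1 :: "'n::finite \<Rightarrow> 'i::countable" and S1 :: "('i \<Rightarrow> real) \<Rightarrow> 'c::{metric_space,second_countable_topology}"
    and b2 :: "'n \<Rightarrow> 'j::countable" and S2 :: "('j \<Rightarrow> real) \<Rightarrow> 'c"
  assumes ab1: "affine_block b1 L1 A1" and L1: "continuous_on UNIV L1" and S1: "continuous_on UNIV S1"
    and ab2: "affine_block b2 L2 A2" and L2: "continuous_on UNIV L2" and S2: "continuous_on UNIV S2"
    and law: "\<And>\<phi> \<Theta>. \<phi> \<in> borel_measurable borel \<Longrightarrow> \<Theta> \<in> borel_measurable borel \<Longrightarrow>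
      (\<integral>\<^sup>+J. \<phi> (L1 J) * \<Theta> (S1 J) \<partial>gam) = (\<integral>\<^sup>+J. \<phi> (L2 J) * \<Theta> (S2 J) \<partial>gam)"
    and \<Theta>: "\<Theta> \<in> borel_measurable borel"
  shows "dkern b1 L1 A1 S1 w \<Theta> = dkern b2 L2 A2 S2 w \<Theta>"
proof -
  have A1: "absdet A1 \<noteq> 0" and A2: "absdet A2 \<noteq> 0" using ab1 ab2 by (auto simp: affine_block_def)
  have cont: "dkern b1 L1 A1 S1 w (\<lambda>s. ennreal (\<theta> s)) = dkern b2 L2 A2 S2 w (\<lambda>s. ennreal (\<theta> s))"
    if \<theta>: "continuous_on UNIV \<theta>" "\<And>s. 0 \<le> \<theta> s" "\<And>s. \<theta> s \<le> (1::real)" for \<theta>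
  proof -
    obtain k1 where k1: "continuous_on UNIV k1" "\<And>w. dkern b1 L1 A1 S1 w (\<lambda>s. ennreal (\<theta> s)) = ennreal (k1 w)" "\<And>w. 0 \<le> k1 w"
      using dkern_continuous[OF L1 S1 A1 \<theta>] by metis
    obtain k2 where k2: "continuous_on UNIV k2" "\<And>w. dkern b2 L2 A2 S2 w (\<lambda>s. ennreal (\<theta> s)) = ennreal (k2 w)" "\<And>w. 0 \<le> k2 w"
      using dkern_continuous[OF L2 S2 A2 \<theta>] by metis
    have \<theta>m: "(\<lambda>s. ennreal (\<theta> s)) \<in> borel_measurable borel"
      using borel_measurable_continuous_onI[OF \<theta>(1)] by measurable
    have km: "k1 \<in> borel_measurable borel" "k2 \<in> borel_measurable borel"
      using k1 k2 by (auto intro: borel_measurable_continuous_onI)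
    \<comment> \<open>Both measures are the image under \<open>L\<close> of the Gaussian measure
      weighted by \<open>\<theta>\<close> evaluated at \<open>S\<close>.\<close>
    have "density lborel (\<lambda>w. ennreal (k1 w)) = density lborel (\<lambda>w. ennreal (k2 w))"
    proof (rule measure_eqI)
      fix X assume "X \<in> sets (density lborel (\<lambda>w. ennreal (k1 w)))"
      then have X: "X \<in> sets borel" by simp
      have "emeasure (density lborel (\<lambda>w. ennreal (k1 w))) X = (\<integral>\<^sup>+J. indicator X (L1 J) * ennreal (\<theta> (S1 J)) \<partial>gam)"
        using dkern_disintegration(1)[OF ab1 L1 S1 _ \<theta>m, of "indicator X"] X km by (simp add: emeasure_density k1)
      also have "\<dots> = (\<integral>\<^sup>+J. indicator X (L2 J) * ennreal (\<theta> (S2 J)) \<partial>gam)"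
        using X \<theta>m by (intro law) auto
      also have "\<dots> = emeasure (density lborel (\<lambda>w. ennreal (k2 w))) X"
        using dkern_disintegration(1)[OF ab2 L2 S2 _ \<theta>m, of "indicator X"] X km by (simp add: emeasure_density k2)
      finally show "emeasure (density lborel (\<lambda>w. ennreal (k1 w))) X = emeasure (density lborel (\<lambda>w. ennreal (k2 w))) X" .
    qed simp
    then have "AE w in lborel. ennreal (k1 w) = ennreal (k2 w)"
      using km by (intro sigma_finite_measure.density_unique[OF sigma_finite_lborel]) auto
    then have "AE w in lborel. k1 w = k2 w"
      by eventually_elim (use k1(3) k2(3) in simp)
    then have "k1 = k2" by (rule AE_eq_imp_eq[OF k1(1) k2(1)])
    then show ?thesis by (simp add: k1 k2)
  qed
  define N1 where "N1 = distr (density gam (\<lambda>J. ennreal (gdens (bsol b1 L1 A1 w J) / absdet A1))) borel (\<lambda>J. S1 (updb b1 J (bsol b1 L1 A1 w J)))"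
  define N2 where "N2 = distr (density gam (\<lambda>J. ennreal (gdens (bsol b2 L2 A2 w J) / absdet A2))) borel (\<lambda>J. S2 (updb b2 J (bsol b2 L2 A2 w J)))"
  have c1: "continuous_on UNIV (\<lambda>J. bsol b1 L1 A1 w J)" and c2: "continuous_on UNIV (\<lambda>J. bsol b2 L2 A2 w J)"
    by (rule continuous_on_bsol[OF L1 continuous_on_const continuous_on_id],
        rule continuous_on_bsol[OF L2 continuous_on_const continuous_on_id])
  have [measurable]: "(\<lambda>J. bsol b1 L1 A1 w J) \<in> borel_measurable borel" "(\<lambda>J. bsol b2 L2 A2 w J) \<in> borel_measurable borel"
    using c1 c2 by (auto intro: borel_measurable_continuous_onI)
  have [measurable]: "(\<lambda>J. S1 (updb b1 J (bsol b1 L1 A1 w J))) \<in> borel_measurable borel"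
    by (intro borel_measurable_continuous_onI continuous_on_compose2[OF S1 continuous_on_updb[OF _ c1]]) (auto intro: continuous_intros)
  have [measurable]: "(\<lambda>J. S2 (updb b2 J (bsol b2 L2 A2 w J))) \<in> borel_measurable borel"
    by (intro borel_measurable_continuous_onI continuous_on_compose2[OF S2 continuous_on_updb[OF _ c2]]) (auto intro: continuous_intros)
  have N1: "(\<integral>\<^sup>+s. \<Theta> s \<partial>N1) = dkern b1 L1 A1 S1 w \<Theta>" if [measurable]: "\<Theta> \<in> borel_measurable borel" for \<Theta>
    unfolding N1_def dkern_def by (subst nn_integral_distr, simp, simp, subst nn_integral_density) auto
  have N2: "(\<integral>\<^sup>+s. \<Theta> s \<partial>N2) = dkern b2 L2 A2 S2 w \<Theta>" if [measurable]: "\<Theta> \<in> borel_measurable borel" for \<Theta>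
    unfolding N2_def dkern_def by (subst nn_integral_distr, simp, simp, subst nn_integral_density) auto
  have "N1 = N2"
  proof (rule nn_integral_eqI_continuous)
    show "finite_measure N1"
    proof
      obtain k where "\<And>w. dkern b1 L1 A1 S1 w (\<lambda>s. ennreal 1) = ennreal (k w)"
        by (rule dkern_continuous[OF L1 S1 A1, of "\<lambda>_. 1" b1]) auto
      moreover have "emeasure N1 (space N1) = dkern b1 L1 A1 S1 w (\<lambda>s. ennreal 1)"
        using N1[of "\<lambda>s. 1"] by simp
      ultimately show "emeasure N1 (space N1) \<noteq> \<infinity>" by simp
    qed
    show "sets N1 = sets borel" "sets N2 = sets borel" by (simp_all add: N1_def N2_def)
    fix \<theta> :: "'c \<Rightarrow> real" assume \<theta>: "continuous_on UNIV \<theta>" "\<And>s. 0 \<le> \<theta> s" "\<And>s. \<theta> s \<le> 1"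
    then have m: "(\<lambda>s. ennreal (\<theta> s)) \<in> borel_measurable borel"
      using borel_measurable_continuous_onI[OF \<theta>(1)] by measurable
    show "(\<integral>\<^sup>+s. ennreal (\<theta> s) \<partial>N1) = (\<integral>\<^sup>+s. ennreal (\<theta> s) \<partial>N2)"
      unfolding N1[OF m] N2[OF m] by (rule cont[OF \<theta>])
  qed
  then show ?thesis using N1[OF \<Theta>] N2[OF \<Theta>] by simp
qed

section \<open>Spectral theorem, variational characterisation of the index, semicontinuity\<close>

section \<open>Eigenvalues and index of symmetric matrices\<close>

definition selfadj_on :: "'a::euclidean_space set \<Rightarrow> ('a \<Rightarrow> 'a) \<Rightarrow> bool" where
  "selfadj_on V A \<longleftrightarrow> subspace V \<and> linear A \<and> A ` V \<subseteq> V \<and> (\<forall>x\<in>V. \<forall>y\<in>V. A x \<bullet> y = x \<bullet> A y)"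

text \<open>An orthonormal eigenbasis. Reading the eigenvalue of \<open>b\<close> as the Rayleigh
  quotient \<open>b \<bullet> A b\<close> avoids a separate eigenvalue function.\<close>

definition eigenbasis :: "'a::euclidean_space set \<Rightarrow> ('a \<Rightarrow> 'a) \<Rightarrow> 'a set \<Rightarrow> bool" where
  "eigenbasis V A B \<longleftrightarrow> finite B \<and> pairwise orthogonal B \<and> (\<forall>b\<in>B. norm b = 1) \<and> span B = V \<and>
     (\<forall>b\<in>B. A b = (b \<bullet> A b) *\<^sub>R b)"

text \<open>A maximiser \<open>u\<close> of the quadratic form on the unit sphere of
  \<open>V\<close> is an eigenvector: if the residual \<open>w = A u - c u\<close> were nonzero, a
  small move from \<open>u\<close> towards \<open>w\<close> would raise the Rayleigh
  quotient.\<close>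

lemma ex_eigenvector_on:
  assumes A: "selfadj_on V A" and V: "\<exists>v\<in>V. v \<noteq> 0"
  shows "\<exists>u\<in>V. norm u = 1 \<and> A u = (u \<bullet> A u) *\<^sub>R u"
proof -
  have sV: "subspace V" and lA: "linear A" and AV: "\<And>v. v \<in> V \<Longrightarrow> A v \<in> V"
    and sa: "\<And>x y. x \<in> V \<Longrightarrow> y \<in> V \<Longrightarrow> A x \<bullet> y = x \<bullet> A y"
    using A by (auto simp: selfadj_on_def)
  let ?S = "V \<inter> sphere 0 1"
  have "compact ?S"
    by (intro closed_Int_compact closed_subspace sV) simp
  moreover obtain v where "v \<in> V" "v \<noteq> 0" using V by blast
  then have "(1 / norm v) *\<^sub>R v \<in> ?S" using sV by (simp add: subspace_scale)
  then have "?S \<noteq> {}" by blast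
  moreover have "continuous_on ?S (\<lambda>v. v \<bullet> A v)"
    using lA by (intro continuous_intros linear_continuous_on) (simp add: linear_conv_bounded_linear)
  ultimately obtain u where u: "u \<in> ?S" and max: "\<And>v. v \<in> ?S \<Longrightarrow> v \<bullet> A v \<le> u \<bullet> A u"
    using continuous_attains_sup[of ?S "\<lambda>v. v \<bullet> A v"] by blast
  define c where "c = u \<bullet> A u"
  have uV: "u \<in> V" and nu: "norm u = 1" using u by auto
  have uu: "u \<bullet> u = 1" using nu by (simp add: norm_eq_sqrt_inner)
  have le: "v \<bullet> A v \<le> c * (v \<bullet> v)" if "v \<in> V" for v
  proof (cases "v = 0")
    case True then show ?thesis using lA by (simp add: linear_0)
  next
    case False
    let ?w = "(1 / norm v) *\<^sub>R v"
    have "?w \<in> ?S" using that sV False by (simp add: subspace_scale)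
    then have "?w \<bullet> A ?w \<le> c" unfolding c_def by (rule max)
    moreover have "?w \<bullet> A ?w = (v \<bullet> A v) / (v \<bullet> v)"
      using lA by (simp add: linear_scale power2_norm_eq_inner[symmetric] power2_eq_square)
    ultimately have "(v \<bullet> A v) / (v \<bullet> v) \<le> c" by (simp only:)
    moreover have "v \<bullet> v > 0" using False by simp
    ultimately show ?thesis by (simp add: divide_le_eq del: inner_gt_zero_iff)
  qed
  define w where "w = A u - c *\<^sub>R u"
  have wV: "w \<in> V" unfolding w_def using sV AV[OF uV] uV by (simp add: subspace_diff subspace_scale)
  have wu: "w \<bullet> u = 0" by (simp add: w_def inner_diff_left c_def uu inner_commute[of "A u" u])
  have wAu: "w \<bullet> A u = w \<bullet> w" 
  proof -
    have "w \<bullet> w = w \<bullet> A u - c * (w \<bullet> u)" by (subst (2) w_def) (simp add: inner_diff_right)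
    then show ?thesis using wu by simp
  qed
  have quad: "2 * t * (w \<bullet> w) + t\<^sup>2 * (w \<bullet> A w - c * (w \<bullet> w)) \<le> 0" for t
  proof -
    have "u + t *\<^sub>R w \<in> V" using sV uV wV by (simp add: subspace_add subspace_scale)
    note l = le[OF this]
    have "u \<bullet> A w = w \<bullet> w" using sa[OF uV wV] wAu by (simp add: inner_commute[of "A u"])
    then have e1: "(u + t *\<^sub>R w) \<bullet> A (u + t *\<^sub>R w) = c + 2 * t * (w \<bullet> w) + t\<^sup>2 * (w \<bullet> A w)"
      using lA wAu
      by (simp add: linear_add linear_scale inner_add_left inner_add_right c_def power2_eq_square algebra_simps)
    have e2: "(u + t *\<^sub>R w) \<bullet> (u + t *\<^sub>R w) = 1 + t\<^sup>2 * (w \<bullet> w)"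
      using wu by (simp add: inner_add_left inner_add_right uu inner_commute[of u w] power2_eq_square algebra_simps)
    show ?thesis using l unfolding e1 e2 by (simp add: algebra_simps)
  qed
  have "w \<bullet> w = 0"
  proof (rule ccontr)
    assume "w \<bullet> w \<noteq> 0"
    then have pos: "w \<bullet> w > 0" by simp
    \<comment> \<open>\<open>K\<close> exceeds the modulus of the quadratic coefficient, and at
      \<open>t = (w \<bullet> w) / K\<close> the linear gain in \<open>quad\<close> is at least
      twice the quadratic loss.\<close>
    define K where "K = \<bar>w \<bullet> A w - c * (w \<bullet> w)\<bar> + 1"
    define t where "t = (w \<bullet> w) / K"
    have K: "K > 0" "w \<bullet> A w - c * (w \<bullet> w) \<ge> - K" by (auto simp: K_def)
    have t: "t > 0" "t * K = w \<bullet> w" using K pos by (auto simp: t_def)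
    have "t\<^sup>2 * (w \<bullet> A w - c * (w \<bullet> w)) \<ge> t\<^sup>2 * (- K)" using K by (intro mult_left_mono) auto
    then have "2 * t * (w \<bullet> w) + t\<^sup>2 * (w \<bullet> A w - c * (w \<bullet> w)) \<ge> 2 * t * (w \<bullet> w) - t * (t * K)"
      by (simp add: power2_eq_square)
    also have "2 * t * (w \<bullet> w) - t * (t * K) = t * (w \<bullet> w)" by (simp add: t)
    finally show False using quad[of t] mult_pos_pos[OF t(1) pos] by simp
  qed
  then have "A u = c *\<^sub>R u" by (simp add: w_def)
  then show ?thesis using uV nu c_def by auto
qed

lemma ex_eigenbasis: "selfadj_on V A \<Longrightarrow> \<exists>B. eigenbasis V A B"
proof (induction "dim V" arbitrary: V rule: less_induct)
  case less
  have sV: "subspace V" and lA: "linear A" and AV: "\<And>v. v \<in> V \<Longrightarrow> A v \<in> V"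
    and sa: "\<And>x y. x \<in> V \<Longrightarrow> y \<in> V \<Longrightarrow> A x \<bullet> y = x \<bullet> A y"
    using less.prems by (auto simp: selfadj_on_def)
  show ?case
  proof (cases "\<exists>v\<in>V. v \<noteq> 0")
    case False
    then have "V = {0}" using sV subspace_0 by blast
    then have "eigenbasis V A {}" by (simp add: eigenbasis_def)
    then show ?thesis by blast
  next
    case True
    then obtain u where u: "u \<in> V" "norm u = 1" "A u = (u \<bullet> A u) *\<^sub>R u"
      using ex_eigenvector_on[OF less.prems] by blast
    have uu: "u \<bullet> u = 1" using u by (simp add: norm_eq_sqrt_inner)
    define V' where "V' = {v \<in> V. v \<bullet> u = 0}"
    have sV': "subspace V'" using sV by (auto simp: V'_def subspace_def inner_add_left)
    have "selfadj_on V' A"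
      unfolding selfadj_on_def
    proof (intro conjI sV' lA)
      show "A ` V' \<subseteq> V'"
      proof
        fix x assume "x \<in> A ` V'"
        then obtain v where v: "v \<in> V" "v \<bullet> u = 0" "x = A v" by (auto simp: V'_def)
        have "A v \<bullet> u = v \<bullet> A u" using sa v u by simp
        also have "\<dots> = 0" by (subst u(3)) (simp add: v)
        finally show "x \<in> V'" using v AV by (simp add: V'_def)
      qed
      show "\<forall>x\<in>V'. \<forall>y\<in>V'. A x \<bullet> y = x \<bullet> A y" using sa by (auto simp: V'_def)
    qed
    moreover have "u \<notin> V'" "V' \<subseteq> V" using uu by (auto simp: V'_def)
    then have "V' \<subset> V" using u by blast
    then have "dim V' < dim V" using sV sV' by (intro dim_psubset) (simp add: span_eq_iff[THEN iffD2])
    ultimately obtain B where B: "eigenbasis V' A B" using less.hyps by blast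
    have BV: "B \<subseteq> V'" using B span_superset[of B] by (auto simp: eigenbasis_def)
    have "span (insert u B) = V"
    proof
      show "span (insert u B) \<subseteq> V" using BV u sV by (intro span_minimal) (auto simp: V'_def)
      show "V \<subseteq> span (insert u B)"
      proof
        fix v assume v: "v \<in> V"
        have "v - (v \<bullet> u) *\<^sub>R u \<in> V'" using v u sV uu
          by (simp add: V'_def subspace_diff subspace_scale inner_diff_left)
        then have "v - (v \<bullet> u) *\<^sub>R u \<in> span B" using B by (simp add: eigenbasis_def)
        then show "v \<in> span (insert u B)" unfolding span_insert by blast
      qed
    qed
    then have "eigenbasis V A (insert u B)"
      using B BV u unfolding eigenbasis_def
      by (auto simp: pairwise_insert orthogonal_def V'_def inner_commute)
    then show ?thesis by blast
  qed
qed

text \<open>Turns an order statistic into a count below a threshold, the form in which ordered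
  eigenvalues are handled below.\<close>

lemma sorted_nth_ge_iff:
  fixes c :: "'a::linorder"
  shows "k < length xs \<Longrightarrow> sorted xs \<Longrightarrow> c \<le> xs ! k \<longleftrightarrow> length (filter (\<lambda>x. x < c) xs) \<le> k"
proof (induction xs arbitrary: k)
  case (Cons x xs)
  show ?case
  proof (cases "x < c")
    case True
    then show ?thesis using Cons by (cases k) auto
  next
    case False
    then have "filter (\<lambda>x. x < c) xs = []" using Cons by (auto simp: filter_empty_conv)
    moreover have "c \<le> (x # xs) ! k"
      using False Cons.prems by (cases k) (auto, metis leD le_less_trans linorder_le_less_linear nth_mem)
    ultimately show ?thesis using False by simp
  qed
qed simp

lemma sorted_concat_replicate:
  fixes cs :: "'a::linorder list"
  shows "sorted cs \<Longrightarrow> sorted (concat (map (\<lambda>c. replicate (f c) c) cs))"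
proof (induction cs)
  case (Cons c cs)
  then have "\<forall>x\<in>set (concat (map (\<lambda>c. replicate (f c) c) cs)). c \<le> x" by auto
  then show ?case using Cons by (simp add: sorted_append sorted_replicate)
qed simp

lemma length_filter_concat_replicate:
  "length (filter P (concat (map (\<lambda>c. replicate (f c) c) cs))) = (\<Sum>c\<leftarrow>cs. if P c then f c else 0)"
  by (induction cs) auto

context
  fixes V A B
  assumes sa: "selfadj_on V A" and eb: "eigenbasis (V :: 'a::euclidean_space set) A B"
begin

lemma eigenbasis_inner: "b \<in> B \<Longrightarrow> b' \<in> B \<Longrightarrow> b \<bullet> b' = of_bool (b = b')"
  using eb by (auto simp: eigenbasis_def pairwise_def orthogonal_def norm_eq_sqrt_inner)

lemma eigenbasis_independent: "S \<subseteq> B \<Longrightarrow> independent S"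
proof -
  assume S: "S \<subseteq> B"
  have "independent B"
    using eb by (intro pairwise_orthogonal_independent) (auto simp: eigenbasis_def)
  then show ?thesis using S independent_mono by blast
qed

lemma eigenbasis_span_expand:
  assumes S: "S \<subseteq> B" and v: "v \<in> span S" shows "v = (\<Sum>b\<in>S. (v \<bullet> b) *\<^sub>R b)"
proof -
  have fin: "finite S" using S eb finite_subset by (auto simp: eigenbasis_def)
  obtain u where u: "v = (\<Sum>b\<in>S. u b *\<^sub>R b)" using v fin by (auto simp: span_finite)
  have "v \<bullet> b = u b" if "b \<in> S" for b
  proof -
    have "v \<bullet> b = (\<Sum>b'\<in>S. if b' = b then u b else 0)"
      unfolding u inner_sum_left using S that by (intro sum.cong) (auto simp: eigenbasis_inner subset_iff)
    then show ?thesis using fin that by simp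
  qed
  then show ?thesis using u by simp
qed

lemma eigenbasis_apply: "v \<in> V \<Longrightarrow> b \<in> B \<Longrightarrow> A v \<bullet> b = (b \<bullet> A b) * (v \<bullet> b)"
proof -
  assume v: "v \<in> V" and b: "b \<in> B"
  have bV: "b \<in> V" using b eb span_superset by (auto simp: eigenbasis_def)
  have "A v \<bullet> b = v \<bullet> A b" using sa v bV by (auto simp: selfadj_on_def)
  also have "\<dots> = (b \<bullet> A b) * (v \<bullet> b)" using eb b unfolding eigenbasis_def by (metis inner_scaleR_right)
  finally show ?thesis .
qed

lemma eigenbasis_quad: "v \<in> V \<Longrightarrow> v \<bullet> A v = (\<Sum>b\<in>B. (b \<bullet> A b) * (v \<bullet> b)\<^sup>2)"
proof -
  assume v: "v \<in> V"
  have "A v \<bullet> v = A v \<bullet> (\<Sum>b\<in>B. (v \<bullet> b) *\<^sub>R b)"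
    using eigenbasis_span_expand[of B v] v eb by (simp add: eigenbasis_def)
  also have "\<dots> = (\<Sum>b\<in>B. (b \<bullet> A b) * (v \<bullet> b)\<^sup>2)"
    unfolding inner_sum_right using v by (intro sum.cong) (auto simp: eigenbasis_apply power2_eq_square)
  finally show ?thesis by (simp add: inner_commute)
qed

lemma eigenspace_eq_span: "eigenspace_on V A c = span {b \<in> B. b \<bullet> A b = c}"
proof
  show "eigenspace_on V A c \<subseteq> span {b \<in> B. b \<bullet> A b = c}"
  proof
    fix v assume "v \<in> eigenspace_on V A c"
    then have v: "v \<in> V" "A v = c *\<^sub>R v" by (auto simp: eigenspace_on_def)
    have z: "v \<bullet> b = 0" if "b \<in> B" "b \<bullet> A b \<noteq> c" for b
      using eigenbasis_apply[OF v(1) that(1)] that(2) v(2) by simp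
    have "v = (\<Sum>b\<in>B. (v \<bullet> b) *\<^sub>R b)"
      using eigenbasis_span_expand[of B v] v eb by (simp add: eigenbasis_def)
    also have "\<dots> = (\<Sum>b\<in>{b \<in> B. b \<bullet> A b = c}. (v \<bullet> b) *\<^sub>R b)"
      using eb z by (intro sum.mono_neutral_right) (auto simp: eigenbasis_def)
    also have "\<dots> \<in> span {b \<in> B. b \<bullet> A b = c}"
      by (intro span_sum span_scale span_base)
    finally show "v \<in> span {b \<in> B. b \<bullet> A b = c}" .
  qed
  have sub: "subspace (eigenspace_on V A c)"
    using sa by (auto simp: eigenspace_on_def selfadj_on_def subspace_def linear_add linear_scale linear_0 scaleR_right_distrib)
  have "{b \<in> B. b \<bullet> A b = c} \<subseteq> eigenspace_on V A c"
    using eb span_superset[of B] unfolding eigenspace_on_def eigenbasis_def by auto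
  then show "span {b \<in> B. b \<bullet> A b = c} \<subseteq> eigenspace_on V A c"
    using sub by (rule span_minimal)
qed

lemma eigenvalues_on_eigenbasis:
  "eigenvalues_on V A = concat (map (\<lambda>c. replicate (card {b \<in> B. b \<bullet> A b = c}) c) (sorted_list_of_set ((\<lambda>b. b \<bullet> A b) ` B)))"
proof -
  have d: "dim (eigenspace_on V A c) = card {b \<in> B. b \<bullet> A b = c}" for c
    unfolding eigenspace_eq_span dim_span by (intro dim_eq_card_independent eigenbasis_independent) auto
  have "{c. \<exists>v \<in> eigenspace_on V A c. v \<noteq> 0} = (\<lambda>b. b \<bullet> A b) ` B"
  proof safe
    fix c v assume v: "v \<in> eigenspace_on V A c" "v \<noteq> 0"
    then have "{b \<in> B. b \<bullet> A b = c} \<noteq> {}" unfolding eigenspace_eq_span by (metis singletonD span_empty)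
    then show "c \<in> (\<lambda>b. b \<bullet> A b) ` B" by auto
  next
    fix b assume b: "b \<in> B"
    then have "b \<in> eigenspace_on V A (b \<bullet> A b)" unfolding eigenspace_eq_span by (intro span_base) auto
    moreover have "b \<noteq> 0" using b eb by (auto simp: eigenbasis_def)
    ultimately show "\<exists>v\<in>eigenspace_on V A (b \<bullet> A b). v \<noteq> 0" by blast
  qed
  then show ?thesis by (simp add: eigenvalues_on_def d)
qed

text \<open>Multiplicities in the list are dimensions of eigenspaces, and each eigenspace is spanned
  by the basis vectors with that eigenvalue; so every count in the list is a count in an arbitrary
  eigenbasis.\<close>

lemma length_filter_eigenvalues:
  "length (filter P (eigenvalues_on V A)) = card {b \<in> B. P (b \<bullet> A b)}"
proof -
  have fB: "finite B" using eb by (simp add: eigenbasis_def)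
  have "length (filter P (eigenvalues_on V A)) =
     (\<Sum>c\<in>(\<lambda>b. b \<bullet> A b) ` B. if P c then card {b \<in> B. b \<bullet> A b = c} else 0)"
    unfolding eigenvalues_on_eigenbasis length_filter_concat_replicate using fB by (subst sum_list_distinct_conv_sum_set) auto
  also have "\<dots> = (\<Sum>c\<in>(\<lambda>b. b \<bullet> A b) ` B. card {b \<in> B. P (b \<bullet> A b) \<and> b \<bullet> A b = c})"
  proof (intro sum.cong refl)
    fix c
    have "{b \<in> B. P (b \<bullet> A b) \<and> b \<bullet> A b = c} = (if P c then {b \<in> B. b \<bullet> A b = c} else {})" by auto
    then show "(if P c then card {b \<in> B. b \<bullet> A b = c} else 0) = card {b \<in> B. P (b \<bullet> A b) \<and> b \<bullet> A b = c}" by simp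
  qed
  also have "\<dots> = card (\<Union>c\<in>(\<lambda>b. b \<bullet> A b) ` B. {b \<in> B. P (b \<bullet> A b) \<and> b \<bullet> A b = c})"
    using fB by (intro card_UN_disjoint[symmetric]) auto
  also have "(\<Union>c\<in>(\<lambda>b. b \<bullet> A b) ` B. {b \<in> B. P (b \<bullet> A b) \<and> b \<bullet> A b = c}) = {b \<in> B. P (b \<bullet> A b)}"
    by auto
  finally show ?thesis .
qed

lemma sorted_eigenvalues: "sorted (eigenvalues_on V A)"
  unfolding eigenvalues_on_eigenbasis by (intro sorted_concat_replicate) simp

lemma index_on_eigenbasis: "index_on V A = card {b \<in> B. b \<bullet> A b < 0}"
  unfolding index_on_def by (rule length_filter_eigenvalues)

end

text \<open>The eigenvectors with negative eigenvalue span a negative subspace. Conversely, a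
  negative subspace meets the span of the other eigenvectors only in 0, so its dimension is at most
  their codimension. Being free of bases, this form carries all comparisons of indices.\<close>

lemma le_index_on_iff:
  fixes V :: "'a::euclidean_space set"
  assumes sa: "selfadj_on V A"
  shows "m \<le> index_on V A \<longleftrightarrow> (\<exists>W. subspace W \<and> W \<subseteq> V \<and> dim W = m \<and> (\<forall>x\<in>W. x \<noteq> 0 \<longrightarrow> x \<bullet> A x < 0))"
proof
  obtain B where eb: "eigenbasis V A B" using ex_eigenbasis[OF sa] by blast
  have fB: "finite B" and sB: "span B = V" using eb by (auto simp: eigenbasis_def)
  note ix = index_on_eigenbasis[OF sa eb]
  {
    assume "m \<le> index_on V A"
    then have "m \<le> card {b \<in> B. b \<bullet> A b < 0}" unfolding ix .
    then obtain C where C: "C \<subseteq> {b \<in> B. b \<bullet> A b < 0}" "card C = m" "finite C"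
      by (rule obtain_subset_with_card_n)
    have CB: "C \<subseteq> B" using C by auto
    show "\<exists>W. subspace W \<and> W \<subseteq> V \<and> dim W = m \<and> (\<forall>x\<in>W. x \<noteq> 0 \<longrightarrow> x \<bullet> A x < 0)"
    proof (intro exI[of _ "span C"] conjI ballI impI)
      show CV: "span C \<subseteq> V" using span_mono[OF CB] sB by simp
      show "dim (span C) = m"
        using C eigenbasis_independent[OF sa eb CB] by (simp add: dim_eq_card_independent)
      fix x assume x: "x \<in> span C" "x \<noteq> 0"
      have e: "x = (\<Sum>b\<in>C. (x \<bullet> b) *\<^sub>R b)" by (rule eigenbasis_span_expand[OF sa eb CB x(1)])
      have z: "x \<bullet> b = 0" if "b \<in> B - C" for b
      proof -
        have "x \<bullet> b = (\<Sum>c\<in>C. (x \<bullet> c) * (c \<bullet> b))" by (subst e) (simp add: inner_sum_left)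
        also have "\<dots> = 0" using that CB by (intro sum.neutral) (auto simp: eigenbasis_inner[OF sa eb] subset_iff)
        finally show ?thesis .
      qed
      have "x \<bullet> A x = (\<Sum>b\<in>C. (b \<bullet> A b) * (x \<bullet> b)\<^sup>2)"
        using x CV fB CB z by (subst eigenbasis_quad[OF sa eb]) (auto intro!: sum.mono_neutral_right)
      also have "\<dots> < 0"
      proof -
        have "\<exists>b\<in>C. x \<bullet> b \<noteq> 0"
        proof (rule ccontr)
          assume "\<not> ?thesis"
          then have "(\<Sum>b\<in>C. (x \<bullet> b) *\<^sub>R b) = 0" by (intro sum.neutral) auto
          then show False using e x(2) by simp
        qed
        then obtain b where b: "b \<in> C" "x \<bullet> b \<noteq> 0" by blast
        have "(\<Sum>b\<in>C. (b \<bullet> A b) * (x \<bullet> b)\<^sup>2) < (\<Sum>b\<in>C. 0)"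
        proof (rule sum_strict_mono_ex1)
          show "\<forall>x'\<in>C. x' \<bullet> A x' * (x \<bullet> x')\<^sup>2 \<le> 0" using C by (auto intro!: mult_nonpos_nonneg)
          show "\<exists>a\<in>C. a \<bullet> A a * (x \<bullet> a)\<^sup>2 < 0" using C b by (intro bexI[of _ b] mult_neg_pos) auto
        qed (use C in auto)
        then show ?thesis by simp
      qed
      finally show "x \<bullet> A x < 0" .
    qed (simp add: subspace_span)
  next
    assume "\<exists>W. subspace W \<and> W \<subseteq> V \<and> dim W = m \<and> (\<forall>x\<in>W. x \<noteq> 0 \<longrightarrow> x \<bullet> A x < 0)"
    then obtain W where W: "subspace W" "W \<subseteq> V" "dim W = m" "\<And>x. x \<in> W \<Longrightarrow> x \<noteq> 0 \<Longrightarrow> x \<bullet> A x < 0" by blast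
    let ?P = "{b \<in> B. \<not> b \<bullet> A b < 0}"
    have PB: "?P \<subseteq> B" by auto
    have "W \<inter> span ?P \<subseteq> {0}"
    proof safe
      fix x assume x: "x \<in> W" "x \<in> span ?P"
      have e: "x = (\<Sum>b\<in>?P. (x \<bullet> b) *\<^sub>R b)" by (rule eigenbasis_span_expand[OF sa eb PB x(2)])
      have z: "x \<bullet> b = 0" if "b \<in> B - ?P" for b
      proof -
        have "x \<bullet> b = (\<Sum>c\<in>?P. (x \<bullet> c) * (c \<bullet> b))" by (subst e) (simp add: inner_sum_left)
        also have "\<dots> = 0" using that by (intro sum.neutral) (auto simp: eigenbasis_inner[OF sa eb])
        finally show ?thesis .
      qed
      have "x \<bullet> A x = (\<Sum>b\<in>B. (b \<bullet> A b) * (x \<bullet> b)\<^sup>2)"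
        using x W by (intro eigenbasis_quad[OF sa eb]) auto
      also have "\<dots> \<ge> 0"
      proof (intro sum_nonneg)
        fix b assume "b \<in> B"
        then show "0 \<le> (b \<bullet> A b) * (x \<bullet> b)\<^sup>2" using z[of b] by (cases "b \<in> ?P") auto
      qed
      finally show "x = 0" using W(4)[OF x(1)] by linarith
    qed
    moreover have "0 \<in> W \<inter> span ?P" using W(1) by (simp add: subspace_0 span_zero)
    ultimately have "dim (W \<inter> span ?P) = 0" by (metis dim_eq_0 )
    with dim_sums_Int[OF W(1) subspace_span[of ?P]]
    have "dim {x + y |x y. x \<in> W \<and> y \<in> span ?P} = dim W + dim (span ?P)"
      by linarith
    moreover have "{x + y |x y. x \<in> W \<and> y \<in> span ?P} \<subseteq> V"
      using W(2) span_mono[OF PB] sB sa by (auto simp: selfadj_on_def intro!: subspace_add)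
    then have "dim {x + y |x y. x \<in> W \<and> y \<in> span ?P} \<le> dim V" by (rule dim_subset)
    moreover have "dim (span ?P) = card ?P"
      using eigenbasis_independent[OF sa eb PB] by (simp add: dim_eq_card_independent)
    moreover have "dim V = card B"
      using eigenbasis_independent[OF sa eb order_refl] sB by (metis dim_eq_card_independent dim_span)
    ultimately have "m + card ?P \<le> card B" using W(3) by simp
    moreover have "card B = card {b \<in> B. b \<bullet> A b < 0} + card ?P"
      using fB by (subst card_Un_disjoint[symmetric]) (auto intro!: arg_cong[where f=card])
    ultimately show "m \<le> index_on V A" unfolding ix by simp
  }
qed

lemma index_on_cong: "(\<And>v. v \<in> V \<Longrightarrow> A v = B v) \<Longrightarrow> index_on V A = index_on V B"
proof -
  assume "\<And>v. v \<in> V \<Longrightarrow> A v = B v"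
  then have "eigenspace_on V A = eigenspace_on V B" by (auto simp: eigenspace_on_def fun_eq_iff)
  then show ?thesis by (simp add: index_on_def eigenvalues_on_def)
qed

text \<open>\<open>f\<close> is injective on a negative subspace, because a vector with negative
  form value has nonzero image; the image is again a negative subspace.\<close>

lemma index_on_mono_map:
  fixes V :: "'a::euclidean_space set" and V' :: "'b::euclidean_space set"
  assumes "selfadj_on V A" "selfadj_on V' A'" and f: "linear f" "f ` V \<subseteq> V'"
    and neg: "\<And>x. x \<in> V \<Longrightarrow> x \<bullet> A x < 0 \<Longrightarrow> f x \<bullet> A' (f x) < 0"
  shows "index_on V A \<le> index_on V' A'"
proof -
  obtain W where W: "subspace W" "W \<subseteq> V" "dim W = index_on V A" "\<And>x. x \<in> W \<Longrightarrow> x \<noteq> 0 \<Longrightarrow> x \<bullet> A x < 0"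
    using le_index_on_iff[OF assms(1), of "index_on V A"] by auto
  have n0: "f x \<noteq> 0" if "x \<in> W" "x \<noteq> 0" for x
    using neg[of x] W(2) W(4)[OF that] that by auto
  have "inj_on f W"
  proof (rule inj_onI)
    fix x y assume xy: "x \<in> W" "y \<in> W" "f x = f y"
    then have "f (x - y) = 0" using f(1) by (simp add: linear_diff)
    then show "x = y" using n0[of "x - y"] subspace_diff[OF W(1) xy(1,2)] by auto
  qed
  then have "dim (f ` W) = dim W"
    using W(1) f(1) by (intro dim_image_eq) (simp_all add: span_eq_iff[THEN iffD2])
  moreover have "subspace (f ` W)" using W(1) f(1) by (rule linear_subspace_image[rotated])
  moreover have "f ` W \<subseteq> V'" using W(2) f(2) by auto
  moreover have "\<forall>y\<in>f ` W. y \<noteq> 0 \<longrightarrow> y \<bullet> A' y < 0"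
  proof (intro ballI impI)
    fix y assume "y \<in> f ` W" "y \<noteq> 0"
    then obtain x where x: "x \<in> W" "y = f x" "x \<noteq> 0" using f(1) linear_0 by auto
    then show "y \<bullet> A' y < 0" using neg[of x] W(2) W(4)[of x] by auto
  qed
  ultimately show ?thesis using le_index_on_iff[OF assms(2), of "index_on V A"] W(3) by metis
qed

section \<open>Lower semicontinuity of the index\<close>

definition ind :: "real^'n::finite^'n \<Rightarrow> nat" where
  "ind M = index_on UNIV ((*v) M)"

lemma selfadj_matrix: "transpose M = (M :: real^'n::finite^'n) \<Longrightarrow> selfadj_on UNIV ((*v) M)"
  unfolding selfadj_on_def using dot_lmul_matrix[of _ M] transpose_matrix_vector[of M]
  by (auto simp: inner_commute)

lemma quad_form_bound:
  fixes D :: "real^'n::finite^'n"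
  shows "\<bar>x \<bullet> (D *v x)\<bar> \<le> (\<Sum>i\<in>UNIV. \<Sum>j\<in>UNIV. \<bar>D $ i $ j\<bar>) * (x \<bullet> x)"
proof -
  have "\<bar>x \<bullet> (D *v x)\<bar> \<le> norm x * norm (D *v x)" by (rule Cauchy_Schwarz_ineq2)
  also have "norm (D *v x) \<le> onorm ((*v) D) * norm x"
    by (rule onorm[OF matrix_vector_mul_bounded_linear])
  also have "onorm ((*v) D) \<le> (\<Sum>i\<in>UNIV. \<Sum>j\<in>UNIV. \<bar>D $ i $ j\<bar>)" by (rule onorm_le_matrix_component_sum)
  finally show ?thesis by (simp add: power2_norm_eq_inner[symmetric] power2_eq_square mult_ac mult_left_mono mult_right_mono)
qed

text \<open>On a negative subspace of maximal dimension the form is at most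
  \<open>- \<delta> * (x \<bullet> x)\<close>, by compactness of the unit sphere. A perturbation
  whose entries sum to less than \<open>\<delta>\<close> keeps it negative there.\<close>

lemma ind_nbhd:
  fixes M :: "real^'n::finite^'n"
  assumes M: "transpose M = M"
  shows "\<exists>\<epsilon>>0. \<forall>M'. transpose M' = M' \<longrightarrow> (\<Sum>i\<in>UNIV. \<Sum>j\<in>UNIV. \<bar>(M' - M) $ i $ j\<bar>) < \<epsilon> \<longrightarrow> ind M \<le> ind M'"
proof -
  obtain W where W: "subspace W" "dim W = ind M" "\<And>x. x \<in> W \<Longrightarrow> x \<noteq> 0 \<Longrightarrow> x \<bullet> (M *v x) < 0"
    using le_index_on_iff[OF selfadj_matrix[OF M], of "ind M"] by (auto simp: ind_def)
  have "\<exists>\<delta>>0. \<forall>x\<in>W. x \<bullet> (M *v x) \<le> - \<delta> * (x \<bullet> x)"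
  proof (cases "W \<inter> sphere 0 1 = {}")
    case True
    have "x = 0" if "x \<in> W" for x
    proof (rule ccontr)
      assume "x \<noteq> 0"
      then have "(1 / norm x) *\<^sub>R x \<in> W \<inter> sphere 0 1" using that W(1) by (simp add: subspace_scale)
      then show False using True by blast
    qed
    then have "x \<bullet> (M *v x) \<le> - 1 * (x \<bullet> x)" if "x \<in> W" for x
      using that by (metis inner_zero_left mult_zero_right order_refl)
    then show ?thesis by (intro exI[of _ 1]) auto
  next
    case False
    have "compact (W \<inter> sphere 0 1)" by (intro closed_Int_compact closed_subspace W) simp
    moreover have "continuous_on (W \<inter> sphere 0 1) (\<lambda>v. v \<bullet> (M *v v))"
      by (intro continuous_intros matrix_vector_mult_linear_continuous_on)
    ultimately obtain u where u: "u \<in> W \<inter> sphere 0 1" and max: "\<And>v. v \<in> W \<inter> sphere 0 1 \<Longrightarrow> v \<bullet> (M *v v) \<le> u \<bullet> (M *v u)"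
      using continuous_attains_sup[of "W \<inter> sphere 0 1" "\<lambda>v. v \<bullet> (M *v v)"] False by blast
    show ?thesis
    proof (intro exI[of _ "- (u \<bullet> (M *v u))"] conjI ballI)
      have "u \<noteq> 0" using u by auto
      then show "- (u \<bullet> (M *v u)) > 0" using W(3)[of u] u by auto
      fix x assume x: "x \<in> W"
      show "x \<bullet> (M *v x) \<le> - (- (u \<bullet> (M *v u))) * (x \<bullet> x)"
      proof (cases "x = 0")
        case False
        let ?w = "(1 / norm x) *\<^sub>R x"
        have "?w \<in> W \<inter> sphere 0 1" using x W(1) False by (simp add: subspace_scale)
        then have "?w \<bullet> (M *v ?w) \<le> u \<bullet> (M *v u)" by (rule max)
        moreover have "?w \<bullet> (M *v ?w) = (x \<bullet> (M *v x)) / (x \<bullet> x)"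
          by (simp add: matrix_vector_mult_scaleR power2_norm_eq_inner[symmetric] power2_eq_square)
        ultimately have "(x \<bullet> (M *v x)) / (x \<bullet> x) \<le> u \<bullet> (M *v u)" by (simp only:)
        moreover have "x \<bullet> x > 0" using False by simp
        ultimately show ?thesis by (simp add: divide_le_eq del: inner_gt_zero_iff)
      qed simp
    qed
  qed
  then obtain \<delta> where \<delta>: "\<delta> > 0" "\<And>x. x \<in> W \<Longrightarrow> x \<bullet> (M *v x) \<le> - \<delta> * (x \<bullet> x)" by blast
  show ?thesis
  proof (intro exI[of _ \<delta>] conjI \<delta>(1) allI impI)
    fix M' :: "real^'n^'n" assume M': "transpose M' = M'" and s: "(\<Sum>i\<in>UNIV. \<Sum>j\<in>UNIV. \<bar>(M' - M) $ i $ j\<bar>) < \<delta>"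
    have "x \<bullet> (M' *v x) < 0" if x: "x \<in> W" "x \<noteq> 0" for x
    proof -
      have xx: "x \<bullet> x > 0" using x by simp
      have "x \<bullet> (M' *v x) = x \<bullet> (M *v x) + x \<bullet> ((M' - M) *v x)"
        by (simp add: matrix_vector_mult_diff_rdistrib inner_diff_right)
      also have "\<dots> \<le> - \<delta> * (x \<bullet> x) + (\<Sum>i\<in>UNIV. \<Sum>j\<in>UNIV. \<bar>(M' - M) $ i $ j\<bar>) * (x \<bullet> x)"
        using \<delta>(2)[OF x(1)] quad_form_bound[of x "M' - M"] by linarith
      also have "\<dots> = ((\<Sum>i\<in>UNIV. \<Sum>j\<in>UNIV. \<bar>(M' - M) $ i $ j\<bar>) - \<delta>) * (x \<bullet> x)" by (simp only: left_diff_distrib)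
      also have "\<dots> < 0" using s xx by (intro mult_neg_pos) auto
      finally show ?thesis .
    qed
    then show "ind M \<le> ind M'"
      unfolding ind_def[of M'] le_index_on_iff[OF selfadj_matrix[OF M']] using W by (intro exI[of _ W]) auto
  qed
qed

text \<open>The set \<open>U\<close> is open among all matrices, although its defining property
  concerns the symmetric ones, which form a thin set. It can thus be pulled back along any
  continuous map with symmetric values.\<close>

lemma ind_open: "\<exists>U. open U \<and> (\<forall>M::real^'n::finite^'n. transpose M = M \<longrightarrow> (M \<in> U \<longleftrightarrow> k < ind M))"
proof -
  have "\<forall>M\<in>{M::real^'n^'n. transpose M = M}. \<exists>\<epsilon>. \<epsilon> > 0 \<and> (\<forall>M'. transpose M' = M' \<longrightarrow> (\<Sum>i\<in>UNIV. \<Sum>j\<in>UNIV. \<bar>(M' - M) $ i $ j\<bar>) < \<epsilon> \<longrightarrow> ind M \<le> ind M')"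
    using ind_nbhd by blast
  from bchoice[OF this] obtain \<epsilon> where "\<forall>M\<in>{M::real^'n^'n. transpose M = M}. \<epsilon> M > 0 \<and>
     (\<forall>M'. transpose M' = M' \<longrightarrow> (\<Sum>i\<in>UNIV. \<Sum>j\<in>UNIV. \<bar>(M' - M) $ i $ j\<bar>) < \<epsilon> M \<longrightarrow> ind M \<le> ind M')" ..
  then have \<epsilon>: "\<epsilon> M > 0" "transpose M' = M' \<Longrightarrow> (\<Sum>i\<in>UNIV. \<Sum>j\<in>UNIV. \<bar>(M' - M) $ i $ j\<bar>) < \<epsilon> M \<Longrightarrow> ind M \<le> ind M'"
    if "transpose M = M" for M M' :: "real^'n^'n" using that by blast+
  let ?U = "\<Union>M\<in>{M. transpose M = M \<and> k < ind M}. {M'. (\<Sum>i\<in>UNIV. \<Sum>j\<in>UNIV. \<bar>(M' - M) $ i $ j\<bar>) < \<epsilon> M}"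
  have "open ?U" by (intro open_UN ballI open_Collect_less continuous_intros)
  moreover have "M \<in> ?U \<longleftrightarrow> k < ind M" if M: "transpose M = M" for M
  proof
    assume "M \<in> ?U"
    then obtain M0 where "transpose M0 = M0" "k < ind M0" "(\<Sum>i\<in>UNIV. \<Sum>j\<in>UNIV. \<bar>(M - M0) $ i $ j\<bar>) < \<epsilon> M0" by blast
    then show "k < ind M" using \<epsilon>(2)[of M0 M] M by simp
  next
    assume "k < ind M"
    then show "M \<in> ?U" using M \<epsilon>(1)[OF M] by (intro UN_I[of M]) auto
  qed
  ultimately show ?thesis by blast
qed

section \<open>The Hessian form on the tangent space and its extension to the whole space\<close>

lemma linear_tangent_proj: "linear (tangent_proj y)"
  by (rule linearI) (simp_all add: tangent_proj_def inner_add_right algebra_simps add_divide_distrib)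

lemma tangent_proj_orth: "y \<noteq> 0 \<Longrightarrow> y \<bullet> tangent_proj y v = 0"
  by (simp add: tangent_proj_def inner_diff_right)

lemma tangent_proj_selfadj: "tangent_proj y v \<bullet> w = v \<bullet> tangent_proj y w"
  by (simp add: tangent_proj_def inner_diff_right inner_diff_left inner_commute)

lemma tangent_proj_id: "y \<bullet> v = 0 \<Longrightarrow> tangent_proj y v = v"
  by (simp add: tangent_proj_def)

text \<open>With the Euclidean Hessian for \<open>S\<close> and the Lagrange multiplier for
  \<open>c\<close> this is the covariant Hessian on tangent vectors.\<close>

definition tform :: "real^'n \<Rightarrow> real^'n^'n \<Rightarrow> real \<Rightarrow> real^'n::finite \<Rightarrow> real^'n" where
  "tform y S c v = tangent_proj y (S *v v) - c *\<^sub>R v"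

text \<open>Extends the tangential form by a positive direction along \<open>y\<close>. The index on
  a moving tangent space becomes the index of a symmetric matrix that depends continuously on all
  its data.\<close>

definition tmat :: "real^'n \<Rightarrow> real^'n^'n \<Rightarrow> real \<Rightarrow> real^'n::finite^'n" where
  "tmat y S c = matrix (\<lambda>v. tform y S c (tangent_proj y v) + (y \<bullet> v) *\<^sub>R y)"

lemma linear_tform: "linear (tform y S c)"
  using linear_tangent_proj[of y]
  by (intro linearI) (simp_all add: tform_def matrix_vector_right_distrib linear_add linear_scale matrix_vector_mult_scaleR algebra_simps)

lemma tmat_mult: "tmat y S c *v v = tform y S c (tangent_proj y v) + (y \<bullet> v) *\<^sub>R y"
proof -
  have "linear (\<lambda>v. tform y S c (tangent_proj y v) + (y \<bullet> v) *\<^sub>R y)"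
    using linear_tangent_proj[of y] linear_tform[of y S c]
    by (intro linearI) (simp_all add: linear_add linear_scale inner_add_right algebra_simps)
  then show ?thesis unfolding tmat_def by (simp add: matrix_works)
qed

lemma symmetric_matrix_inner: "transpose S = S \<Longrightarrow> (S *v x) \<bullet> y = x \<bullet> (S *v (y :: real^'n::finite))"
  by (metis dot_lmul_matrix transpose_matrix_vector)

lemma selfadj_tform:
  assumes y: "y \<noteq> 0" and S: "transpose S = S"
  shows "selfadj_on (tangent_space y) (tform y S c)"
  unfolding selfadj_on_def
proof (intro conjI linear_tform ballI)
  show "subspace (tangent_space y)" by (auto simp: tangent_space_def subspace_def inner_add_right)
  show "tform y S c ` tangent_space y \<subseteq> tangent_space y"
    using y by (auto simp: tangent_space_def tform_def inner_diff_right tangent_proj_orth)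
  fix v w assume "v \<in> tangent_space y" "w \<in> tangent_space y"
  then have "tangent_proj y v = v" "tangent_proj y w = w" by (simp_all add: tangent_space_def tangent_proj_id)
  then show "tform y S c v \<bullet> w = v \<bullet> tform y S c w"
    by (simp add: tform_def inner_diff_left inner_diff_right tangent_proj_selfadj tangent_proj_selfadj[symmetric] symmetric_matrix_inner[OF S])
qed

lemma tmat_inner:
  assumes y: "y \<noteq> 0"
  shows "v \<bullet> (tmat y S c *v w) = tangent_proj y v \<bullet> tform y S c (tangent_proj y w) + (y \<bullet> v) * (y \<bullet> w)"
proof -
  have "tangent_proj y v \<bullet> tform y S c (tangent_proj y w) = v \<bullet> tform y S c (tangent_proj y w)"
  proof -
    have "y \<bullet> tform y S c (tangent_proj y w) = 0"
      using y by (simp add: tform_def inner_diff_right tangent_proj_orth)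
    then show ?thesis by (simp add: tangent_proj_selfadj tangent_proj_id)
  qed
  then show ?thesis by (simp add: tmat_mult inner_add_right inner_commute mult.commute)
qed

lemma transpose_tmat:
  assumes y: "y \<noteq> 0" and S: "transpose S = S"
  shows "transpose (tmat y S c) = tmat y S c"
proof -
  have "v \<bullet> (tmat y S c *v w) = (tmat y S c *v v) \<bullet> w" for v w
    using selfadj_tform[OF y S, of c] tangent_proj_orth[OF y]
    unfolding inner_commute[of "tmat y S c *v v"] tmat_inner[OF y]
    by (simp add: selfadj_on_def tangent_space_def inner_commute mult.commute)
  then have "v \<bullet> (tmat y S c *v w) = v \<bullet> (transpose (tmat y S c) *v w)" for v w
    by (metis dot_lmul_matrix transpose_matrix_vector transpose_transpose)
  then show ?thesis by (metis matrix_eq vector_eq_ldot)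
qed

text \<open>The added direction is positive, so neither projecting to the tangent space nor
  including it can lose a negative direction.\<close>

lemma ind_tmat:
  assumes y: "y \<noteq> 0" and S: "transpose S = S"
  shows "ind (tmat y S c) = index_on (tangent_space y) (tform y S c)"
proof (rule antisym)
  show "ind (tmat y S c) \<le> index_on (tangent_space y) (tform y S c)"
    unfolding ind_def
  proof (rule index_on_mono_map[OF selfadj_matrix[OF transpose_tmat[OF y S]] selfadj_tform[OF y S] linear_tangent_proj[of y]])
    show "range (tangent_proj y) \<subseteq> tangent_space y" using y by (auto simp: tangent_space_def tangent_proj_orth)
    fix x assume "x \<bullet> (tmat y S c *v x) < 0"
    then show "tangent_proj y x \<bullet> tform y S c (tangent_proj y x) < 0"
      unfolding tmat_inner[OF y] using zero_le_square[of "y \<bullet> x"] by linarith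
  qed
  show "index_on (tangent_space y) (tform y S c) \<le> ind (tmat y S c)"
    unfolding ind_def
  proof (rule index_on_mono_map[OF selfadj_tform[OF y S] selfadj_matrix[OF transpose_tmat[OF y S]] linear_id])
    fix x assume "x \<in> tangent_space y" "x \<bullet> tform y S c x < 0"
    then show "id x \<bullet> (tmat y S c *v id x) < 0"
      by (simp add: tmat_inner[OF y] tangent_space_def tangent_proj_id)
  qed simp
qed

lemma continuous_on_tmat [continuous_intros]:
  assumes "continuous_on X f" "continuous_on X S" "continuous_on X c" "\<And>x. x \<in> X \<Longrightarrow> f x \<noteq> 0"
  shows "continuous_on X (\<lambda>x. tmat (f x) (S x) (c x))"
  unfolding tmat_def matrix_def tform_def tangent_proj_def matrix_vector_mult_def
  using assms by (intro continuous_intros) auto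

lemma card_eigenbasis:
  fixes M :: "real^'n::finite^'n"
  assumes "eigenbasis UNIV ((*v) M) Bs" "transpose M = M"
  shows "card Bs = CARD('n)"
  using eigenbasis_independent[OF selfadj_matrix[OF assms(2)] assms(1) order_refl] assms(1)
  by (metis dim_eq_card_independent dim_span eigenbasis_def dim_UNIV DIM_cart DIM_real mult.right_neutral)

lemma ind_diff_mat:
  fixes M :: "real^'n::finite^'n"
  assumes B: "eigenbasis UNIV ((*v) M) Bs" and M: "transpose M = M"
  shows "ind (M - mat c) = card {b \<in> Bs. b \<bullet> (M *v b) < c}"
proof -
  have mc: "mat c *v v = c *\<^sub>R v" for v :: "real^'n"
    by (simp add: vec_eq_iff matrix_vector_mult_def mat_def if_distrib if_distribR cong: if_cong)
  have "transpose (M - mat c) = M - mat c"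
    using M by (auto simp: transpose_def mat_def vec_eq_iff)
  then have sa': "selfadj_on UNIV ((*v) (M - mat c))" by (rule selfadj_matrix)
  have n1: "b \<bullet> b = 1" if "b \<in> Bs" for b using B that by (auto simp: eigenbasis_def norm_eq_sqrt_inner)
  have q: "b \<bullet> ((M - mat c) *v b) = b \<bullet> (M *v b) - c" if "b \<in> Bs" for b
    using n1[OF that] by (simp add: matrix_vector_mult_diff_rdistrib inner_diff_right mc)
  have B': "eigenbasis UNIV ((*v) (M - mat c)) Bs"
    unfolding eigenbasis_def
  proof (intro conjI ballI)
    fix b assume b: "b \<in> Bs"
    have "M *v b = (b \<bullet> (M *v b)) *\<^sub>R b" using B b by (auto simp: eigenbasis_def)
    then have "(M - mat c) *v b = (b \<bullet> (M *v b) - c) *\<^sub>R b"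
      by (metis matrix_vector_mult_diff_rdistrib mc scaleR_left_diff_distrib)
    then show "(M - mat c) *v b = (b \<bullet> ((M - mat c) *v b)) *\<^sub>R b" unfolding q[OF b] .
  qed (use B in \<open>auto simp: eigenbasis_def\<close>)
  show ?thesis
    unfolding ind_def index_on_eigenbasis[OF sa' B'] using q by (intro arg_cong[where f=card]) auto
qed

lemma ordered_eigenvalue_ge_iff:
  fixes M :: "real^'n::finite^'n"
  assumes M: "transpose M = M" and k: "k < CARD('n)"
  shows "c \<le> ordered_eigenvalue M k \<longleftrightarrow> ind (M - mat c) \<le> k"
proof -
  have sa: "selfadj_on UNIV ((*v) M)" by (rule selfadj_matrix[OF M])
  obtain B where B: "eigenbasis UNIV ((*v) M) B" using ex_eigenbasis[OF sa] by blast
  let ?xs = "eigenvalues_on UNIV ((*v) M)"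
  have len: "length ?xs = CARD('n)"
    using length_filter_eigenvalues[OF sa B, of "\<lambda>_. True"] card_eigenbasis[OF B M] by simp
  have "ind (M - mat c) = length (filter (\<lambda>x. x < c) ?xs)"
    unfolding ind_diff_mat[OF B M] by (rule length_filter_eigenvalues[OF sa B, symmetric])
  then show ?thesis
    unfolding ordered_eigenvalue_def using sorted_nth_ge_iff[of k ?xs c] k len sorted_eigenvalues[OF sa B] by simp
qed

section \<open>The Lagrange equation on the sphere and its encoding in N-space\<close>

section \<open>Critical points as zeros of a vector field\<close>

lemma index_on_tform_scale:
  assumes y: "y \<noteq> 0" and S: "transpose S = S" and a: "a > 0"
  shows "index_on (tangent_space y) (tform y (a *\<^sub>R S) (a * c)) = index_on (tangent_space y) (tform y S c)"
proof -
  have S': "transpose (a *\<^sub>R S) = a *\<^sub>R S" using S by (simp add: transpose_def vec_eq_iff)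
  have e: "tform y (a *\<^sub>R S) (a * c) v = a *\<^sub>R tform y S c v" for v
    using linear_tangent_proj[of y] by (simp add: tform_def scaleR_matrix_vector_assoc[symmetric] linear_scale algebra_simps)
  show ?thesis
  proof (rule antisym)
    show "index_on (tangent_space y) (tform y (a *\<^sub>R S) (a * c)) \<le> index_on (tangent_space y) (tform y S c)"
      using a by (intro index_on_mono_map[OF selfadj_tform[OF y S'] selfadj_tform[OF y S] linear_id])
        (auto simp: e mult_less_0_iff)
    show "index_on (tangent_space y) (tform y S c) \<le> index_on (tangent_space y) (tform y (a *\<^sub>R S) (a * c))"
      using a by (intro index_on_mono_map[OF selfadj_tform[OF y S] selfadj_tform[OF y S'] linear_id])
        (auto simp: e mult_less_0_iff)
  qed
qed

lemma tangent_proj_scale: "t \<noteq> 0 \<Longrightarrow> tangent_proj (t *\<^sub>R y) v = tangent_proj y v"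
  by (cases "y = 0") (simp_all add: tangent_proj_def)

lemma tangent_space_scale: "t \<noteq> 0 \<Longrightarrow> tangent_space (t *\<^sub>R y) = tangent_space y"
  by (simp add: tangent_space_def)

lemma tform_point_scale: "t \<noteq> 0 \<Longrightarrow> tform (t *\<^sub>R y) S c = tform y S c"
  by (simp add: tform_def fun_eq_iff tangent_proj_scale)

lemma ind_tmat_scale:
  assumes "y \<noteq> 0" "transpose S = S" "a > 0" "t \<noteq> 0"
  shows "ind (tmat (t *\<^sub>R y) (a *\<^sub>R S) (a * c)) = ind (tmat y S c)"
proof -
  have "transpose (a *\<^sub>R S) = a *\<^sub>R S" using assms by (simp add: transpose_def vec_eq_iff)
  then show ?thesis using assms
    by (simp add: ind_tmat tform_point_scale tangent_space_scale index_on_tform_scale)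
qed

lemma tangent_proj_eq_0_iff: "y \<noteq> 0 \<Longrightarrow> tangent_proj y g = 0 \<longleftrightarrow> g = ((y \<bullet> g) / (y \<bullet> y)) *\<^sub>R y"
  by (simp add: tangent_proj_def)

context
  fixes p :: nat and J :: "'n::finite list \<Rightarrow> real" and c :: real
  assumes p: "p \<ge> 1" and c: "c > 0"
begin

lemma sphere_grad_pform: "sphere_grad (\<lambda>x. c * pform p J x) x = tangent_proj x (c *\<^sub>R pgrad p J x)"
proof -
  have "((\<lambda>x. c * pform p J x) has_derivative (\<lambda>v. c * (pgrad p J x \<bullet> v))) (at x)"
    by (intro has_derivative_mult_right pform_has_derivative)
  then have g: "GDERIV (\<lambda>x. c * pform p J x) x :> c *\<^sub>R pgrad p J x"
    by (simp add: gderiv_def inner_commute)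
  have "(THE D. GDERIV (\<lambda>x. c * pform p J x) x :> D) = c *\<^sub>R pgrad p J x"
  proof (rule the_equality)
    show "GDERIV (\<lambda>x. c * pform p J x) x :> c *\<^sub>R pgrad p J x" by (rule g)
    fix D assume "GDERIV (\<lambda>x. c * pform p J x) x :> D"
    then have "(\<lambda>h. h \<bullet> D) = (\<lambda>h. h \<bullet> (c *\<^sub>R pgrad p J x))"
      using g unfolding gderiv_def by (rule has_derivative_unique)
    from fun_cong[OF this] have "\<forall>h. h \<bullet> D = h \<bullet> (c *\<^sub>R pgrad p J x)" by blast
    then show "D = c *\<^sub>R pgrad p J x" by (simp only: vector_eq_ldot)
  qed
  then show ?thesis by (simp add: sphere_grad_def)
qed

lemma sphere_hess_pform:
  assumes x: "x \<noteq> 0" and v: "v \<in> tangent_space x"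
  shows "sphere_hess (\<lambda>x. c * pform p J x) x v = tform x (c *\<^sub>R phess p J x) (c * (real p * pform p J x / (x \<bullet> x))) v"
proof -
  let ?m = "\<lambda>x. (x \<bullet> (c *\<^sub>R pgrad p J x)) / (x \<bullet> x)"
  have xx: "x \<bullet> x \<noteq> 0" using x by simp
  \<comment> \<open>The derivative \<open>d\<close> of the radial coefficient stays implicit: it
    multiplies \<open>x\<close>, which the tangential projection kills.\<close>
  obtain d where d: "(?m has_derivative d) (at x)"
  proof -
    have "(\<lambda>x. x \<bullet> (c *\<^sub>R pgrad p J x)) differentiable at x"
      by (rule differentiableI, rule has_derivative_inner[OF has_derivative_ident has_derivative_scaleR_right[OF pgrad_has_derivative]])
    moreover have "(\<lambda>x. x \<bullet> x) differentiable at x"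
      by (rule differentiableI, rule has_derivative_inner[OF has_derivative_ident has_derivative_ident])
    ultimately have "?m differentiable at x" using xx by (intro differentiable_divide) auto
    then show ?thesis using that by (auto simp: differentiable_def)
  qed
  have "((\<lambda>x. c *\<^sub>R pgrad p J x - ?m x *\<^sub>R x) has_derivative (\<lambda>v. c *\<^sub>R (phess p J x *v v) - (?m x *\<^sub>R v + d v *\<^sub>R x))) (at x)"
    by (intro has_derivative_diff has_derivative_scaleR has_derivative_scaleR_right pgrad_has_derivative d has_derivative_ident)
  then have D: "(sphere_grad (\<lambda>x. c * pform p J x) has_derivative (\<lambda>v. c *\<^sub>R (phess p J x *v v) - (?m x *\<^sub>R v + d v *\<^sub>R x))) (at x)"
    by (simp add: sphere_grad_pform[abs_def] tangent_proj_def)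
  have m: "?m x = c * (real p * pform p J x / (x \<bullet> x))"
    using pgrad_inner_self[of p J x] by (simp add: inner_commute)
  have xv: "tangent_proj x v = v" using v by (simp add: tangent_space_def tangent_proj_id)
  have x0: "tangent_proj x x = 0" using xx by (simp add: tangent_proj_def)
  have "sphere_hess (\<lambda>x. c * pform p J x) x v = tangent_proj x (c *\<^sub>R (phess p J x *v v) - (?m x *\<^sub>R v + d v *\<^sub>R x))"
    by (simp only: sphere_hess_def frechet_derivative_at[OF D, symmetric])
  also have "\<dots> = tangent_proj x ((c *\<^sub>R phess p J x) *v v) - ?m x *\<^sub>R v"
    using linear_tangent_proj[of x]
    by (simp add: linear_diff linear_add linear_scale x0 xv scaleR_matrix_vector_assoc[symmetric])
  finally show ?thesis unfolding m tform_def .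
qed

lemma sphere_crit_iff:
  assumes x: "x \<noteq> 0"
  shows "sphere_grad (\<lambda>x. c * pform p J x) x = 0 \<longleftrightarrow> pgrad p J x = (real p * pform p J x / (x \<bullet> x)) *\<^sub>R x"
proof -
  have "tangent_proj x (c *\<^sub>R pgrad p J x) = c *\<^sub>R tangent_proj x (pgrad p J x)"
    using linear_tangent_proj[of x] by (simp add: linear_scale)
  then show ?thesis
    using c pgrad_inner_self[of p J x]
    by (simp add: sphere_grad_pform tangent_proj_eq_0_iff[OF x] inner_commute[of x "pgrad p J x"])
qed

lemma sphere_index_pform:
  assumes x: "x \<noteq> 0"
  shows "index_on (tangent_space x) (sphere_hess (\<lambda>x. c * pform p J x) x) =
    ind (tmat x (phess p J x) (real p * pform p J x / (x \<bullet> x)))"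
proof -
  have "index_on (tangent_space x) (sphere_hess (\<lambda>x. c * pform p J x) x) =
      index_on (tangent_space x) (tform x (c *\<^sub>R phess p J x) (c * (real p * pform p J x / (x \<bullet> x))))"
    using x by (intro index_on_cong) (simp add: sphere_hess_pform)
  also have "\<dots> = ind (tmat x (phess p J x) (real p * pform p J x / (x \<bullet> x)))"
    by (simp only: index_on_tform_scale[OF x transpose_phess c] ind_tmat[OF x transpose_phess])
  finally show ?thesis .
qed

end

text \<open>The standard deviation of an off-diagonal tangential entry of the Hessian at a unit
  vector. In this unit the law of the tangential Hessian no longer depends on
  \<open>p\<close>.\<close>

definition kap :: "nat \<Rightarrow> real" where
  "kap p = sqrt (real p * (real p - 1))"

text \<open>The power of the norm matches the degree of the equation
  \<open>pgrad p J y = lev p y *\<^sub>R y\<close>, and \<open>ln (norm y)\<close> runs exactly once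
  through all real levels as the radius varies.\<close>

definition lev :: "nat \<Rightarrow> real^'n::finite \<Rightarrow> real" where
  "lev p y = kap p * norm y ^ (p - 2) * ln (norm y)"

definition enc_crit :: "nat \<Rightarrow> ('n::finite list \<Rightarrow> real) \<Rightarrow> (real^'n) set" where
  "enc_crit p J = {y. y \<noteq> 0 \<and> pgrad p J y = lev p y *\<^sub>R y}"

definition enc_index :: "nat \<Rightarrow> ('n::finite list \<Rightarrow> real) \<Rightarrow> real^'n \<Rightarrow> nat" where
  "enc_index p J y = ind (tmat y (phess p J y) (lev p y))"

text \<open>Converts \<open>ln (norm y)\<close> into the energy divided by N at the corresponding
  point of the sphere.\<close>

definition en :: "nat \<Rightarrow> 'n::finite itself \<Rightarrow> real" where
  "en p _ = kap p / (real p * sqrt (real CARD('n)))"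

lemma kap_pos: "p \<ge> 2 \<Longrightarrow> kap p > 0"
  by (simp add: kap_def)

lemma spin_hamiltonian_eq:
  fixes J :: "'n::finite list \<Rightarrow> real"
  assumes p: "p \<ge> 1"
  shows "spin_hamiltonian p J = (\<lambda>x. 1 / sqrt (real CARD('n)) ^ (p - 1) * pform p J x)"
proof -
  have N: "real CARD('n) > 0" by simp
  have "real CARD('n) powr ((real p - 1) / 2) = (real CARD('n) powr (1/2)) powr real (p - 1)"
    using p by (simp add: powr_powr of_nat_diff)
  also have "\<dots> = sqrt (real CARD('n)) ^ (p - 1)"
    using N by (simp add: powr_half_sqrt powr_realpow)
  finally show ?thesis
    by (simp add: spin_hamiltonian_def fun_eq_iff pform_eq_sum)
qed

text \<open>At a zero \<open>y\<close> Euler's identity computes the form from the norm alone, so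
  the energy determines the radius. Rescaling to the sphere multiplies Hessian and multiplier by the
  same positive number and leaves the index unchanged.\<close>

lemma bij_betw_enc_crit:
  fixes J :: "'n::finite list \<Rightarrow> real"
  assumes p: "p \<ge> 2"
  shows "bij_betw (\<lambda>y. (sqrt (real CARD('n)) / norm y) *\<^sub>R y)
    {y \<in> enc_crit p J. en p TYPE('n) * ln (norm y) \<in> B \<and> enc_index p J y = k}
    (crit_points (spin_hamiltonian p J) k B)"
proof -
  define s where "s = sqrt (real CARD('n))"
  have s: "s > 0" "s * s = real CARD('n)" "s\<^sup>2 = real CARD('n)" by (simp_all add: s_def)
  have p1: "p \<ge> 1" "real p > 0" using p by auto
  define c where "c = 1 / s ^ (p - 1)"
  have c: "c > 0" using s by (simp add: c_def)
  have H: "spin_hamiltonian p J = (\<lambda>x. c * pform p J x)"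
    using spin_hamiltonian_eq[OF p1(1), of J] by (simp add: c_def s_def)
  note kp = kap_pos[OF p]
  let ?f = "\<lambda>y::real^'n. (s / norm y) *\<^sub>R y"
  have pp: "p = Suc (Suc (p - 2))" "p - 1 = Suc (p - 2)" using p by auto
  have pw: "a ^ p = a ^ (p - 2) * a\<^sup>2" for a :: real
    by (subst pp(1)) (simp add: power2_eq_square)
  have norm_f: "norm (?f y) = s" if "y \<noteq> 0" for y using that s by simp
  have crit: "\<sigma> \<in> crit_points (spin_hamiltonian p J) k B \<longleftrightarrow>
      norm \<sigma> = s \<and> pgrad p J \<sigma> = (real p * pform p J \<sigma> / s\<^sup>2) *\<^sub>R \<sigma> \<and>
      c * pform p J \<sigma> / s\<^sup>2 \<in> B \<and> ind (tmat \<sigma> (phess p J \<sigma>) (real p * pform p J \<sigma> / s\<^sup>2)) = k" for \<sigma>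
  proof (cases "norm \<sigma> = s")
    case True
    then have \<sigma>: "\<sigma> \<noteq> 0" "\<sigma> \<bullet> \<sigma> = s\<^sup>2" using s(1) by (auto simp: power2_norm_eq_inner[symmetric])
    have e: "c * pform p J \<sigma> \<in> (\<lambda>x. real CARD('n) * x) ` B \<longleftrightarrow> c * pform p J \<sigma> / s\<^sup>2 \<in> B"
    proof
      assume "c * pform p J \<sigma> / s\<^sup>2 \<in> B"
      then show "c * pform p J \<sigma> \<in> (\<lambda>x. real CARD('n) * x) ` B"
        using s by (intro image_eqI[of _ _ "c * pform p J \<sigma> / s\<^sup>2"]) auto
    qed (use s in auto)
    show ?thesis
      using True \<sigma> unfolding crit_points_def H
      by (simp add: sphere_crit_iff[OF p1(1) c] sphere_index_pform[OF p1(1) c] e s_def[symmetric])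
  next
    case False
    then show ?thesis by (auto simp: crit_points_def s_def)
  qed
  have val: "pform p J y = kap p / real p * norm y ^ p * ln (norm y)" if "y \<in> enc_crit p J" for y
  proof -
    have "real p * pform p J y = lev p y * (norm y)\<^sup>2"
      using that pgrad_inner_self[of p J y] by (simp add: enc_crit_def power2_norm_eq_inner)
    also have "\<dots> = kap p * norm y ^ p * ln (norm y)"
      by (simp add: lev_def pw)
    finally show ?thesis using p1 by (simp add: field_simps)
  qed
  have fwd: "pform p J (?f y) = s ^ p * (kap p / real p) * ln (norm y)" if "y \<in> enc_crit p J" for y
    using val[OF that] that by (simp add: pform_scale power_divide enc_crit_def)
  have lvl: "real p * pform p J (?f y) / s\<^sup>2 = (s / norm y) ^ (p - 2) * lev p y" if y: "y \<in> enc_crit p J" for y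
  proof -
    have "real p * pform p J (?f y) / s\<^sup>2 = s ^ (p - 2) * kap p * ln (norm y)"
      unfolding fwd[OF y] using s(1) p1 by (simp add: pw)
    also have "\<dots> = (s / norm y) ^ (p - 2) * lev p y"
      using y by (simp add: lev_def power_divide enc_crit_def)
    finally show ?thesis .
  qed
  have ene: "c * pform p J (?f y) / s\<^sup>2 = en p TYPE('n) * ln (norm y)" if y: "y \<in> enc_crit p J" for y
  proof -
    have "s ^ (p - 1) = s * s ^ (p - 2)" unfolding pp(2) by simp
    then show ?thesis
      unfolding fwd[OF y] c_def en_def s_def[symmetric] using s(1) p1
      by (simp add: pw power2_eq_square field_simps)
  qed
  have idx: "ind (tmat (?f y) (phess p J (?f y)) (real p * pform p J (?f y) / s\<^sup>2)) = enc_index p J y" if y: "y \<in> enc_crit p J" for y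
    unfolding lvl[OF y] enc_index_def phess_scale
    using y s by (intro ind_tmat_scale transpose_phess) (auto simp: enc_crit_def)
  have cr: "pgrad p J (?f y) = (real p * pform p J (?f y) / s\<^sup>2) *\<^sub>R ?f y" if y: "y \<in> enc_crit p J" for y
    unfolding lvl[OF y] pgrad_scale pp(2) using y by (simp add: enc_crit_def)
  show ?thesis
    unfolding s_def[symmetric]
  proof (rule bij_betw_imageI)
    show "inj_on ?f {y \<in> enc_crit p J. en p TYPE('n) * ln (norm y) \<in> B \<and> enc_index p J y = k}"
    proof (rule inj_onI, clarify)
      fix x y assume x: "x \<in> enc_crit p J" and y: "y \<in> enc_crit p J" and eq: "?f x = ?f y"
      have nz: "norm x > 0" "norm y > 0" using x y by (auto simp: enc_crit_def)
      have "s ^ p * (kap p / real p) * ln (norm x) = s ^ p * (kap p / real p) * ln (norm y)"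
        unfolding fwd[OF x, symmetric] fwd[OF y, symmetric] eq ..
      then have "norm x = norm y" using s kp p1 nz by simp
      then show "x = y" using eq s nz by simp
    qed
    show "?f ` {y \<in> enc_crit p J. en p TYPE('n) * ln (norm y) \<in> B \<and> enc_index p J y = k} =
      crit_points (spin_hamiltonian p J) k B"
    proof (intro equalityI subsetI)
      fix \<sigma> assume "\<sigma> \<in> ?f ` {y \<in> enc_crit p J. en p TYPE('n) * ln (norm y) \<in> B \<and> enc_index p J y = k}"
      then obtain y where y: "y \<in> enc_crit p J" "en p TYPE('n) * ln (norm y) \<in> B" "enc_index p J y = k" "\<sigma> = ?f y" by auto
      then show "\<sigma> \<in> crit_points (spin_hamiltonian p J) k B"
        unfolding crit using norm_f[of y] cr[OF y(1)] ene[OF y(1)] idx[OF y(1)] by (simp add: enc_crit_def)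
    next
      fix \<sigma> assume "\<sigma> \<in> crit_points (spin_hamiltonian p J) k B"
      then have \<sigma>: "norm \<sigma> = s" "pgrad p J \<sigma> = (real p * pform p J \<sigma> / s\<^sup>2) *\<^sub>R \<sigma>"
          "c * pform p J \<sigma> / s\<^sup>2 \<in> B" "ind (tmat \<sigma> (phess p J \<sigma>) (real p * pform p J \<sigma> / s\<^sup>2)) = k"
        unfolding crit by auto
      \<comment> \<open>The logarithm of the radius that the energy of \<open>\<sigma>\<close>
        demands, obtained by solving \<open>ps\<close> below.\<close>
      define \<tau> where "\<tau> = real p * pform p J \<sigma> / (s ^ p * kap p)"
      define y where "y = (exp \<tau> / s) *\<^sub>R \<sigma>"
      have ny: "norm y = exp \<tau>" using \<sigma>(1) s by (simp add: y_def)
      have fy: "?f y = \<sigma>" using s by (simp add: ny) (simp add: y_def)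
      have ps: "real p * pform p J \<sigma> / s\<^sup>2 = kap p * s ^ (p - 2) * \<tau>"
        unfolding \<tau>_def using s(1) kp by (simp add: pw)
      have "lev p y *\<^sub>R y = (exp \<tau> / s) ^ (p - 1) *\<^sub>R ((kap p * s ^ (p - 2) * \<tau>) *\<^sub>R \<sigma>)"
        unfolding lev_def ny pp(2) using s by (simp add: y_def power_divide)
      then have yc: "y \<in> enc_crit p J"
        using ny \<sigma>(2) unfolding enc_crit_def ps by (auto simp: y_def pgrad_scale)
      then show "\<sigma> \<in> ?f ` {y \<in> enc_crit p J. en p TYPE('n) * ln (norm y) \<in> B \<and> enc_index p J y = k}"
        using \<sigma> ene[OF yc] idx[OF yc] fy by (intro image_eqI[of _ _ y]) auto
    qed
  qed
qed

corollary crt_eq_enc_crit: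
  fixes J :: "'n::finite list \<Rightarrow> real"
  assumes p: "p \<ge> 2"
  shows "crt (spin_hamiltonian p J) k B =
    emeasure (count_space UNIV) {y \<in> enc_crit p J. en p TYPE('n) * ln (norm y) \<in> B \<and> enc_index p J y = k}"
proof -
  note b = bij_betw_enc_crit[OF p, of J B k]
  show ?thesis
    using bij_betw_finite[OF b] bij_betw_same_card[OF b]
    by (auto simp: crt_def emeasure_count_space)
qed

section \<open>Covariance structure of the second derivatives at a fixed point\<close>

section \<open>The law of the Hessian\<close>

lemma sum_axis: "(\<Sum>i\<in>UNIV. axis i0 1 $ i * f i) = (f i0 :: real)" for i0 :: "'n::finite"
  by (simp add: axis_def if_distribR if_distrib cong: if_cong)

lemma pform_axis: "pform p J (axis i0 1) = J (replicate p i0)"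
  by (induction p arbitrary: J) (simp_all add: sum_axis)

lemma pgrad_axis: "pgrad p J (axis i0 1) $ j = (\<Sum>a<p. J ((replicate p i0)[a := j]))"
proof (induction p arbitrary: J)
  case (Suc p)
  show ?case
    by (simp add: sum_axis pform_axis Suc sum.lessThan_Suc_shift del: sum.lessThan_Suc)
qed simp

definition slot2 :: "nat \<Rightarrow> 'n \<Rightarrow> 'n \<Rightarrow> 'n \<Rightarrow> nat \<times> nat \<Rightarrow> 'n list" where
  "slot2 p i0 j k ab = (replicate p i0)[fst ab := j, snd ab := k]"

definition distinct_pairs :: "nat \<Rightarrow> (nat \<times> nat) set" where
  "distinct_pairs p = {(a, b). a < p \<and> b < p \<and> a \<noteq> b}"

lemma finite_distinct_pairs [simp]: "finite (distinct_pairs p)"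
  by (rule finite_subset[of _ "{..<p} \<times> {..<p}"]) (auto simp: distinct_pairs_def)

lemma distinct_pairs_Suc:
  "distinct_pairs (Suc p) = (\<lambda>b. (0, Suc b)) ` {..<p} \<union> (\<lambda>a. (Suc a, 0)) ` {..<p} \<union> map_prod Suc Suc ` distinct_pairs p"
proof (intro equalityI subsetI)
  fix x assume "x \<in> distinct_pairs (Suc p)"
  then obtain a b where x: "x = (a, b)" "a < Suc p" "b < Suc p" "a \<noteq> b" by (auto simp: distinct_pairs_def)
  then show "x \<in> (\<lambda>b. (0, Suc b)) ` {..<p} \<union> (\<lambda>a. (Suc a, 0)) ` {..<p} \<union> map_prod Suc Suc ` distinct_pairs p"
    by (cases a; cases b) (auto simp: distinct_pairs_def image_iff)
qed (auto simp: distinct_pairs_def)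

lemma sum_distinct_pairs_Suc:
  "sum f (distinct_pairs (Suc p)) = (\<Sum>b<p. f (0, Suc b)) + (\<Sum>a<p. f (Suc a, 0)) + (\<Sum>(a, b)\<in>distinct_pairs p. f (Suc a, Suc b) :: real)"
proof -
  have "sum f (distinct_pairs (Suc p)) = sum f ((\<lambda>b. (0, Suc b)) ` {..<p}) + sum f ((\<lambda>a. (Suc a, 0)) ` {..<p}) + sum f (map_prod Suc Suc ` distinct_pairs p)"
    unfolding distinct_pairs_Suc by (subst sum.union_disjoint, auto)+
  moreover have "sum f ((\<lambda>b. (0, Suc b)) ` {..<p}) = (\<Sum>b<p. f (0, Suc b))"
    by (subst sum.reindex) (auto simp: inj_on_def)
  moreover have "sum f ((\<lambda>a. (Suc a, 0)) ` {..<p}) = (\<Sum>a<p. f (Suc a, 0))"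
    by (subst sum.reindex) (auto simp: inj_on_def)
  moreover have "sum f (map_prod Suc Suc ` distinct_pairs p) = (\<Sum>(a, b)\<in>distinct_pairs p. f (Suc a, Suc b))"
    by (subst sum.reindex) (auto simp: inj_on_def intro!: sum.cong)
  ultimately show ?thesis by (simp only:)
qed

lemma card_distinct_pairs: "real (card (distinct_pairs p)) = real p * (real p - 1)"
proof (induction p)
  case 0
  then show ?case by (simp add: distinct_pairs_def)
next
  case (Suc p)
  have "real (card (distinct_pairs (Suc p))) = sum (\<lambda>_. 1) (distinct_pairs (Suc p))" by simp
  also have "\<dots> = real p + real p + real (card (distinct_pairs p))"
    unfolding sum_distinct_pairs_Suc by (simp add: split_def)
  finally show ?case using Suc by (simp add: algebra_simps)
qed

text \<open>At a coordinate vector the surviving monomials have the letter \<open>i0\<close> in all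
  but the two differentiated positions.\<close>

lemma phess_axis: "phess p J (axis i0 1) $ j $ k = (\<Sum>ab\<in>distinct_pairs p. J (slot2 p i0 j k ab))"
proof (induction p arbitrary: J)
  case 0
  then show ?case by (simp add: distinct_pairs_def)
next
  case (Suc p)
  have "phess (Suc p) J (axis i0 1) $ j $ k = (\<Sum>b<p. J (j # (replicate p i0)[b := k])) + (\<Sum>a<p. J (k # (replicate p i0)[a := j])) +
     (\<Sum>ab\<in>distinct_pairs p. J (i0 # slot2 p i0 j k ab))"
    by (simp add: pgrad_axis sum_axis Suc)
  also have "\<dots> = (\<Sum>ab\<in>distinct_pairs (Suc p). J (slot2 (Suc p) i0 j k ab))"
    unfolding sum_distinct_pairs_Suc by (simp add: slot2_def split_def)
  finally show ?case .
qed

text \<open>The number of ordered pairs of positions that produce the same multi-index, that is, the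
  weight of one coefficient in the Hessian entry \<open>j\<close>, \<open>k\<close>.\<close>

definition mm :: "'n \<Rightarrow> nat \<Rightarrow> 'n \<Rightarrow> 'n \<Rightarrow> real" where
  "mm i0 p j k = (if j = i0 \<and> k = i0 then real p * (real p - 1) else if j = i0 \<or> k = i0 then real p - 1 else if j = k then 2 else 1)"

text \<open>The coefficients that enter the Hessian entries \<open>(j, k)\<close> and
  \<open>(k, j)\<close>, which share them; hence the unordered pair as index.\<close>

definition grp :: "nat \<Rightarrow> 'n \<Rightarrow> 'n set \<Rightarrow> 'n list set" where
  "grp p i0 E = {slot2 p i0 j k ab | j k ab. E = {j, k} \<and> ab \<in> distinct_pairs p}"

lemma slot2_nth: "ab \<in> distinct_pairs p \<Longrightarrow> x < p \<Longrightarrow>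
    slot2 p i0 j k ab ! x = (if x = snd ab then k else if x = fst ab then j else i0)"
  by (auto simp: slot2_def distinct_pairs_def nth_list_update)

lemma length_slot2 [simp]: "length (slot2 p i0 j k ab) = p"
  by (simp add: slot2_def)

lemma slot2_swap: "ab \<in> distinct_pairs p \<Longrightarrow> slot2 p i0 j k ab = slot2 p i0 k j (snd ab, fst ab)"
  by (auto simp: slot2_def distinct_pairs_def list_update_swap)

lemma swap_distinct_pairs: "(a, b) \<in> distinct_pairs p \<Longrightarrow> (b, a) \<in> distinct_pairs p"
  by (auto simp: distinct_pairs_def)

lemma grp_eq: "grp p i0 {j, k} = slot2 p i0 j k ` distinct_pairs p"
proof (intro equalityI subsetI)
  fix l assume "l \<in> grp p i0 {j, k}"
  then obtain j' k' ab where l: "l = slot2 p i0 j' k' ab" "{j, k} = {j', k'}" "ab \<in> distinct_pairs p" by (auto simp: grp_def)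
  then consider "j' = j" "k' = k" | "j' = k" "k' = j" by (metis doubleton_eq_iff)
  then show "l \<in> slot2 p i0 j k ` distinct_pairs p"
  proof cases
    case 2
    then have "l = slot2 p i0 j k (snd ab, fst ab)" using l slot2_swap by metis
    then show ?thesis using l(3) swap_distinct_pairs[of "fst ab" "snd ab" p] by (intro image_eqI[of _ _ "(snd ab, fst ab)"]) auto
  qed (use l in auto)
qed (auto simp: grp_def)

lemma disjoint_grp: "disjoint_family_on (grp p i0) {{j, k} | j k :: 'n. True}"
proof -
  \<comment> \<open>Recovers the pair from a multi-index: its letters other than \<open>i0\<close>,
    completed by \<open>i0\<close> unless two positions carry such letters. Counting positions
    rather than letters separates \<open>{j}\<close> from \<open>{i0, j}\<close>.\<close>
  define E where "E l = {l ! x | x. x < p \<and> l ! x \<noteq> i0} \<union> (if card {x. x < p \<and> l ! x \<noteq> i0} < 2 then {i0} else {})" for l :: "'n list"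
  have "E (slot2 p i0 j k ab) = {j, k}" if ab: "ab \<in> distinct_pairs p" for j k ab
  proof -
    have lt: "fst ab < p" "snd ab < p" "fst ab \<noteq> snd ab" using ab by (auto simp: distinct_pairs_def)
    have "{x. x < p \<and> slot2 p i0 j k ab ! x \<noteq> i0} = (if j \<noteq> i0 then {fst ab} else {}) \<union> (if k \<noteq> i0 then {snd ab} else {})"
      using lt by (auto simp: slot2_nth[OF ab] split: if_splits)
    moreover have "{slot2 p i0 j k ab ! x | x. x < p \<and> slot2 p i0 j k ab ! x \<noteq> i0} = {j, k} - {i0}"
    proof (intro equalityI subsetI)
      fix z assume "z \<in> {j, k} - {i0}"
      then obtain x where "x < p" "slot2 p i0 j k ab ! x = z" "z \<noteq> i0"
        using lt slot2_nth[OF ab, of "fst ab" i0 j k] slot2_nth[OF ab, of "snd ab" i0 j k] by fastforce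
      then show "z \<in> {slot2 p i0 j k ab ! x | x. x < p \<and> slot2 p i0 j k ab ! x \<noteq> i0}" by blast
    qed (auto simp: slot2_nth[OF ab])
    ultimately show ?thesis unfolding E_def using lt by auto
  qed
  then have "E l = X" if "l \<in> grp p i0 X" for l X using that by (auto simp: grp_def)
  then have "grp p i0 X \<inter> grp p i0 Y = {}" if "X \<noteq> Y" for X Y using that by blast
  then show ?thesis by (simp add: disjoint_family_on_def)
qed

text \<open>A prescribed letter equal to \<open>i0\<close> leaves no trace in the multi-index, so
  its position is free; two equal letters may be exchanged; otherwise both positions can be read
  off.\<close>

lemma fiber_slot2:
  assumes p: "p \<ge> 2" and ab: "ab \<in> distinct_pairs p"
  shows "real (card {cd \<in> distinct_pairs p. slot2 p i0 j k cd = slot2 p i0 j k ab}) = mm i0 p j k"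
proof -
  have lt: "fst ab < p" "snd ab < p" "fst ab \<noteq> snd ab" using ab by (auto simp: distinct_pairs_def)
  have eq: "slot2 p i0 j k cd = slot2 p i0 j k ab \<longleftrightarrow>
     (\<forall>x<p. (if x = snd cd then k else if x = fst cd then j else i0) = (if x = snd ab then k else if x = fst ab then j else i0))"
    if "cd \<in> distinct_pairs p" for cd
    by (simp add: list_eq_iff_nth_eq slot2_nth[OF that] slot2_nth[OF ab])
  consider "j = i0" "k = i0" | "j = i0" "k \<noteq> i0" | "j \<noteq> i0" "k = i0" | "j \<noteq> i0" "k \<noteq> i0" "j = k" | "j \<noteq> i0" "k \<noteq> i0" "j \<noteq> k" by blast
  then show ?thesis
  proof cases
    case 1
    have "slot2 p i0 j k cd = slot2 p i0 j k ab" if "cd \<in> distinct_pairs p" for cd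
      unfolding eq[OF that] using 1 by simp
    then have "{cd \<in> distinct_pairs p. slot2 p i0 j k cd = slot2 p i0 j k ab} = distinct_pairs p"
      by blast
    then show ?thesis using 1 by (simp add: mm_def card_distinct_pairs)
  next
    case 2
    have "{cd \<in> distinct_pairs p. slot2 p i0 j k cd = slot2 p i0 j k ab} = (\<lambda>a. (a, snd ab)) ` ({..<p} - {snd ab})"
    proof (intro equalityI subsetI)
      fix cd assume "cd \<in> {cd \<in> distinct_pairs p. slot2 p i0 j k cd = slot2 p i0 j k ab}"
      then have cd: "cd \<in> distinct_pairs p" and e: "\<forall>x<p. (if x = snd cd then k else if x = fst cd then j else i0) = (if x = snd ab then k else if x = fst ab then j else i0)"
        using eq[of cd] by blast+
      have "snd cd = snd ab" using e[rule_format, of "snd ab"] lt 2 by (auto split: if_splits)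
      then show "cd \<in> (\<lambda>a. (a, snd ab)) ` ({..<p} - {snd ab})"
        using cd by (cases cd) (auto simp: distinct_pairs_def)
    next
      fix cd assume "cd \<in> (\<lambda>a. (a, snd ab)) ` ({..<p} - {snd ab})"
      then obtain z where z: "z < p" "z \<noteq> snd ab" "cd = (z, snd ab)" by auto
      have dp: "cd \<in> distinct_pairs p" using z lt by (auto simp: distinct_pairs_def)
      have "slot2 p i0 j k cd = slot2 p i0 j k ab" unfolding eq[OF dp] using z 2 by auto
      then show "cd \<in> {cd \<in> distinct_pairs p. slot2 p i0 j k cd = slot2 p i0 j k ab}" using dp by blast
    qed
    moreover have "card ((\<lambda>a. (a, snd ab)) ` ({..<p} - {snd ab})) = p - 1"
      using lt by (subst card_image) (auto simp: inj_on_def)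
    ultimately show ?thesis using 2 p by (simp add: mm_def of_nat_diff)
  next
    case 3
    have "{cd \<in> distinct_pairs p. slot2 p i0 j k cd = slot2 p i0 j k ab} = (\<lambda>b. (fst ab, b)) ` ({..<p} - {fst ab})"
    proof (intro equalityI subsetI)
      fix cd assume "cd \<in> {cd \<in> distinct_pairs p. slot2 p i0 j k cd = slot2 p i0 j k ab}"
      then have cd: "cd \<in> distinct_pairs p" and e: "\<forall>x<p. (if x = snd cd then k else if x = fst cd then j else i0) = (if x = snd ab then k else if x = fst ab then j else i0)"
        using eq[of cd] by blast+
      have "fst cd = fst ab" using e[rule_format, of "fst ab"] lt 3 by (auto split: if_splits)
      then show "cd \<in> (\<lambda>b. (fst ab, b)) ` ({..<p} - {fst ab})"
        using cd by (cases cd) (auto simp: distinct_pairs_def)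
    next
      fix cd assume "cd \<in> (\<lambda>b. (fst ab, b)) ` ({..<p} - {fst ab})"
      then obtain z where z: "z < p" "z \<noteq> fst ab" "cd = (fst ab, z)" by auto
      have dp: "cd \<in> distinct_pairs p" using z lt by (auto simp: distinct_pairs_def)
      have "slot2 p i0 j k cd = slot2 p i0 j k ab" unfolding eq[OF dp] using z 3 lt by auto
      then show "cd \<in> {cd \<in> distinct_pairs p. slot2 p i0 j k cd = slot2 p i0 j k ab}" using dp by blast
    qed
    moreover have "card ((\<lambda>b. (fst ab, b)) ` ({..<p} - {fst ab})) = p - 1"
      using lt by (subst card_image) (auto simp: inj_on_def)
    ultimately show ?thesis using 3 p by (simp add: mm_def of_nat_diff)
  next
    case 4
    have "{cd \<in> distinct_pairs p. slot2 p i0 j k cd = slot2 p i0 j k ab} = {ab, (snd ab, fst ab)}"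
    proof (intro equalityI subsetI)
      fix cd assume "cd \<in> {cd \<in> distinct_pairs p. slot2 p i0 j k cd = slot2 p i0 j k ab}"
      then have cd: "cd \<in> distinct_pairs p" and e: "\<forall>x<p. (if x = snd cd then k else if x = fst cd then j else i0) = (if x = snd ab then k else if x = fst ab then j else i0)"
        using eq[of cd] by blast+
      have "fst ab = fst cd \<or> fst ab = snd cd" "snd ab = fst cd \<or> snd ab = snd cd"
        using e[rule_format, of "fst ab"] e[rule_format, of "snd ab"] lt 4 by (auto split: if_splits)
      then show "cd \<in> {ab, (snd ab, fst ab)}" using lt by (cases ab; cases cd) auto
    next
      fix cd assume "cd \<in> {ab, (snd ab, fst ab)}"
      then show "cd \<in> {cd \<in> distinct_pairs p. slot2 p i0 j k cd = slot2 p i0 j k ab}"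
        using ab swap_distinct_pairs[of "fst ab" "snd ab" p] slot2_swap[OF ab, of i0 j k] 4(3) by auto
    qed
    then show ?thesis using 4 lt by (cases ab) (simp add: mm_def)
  next
    case 5
    have "{cd \<in> distinct_pairs p. slot2 p i0 j k cd = slot2 p i0 j k ab} = {ab}"
    proof (intro equalityI subsetI)
      fix cd assume "cd \<in> {cd \<in> distinct_pairs p. slot2 p i0 j k cd = slot2 p i0 j k ab}"
      then have cd: "cd \<in> distinct_pairs p" and e: "\<forall>x<p. (if x = snd cd then k else if x = fst cd then j else i0) = (if x = snd ab then k else if x = fst ab then j else i0)"
        using eq[of cd] by blast+
      have "fst ab = fst cd" "snd ab = snd cd"
        using e[rule_format, of "fst ab"] e[rule_format, of "snd ab"] lt 5 by (auto split: if_splits)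
      then show "cd \<in> {ab}" by (cases ab; cases cd) auto
    qed (use ab in auto)
    then show ?thesis using 5 by (simp add: mm_def)
  qed
qed

lemma mm_pos: "p \<ge> 2 \<Longrightarrow> mm i0 p j k > 0"
  by (auto simp: mm_def)

text \<open>Double counting: the ordered pairs of distinct positions are partitioned into fibres of
  equal size, one for each coefficient in the group.\<close>

lemma card_grp: "p \<ge> 2 \<Longrightarrow> mm i0 p j k * real (card (grp p i0 {j, k})) = real p * (real p - 1)"
proof -
  assume p: "p \<ge> 2"
  have "real p * (real p - 1) = (\<Sum>ab\<in>distinct_pairs p. 1)" by (simp add: card_distinct_pairs)
  also have "\<dots> = (\<Sum>l\<in>grp p i0 {j, k}. \<Sum>ab\<in>{ab \<in> distinct_pairs p. slot2 p i0 j k ab = l}. 1)"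
    unfolding grp_eq by (rule sum.image_gen) simp
  also have "\<dots> = (\<Sum>l\<in>grp p i0 {j, k}. mm i0 p j k)"
    using fiber_slot2[OF p] by (intro sum.cong) (auto simp: grp_eq)
  finally show ?thesis by simp
qed

lemma phess_axis_grp:
  assumes p: "p \<ge> 2"
  shows "phess p J (axis i0 1) $ j $ k = sqrt (mm i0 p j k * (real p * (real p - 1))) * ((\<Sum>l\<in>grp p i0 {j, k}. J l) / sqrt (card (grp p i0 {j, k})))"
proof -
  have "phess p J (axis i0 1) $ j $ k = (\<Sum>l\<in>grp p i0 {j, k}. \<Sum>ab\<in>{ab \<in> distinct_pairs p. slot2 p i0 j k ab = l}. J (slot2 p i0 j k ab))"
    unfolding phess_axis grp_eq by (rule sum.image_gen) simp
  also have "\<dots> = (\<Sum>l\<in>grp p i0 {j, k}. mm i0 p j k * J l)"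
  proof (intro sum.cong refl)
    fix l assume "l \<in> grp p i0 {j, k}"
    then obtain ab where ab: "ab \<in> distinct_pairs p" "l = slot2 p i0 j k ab" by (auto simp: grp_eq)
    have "(\<Sum>ab\<in>{ab \<in> distinct_pairs p. slot2 p i0 j k ab = l}. J (slot2 p i0 j k ab)) =
      real (card {ab \<in> distinct_pairs p. slot2 p i0 j k ab = l}) * J l" by simp
    then show "(\<Sum>ab\<in>{ab \<in> distinct_pairs p. slot2 p i0 j k ab = l}. J (slot2 p i0 j k ab)) = mm i0 p j k * J l"
      using fiber_slot2[OF p ab(1), of i0 j k] ab(2) by simp
  qed
  also have "\<dots> = mm i0 p j k * (\<Sum>l\<in>grp p i0 {j, k}. J l)" by (simp add: sum_distrib_left)
  also have "mm i0 p j k = sqrt (mm i0 p j k * (real p * (real p - 1))) / sqrt (card (grp p i0 {j, k}))"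
  proof -
    have m: "mm i0 p j k > 0" by (rule mm_pos[OF p])
    have "mm i0 p j k * real (card (grp p i0 {j, k})) > 0" unfolding card_grp[OF p] using p by simp
    then have "card (grp p i0 {j, k}) \<noteq> 0" by (metis less_irrefl mult_zero_right of_nat_0)
    moreover have "sqrt (mm i0 p j k * (real p * (real p - 1))) = mm i0 p j k * sqrt (card (grp p i0 {j, k}))"
      unfolding card_grp[OF p, of i0 j k, symmetric] using m by (simp add: real_sqrt_mult mult.assoc[symmetric])
    ultimately show ?thesis by simp
  qed
  finally show ?thesis by simp
qed

text \<open>A model of the Hessian at a coordinate vector with independent entries up to symmetry.
  Standard deviations are \<open>p * (p - 1)\<close> in the corner, \<open>(p - 1) * sqrt p\<close>
  on the rest of row and column \<open>i0\<close>, and tangentially \<open>kap p\<close>, with an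
  extra \<open>sqrt 2\<close> on the diagonal.\<close>

definition hmat :: "'n::finite \<Rightarrow> nat \<Rightarrow> ('n set \<Rightarrow> real) \<Rightarrow> real^'n^'n" where
  "hmat i0 p g = (\<chi> j k. sqrt (mm i0 p j k * (real p * (real p - 1))) * g {j, k})"

lemma hmat_continuous: "continuous_on UNIV (hmat i0 p)"
  unfolding hmat_def by (intro continuous_intros continuous_on_product_coordinates)

lemma phess_axis_law:
  fixes i0 :: "'n::finite"
  assumes p: "p \<ge> 2" and F: "F \<in> borel_measurable borel"
  shows "(\<integral>\<^sup>+J. F (phess p J (axis i0 1)) \<partial>gam) = (\<integral>\<^sup>+g. F (hmat i0 p g) \<partial>gam)"
proof -
  let ?E = "{{j, k} | j k :: 'n. True}"
  let ?Y = "\<lambda>J E. (\<Sum>l\<in>grp p i0 E. J l) / sqrt (card (grp p i0 E))"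
  have "(\<integral>\<^sup>+J. F (hmat i0 p (?Y J)) \<partial>gam) = (\<integral>\<^sup>+g. F (hmat i0 p g) \<partial>gam)"
  proof (rule nn_integral_group_sums[where A="grp p i0" and E="?E" and F="\<lambda>g. F (hmat i0 p g)"])
    have "(0, 1) \<in> distinct_pairs p" using p by (auto simp: distinct_pairs_def)
    then show "grp p i0 E \<noteq> {}" if "E \<in> ?E" for E using that by (auto simp: grp_eq)
    show "finite (grp p i0 E)" if "E \<in> ?E" for E using that by (auto simp: grp_eq)
    show "(\<lambda>g. F (hmat i0 p g)) \<in> borel_measurable borel"
      by (rule measurable_compose[OF borel_measurable_continuous_onI[OF hmat_continuous] F])
    show "F (hmat i0 p h) = F (hmat i0 p k)" if "\<And>e. e \<in> ?E \<Longrightarrow> h e = k e" for h k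
    proof -
      have "h {i, j} = k {i, j}" for i j using that[of "{i, j}"] by blast
      then show ?thesis by (simp add: hmat_def)
    qed
    show "disjoint_family_on (grp p i0) ?E" by (rule disjoint_grp)
  qed auto
  moreover have "phess p J (axis i0 1) = hmat i0 p (?Y J)" for J
    by (simp add: vec_eq_iff hmat_def phess_axis_grp[OF p])
  ultimately show ?thesis by simp
qed

text \<open>Rotation invariance moves the direction of \<open>y\<close> to the coordinate vector,
  and homogeneity supplies the power of the radius.\<close>

lemma phess_law:
  fixes i0 :: "'n::finite"
  assumes p: "p \<ge> 2" and R: "orthogonal_matrix R" and y: "y = r *\<^sub>R (R *v axis i0 1)"
    and F: "F \<in> borel_measurable borel"
  shows "(\<integral>\<^sup>+J. F (phess p J y) \<partial>gam) = (\<integral>\<^sup>+g. F (r ^ (p - 2) *\<^sub>R (R ** hmat i0 p g ** transpose R)) \<partial>gam)"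
proof -
  have "continuous_on UNIV (\<lambda>J. phess p J y)"
    by (intro continuous_intros continuous_on_product_coordinates)
  then have m: "(\<lambda>J. phess p J y) \<in> borel_measurable borel" by (rule borel_measurable_continuous_onI)
  have "(\<integral>\<^sup>+J. F (phess p J y) \<partial>gam) = (\<integral>\<^sup>+J. F (phess p (\<lambda>l. rot R l J) y) \<partial>gam)"
  proof (intro nn_integral_rot[OF R, of "\<lambda>J. F (phess p J y)" p, symmetric])
    show "(\<lambda>J. F (phess p J y)) \<in> borel_measurable borel" by (rule measurable_compose[OF m F])
    fix J K :: "'n list \<Rightarrow> real" assume "\<And>l. length l = p \<Longrightarrow> J l = K l"
    then have "phess p J y = phess p K y" by (rule phess_cong)
    then show "F (phess p J y) = F (phess p K y)" by simp
  qed
  also have "\<dots> = (\<integral>\<^sup>+J. F (r ^ (p - 2) *\<^sub>R (R ** phess p J (axis i0 1) ** transpose R)) \<partial>gam)"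
    unfolding y phess_scale phess_rot[OF R] ..
  also have "\<dots> = (\<integral>\<^sup>+g. F (r ^ (p - 2) *\<^sub>R (R ** hmat i0 p g ** transpose R)) \<partial>gam)"
  proof (rule phess_axis_law[OF p, of "\<lambda>S. F (r ^ (p - 2) *\<^sub>R (R ** S ** transpose R))"])
    have "continuous_on UNIV (\<lambda>S::real^'n^'n. r ^ (p - 2) *\<^sub>R (R ** S ** transpose R))"
      unfolding matrix_matrix_mult_def by (intro continuous_intros)
    then show "(\<lambda>S. F (r ^ (p - 2) *\<^sub>R (R ** S ** transpose R))) \<in> borel_measurable borel"
      by (intro measurable_compose[OF _ F] borel_measurable_continuous_onI)
  qed
  finally show ?thesis .
qed

section \<open>The Kac--Rice formula\<close>

text \<open>Multi-indices with a free first letter and \<open>i0\<close> elsewhere. They contribute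
  \<open>(u \<bullet> y) * (y $ i0) ^ (p - 1)\<close> to the form, whose gradient is a bijective
  linear function of \<open>u\<close> as soon as \<open>y $ i0 \<noteq> 0\<close>.\<close>

definition bl :: "nat \<Rightarrow> 'n \<Rightarrow> 'n \<Rightarrow> 'n list" where
  "bl p i0 i = i # replicate (p - 1) i0"

lemma inj_bl: "inj (bl p i0)" by (auto simp: inj_on_def bl_def)

definition outer :: "real^'n \<Rightarrow> real^'n \<Rightarrow> real^'n^'n" where
  "outer x y = (\<chi> i j. x $ i * y $ j)"

lemma outer_mult: "outer x y *v v = (y \<bullet> v) *\<^sub>R (x :: real^'n::finite)"
  by (simp add: vec_eq_iff outer_def matrix_vector_mult_def inner_vec_def sum_distrib_right sum_distrib_left mult_ac)

definition lv :: "'n \<Rightarrow> nat \<Rightarrow> real^'n \<Rightarrow> real^'n^'n::finite" where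
  "lv i0 p y = (y $ i0) ^ (p - 1) *\<^sub>R mat 1 + ((real p - 1) * (y $ i0) ^ (p - 2)) *\<^sub>R outer (axis i0 1) y"

text \<open>The inverse of \<open>lv\<close> for \<open>y $ i0 \<noteq> 0\<close>, by the
  Sherman-Morrison formula for a rank one perturbation. In this rational form the solution
  \<open>gsol\<close> is visibly differentiable in \<open>y\<close>.\<close>

definition lvi :: "'n \<Rightarrow> nat \<Rightarrow> real^'n \<Rightarrow> real^'n^'n::finite" where
  "lvi i0 p y = inverse ((y $ i0) ^ (p - 1)) *\<^sub>R (mat 1 - ((real p - 1) / (real p * y $ i0)) *\<^sub>R outer (axis i0 1) y)"

lemma lv_mult: "lv i0 p y *v u = (y $ i0) ^ (p - 1) *\<^sub>R u + ((real p - 1) * (y $ i0) ^ (p - 2) * (u \<bullet> y)) *\<^sub>R axis i0 1"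
  by (simp add: lv_def matrix_vector_mult_add_rdistrib scaleR_matrix_vector_assoc[symmetric] outer_mult inner_commute)

lemma lvi_mult: "lvi i0 p y *v w = inverse ((y $ i0) ^ (p - 1)) *\<^sub>R (w - ((real p - 1) / (real p * y $ i0) * (w \<bullet> y)) *\<^sub>R axis i0 1)"
  by (simp add: lvi_def matrix_vector_mult_diff_rdistrib scaleR_matrix_vector_assoc[symmetric] outer_mult inner_commute)

context
  fixes i0 :: "'n::finite" and p :: nat and y :: "real^'n"
  assumes p: "p \<ge> 2" and y: "y $ i0 \<noteq> 0"
begin

lemma lv_lvi: "lv i0 p y ** lvi i0 p y = mat 1"
proof -
  have pw: "(y $ i0) ^ (p - 1) = y $ i0 * (y $ i0) ^ (p - 2)"
    using p by (metis Suc_diff_Suc Suc_1 Suc_le_lessD power_Suc)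
  have "lv i0 p y *v (lvi i0 p y *v w) = w" for w
  proof -
    have iy: "(lvi i0 p y *v w) \<bullet> y = inverse ((y $ i0) ^ (p - 1)) * ((w \<bullet> y) / real p)"
      using y p by (simp add: lvi_mult inner_diff_left inner_axis' field_simps)
    have c: "(real p - 1) * (y $ i0) ^ (p - 2) * (inverse ((y $ i0) ^ (p - 1)) * ((w \<bullet> y) / real p)) = (real p - 1) / (real p * y $ i0) * (w \<bullet> y)"
      using y p unfolding pw by (simp add: field_simps)
    show ?thesis
      unfolding lv_mult iy c using y by (simp add: lvi_mult)
  qed
  then show ?thesis by (simp add: matrix_eq matrix_vector_mul_assoc[symmetric])
qed

lemma lvi_lv: "lvi i0 p y ** lv i0 p y = mat 1"
  using lv_lvi matrix_left_right_inverse by blast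

lemma absdet_lv: "absdet (lv i0 p y) \<noteq> 0"
  using absdet_mult[of "lv i0 p y" "lvi i0 p y"] by (auto simp: lv_lvi)

lemma absdet_lvi: "absdet (lvi i0 p y) = 1 / absdet (lv i0 p y)"
  using absdet_mult[of "lv i0 p y" "lvi i0 p y"] absdet_lv by (simp add: lv_lvi field_simps)

lemma matrix_inv_lv: "matrix_inv (lv i0 p y) = lvi i0 p y"
proof -
  have "invertible (lv i0 p y)" unfolding invertible_def using lv_lvi lvi_lv by blast
  then have "lv i0 p y ** matrix_inv (lv i0 p y) = mat 1" by (rule matrix_inv_cancel)
  then have "lvi i0 p y ** (lv i0 p y ** matrix_inv (lv i0 p y)) = lvi i0 p y" by simp
  then show ?thesis by (simp add: matrix_mul_assoc lvi_lv)
qed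

end

lemma pform_single: "pform q (\<lambda>l. if l = replicate q i0 then c else 0) y = c * (y $ i0) ^ q"
proof (induction q)
  case (Suc q)
  have "pform q (\<lambda>l. if i = i0 \<and> l = replicate q i0 then c else 0) y = (if i = i0 then c * (y $ i0) ^ q else 0)" for i
    by (cases "i = i0") (simp_all add: Suc, simp add: pform_eq_sum)
  then have "(\<Sum>i\<in>UNIV. y $ i * pform q (\<lambda>l. if i = i0 \<and> l = replicate q i0 then c else 0) y) =
      (\<Sum>i\<in>UNIV. if i = i0 then y $ i0 * (c * (y $ i0) ^ q) else 0)"
    by (intro sum.cong) auto
  then show ?case by simp
qed simp

lemma pform_block:
  assumes p: "p \<ge> 1" shows "pform p (updb (bl p i0) (\<lambda>_. 0) u) y = (u \<bullet> y) * (y $ i0) ^ (p - 1)"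
proof -
  obtain q where q: "p = Suc q" using p by (cases p) auto
  have "updb (bl p i0) (\<lambda>_. 0) u (i # l) = (if l = replicate q i0 then u $ i else 0)" for i l
  proof (cases "l = replicate q i0")
    case True
    then have "i # l = bl p i0 i" by (simp add: bl_def q)
    then show ?thesis using True by (simp add: updb_block[OF inj_bl])
  next
    case False
    then have "i # l \<notin> range (bl p i0)" by (auto simp: bl_def q)
    then show ?thesis using False by (simp add: updb_other)
  qed
  then show ?thesis unfolding q
    by (simp add: pform_single inner_vec_def sum_distrib_left sum_distrib_right mult_ac)
qed

lemma pgrad_block:
  assumes p: "p \<ge> 2" shows "pgrad p (updb (bl p i0) (\<lambda>_. 0) u) y = lv i0 p y *v u"
proof -
  have d1: "((\<lambda>y. (u \<bullet> y) * (y $ i0) ^ (p - 1)) has_derivative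
      (\<lambda>v. (u \<bullet> y) * (real (p - 1) * (v $ i0) * (y $ i0) ^ (p - 1 - 1)) + (u \<bullet> v) * (y $ i0) ^ (p - 1))) (at y)"
    by (intro has_derivative_mult has_derivative_power bounded_linear_imp_has_derivative bounded_linear_vec_nth bounded_linear_inner_right)
  have f: "pform p (updb (bl p i0) (\<lambda>_. 0) u) = (\<lambda>y. (u \<bullet> y) * (y $ i0) ^ (p - 1))"
    using p by (intro ext pform_block) simp
  have e: "(\<lambda>v. pgrad p (updb (bl p i0) (\<lambda>_. 0) u) y \<bullet> v) =
     (\<lambda>v. (u \<bullet> y) * (real (p - 1) * (v $ i0) * (y $ i0) ^ (p - 1 - 1)) + (u \<bullet> v) * (y $ i0) ^ (p - 1))"
    by (rule has_derivative_unique[OF pform_has_derivative[of p "updb (bl p i0) (\<lambda>_. 0) u" y, unfolded f] d1])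
  have "pgrad p (updb (bl p i0) (\<lambda>_. 0) u) y \<bullet> v = (lv i0 p y *v u) \<bullet> v" for v
    using fun_cong[OF e, of v] p
    by (simp add: lv_mult inner_add_left inner_axis' of_nat_diff mult_ac numeral_2_eq_2)
  then show ?thesis using vector_eq_rdot by blast
qed

lemma pgrad_updb:
  assumes p: "p \<ge> 2"
  shows "pgrad p (updb (bl p i0) J u) y = lv i0 p y *v u + pgrad p (updb (bl p i0) J 0) y"
proof -
  have "updb (bl p i0) J u = (\<lambda>l. updb (bl p i0) (\<lambda>_. 0) u l + updb (bl p i0) J 0 l)"
    by (auto simp: updb_def)
  then show ?thesis by (simp add: pgrad_add pgrad_block[OF p])
qed

lemma affine_block_bl:
  assumes p: "p \<ge> 2" and y: "y $ i0 \<noteq> 0"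
  shows "affine_block (bl p i0) (\<lambda>J. pgrad p J y) (lv i0 p y)"
  unfolding affine_block_def by (intro conjI allI inj_bl absdet_lv[OF p y] pgrad_updb[OF p])

text \<open>The radial factor of the derivative of \<open>lev\<close>: the gradient of
  \<open>lev p\<close> at \<open>y\<close> is \<open>dl p y *\<^sub>R y\<close>.\<close>

definition dl :: "nat \<Rightarrow> real^'n::finite \<Rightarrow> real" where
  "dl p y = (real (p - 2) * lev p y + kap p * norm y ^ (p - 2)) / (norm y)\<^sup>2"

lemma lev_has_derivative:
  assumes y: "y \<noteq> 0"
  shows "(lev p has_derivative (\<lambda>v. dl p y * (y \<bullet> v))) (at y)"
proof -
  let ?r = "norm y"
  have r: "?r > 0" using y by simp
  have n: "(norm has_derivative (\<lambda>v. sgn y \<bullet> v)) (at y)"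
    using has_derivative_norm[OF y] by (simp add: inner_commute)
  have "((\<lambda>y. kap p * norm y ^ (p - 2) * ln (norm y)) has_derivative
     (\<lambda>v. kap p * ?r ^ (p - 2) * ((sgn y \<bullet> v) * inverse ?r) + (kap p * (real (p - 2) * (sgn y \<bullet> v) * ?r ^ (p - 2 - 1))) * ln ?r)) (at y)"
    by (intro has_derivative_mult has_derivative_mult_right has_derivative_power n has_derivative_ln r)
  also have "(\<lambda>v. kap p * ?r ^ (p - 2) * ((sgn y \<bullet> v) * inverse ?r) + (kap p * (real (p - 2) * (sgn y \<bullet> v) * ?r ^ (p - 2 - 1))) * ln ?r) = (\<lambda>v. dl p y * (y \<bullet> v))"
  proof
    fix v
    have s: "sgn y \<bullet> v = (y \<bullet> v) / ?r" by (simp add: sgn_div_norm divide_inverse mult.commute)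
    have q: "real (p - 2) * ?r ^ (p - 2 - 1) = real (p - 2) * ?r ^ (p - 2) / ?r"
      using r by (cases "p - 2") auto
    have "kap p * ?r ^ (p - 2) * ((sgn y \<bullet> v) * inverse ?r) + (kap p * (real (p - 2) * (sgn y \<bullet> v) * ?r ^ (p - 2 - 1))) * ln ?r
      = kap p * ?r ^ (p - 2) * ((sgn y \<bullet> v) * inverse ?r) + kap p * (real (p - 2) * ?r ^ (p - 2 - 1)) * (sgn y \<bullet> v) * ln ?r"
      by (simp only: mult_ac)
    also have "\<dots> = dl p y * (y \<bullet> v)"
      unfolding q s dl_def lev_def using r by (simp add: field_simps power2_eq_square)
    finally show "kap p * ?r ^ (p - 2) * ((sgn y \<bullet> v) * inverse ?r) + (kap p * (real (p - 2) * (sgn y \<bullet> v) * ?r ^ (p - 2 - 1))) * ln ?r = dl p y * (y \<bullet> v)" .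
  qed
  finally show ?thesis by (simp add: lev_def[abs_def])
qed

text \<open>The Jacobian of the vector field \<open>pgrad p J y - lev p y *\<^sub>R y\<close>, with
  the Hessian as the argument \<open>S\<close>.\<close>

definition kmat :: "nat \<Rightarrow> real^'n \<Rightarrow> real^'n^'n \<Rightarrow> real^'n^'n::finite" where
  "kmat p y S = S - lev p y *\<^sub>R mat 1 - dl p y *\<^sub>R outer y y"

lemma kmat_mult: "kmat p y S *v v = S *v v - lev p y *\<^sub>R v - (dl p y * (y \<bullet> v)) *\<^sub>R y"
  by (simp add: kmat_def matrix_vector_mult_diff_rdistrib scaleR_matrix_vector_assoc[symmetric] outer_mult)

definition gsol :: "'n \<Rightarrow> nat \<Rightarrow> ('n list \<Rightarrow> real) \<Rightarrow> real^'n \<Rightarrow> real^'n::finite" where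
  "gsol i0 p J y = lvi i0 p y *v (lev p y *\<^sub>R y - pgrad p (updb (bl p i0) J 0) y)"

lemma gsol_eq_bsol:
  assumes "p \<ge> 2" "y $ i0 \<noteq> 0"
  shows "gsol i0 p J y = bsol (bl p i0) (\<lambda>J. pgrad p J y) (lv i0 p y) (lev p y *\<^sub>R y) J"
  by (simp add: gsol_def bsol_def matrix_inv_lv[OF assms])

lemma gsol_iff:
  assumes "p \<ge> 2" "y $ i0 \<noteq> 0"
  shows "pgrad p (updb (bl p i0) J u) y = lev p y *\<^sub>R y \<longleftrightarrow> u = gsol i0 p J y"
  unfolding gsol_eq_bsol[OF assms] by (rule affine_block_solve[OF affine_block_bl[OF assms]])

text \<open>Differentiability is read off from the explicit formula; the value comes from implicit
  differentiation of the equation that \<open>gsol\<close> solves, written relative to the block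
  frozen at its value at \<open>y\<close>.\<close>

lemma gsol_has_derivative:
  fixes y :: "real^'n::finite"
  assumes p: "p \<ge> 2" and y: "y $ i0 \<noteq> 0"
  shows "(gsol i0 p J has_derivative (\<lambda>v. (- (lvi i0 p y ** kmat p y (phess p (updb (bl p i0) J (gsol i0 p J y)) y))) *v v)) (at y)"
proof -
  let ?b = "bl p i0"
  let ?u = "gsol i0 p J y"
  have y0: "y \<noteq> 0" using y by auto
  have dlev: "lev p differentiable at y" using lev_has_derivative[OF y0, of p] differentiable_def by blast
  have dpg: "pgrad p K differentiable at y" for K using pgrad_has_derivative[of p K y] differentiable_def by blast
  have did: "(\<lambda>y::real^'n. y) differentiable at y" by simp
  have ds: "(\<lambda>y::real^'n. y $ i0) differentiable at y"
    using bounded_linear_imp_has_derivative[OF bounded_linear_vec_nth] unfolding differentiable_def by blast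
  have dw: "(\<lambda>y. lev p y *\<^sub>R y - pgrad p (updb ?b J 0) y) differentiable at y"
    by (intro differentiable_diff differentiable_scaleR dlev dpg did)
  have "(\<lambda>y. inverse ((y $ i0) ^ (p - 1)) *\<^sub>R ((lev p y *\<^sub>R y - pgrad p (updb ?b J 0) y) -
      ((real p - 1) / (real p * y $ i0) * ((lev p y *\<^sub>R y - pgrad p (updb ?b J 0) y) \<bullet> y)) *\<^sub>R axis i0 1)) differentiable at y"
    using y p
    by (intro differentiable_diff differentiable_scaleR differentiable_inverse differentiable_power
      differentiable_mult differentiable_divide differentiable_inner dw ds did differentiable_const) auto
  then obtain D where D: "(gsol i0 p J has_derivative D) (at y)"
    unfolding differentiable_def gsol_def[abs_def] lvi_mult by blast
  have U: "open {y::real^'n. y $ i0 \<noteq> 0}" by (intro open_Collect_neq continuous_intros)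
  have id: "(x $ i0) ^ (p - 1) *\<^sub>R (gsol i0 p J x - ?u) + ((real p - 1) * (x $ i0) ^ (p - 2) * ((gsol i0 p J x - ?u) \<bullet> x)) *\<^sub>R axis i0 1
      + pgrad p (updb ?b J ?u) x = lev p x *\<^sub>R x" if "x $ i0 \<noteq> 0" for x
  proof -
    have "lv i0 p x *v (gsol i0 p J x - ?u) + pgrad p (updb ?b J ?u) x = pgrad p (updb ?b J (gsol i0 p J x)) x"
      unfolding pgrad_updb[OF p, of i0 J ?u] pgrad_updb[OF p, of i0 J "gsol i0 p J x"]
      by (simp add: matrix_vector_mult_diff_distrib)
    also have "\<dots> = lev p x *\<^sub>R x" using gsol_iff[OF p that] by blast
    finally show ?thesis by (simp add: lv_mult)
  qed
  \<comment> \<open>At \<open>y\<close> the derivatives \<open>d1\<close> and \<open>d2\<close>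
    multiply \<open>gsol i0 p J y - ?u\<close>, which is 0, so their existence is enough.\<close>
  obtain d1 where d1: "((\<lambda>x::real^'n. (x $ i0) ^ (p - 1)) has_derivative d1) (at y)"
    using differentiable_power[OF ds] unfolding differentiable_def by blast
  obtain d2 where d2: "((\<lambda>x::real^'n. (real p - 1) * (x $ i0) ^ (p - 2)) has_derivative d2) (at y)"
    using differentiable_mult[OF differentiable_const differentiable_power[OF ds]] unfolding differentiable_def by blast
  have "((\<lambda>x. (x $ i0) ^ (p - 1) *\<^sub>R (gsol i0 p J x - ?u) + ((real p - 1) * (x $ i0) ^ (p - 2) * ((gsol i0 p J x - ?u) \<bullet> x)) *\<^sub>R axis i0 1
      + pgrad p (updb ?b J ?u) x) has_derivative
     (\<lambda>v. ((y $ i0) ^ (p - 1) *\<^sub>R (D v - 0) + d1 v *\<^sub>R (gsol i0 p J y - ?u)) +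
       ((real p - 1) * (y $ i0) ^ (p - 2) * ((gsol i0 p J y - ?u) \<bullet> v + (D v - 0) \<bullet> y) + d2 v * ((gsol i0 p J y - ?u) \<bullet> y)) *\<^sub>R axis i0 1
       + phess p (updb ?b J ?u) y *v v)) (at y)"
    by (intro has_derivative_add has_derivative_scaleR has_derivative_scaleR_left has_derivative_mult has_derivative_inner has_derivative_diff
      has_derivative_const has_derivative_ident pgrad_has_derivative d1 d2 D)
  then have "((\<lambda>x. lev p x *\<^sub>R x) has_derivative
     (\<lambda>v. ((y $ i0) ^ (p - 1) *\<^sub>R (D v - 0) + d1 v *\<^sub>R (gsol i0 p J y - ?u)) +
       ((real p - 1) * (y $ i0) ^ (p - 2) * ((gsol i0 p J y - ?u) \<bullet> v + (D v - 0) \<bullet> y) + d2 v * ((gsol i0 p J y - ?u) \<bullet> y)) *\<^sub>R axis i0 1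
       + phess p (updb ?b J ?u) y *v v)) (at y)"
    by (rule has_derivative_transform_within_open[OF _ U]) (use id y in auto)
  moreover have "((\<lambda>x. lev p x *\<^sub>R x) has_derivative (\<lambda>v. lev p y *\<^sub>R v + (dl p y * (y \<bullet> v)) *\<^sub>R y)) (at y)"
    by (intro has_derivative_scaleR lev_has_derivative y0 has_derivative_ident)
  ultimately have eq: "(\<lambda>v. ((y $ i0) ^ (p - 1) *\<^sub>R (D v - 0) + d1 v *\<^sub>R (gsol i0 p J y - ?u)) +
       ((real p - 1) * (y $ i0) ^ (p - 2) * ((gsol i0 p J y - ?u) \<bullet> v + (D v - 0) \<bullet> y) + d2 v * ((gsol i0 p J y - ?u) \<bullet> y)) *\<^sub>R axis i0 1
       + phess p (updb ?b J ?u) y *v v) = (\<lambda>v. lev p y *\<^sub>R v + (dl p y * (y \<bullet> v)) *\<^sub>R y)"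
    by (rule has_derivative_unique)
  have "D v = (- (lvi i0 p y ** kmat p y (phess p (updb ?b J ?u) y))) *v v" for v
  proof -
    have "lv i0 p y *v D v + phess p (updb ?b J ?u) y *v v = lev p y *\<^sub>R v + (dl p y * (y \<bullet> v)) *\<^sub>R y"
      using fun_cong[OF eq, of v] by (simp add: lv_mult)
    then have "lv i0 p y *v D v = - (kmat p y (phess p (updb ?b J ?u) y) *v v)"
      unfolding kmat_mult by (simp add: algebra_simps)
    then have "lvi i0 p y *v (lv i0 p y *v D v) = lvi i0 p y *v (- (kmat p y (phess p (updb ?b J ?u) y) *v v))" by simp
    then have "D v = - (lvi i0 p y *v (kmat p y (phess p (updb ?b J ?u) y) *v v))"
      unfolding matrix_vector_mul_assoc lvi_lv[OF p y]
      using linear_neg[OF matrix_vector_mul_linear[of "lvi i0 p y"]] by (simp add: matrix_vector_mul_assoc)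
    then show ?thesis
      using scaleR_matrix_vector_assoc[of "-1" "lvi i0 p y ** kmat p y (phess p (updb ?b J ?u) y)" v]
      by (simp add: matrix_vector_mul_assoc)
  qed
  then have "D = (\<lambda>v. (- (lvi i0 p y ** kmat p y (phess p (updb ?b J ?u) y))) *v v)" by (rule ext)
  then show ?thesis using D by (simp only:)
qed

lemma pgrad_measurable:
  fixes J :: "'a \<Rightarrow> 'n::finite list \<Rightarrow> real"
  assumes J: "J \<in> borel_measurable M" and f: "f \<in> borel_measurable M"
  shows "(\<lambda>x. pgrad p (J x) (f x)) \<in> borel_measurable M"
proof -
  have "continuous_on UNIV (\<lambda>z::('n list \<Rightarrow> real) \<times> (real^'n). pgrad p (fst z) (snd z))"
    by (intro continuous_intros continuous_on_product_then_coordinatewise[OF continuous_on_fst[OF continuous_on_id]])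
  then have m: "(\<lambda>z::('n list \<Rightarrow> real) \<times> (real^'n). pgrad p (fst z) (snd z)) \<in> borel_measurable (borel \<Otimes>\<^sub>M borel)"
    by (rule borel_pair_measurable)
  have "(\<lambda>x. (J x, f x)) \<in> M \<rightarrow>\<^sub>M borel \<Otimes>\<^sub>M borel" using assms by measurable
  from measurable_compose[OF this m] show ?thesis by simp
qed

lemma phess_measurable:
  fixes J :: "'a \<Rightarrow> 'n::finite list \<Rightarrow> real"
  assumes J: "J \<in> borel_measurable M" and f: "f \<in> borel_measurable M"
  shows "(\<lambda>x. phess p (J x) (f x)) \<in> borel_measurable M"
proof -
  have "continuous_on UNIV (\<lambda>z::('n list \<Rightarrow> real) \<times> (real^'n). phess p (fst z) (snd z))"
    by (intro continuous_intros continuous_on_product_then_coordinatewise[OF continuous_on_fst[OF continuous_on_id]])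
  then have m: "(\<lambda>z::('n list \<Rightarrow> real) \<times> (real^'n). phess p (fst z) (snd z)) \<in> borel_measurable (borel \<Otimes>\<^sub>M borel)"
    by (rule borel_pair_measurable)
  have "(\<lambda>x. (J x, f x)) \<in> M \<rightarrow>\<^sub>M borel \<Otimes>\<^sub>M borel" using assms by measurable
  from measurable_compose[OF this m] show ?thesis by simp
qed

lemma lev_measurable [measurable]: "lev p \<in> borel_measurable borel"
  unfolding lev_def[abs_def] by measurable

lemma dl_measurable [measurable]: "dl p \<in> borel_measurable borel"
  unfolding dl_def[abs_def] by measurable

lemma outer_measurable: "(\<lambda>y::real^'n::finite. outer y y) \<in> borel_measurable borel"
  unfolding outer_def by (intro borel_measurable_continuous_onI continuous_intros)

lemma kmat_measurable:
  fixes f :: "'a \<Rightarrow> real^'n::finite"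
  assumes f: "f \<in> borel_measurable M" and S: "S \<in> borel_measurable M"
  shows "(\<lambda>x. kmat p (f x) (S x)) \<in> borel_measurable M"
  unfolding kmat_def using assms measurable_compose[OF f outer_measurable] by measurable

lemma gsol_measurable:
  fixes f :: "'a \<Rightarrow> real^'n::finite"
  assumes J: "J \<in> borel_measurable M" and f [measurable]: "f \<in> borel_measurable M"
  shows "(\<lambda>x. gsol i0 p (J x) (f x)) \<in> borel_measurable M"
proof -
  have [measurable]: "(\<lambda>x. pgrad p (updb (bl p i0) (J x) 0) (f x)) \<in> borel_measurable M"
    by (intro pgrad_measurable updb_comp_measurable J f) simp
  show ?thesis unfolding gsol_def lvi_mult by measurable
qed

lemma continuous_on_gsol:
  assumes p: "p \<ge> 2" shows "continuous_on {y. y $ i0 \<noteq> 0} (gsol i0 p J)"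
  using gsol_has_derivative[OF p, of _ i0 J]
  by (intro has_derivative_continuous_on) (auto intro: has_derivative_at_withinI)

lemma continuous_on_matrix_mult [continuous_intros]:
  fixes f :: "'a::topological_space \<Rightarrow> real^'n::finite^'m::finite" and g :: "'a \<Rightarrow> real^'k::finite^'n"
  shows "continuous_on S f \<Longrightarrow> continuous_on S g \<Longrightarrow> continuous_on S (\<lambda>x. f x ** g x)"
  unfolding matrix_matrix_mult_def by (intro continuous_intros)

text \<open>The density of the gradient at the value prescribed by the equation, times the
  conditional expectation of the absolute Jacobian weighted by the mark \<open>\<Theta>\<close> of
  the Hessian.\<close>

definition kr_density :: "'n::finite \<Rightarrow> nat \<Rightarrow> real^'n \<Rightarrow> (real^'n^'n \<Rightarrow> ennreal) \<Rightarrow> ennreal" where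
  "kr_density i0 p y \<Theta> = dkern (bl p i0) (\<lambda>J. pgrad p J y) (lv i0 p y) (\<lambda>J. phess p J y)
     (lev p y *\<^sub>R y) (\<lambda>S. ennreal (absdet (kmat p y S)) * \<Theta> S)"

text \<open>For fixed other coefficients, the block coefficients \<open>gsol\<close> that make \<open>y\<close> a zero are an explicit
  smooth function of \<open>y\<close>, so the area formula applied to \<open>gsol\<close> counts the zeros.\<close>

proposition kac_rice:
  fixes i0 :: "'n::finite" and \<Theta> :: "real^'n \<Rightarrow> real^'n^'n \<Rightarrow> ennreal"
  assumes p: "p \<ge> 2" and \<Theta>: "(\<lambda>(y, S). \<Theta> y S) \<in> borel_measurable (borel \<Otimes>\<^sub>M borel)"
    and C: "(\<lambda>J. \<integral>\<^sup>+y. \<Theta> y (phess p J y) \<partial>count_space (enc_crit p J \<inter> {y. y $ i0 \<noteq> 0})) \<in> borel_measurable borel"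
  shows "(\<integral>\<^sup>+J. (\<integral>\<^sup>+y. \<Theta> y (phess p J y) \<partial>count_space (enc_crit p J \<inter> {y. y $ i0 \<noteq> 0})) \<partial>gam) =
    (\<integral>\<^sup>+y. indicator {y. y $ i0 \<noteq> 0} y * kr_density i0 p y (\<Theta> y) \<partial>lborel)"
proof -
  let ?b = "bl p i0" and ?U = "{y::real^'n. y $ i0 \<noteq> 0}"
  let ?C = "\<lambda>J. \<integral>\<^sup>+y. \<Theta> y (phess p J y) \<partial>count_space (enc_crit p J \<inter> ?U)"
  let ?G = "gsol i0 p"
  let ?S = "\<lambda>J y. phess p (updb ?b J (?G J y)) y"
  let ?A = "\<lambda>J y. - (lvi i0 p y ** kmat p y (?S J y))"
  have \<Theta>m: "(\<lambda>x. \<Theta> (f x) (h x)) \<in> borel_measurable M" if "f \<in> borel_measurable M" "h \<in> borel_measurable M" for f h M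
  proof -
    have "(\<lambda>x. (f x, h x)) \<in> M \<rightarrow>\<^sub>M borel \<Otimes>\<^sub>M borel" using that by measurable
    from measurable_compose[OF this \<Theta>] show ?thesis by simp
  qed
  have U: "open ?U" by (intro open_Collect_neq continuous_intros)
  have U0: "y \<noteq> 0" if "y \<in> ?U" for y using that by auto
  have Sm: "(\<lambda>x. ?S (f x) (h x)) \<in> borel_measurable M" if "f \<in> borel_measurable M" "h \<in> borel_measurable M" for f h M
    using that by (intro phess_measurable updb_comp_measurable gsol_measurable)
  have crit: "enc_crit p (updb ?b J u) \<inter> ?U = ?U \<inter> ?G J -` {u}" for J u
    using gsol_iff[OF p, of _ i0 J u] U0 by (auto simp: enc_crit_def)
  have contA: "continuous_on ?U (?A J)" for J
  proof -
    have cl: "continuous_on ?U (\<lambda>y. lvi i0 p y)"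
      unfolding lvi_def outer_def using p by (intro continuous_intros) auto
    have cS: "continuous_on ?U (?S J)"
      by (intro continuous_intros continuous_on_product_then_coordinatewise[OF continuous_on_updb[OF continuous_on_const continuous_on_gsol[OF p]]])
    have ck: "continuous_on ?U (\<lambda>y. kmat p y (?S J y))"
      unfolding kmat_def lev_def dl_def outer_def using U0 by (intro continuous_intros cS) auto
    show ?thesis by (intro continuous_intros cl ck)
  qed
  have inner: "(\<integral>\<^sup>+u. ?C (updb ?b J u) \<partial>gvec) =
      (\<integral>\<^sup>+y. indicator ?U y * (ennreal (gdens (?G J y) / absdet (lv i0 p y)) * (ennreal (absdet (kmat p y (?S J y))) * \<Theta> y (?S J y))) \<partial>lborel)" for J
  proof -
    have Cm: "(\<lambda>u. ?C (updb ?b J u)) \<in> borel_measurable borel"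
      by (rule measurable_compose[OF updb_comp_measurable C]) auto
    have "(\<integral>\<^sup>+u. ?C (updb ?b J u) \<partial>gvec) = (\<integral>\<^sup>+u. ennreal (gdens u) * ?C (updb ?b J u) \<partial>lborel)"
      unfolding gvec_eq_density using Cm by (subst nn_integral_density) auto
    also have "\<dots> = (\<integral>\<^sup>+u. (\<integral>\<^sup>+y. ennreal (gdens (?G J y)) * \<Theta> y (?S J y) \<partial>count_space (?U \<inter> ?G J -` {u})) \<partial>lborel)"
    proof (intro nn_integral_cong)
      fix u
      have "ennreal (gdens u) * ?C (updb ?b J u) =
         (\<integral>\<^sup>+y. ennreal (gdens u) * \<Theta> y (phess p (updb ?b J u) y) \<partial>count_space (?U \<inter> ?G J -` {u}))"
        unfolding crit by (simp add: nn_integral_cmult)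
      also have "\<dots> = (\<integral>\<^sup>+y. ennreal (gdens (?G J y)) * \<Theta> y (?S J y) \<partial>count_space (?U \<inter> ?G J -` {u}))"
        by (intro nn_integral_cong) auto
      finally show "ennreal (gdens u) * ?C (updb ?b J u) = \<dots>" .
    qed
    also have "\<dots> = (\<integral>\<^sup>+y. ennreal (absdet (?A J y)) * indicator ?U y * (ennreal (gdens (?G J y)) * \<Theta> y (?S J y)) \<partial>lborel)"
    proof (rule area_formula[OF U _ contA])
      show "(?G J has_derivative (*v) (?A J y)) (at y)" if "y \<in> ?U" for y
        using gsol_has_derivative[OF p, of y i0 J] that by simp
      have [measurable]: "?G J \<in> borel_measurable borel" using gsol_measurable[of "\<lambda>_. J" borel "\<lambda>y. y"] by simp
      have [measurable]: "(\<lambda>y. \<Theta> y (?S J y)) \<in> borel_measurable borel"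
        by (intro \<Theta>m Sm[of "\<lambda>_. J" borel "\<lambda>y. y"]) auto
      show "(\<lambda>y. ennreal (gdens (?G J y)) * \<Theta> y (?S J y)) \<in> borel_measurable borel" by measurable
    qed
    also have "\<dots> = (\<integral>\<^sup>+y. indicator ?U y * (ennreal (gdens (?G J y) / absdet (lv i0 p y)) * (ennreal (absdet (kmat p y (?S J y))) * \<Theta> y (?S J y))) \<partial>lborel)"
    proof (intro nn_integral_cong)
      fix y :: "real^'n"
      show "ennreal (absdet (?A J y)) * indicator ?U y * (ennreal (gdens (?G J y)) * \<Theta> y (?S J y)) =
         indicator ?U y * (ennreal (gdens (?G J y) / absdet (lv i0 p y)) * (ennreal (absdet (kmat p y (?S J y))) * \<Theta> y (?S J y)))"
      proof (cases "y \<in> ?U")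
        case True
        then have y: "y $ i0 \<noteq> 0" by simp
        \<comment> \<open>The sign is invisible to \<open>absdet\<close>; the factor
          \<open>1 / absdet (lv i0 p y)\<close> turns the density of the block into the density of
          the gradient.\<close>
        have "absdet (?A J y) = absdet ((-1) *\<^sub>R (lvi i0 p y ** kmat p y (?S J y)))" by simp
        also have "\<dots> = absdet (kmat p y (?S J y)) / absdet (lv i0 p y)"
          unfolding absdet_scale absdet_mult absdet_lvi[OF p y] by simp
        finally have "absdet (?A J y) * gdens (?G J y) = gdens (?G J y) / absdet (lv i0 p y) * absdet (kmat p y (?S J y))"
          by simp
        then have "ennreal (absdet (?A J y)) * ennreal (gdens (?G J y)) = ennreal (gdens (?G J y) / absdet (lv i0 p y)) * ennreal (absdet (kmat p y (?S J y)))"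
          using gdens_pos[of "?G J y"] by (simp add: ennreal_mult[symmetric] less_imp_le)
        then show ?thesis using True by (simp add: mult.assoc[symmetric])
      qed simp
    qed
    finally show ?thesis .
  qed
  have "(\<integral>\<^sup>+J. ?C J \<partial>gam) = (\<integral>\<^sup>+J. \<integral>\<^sup>+u. ?C (updb ?b J u) \<partial>gvec \<partial>gam)"
    by (rule nn_integral_resample[OF inj_bl C])
  also have "\<dots> = (\<integral>\<^sup>+J. \<integral>\<^sup>+y. indicator ?U y * (ennreal (gdens (?G J y) / absdet (lv i0 p y)) * (ennreal (absdet (kmat p y (?S J y))) * \<Theta> y (?S J y))) \<partial>lborel \<partial>gam)"
    unfolding inner ..
  also have "\<dots> = (\<integral>\<^sup>+y. \<integral>\<^sup>+J. indicator ?U y * (ennreal (gdens (?G J y) / absdet (lv i0 p y)) * (ennreal (absdet (kmat p y (?S J y))) * \<Theta> y (?S J y))) \<partial>gam \<partial>lborel)"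
  proof -
    interpret pair_sigma_finite lborel "gam :: ('n list \<Rightarrow> real) measure"
      by (intro pair_sigma_finite.intro sigma_finite_lborel gam.sigma_finite_measure)
    let ?P = "(borel :: (real^'n) measure) \<Otimes>\<^sub>M (borel :: ('n list \<Rightarrow> real) measure)"
    have f: "fst \<in> borel_measurable ?P" and s: "snd \<in> borel_measurable ?P" by auto
    have [measurable]: "(\<lambda>x. ?G (snd x) (fst x)) \<in> borel_measurable ?P" by (intro gsol_measurable f s)
    have [measurable]: "(\<lambda>x. ?S (snd x) (fst x)) \<in> borel_measurable ?P" by (intro Sm f s)
    have [measurable]: "(\<lambda>x. \<Theta> (fst x) (?S (snd x) (fst x))) \<in> borel_measurable ?P" by (intro \<Theta>m Sm f s)
    have [measurable]: "(\<lambda>x. kmat p (fst x) (?S (snd x) (fst x))) \<in> borel_measurable ?P" by (intro kmat_measurable Sm f s)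
    have "lv i0 p \<in> borel_measurable borel"
      unfolding lv_def[abs_def] outer_def by (intro borel_measurable_continuous_onI continuous_intros)
    then have [measurable]: "(\<lambda>x. lv i0 p (fst x)) \<in> borel_measurable ?P" by (rule measurable_compose[OF f])
    have [measurable]: "?U \<in> sets borel" using U by simp
    have "(\<lambda>x. indicator ?U (fst x) * (ennreal (gdens (?G (snd x) (fst x)) / absdet (lv i0 p (fst x))) * (ennreal (absdet (kmat p (fst x) (?S (snd x) (fst x)))) * \<Theta> (fst x) (?S (snd x) (fst x))))) \<in> borel_measurable ?P"
      by measurable
    then show ?thesis by (intro Fubini') (simp add: split_def cong: measurable_cong_sets)
  qed
  also have "\<dots> = (\<integral>\<^sup>+y. indicator ?U y * kr_density i0 p y (\<Theta> y) \<partial>lborel)"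
  proof (intro nn_integral_cong)
    fix y :: "real^'n"
    show "(\<integral>\<^sup>+J. indicator ?U y * (ennreal (gdens (?G J y) / absdet (lv i0 p y)) * (ennreal (absdet (kmat p y (?S J y))) * \<Theta> y (?S J y))) \<partial>gam) =
      indicator ?U y * kr_density i0 p y (\<Theta> y)"
      by (cases "y \<in> ?U") (simp_all add: kr_density_def dkern_def gsol_eq_bsol[OF p])
  qed
  finally show ?thesis .
qed

section \<open>Evaluation of the density in a rotated frame\<close>

section \<open>The Kac--Rice density\<close>

text \<open>The second block: the Gaussians in row \<open>i0\<close> of \<open>hmat\<close>. By
  Euler's identity they determine the gradient at the coordinate vector, through a diagonal
  matrix.\<close>

definition pairb :: "'n \<Rightarrow> 'n \<Rightarrow> 'n set" where
  "pairb i0 j = {i0, j}"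

lemma inj_pairb: "inj (pairb i0)"
  by (auto simp: inj_on_def pairb_def doubleton_eq_iff)

text \<open>The conditioned Hessian in the rotated frame and in the unit
  \<open>kap p * r ^ (p - 2)\<close>: prescribed corner, vanishing mixed entries, free tangential
  block.\<close>

definition wmat :: "'n \<Rightarrow> ('n set \<Rightarrow> real) \<Rightarrow> real \<Rightarrow> real^'n^'n::finite" where
  "wmat i0 g c = (\<chi> j k. if j = i0 \<and> k = i0 then c else if j = i0 \<or> k = i0 then 0
     else (if j = k then sqrt 2 else 1) * g {j, k})"

text \<open>The Jacobian \<open>kmat\<close> in the same frame and unit: the tangential block
  shifted by \<open>\<tau>\<close>, and a radial entry free of both \<open>p\<close> and
  \<open>\<tau>\<close>.\<close>

definition dmat :: "'n \<Rightarrow> real \<Rightarrow> ('n set \<Rightarrow> real) \<Rightarrow> real^'n^'n::finite" where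
  "dmat i0 \<tau> g = (\<chi> j k. if j = i0 \<and> k = i0 then -1 else if j = i0 \<or> k = i0 then 0
     else (if j = k then sqrt 2 else 1) * g {j, k} - \<tau> * of_bool (j = k))"

text \<open>Makes \<open>idx\<close> the index of a symmetric matrix for every argument, as
  semicontinuity requires; Hessians are left unchanged.\<close>

definition symm :: "real^'n^'n \<Rightarrow> real^'n^'n::finite" where
  "symm S = (1/2) *\<^sub>R (S + transpose S)"

definition idx :: "nat \<Rightarrow> real^'n \<Rightarrow> real^'n^'n::finite \<Rightarrow> nat" where
  "idx p y S = ind (tmat y (symm S) (lev p y))"

lemma transpose_symm [simp]: "transpose (symm S) = symm S"
  by (simp add: symm_def transpose_def vec_eq_iff)

lemma symm_id: "transpose S = S \<Longrightarrow> symm S = S"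
  by (simp add: symm_def vec_eq_iff)

lemma idx_phess: "idx p y (phess p J y) = enc_index p J y"
  by (simp add: idx_def enc_index_def symm_id transpose_phess)

lemma continuous_on_sym [continuous_intros]: "continuous_on X f \<Longrightarrow> continuous_on X (\<lambda>x. symm (f x))"
  unfolding symm_def transpose_def by (intro continuous_intros)

lemma open_less_idx: "open {(y, S). y \<noteq> 0 \<and> k < idx p y (S :: real^'n::finite^'n)}"
proof -
  obtain U where U: "open U" "\<And>M::real^'n^'n. transpose M = M \<Longrightarrow> (M \<in> U \<longleftrightarrow> k < ind M)"
    using ind_open[of k] by blast
  let ?Y = "{x::(real^'n) \<times> (real^'n^'n). fst x \<noteq> 0}"
  have "continuous_on ?Y (\<lambda>x. tmat (fst x) (symm (snd x)) (lev p (fst x)))"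
    unfolding lev_def by (intro continuous_intros) auto
  moreover have "open ?Y" by (intro open_Collect_neq continuous_intros)
  ultimately have "open (?Y \<inter> (\<lambda>x. tmat (fst x) (symm (snd x)) (lev p (fst x))) -` U)"
    using U(1) by (intro continuous_open_preimage)
  also have "?Y \<inter> (\<lambda>x. tmat (fst x) (symm (snd x)) (lev p (fst x))) -` U = {(y, S). y \<noteq> 0 \<and> k < idx p y S}"
    using U(2)[OF transpose_tmat[OF _ transpose_symm]] by (auto simp: idx_def)
  finally show ?thesis .
qed

lemma measurable_nat_gt:
  assumes "\<And>k. {x \<in> space M. k < f x} \<in> sets M"
  shows "f \<in> M \<rightarrow>\<^sub>M count_space (UNIV :: nat set)"
proof (rule measurable_count_space_eq2_countable[THEN iffD2], intro conjI ballI)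
  fix a
  have "f -` {a} \<inter> space M = (case a of 0 \<Rightarrow> space M | Suc k \<Rightarrow> {x \<in> space M. k < f x}) - {x \<in> space M. a < f x}"
    by (cases a) auto
  then show "f -` {a} \<inter> space M \<in> sets M"
    using assms by (cases a) auto
qed auto

lemma idx_measurable:
  "(\<lambda>(y, S). if y = 0 then 0 else idx p y (S :: real^'n::finite^'n)) \<in> (borel \<Otimes>\<^sub>M borel) \<rightarrow>\<^sub>M count_space UNIV"
proof (rule measurable_nat_gt)
  fix k
  have "{x \<in> space (borel \<Otimes>\<^sub>M borel). k < (case x of (y, S) \<Rightarrow> if y = 0 then 0 else idx p y (S :: real^'n^'n))} =
      {(y, S). y \<noteq> 0 \<and> k < idx p y S}"
    by (auto simp: space_pair_measure split: if_splits)
  moreover have "{(y, S). y \<noteq> 0 \<and> k < idx p y (S :: real^'n^'n)} \<in> sets (borel \<Otimes>\<^sub>M borel)"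
    unfolding borel_prod by (rule borel_open[OF open_less_idx])
  ultimately show "{x \<in> space (borel \<Otimes>\<^sub>M borel). k < (case x of (y, S) \<Rightarrow> if y = 0 then 0 else idx p y (S :: real^'n^'n))} \<in> sets (borel \<Otimes>\<^sub>M borel)"
    by (simp only:)
qed

lemma idx_measurable_snd:
  assumes y: "y \<noteq> 0"
  shows "(\<lambda>S. indicator K (idx p y S) :: ennreal) \<in> borel_measurable borel"
proof -
  have "(\<lambda>S. (y, S)) \<in> borel \<rightarrow>\<^sub>M borel \<Otimes>\<^sub>M borel" by measurable
  from measurable_compose[OF this idx_measurable[of p]]
  have [measurable]: "(\<lambda>S. idx p y S) \<in> borel \<rightarrow>\<^sub>M count_space UNIV" using y by simp
  show ?thesis by measurable
qed

lemma div_mult_swap_real: "a / b * c = a * (c / b)" for a b c :: real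
  by simp

text \<open>In the corner, \<open>(p - 1) \<tau> - \<tau> - (p - 2) \<tau> - 1 = -1\<close> for
  every \<open>p\<close>. The logarithm in \<open>lev\<close> is responsible for this
  cancellation.\<close>

lemma dmat_eq: "dmat i0 \<tau> g = wmat i0 g ((real p - 1) * \<tau>) - \<tau> *\<^sub>R mat 1 - ((real p - 2) * \<tau> + 1) *\<^sub>R outer (axis i0 1) (axis i0 1)"
  by (simp add: vec_eq_iff dmat_def wmat_def mat_def outer_def axis_def algebra_simps)

text \<open>At a zero the gradient is radial, so in row \<open>i0\<close> only the corner survives;
  its Gaussian \<open>kap p / p * \<tau>\<close> is multiplied by the standard deviation
  \<open>p * (p - 1)\<close>.\<close>

lemma hmat_pairb:
  fixes i0 :: "'n::finite"
  assumes p: "p \<ge> 2"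
  shows "hmat i0 p (updb (pairb i0) g ((kap p / real p * \<tau>) *\<^sub>R axis i0 1)) = kap p *\<^sub>R wmat i0 g ((real p - 1) * \<tau>)"
proof -
  define u :: "real^'n" where "u = (kap p / real p * \<tau>) *\<^sub>R axis i0 1"
  have u: "u $ i0 = kap p / real p * \<tau>" "k \<noteq> i0 \<Longrightarrow> u $ k = 0" for k
    by (simp_all add: u_def axis_def)
  have a: "updb (pairb i0) g u {i0, k} = u $ k" for k
    using updb_block[OF inj_pairb, of i0 g u k] by (simp add: pairb_def)
  have b: "updb (pairb i0) g u {j, k} = g {j, k}" if "j \<noteq> i0" "k \<noteq> i0" for j k
    using that by (intro updb_other) (auto simp: pairb_def)
  have q: "sqrt (real p * (real p - 1) * (real p * (real p - 1))) = real p * (real p - 1)"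
    unfolding real_sqrt_abs2 using p by simp
  show ?thesis
    unfolding vec_eq_iff u_def[symmetric]
  proof (intro allI)
    fix j k
    consider "j = i0" "k = i0" | "j = i0" "k \<noteq> i0" | "j \<noteq> i0" "k = i0" | "j \<noteq> i0" "k \<noteq> i0" by blast
    then show "hmat i0 p (updb (pairb i0) g u) $ j $ k = (kap p *\<^sub>R wmat i0 g ((real p - 1) * \<tau>)) $ j $ k"
    proof cases
      case 1
      have "updb (pairb i0) g u {i0} = kap p / real p * \<tau>" using a[of i0] u by simp
      then show ?thesis using p unfolding 1 by (simp add: hmat_def wmat_def mm_def q)
    next
      case 2
      have z: "updb (pairb i0) g u {i0, k} = 0" unfolding a using 2 by (simp add: u)
      show ?thesis using 2 by (simp add: hmat_def wmat_def z)
    next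
      case 3
      have z: "updb (pairb i0) g u {i0, j} = 0" unfolding a using 3 by (simp add: u)
      show ?thesis using 3 by (simp add: hmat_def wmat_def z insert_commute[of j])
    next
      case 4
      then show ?thesis using b[OF 4] by (simp add: hmat_def wmat_def mm_def kap_def real_sqrt_mult)
    qed
  qed
qed

definition dvec :: "'n::finite \<Rightarrow> nat \<Rightarrow> 'n \<Rightarrow> real" where
  "dvec i0 p j = sqrt (mm i0 p j i0 * (real p * (real p - 1)))"

lemma dvec_pos: "p \<ge> 2 \<Longrightarrow> dvec i0 p j > 0"
  using mm_pos[of p i0 j i0] by (simp add: dvec_def)

lemma prod_dvec:
  fixes i0 :: "'n::finite"
  assumes p: "p \<ge> 2"
  shows "(\<Prod>j\<in>UNIV. dvec i0 p j) = (real p - 1) ^ CARD('n) * (real p * sqrt (real p) ^ (CARD('n) - 1))"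
proof -
  have a: "dvec i0 p i0 = (real p - 1) * real p"
    using p by (simp add: dvec_def mm_def real_sqrt_mult)
  have b: "dvec i0 p j = (real p - 1) * sqrt (real p)" if "j \<noteq> i0" for j
  proof -
    have "dvec i0 p j = sqrt ((real p - 1)\<^sup>2 * real p)" using that by (simp add: dvec_def mm_def power2_eq_square mult_ac)
    then show ?thesis using p by (simp add: real_sqrt_mult)
  qed
  have "(\<Prod>j\<in>UNIV. dvec i0 p j) = dvec i0 p i0 * (\<Prod>j\<in>UNIV - {i0}. dvec i0 p j)"
    by (rule prod.remove) auto
  also have "(\<Prod>j\<in>UNIV - {i0}. dvec i0 p j) = ((real p - 1) * sqrt (real p)) ^ (CARD('n) - 1)"
    using b by (simp add: card_Diff_singleton)
  also have "dvec i0 p i0 * \<dots> = (real p - 1) ^ Suc (CARD('n) - 1) * (real p * sqrt (real p) ^ (CARD('n) - 1))"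
    unfolding a power_Suc power_mult_distrib by (simp only: mult_ac)
  also have "Suc (CARD('n) - 1) = CARD('n)" by simp
  finally show ?thesis .
qed

lemma absdet_diagonal: "absdet (\<chi> j k. of_bool (j = k) * d j :: real^'n::finite^'n) = \<bar>\<Prod>j\<in>UNIV. d j\<bar>"
proof -
  let ?M = "mat_wo (\<chi> j k. of_bool (j = k) * d j :: real^'n^'n)"
  have "det ?M = (\<Prod>i\<in>UNIV. ?M $ i $ i)"
    by (rule det_diagonal) (simp add: mat_wo_def Rep_wo_inject)
  also have "\<dots> = (\<Prod>j\<in>UNIV. d j)" by (simp add: mat_wo_def prod_wo)
  finally show ?thesis by (simp add: absdet_def)
qed

lemma diagonal_mult: "(\<chi> j k. of_bool (j = k) * d j :: real^'n::finite^'n) *v u = (\<chi> j. d j * u $ j)"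
proof -
  have "(\<Sum>k\<in>UNIV. of_bool (j = k) * d j * u $ k) = (\<Sum>k\<in>UNIV. if k = j then d j * u $ k else 0)" for j
    by (intro sum.cong) auto
  then show ?thesis by (simp add: vec_eq_iff matrix_vector_mult_def)
qed

text \<open>Three factors: the Gaussian density at the solving block, whose squared norm is
  \<open>(p - 1) / p * (ln r)\<^sup>2\<close>, and the two parts of the ratio of
  \<open>(kap p * r ^ (p - 2)) ^ N\<close> to the Jacobian of the row block, where N is the
  dimension.\<close>

definition cst :: "'n::finite itself \<Rightarrow> nat \<Rightarrow> real \<Rightarrow> real" where
  "cst _ p r = exp (- ((real p - 1) / real p * (ln r)\<^sup>2) / 2) / sqrt (2 * pi) ^ CARD('n) *
     (sqrt (real p - 1) ^ CARD('n) / sqrt (real p)) / r ^ CARD('n)"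

text \<open>\<open>R\<close> maps the tangent space at \<open>y\<close> isometrically onto the one
  at \<open>R *v y\<close> and intertwines the two forms.\<close>

lemma ind_tmat_rot:
  assumes R: "orthogonal_matrix R" and y: "y \<noteq> 0" and S: "transpose S = S"
  shows "ind (tmat (R *v y) (R ** S ** transpose R) c) = ind (tmat y S (c::real))"
proof -
  have RT: "orthogonal_matrix (transpose R)" using R by (simp add: orthogonal_matrix_transpose)
  have oR: "orthogonal_transformation ((*v) R)" using R by (simp add: orthogonal_transformation_matrix)
  have inn: "(R *v x) \<bullet> (R *v z) = x \<bullet> z" for x z using oR by (simp add: orthogonal_transformation_def)
  have Ry: "R *v y \<noteq> 0" using y inn[of y y] by auto
  have S': "transpose (R ** S ** transpose R) = R ** S ** transpose R"
    by (simp add: matrix_transpose_mul S matrix_mul_assoc)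
  have tp: "tangent_proj (R *v y) (R *v v) = R *v tangent_proj y v" for v
    by (simp add: tangent_proj_def inn matrix_vector_mult_diff_distrib matrix_vector_mult_scaleR)
  have SR: "(R ** S ** transpose R) *v (R *v v) = R *v (S *v v)" for v
    using orthogonal_matrix_cancel[OF R] by (simp add: matrix_vector_mul_assoc[symmetric] del: transpose_matrix_vector)
  have tf: "tform (R *v y) (R ** S ** transpose R) c (R *v v) = R *v tform y S c v" for v
    by (simp add: tform_def SR tp matrix_vector_mult_diff_distrib matrix_vector_mult_scaleR)
  show ?thesis
    unfolding ind_tmat[OF y S] ind_tmat[OF Ry S']
  proof (rule antisym)
    show "index_on (tangent_space y) (tform y S c) \<le> index_on (tangent_space (R *v y)) (tform (R *v y) (R ** S ** transpose R) c)"
      by (rule index_on_mono_map[OF selfadj_tform[OF y S] selfadj_tform[OF Ry S'] matrix_vector_mul_linear[of R]])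
        (auto simp: tangent_space_def inn tf)
    have bck: "R *v (transpose R *v x) = x" for x by (rule orthogonal_matrix_cancel[OF R])
    show "index_on (tangent_space (R *v y)) (tform (R *v y) (R ** S ** transpose R) c) \<le> index_on (tangent_space y) (tform y S c)"
    proof (rule index_on_mono_map[OF selfadj_tform[OF Ry S'] selfadj_tform[OF y S] matrix_vector_mul_linear[of "transpose R"]])
      show "(*v) (transpose R) ` tangent_space (R *v y) \<subseteq> tangent_space y"
        unfolding tangent_space_def using inn bck by (metis (mono_tags, lifting) image_subsetI mem_Collect_eq)
      fix x assume "x \<bullet> tform (R *v y) (R ** S ** transpose R) c x < 0"
      then have "(R *v (transpose R *v x)) \<bullet> tform (R *v y) (R ** S ** transpose R) c (R *v (transpose R *v x)) < 0"
        unfolding bck .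
      then show "(transpose R *v x) \<bullet> tform y S c (transpose R *v x) < 0" unfolding tf inn .
    qed
  qed
qed

lemma transpose_wmat: "transpose (wmat i0 g c) = wmat i0 g c"
  by (auto simp: transpose_def wmat_def vec_eq_iff insert_commute)

text \<open>Tangent vectors do not see the corner entry, which alone carries \<open>p\<close> in the
  conditioned Hessian.\<close>

lemma ind_tmat_wmat: "ind (tmat (axis i0 1) (wmat i0 g c) \<tau>) = ind (tmat (axis i0 1) (wmat i0 g c') \<tau>)"
proof -
  have a: "axis i0 1 \<noteq> (0 :: real^'n)" for i0 :: "'n::finite" by (simp add: axis_eq_0_iff)
  have "wmat i0 g c *v v = wmat i0 g c' *v v" if "v \<in> tangent_space (axis i0 1)" for v
  proof -
    have "v $ i0 = 0" using that by (simp add: tangent_space_def inner_axis')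
    moreover have "wmat i0 g c - wmat i0 g c' = (c - c') *\<^sub>R outer (axis i0 1) (axis i0 1)"
      by (simp add: vec_eq_iff wmat_def outer_def axis_def)
    then have "(wmat i0 g c - wmat i0 g c') *v v = ((c - c') * v $ i0) *\<^sub>R axis i0 1"
      by (simp add: scaleR_matrix_vector_assoc[symmetric] outer_mult inner_axis')
    ultimately show ?thesis by (simp add: matrix_vector_mult_diff_rdistrib)
  qed
  then show ?thesis unfolding ind_tmat[OF a transpose_wmat]
    by (intro index_on_cong) (simp add: tform_def)
qed

text \<open>This factor of the density does not depend on \<open>p\<close>, which reduces the general case to \<open>p = 2\<close>.\<close>

definition Psi :: "'n::finite \<Rightarrow> nat set \<Rightarrow> real \<Rightarrow> ennreal" where
  "Psi i0 K \<tau> = (\<integral>\<^sup>+g. ennreal (absdet (dmat i0 \<tau> g)) * indicator K (ind (tmat (axis i0 1) (wmat i0 g 0) \<tau>)) \<partial>gam)"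

lemma Psi_integrand_measurable:
  fixes i0 :: "'n::finite"
  shows "(\<lambda>(\<tau>, g). ennreal (absdet (dmat i0 \<tau> g)) * indicator K (ind (tmat (axis i0 1) (wmat i0 g 0) \<tau>))) \<in> borel_measurable (borel \<Otimes>\<^sub>M borel)"
proof -
  have cg: "continuous_on UNIV (\<lambda>x::real \<times> ('n set \<Rightarrow> real). snd x E)" for E
    by (rule continuous_on_product_then_coordinatewise[OF continuous_on_snd[OF continuous_on_id]])
  have "continuous_on UNIV (\<lambda>x::real \<times> ('n set \<Rightarrow> real). dmat i0 (fst x) (snd x) $ j $ k)" for j k
    unfolding dmat_def using cg
    by (cases "j = i0"; cases "k = i0") (auto intro!: continuous_intros)
  then have "continuous_on UNIV (\<lambda>x::real \<times> ('n set \<Rightarrow> real). \<chi> j k. dmat i0 (fst x) (snd x) $ j $ k)"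
    by (intro continuous_on_vec_lambda)
  moreover have "(\<lambda>x::real \<times> ('n set \<Rightarrow> real). \<chi> j k. dmat i0 (fst x) (snd x) $ j $ k) = (\<lambda>x. dmat i0 (fst x) (snd x))"
    by (simp add: vec_eq_iff fun_eq_iff)
  ultimately have "continuous_on UNIV (\<lambda>x::real \<times> ('n set \<Rightarrow> real). dmat i0 (fst x) (snd x))"
    by (simp only:)
  then have [measurable]: "(\<lambda>x::real \<times> ('n set \<Rightarrow> real). dmat i0 (fst x) (snd x)) \<in> borel_measurable (borel \<Otimes>\<^sub>M borel)"
    by (rule borel_pair_measurable)
  have "continuous_on UNIV (\<lambda>x::real \<times> ('n set \<Rightarrow> real). wmat i0 (snd x) 0 $ j $ k)" for j k
    unfolding wmat_def using cg
    by (cases "j = i0"; cases "k = i0") (auto intro!: continuous_intros)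
  then have "continuous_on UNIV (\<lambda>x::real \<times> ('n set \<Rightarrow> real). \<chi> j k. wmat i0 (snd x) 0 $ j $ k)"
    by (intro continuous_on_vec_lambda)
  moreover have "(\<lambda>x::real \<times> ('n set \<Rightarrow> real). \<chi> j k. wmat i0 (snd x) 0 $ j $ k) = (\<lambda>x. wmat i0 (snd x) 0)"
    by (simp add: vec_eq_iff fun_eq_iff)
  ultimately have cw: "continuous_on UNIV (\<lambda>x::real \<times> ('n set \<Rightarrow> real). wmat i0 (snd x) 0)"
    by (simp only:)
  have e: "axis i0 1 \<noteq> (0::real^'n)" by (simp add: axis_eq_0_iff)
  have ct: "continuous_on UNIV (\<lambda>x::real \<times> ('n set \<Rightarrow> real). tmat (axis i0 1) (wmat i0 (snd x) 0) (fst x))"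
    using e by (intro continuous_intros cw) auto
  have [measurable]: "(\<lambda>x::real \<times> ('n set \<Rightarrow> real). ind (tmat (axis i0 1) (wmat i0 (snd x) 0) (fst x))) \<in> (borel \<Otimes>\<^sub>M borel) \<rightarrow>\<^sub>M count_space UNIV"
  proof (rule measurable_nat_gt)
    fix k
    obtain U where U: "open U" "\<And>M::real^'n^'n. transpose M = M \<Longrightarrow> (M \<in> U \<longleftrightarrow> k < ind M)"
      using ind_open[of k] by blast
    have "{x \<in> space (borel \<Otimes>\<^sub>M borel). k < ind (tmat (axis i0 1) (wmat i0 (snd x) 0) (fst x))} =
       (\<lambda>x::real \<times> ('n set \<Rightarrow> real). tmat (axis i0 1) (wmat i0 (snd x) 0) (fst x)) -` U"
      using U(2)[OF transpose_tmat[OF e transpose_wmat]] by (auto simp: space_pair_measure)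
    moreover have "open ((\<lambda>x::real \<times> ('n set \<Rightarrow> real). tmat (axis i0 1) (wmat i0 (snd x) 0) (fst x)) -` U)"
      using U(1) ct by (rule open_vimage)
    then have "(\<lambda>x::real \<times> ('n set \<Rightarrow> real). tmat (axis i0 1) (wmat i0 (snd x) 0) (fst x)) -` U \<in> sets (borel \<Otimes>\<^sub>M borel)"
      unfolding borel_prod by (rule borel_open)
    ultimately show "{x \<in> space (borel \<Otimes>\<^sub>M borel). k < ind (tmat (axis i0 1) (wmat i0 (snd x) 0) (fst x))} \<in> sets (borel \<Otimes>\<^sub>M borel)"
      by (simp only:)
  qed
  show ?thesis unfolding split_def by measurable
qed

lemma Psi_measurable [measurable]: "Psi i0 K \<in> borel_measurable borel"
proof -
  have [measurable]: "(\<lambda>(\<tau>, g). ennreal (absdet (dmat i0 \<tau> g)) * indicator K (ind (tmat (axis i0 1) (wmat i0 g 0) \<tau>))) \<in> borel_measurable (borel \<Otimes>\<^sub>M gam)"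
    using Psi_integrand_measurable[of i0 K] by (simp cong: measurable_cong_sets add: sets_pair_measure_cong[OF refl sets_gam])
  have "(\<lambda>\<tau>. \<integral>\<^sup>+g. ennreal (absdet (dmat i0 \<tau> g)) * indicator K (ind (tmat (axis i0 1) (wmat i0 g 0) \<tau>)) \<partial>gam) \<in> borel_measurable borel"
    by measurable
  then show ?thesis by (simp add: Psi_def[abs_def])
qed

text \<open>The coefficient block is exchanged for row \<open>i0\<close> of the rotated Hessian
  model, which has the same joint law of gradient and Hessian. There the solving block is the same
  for all \<open>g\<close>, so the Gaussian factor is constant and the tangential entries keep their
  unconditional law.\<close>

proposition kr_density_index:
  fixes i0 :: "'n::finite"
  assumes p: "p \<ge> 2" and y: "y $ i0 \<noteq> 0"
  shows "kr_density i0 p y (\<lambda>S. indicator K (idx p y S)) = ennreal (cst TYPE('n) p (norm y)) * Psi i0 K (ln (norm y))"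
proof -
  define r where "r = norm y"
  define \<tau> where "\<tau> = ln r"
  let ?N = "CARD('n)" and ?e = "axis i0 1 :: real^'n"
  have y0: "y \<noteq> 0" using y by auto
  have r: "r > 0" using y0 by (simp add: r_def)
  have pp: "p - 1 = Suc (p - 2)" "real p - 1 > 0" "real p > 0" using p by auto
  have rp: "r ^ (p - 1) = r * r ^ (p - 2)" unfolding pp(1) by simp
  note kp = kap_pos[OF p]
  \<comment> \<open>A frame whose vector of index \<open>i0\<close> points in the direction of
    \<open>y\<close>.\<close>
  obtain R where R: "orthogonal_matrix R" "R *v ?e = (1 / r) *\<^sub>R y"
    using orthogonal_matrix_exists_basis[of "(1 / r) *\<^sub>R y" i0] r by (auto simp: r_def)
  have yR: "y = r *\<^sub>R (R *v ?e)" using R(2) r by simp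
  have lev: "lev p y = kap p * r ^ (p - 2) * \<tau>" by (simp add: lev_def r_def \<tau>_def)
  have inn: "(R *v x) \<bullet> (R *v z) = x \<bullet> z" for x z
    using R(1) by (simp add: orthogonal_transformation_matrix orthogonal_transformation_def[symmetric]
      orthogonal_transformation_def[THEN iffD1, THEN conjunct2, rule_format])
  let ?S2 = "\<lambda>g. r ^ (p - 2) *\<^sub>R (R ** hmat i0 p g ** transpose R)"
  let ?L2 = "\<lambda>g. (1 / (real p - 1)) *\<^sub>R (?S2 g *v y)"
  let ?dg = "\<chi> j k. of_bool (j = k) * dvec i0 p j :: real^'n^'n"
  let ?A2 = "(r ^ (p - 1) / (real p - 1)) *\<^sub>R (R ** ?dg)"
  have SR: "(R ** M ** transpose R) *v (R *v v) = R *v (M *v v)" for M v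
    using orthogonal_matrix_cancel[OF R(1)] by (simp add: matrix_vector_mul_assoc[symmetric] del: transpose_matrix_vector)
  have L2: "?L2 g = (r ^ (p - 1) / (real p - 1)) *\<^sub>R (R *v (hmat i0 p g *v ?e))" for g
  proof -
    have "?S2 g *v y = (r ^ (p - 2) * r) *\<^sub>R (R *v (hmat i0 p g *v ?e))"
      by (subst yR) (simp add: scaleR_matrix_vector_assoc[symmetric] matrix_vector_mult_scaleR SR)
    then show ?thesis unfolding rp by (simp add: mult.commute)
  qed
  have he: "hmat i0 p (updb (pairb i0) g u) *v ?e = ?dg *v u" for g u
  proof -
    have "updb (pairb i0) g u {j, i0} = u $ j" for j
      using updb_block[OF inj_pairb, of i0 g u j] by (simp add: pairb_def insert_commute)
    moreover have "(hmat i0 p g' *v ?e) $ j = hmat i0 p g' $ j $ i0" for g' j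
      by (simp add: matrix_vector_mult_def axis_def if_distrib cong: if_cong)
    ultimately show ?thesis
      unfolding diagonal_mult by (simp add: vec_eq_iff hmat_def dvec_def)
  qed
  have L2u: "?L2 (updb (pairb i0) g u) = ?A2 *v u" for g u
    unfolding L2 he by (simp add: scaleR_matrix_vector_assoc[symmetric] matrix_vector_mul_assoc)
  have aA2: "absdet ?A2 = (r ^ (p - 1) / (real p - 1)) ^ ?N * (\<Prod>j\<in>UNIV. dvec i0 p j)"
  proof -
    have "\<bar>\<Prod>j\<in>UNIV. dvec i0 p j\<bar> = (\<Prod>j\<in>UNIV. dvec i0 p j)"
      using dvec_pos[OF p, of i0] by (intro abs_of_pos prod_pos) auto
    then show ?thesis using r pp
      by (simp add: absdet_scale absdet_mult absdet_orthogonal[OF R(1)] absdet_diagonal)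
  qed
  have aA2p: "absdet ?A2 > 0"
    unfolding aA2 using r pp dvec_pos[OF p, of i0] by (intro mult_pos_pos zero_less_power prod_pos) auto
  have ab2: "affine_block (pairb i0) ?L2 ?A2"
    unfolding affine_block_def using inj_pairb aA2p by (simp only: L2u) auto
  have cS2: "continuous_on UNIV ?S2"
    by (intro continuous_intros hmat_continuous)
  have cm: "continuous_on UNIV (\<lambda>S::real^'n^'n. (1 / (real p - 1)) *\<^sub>R (S *v y))"
    unfolding matrix_vector_mult_def by (intro continuous_intros)
  have cL2: "continuous_on UNIV ?L2"
    by (rule continuous_on_compose2[OF cm cS2]) auto
  have cS1: "continuous_on UNIV (\<lambda>J. phess p J y)" "continuous_on UNIV (\<lambda>J. pgrad p J y)"
    by (intro continuous_intros continuous_on_product_coordinates)+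
  \<comment> \<open>The gradient is a function of the Hessian, so the law of the pair follows from
    the law of the Hessian.\<close>
  have L1: "pgrad p J y = (1 / (real p - 1)) *\<^sub>R (phess p J y *v y)" for J
    using pp by (simp add: phess_mult_self)
  let ?T = "\<lambda>S. ennreal (absdet (kmat p y S)) * indicator K (idx p y S)"
  have Tm: "?T \<in> borel_measurable borel"
    using kmat_measurable[of "\<lambda>_. y" borel "\<lambda>S. S" p] idx_measurable_snd[OF y0] by measurable
  have "kr_density i0 p y (\<lambda>S. indicator K (idx p y S)) =
      dkern (pairb i0) ?L2 ?A2 ?S2 (lev p y *\<^sub>R y) ?T"
    unfolding kr_density_def
  proof (rule dkern_unique[OF affine_block_bl[OF p y] cS1(2) cS1(1) ab2 cL2 cS2 _ Tm])
    fix \<phi> :: "real^'n \<Rightarrow> ennreal" and \<Theta> :: "real^'n^'n \<Rightarrow> ennreal"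
    assume \<phi>: "\<phi> \<in> borel_measurable borel" and \<Theta>: "\<Theta> \<in> borel_measurable borel"
    have "(\<lambda>S. \<phi> ((1 / (real p - 1)) *\<^sub>R (S *v y)) * \<Theta> S) \<in> borel_measurable borel"
      using measurable_compose[OF borel_measurable_continuous_onI[OF cm] \<phi>] \<Theta> by measurable
    from phess_law[OF p R(1) yR this]
    show "(\<integral>\<^sup>+J. \<phi> (pgrad p J y) * \<Theta> (phess p J y) \<partial>gam) = (\<integral>\<^sup>+g. \<phi> (?L2 g) * \<Theta> (?S2 g) \<partial>gam)"
      unfolding L1 .
  qed
  also have "\<dots> = (\<integral>\<^sup>+g. ennreal (cst TYPE('n) p (norm y)) * (ennreal (absdet (dmat i0 \<tau> g)) * indicator K (ind (tmat ?e (wmat i0 g 0) \<tau>))) \<partial>gam)"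
    unfolding dkern_def
  proof (intro nn_integral_cong)
    fix g :: "'n set \<Rightarrow> real"
    \<comment> \<open>Only the \<open>i0\<close> component is nonzero, because the prescribed
      gradient \<open>lev p y *\<^sub>R y\<close> is radial.\<close>
    let ?u = "(kap p / real p * \<tau>) *\<^sub>R ?e"
    let ?W = "wmat i0 g ((real p - 1) * \<tau>)"
    have "?L2 (updb (pairb i0) g ?u) = lev p y *\<^sub>R y"
    proof -
      have "?dg *v ?u = (dvec i0 p i0 * (kap p / real p * \<tau>)) *\<^sub>R ?e"
        unfolding diagonal_mult by (simp add: vec_eq_iff axis_def)
      then have "?L2 (updb (pairb i0) g ?u) = (r ^ (p - 1) / (real p - 1) * (dvec i0 p i0 * (kap p / real p * \<tau>))) *\<^sub>R (R *v ?e)"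
        unfolding L2 he by (simp add: matrix_vector_mult_scaleR)
      also have "dvec i0 p i0 = (real p - 1) * real p" using p by (simp add: dvec_def mm_def real_sqrt_mult)
      also have "r ^ (p - 1) / (real p - 1) * ((real p - 1) * real p * (kap p / real p * \<tau>)) = lev p y * r"
        using pp by (simp add: lev rp)
      also have "(lev p y * r) *\<^sub>R (R *v ?e) = lev p y *\<^sub>R y" by (subst (2) yR) simp
      finally show ?thesis .
    qed
    then have "?u = bsol (pairb i0) ?L2 ?A2 (lev p y *\<^sub>R y) g"
      by (simp only: affine_block_solve[OF ab2])
    then have u: "bsol (pairb i0) ?L2 ?A2 (lev p y *\<^sub>R y) g = ?u" by (rule sym)
    have S2: "?S2 (updb (pairb i0) g ?u) = (r ^ (p - 2) * kap p) *\<^sub>R (R ** ?W ** transpose R)"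
      unfolding hmat_pairb[OF p] by (simp add: matrix_scalar_ac scalar_matrix_assoc[symmetric])
    let ?S = "(r ^ (p - 2) * kap p) *\<^sub>R (R ** ?W ** transpose R)"
    have trS: "transpose (R ** ?W ** transpose R) = R ** ?W ** transpose R"
      by (simp add: matrix_transpose_mul transpose_wmat matrix_mul_assoc)
    then have "transpose ?S = ?S" by (simp add: transpose_def vec_eq_iff)
    then have "idx p y ?S = ind (tmat y ?S (lev p y))" by (simp add: idx_def symm_id)
    also have "\<dots> = ind (tmat (r *\<^sub>R (R *v ?e)) ?S ((r ^ (p - 2) * kap p) * \<tau>))"
      unfolding yR[symmetric] lev by (simp only: mult_ac)
    also have "\<dots> = ind (tmat (R *v ?e) (R ** ?W ** transpose R) \<tau>)"
    proof (intro ind_tmat_scale trS)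
      show "R *v ?e \<noteq> 0" using y0 yR by auto
    qed (use r kp in auto)
    also have "\<dots> = ind (tmat ?e ?W \<tau>)"
      by (intro ind_tmat_rot R(1) transpose_wmat) (simp add: axis_eq_0_iff)
    also have "\<dots> = ind (tmat ?e (wmat i0 g 0) \<tau>)" by (rule ind_tmat_wmat)
    finally have ix: "idx p y ?S = ind (tmat ?e (wmat i0 g 0) \<tau>)" .
    have "kmat p y ?S = (r ^ (p - 2) * kap p) *\<^sub>R (R ** dmat i0 \<tau> g ** transpose R)"
    proof -
      have dl: "dl p y * r\<^sup>2 = r ^ (p - 2) * kap p * ((real p - 2) * \<tau> + 1)"
      proof -
        have "dl p y * r\<^sup>2 = real (p - 2) * lev p y + kap p * r ^ (p - 2)"
          using r by (simp add: dl_def r_def[symmetric])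
        then show ?thesis using p by (simp add: lev algebra_simps of_nat_diff)
      qed
      have "kmat p y ?S *v (R *v x) = ((r ^ (p - 2) * kap p) *\<^sub>R (R ** dmat i0 \<tau> g ** transpose R)) *v (R *v x)" for x
      proof -
        have yx: "y \<bullet> (R *v x) = r * (?e \<bullet> x)" by (subst yR) (simp add: inn)
        have "kmat p y ?S *v (R *v x) = (r ^ (p - 2) * kap p) *\<^sub>R (R *v (?W *v x)) - lev p y *\<^sub>R (R *v x) - (dl p y * (r * (?e \<bullet> x)) * r) *\<^sub>R (R *v ?e)"
        proof -
          have "(dl p y * (r * (?e \<bullet> x))) *\<^sub>R y = (dl p y * (r * (?e \<bullet> x)) * r) *\<^sub>R (R *v ?e)"
            by (subst (2) yR) simp
          then show ?thesis
            unfolding kmat_mult yx by (simp add: scaleR_matrix_vector_assoc[symmetric] SR)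
        qed
        also have "dl p y * (r * (?e \<bullet> x)) * r = dl p y * r\<^sup>2 * (?e \<bullet> x)" by (simp add: power2_eq_square)
        also have "(r ^ (p - 2) * kap p) *\<^sub>R (R *v (?W *v x)) - lev p y *\<^sub>R (R *v x) - (dl p y * r\<^sup>2 * (?e \<bullet> x)) *\<^sub>R (R *v ?e) =
          (r ^ (p - 2) * kap p) *\<^sub>R (R *v (?W *v x - \<tau> *\<^sub>R x - (((real p - 2) * \<tau> + 1) * (?e \<bullet> x)) *\<^sub>R ?e))"
          unfolding dl lev by (simp add: matrix_vector_mult_diff_distrib matrix_vector_mult_scaleR scaleR_diff_right mult_ac)
        also have "?W *v x - \<tau> *\<^sub>R x - (((real p - 2) * \<tau> + 1) * (?e \<bullet> x)) *\<^sub>R ?e = dmat i0 \<tau> g *v x"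
          unfolding dmat_eq[of i0 \<tau> g p]
          by (simp add: matrix_vector_mult_diff_rdistrib scaleR_matrix_vector_assoc[symmetric] outer_mult)
        finally show ?thesis by (simp add: scaleR_matrix_vector_assoc[symmetric] SR)
      qed
      then have "kmat p y ?S *v x = ((r ^ (p - 2) * kap p) *\<^sub>R (R ** dmat i0 \<tau> g ** transpose R)) *v x" for x
        using orthogonal_matrix_cancel(2)[OF R(1), of x] by metis
      then show ?thesis unfolding matrix_eq by blast
    qed
    then have ad: "absdet (kmat p y ?S) = (r ^ (p - 2) * kap p) ^ ?N * absdet (dmat i0 \<tau> g)"
      using R(1) r kp by (simp add: absdet_scale absdet_mult absdet_orthogonal orthogonal_matrix_transpose)
    have gd: "gdens ?u = exp (- ((real p - 1) / real p * \<tau>\<^sup>2) / 2) / sqrt (2 * pi) ^ ?N"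
    proof -
      have "(norm ?u)\<^sup>2 = (kap p / real p)\<^sup>2 * \<tau>\<^sup>2" by (simp add: power_mult_distrib power2_abs abs_mult power_divide)
      also have "(kap p / real p)\<^sup>2 = (real p - 1) / real p"
        using pp by (simp add: kap_def power_divide power2_eq_square)
      finally show ?thesis by (simp add: gdens_def)
    qed
    have kN: "kap p ^ ?N = sqrt (real p) ^ ?N * sqrt (real p - 1) ^ ?N"
      by (simp add: kap_def real_sqrt_mult power_mult_distrib)
    have sN: "sqrt (real p) ^ ?N = sqrt (real p) * sqrt (real p) ^ (?N - 1)"
      by (metis power_Suc Suc_pred' zero_less_card_finite)
    have const: "gdens ?u / absdet ?A2 * (r ^ (p - 2) * kap p) ^ ?N = cst TYPE('n) p (norm y)"
    proof -
      have "(r ^ (p - 2) * kap p) ^ ?N / absdet ?A2 = (sqrt (real p - 1) ^ ?N / sqrt (real p)) / r ^ ?N"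
      proof -
        have *: "A * ((q * Q) * S) / ((Rn * A) / P * (P * ((q * q) * Q))) = S / q / Rn"
          if "A > 0" "q > 0" "Q > 0" "Rn > 0" "P > 0" for A q Q S Rn P :: real
          using that by (simp add: divide_simps)
        have n1: "(r ^ (p - 2) * kap p) ^ ?N = (r ^ (p - 2)) ^ ?N * ((sqrt (real p) * sqrt (real p) ^ (?N - 1)) * sqrt (real p - 1) ^ ?N)"
          by (simp only: power_mult_distrib kN sN[symmetric])
        have n2: "absdet ?A2 = (r ^ ?N * (r ^ (p - 2)) ^ ?N) / (real p - 1) ^ ?N *
            ((real p - 1) ^ ?N * ((sqrt (real p) * sqrt (real p)) * sqrt (real p) ^ (?N - 1)))"
        proof -
          have "sqrt (real p) * sqrt (real p) = real p" by simp
          then show ?thesis unfolding aA2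
            unfolding prod_dvec[OF p] rp by (simp only: power_mult_distrib power_divide)
        qed
        show ?thesis unfolding n2 unfolding n1 by (rule *) (use r pp in auto)
      qed
      moreover have "gdens ?u / absdet ?A2 * (r ^ (p - 2) * kap p) ^ ?N =
          gdens ?u * ((r ^ (p - 2) * kap p) ^ ?N / absdet ?A2)"
        by (rule div_mult_swap_real)
      ultimately have "gdens ?u / absdet ?A2 * (r ^ (p - 2) * kap p) ^ ?N =
          gdens ?u * (sqrt (real p - 1) ^ ?N / sqrt (real p) / r ^ ?N)"
        by (simp only:)
      then show ?thesis unfolding gd cst_def r_def[symmetric] \<tau>_def[symmetric] by simp
    qed
    have "ennreal (gdens ?u / absdet ?A2) * (ennreal (absdet (kmat p y ?S)) * indicator K (idx p y ?S)) =
       ennreal (gdens ?u / absdet ?A2 * (r ^ (p - 2) * kap p) ^ ?N * absdet (dmat i0 \<tau> g)) * indicator K (idx p y ?S)"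
      unfolding ad using aA2p gdens_pos[of ?u]
      by (simp add: ennreal_mult'[symmetric] mult.assoc[symmetric] less_imp_le)
    also have "\<dots> = ennreal (cst TYPE('n) p (norm y)) * (ennreal (absdet (dmat i0 \<tau> g)) * indicator K (ind (tmat ?e (wmat i0 g 0) \<tau>)))"
      unfolding const ix by (simp add: ennreal_mult'' mult.assoc)
    finally show "ennreal (gdens (bsol (pairb i0) ?L2 ?A2 (lev p y *\<^sub>R y) g) / absdet ?A2) *
        ?T (?S2 (updb (pairb i0) g (bsol (pairb i0) ?L2 ?A2 (lev p y *\<^sub>R y) g))) =
      ennreal (cst TYPE('n) p (norm y)) * (ennreal (absdet (dmat i0 \<tau> g)) * indicator K (ind (tmat ?e (wmat i0 g 0) \<tau>)))"
      unfolding u S2 .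
  qed
  also have "\<dots> = ennreal (cst TYPE('n) p (norm y)) * Psi i0 K \<tau>"
  proof -
    have "(\<lambda>g. (\<tau>, g)) \<in> borel \<rightarrow>\<^sub>M borel \<Otimes>\<^sub>M (borel :: ('n set \<Rightarrow> real) measure)" by measurable
    from measurable_compose[OF this Psi_integrand_measurable[of i0 K]] show ?thesis
      unfolding Psi_def by (intro nn_integral_cmult) simp
  qed
  finally show ?thesis by (simp add: \<tau>_def r_def)
qed

section \<open>Borel measurability of random point counts, and zeros that almost surely do not
  occur\<close>

section \<open>Measurability of counts\<close>

text \<open>The number of points is the supremum, over finite disjoint families of compact closures
  of basic open sets, of the number of members that are hit. There are countably many such families,
  so measurability of hitting one compact set suffices.\<close>

lemma count_measurable:
  fixes Z :: "'j \<Rightarrow> 'a::euclidean_space set"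
  assumes U: "open U" and ZU: "\<And>J. Z J \<subseteq> U"
    and hit: "\<And>K. compact K \<Longrightarrow> K \<subseteq> U \<Longrightarrow> {J \<in> space M. Z J \<inter> K \<noteq> {}} \<in> sets M"
  shows "(\<lambda>J. emeasure (count_space UNIV) (Z J)) \<in> borel_measurable M"
proof -
  obtain \<O> :: "'a set set" where \<O>: "countable \<O>" "topological_basis \<O>" using ex_countable_basis by auto
  define \<K> where "\<K> = {closure X | X. X \<in> \<O> \<and> compact (closure X) \<and> closure X \<subseteq> U}"
  define \<F> where "\<F> = {F. F \<subseteq> \<K> \<and> finite F \<and> disjoint F}"
  have cK: "countable \<K>"
  proof -
    have "\<K> \<subseteq> closure ` \<O>" by (auto simp: \<K>_def)
    then show ?thesis by (rule countable_subset[OF _ countable_image[OF \<O>(1)]])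
  qed
  have "\<F> \<subseteq> {F. finite F \<and> F \<subseteq> \<K>}" by (auto simp: \<F>_def)
  then have cF: "countable \<F>"
    by (rule countable_subset[OF _ countable_Collect_finite_subset[OF cK]])
  have Kc: "compact K" "K \<subseteq> U" if "K \<in> \<K>" for K using that by (auto simp: \<K>_def)
  let ?f = "\<lambda>F J. \<Sum>K\<in>F. indicator {J. Z J \<inter> K \<noteq> {}} J :: ennreal"
  have eq: "emeasure (count_space UNIV) (Z J) = (SUP F\<in>\<F>. ?f F J)" for J
  proof (rule antisym)
    have fin: "of_nat (card T) \<le> (SUP F\<in>\<F>. ?f F J)" if T: "finite T" "T \<subseteq> Z J" for T
    proof -
      have "\<exists>e>0. (\<forall>x\<in>T. cball x e \<subseteq> U) \<and> (\<forall>x\<in>T. \<forall>y\<in>T. x \<noteq> y \<longrightarrow> 2 * e < dist x y)"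
      proof -
        have "\<forall>x\<in>T. \<exists>e>0. cball x e \<subseteq> U" using U T(2) ZU[of J] open_contains_cball by blast
        then obtain r where r: "\<And>x. x \<in> T \<Longrightarrow> r x > 0 \<and> cball x (r x) \<subseteq> U"
          using bchoice[of T "\<lambda>x e. 0 < e \<and> cball x e \<subseteq> U"] by blast
        let ?D = "{dist x y | x y. x \<in> T \<and> y \<in> T \<and> x \<noteq> y}"
        have fD: "finite ?D"
        proof -
          have "?D \<subseteq> (\<lambda>(x, y). dist x y) ` (T \<times> T)" by auto
          moreover have "finite ((\<lambda>(x, y). dist x y) ` (T \<times> T))" using T(1) by simp
          ultimately show ?thesis by (rule finite_subset)
        qed
        \<comment> \<open>A third of the smallest distance keeps the closed balls disjoint; the
          entry 1 gives the minimum a meaning for empty \<open>T\<close>.\<close>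
        define e where "e = Min (insert 1 (r ` T \<union> (\<lambda>d. d / 3) ` ?D))"
        have e0: "e > 0" unfolding e_def using T(1) fD r by (subst Min_gr_iff) auto
        have er: "e \<le> r x" if "x \<in> T" for x unfolding e_def using that T(1) fD by (intro Min_le) auto
        have ed: "e \<le> dist x y / 3" if "x \<in> T" "y \<in> T" "x \<noteq> y" for x y
          unfolding e_def using that T(1) fD by (intro Min_le) auto
        have "cball x e \<subseteq> U" if "x \<in> T" for x
          using r[OF that] subset_cball[OF er[OF that]] by blast
        moreover have "2 * e < dist x y" if "x \<in> T" "y \<in> T" "x \<noteq> y" for x y
          using ed[OF that] e0 by simp
        ultimately show ?thesis using e0 by blast
      qed
      then obtain e where e: "e > 0" "\<And>x. x \<in> T \<Longrightarrow> cball x e \<subseteq> U" "\<And>x y. x \<in> T \<Longrightarrow> y \<in> T \<Longrightarrow> x \<noteq> y \<Longrightarrow> 2 * e < dist x y" by blast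
      have "\<exists>X. X \<in> \<O> \<and> x \<in> X \<and> X \<subseteq> ball x e" for x
      proof -
        have "x \<in> ball x e" using e(1) by simp
        from topological_basisE[OF \<O>(2) open_ball this] show ?thesis by blast
      qed
      then have "\<forall>x. \<exists>X. X \<in> \<O> \<and> x \<in> X \<and> X \<subseteq> ball x e" ..
      from choice[OF this] obtain X where "\<forall>x. X x \<in> \<O> \<and> x \<in> X x \<and> X x \<subseteq> ball x e" ..
      then have X: "\<And>x. x \<in> T \<Longrightarrow> X x \<in> \<O> \<and> x \<in> X x \<and> X x \<subseteq> ball x e" by simp
      have cl: "closure (X x) \<subseteq> cball x e" if "x \<in> T" for x
        using X[OF that] by (intro closure_minimal) (auto intro: less_imp_le)
      have dj: "closure (X x) \<inter> closure (X y) = {}" if "x \<in> T" "y \<in> T" "x \<noteq> y" for x y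
      proof (rule ccontr)
        assume "\<not> ?thesis"
        then have "cball x e \<inter> cball y e \<noteq> {}" using cl[OF that(1)] cl[OF that(2)] by auto
        then obtain z where "z \<in> cball x e" "z \<in> cball y e" by auto
        then have "dist x y \<le> 2 * e" using dist_triangle2[of x y z] by (auto simp: dist_commute)
        then show False using e(3)[OF that] by simp
      qed
      have mem: "x \<in> closure (X x)" if "x \<in> T" for x using X[OF that] closure_subset by blast
      let ?F = "(\<lambda>x. closure (X x)) ` T"
      have inj: "inj_on (\<lambda>x. closure (X x)) T"
      proof (rule inj_onI, rule ccontr)
        fix x y assume *: "x \<in> T" "y \<in> T" "closure (X x) = closure (X y)" "x \<noteq> y"
        show False using dj[OF *(1,2,4)] mem[OF *(1)] *(3) by blast
      qed
      have "?F \<in> \<F>"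
        unfolding \<F>_def \<K>_def
      proof (intro CollectI conjI subsetI)
        fix K assume "K \<in> ?F"
        then obtain x where x: "x \<in> T" "K = closure (X x)" by auto
        have "compact (closure (X x))"
          unfolding compact_eq_bounded_closed using bounded_subset[OF bounded_cball cl[OF x(1)]] by simp
        then show "\<exists>X. K = closure X \<and> X \<in> \<O> \<and> compact (closure X) \<and> closure X \<subseteq> U"
          using X[OF x(1)] cl[OF x(1)] e(2)[OF x(1)] x(2) by blast
      next
        show "finite ?F" using T by simp
        show "disjoint ?F" using dj by (auto simp: disjoint_def)
      qed
      moreover have "?f ?F J = of_nat (card T)"
      proof -
        have "?f ?F J = (\<Sum>x\<in>T. indicator {J. Z J \<inter> closure (X x) \<noteq> {}} J)"
          using inj by (simp add: sum.reindex)
        also have "\<dots> = (\<Sum>x\<in>T. 1)"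
          using mem T(2) by (intro sum.cong) (auto simp: indicator_def)
        finally show ?thesis by simp
      qed
      ultimately show ?thesis using SUP_upper[of ?F \<F> "\<lambda>F. ?f F J"] by simp
    qed
    show "emeasure (count_space UNIV) (Z J) \<le> (SUP F\<in>\<F>. ?f F J)"
    proof (cases "finite (Z J)")
      case True
      then show ?thesis using fin[of "Z J"] by simp
    next
      case False
      have "of_nat n \<le> (SUP F\<in>\<F>. ?f F J)" for n
      proof -
        obtain T where "finite T" "card T = n" "T \<subseteq> Z J" using infinite_arbitrarily_large[OF False] by blast
        then show ?thesis using fin[of T] by simp
      qed
      then have "(SUP n. of_nat n :: ennreal) \<le> (SUP F\<in>\<F>. ?f F J)" by (intro SUP_least)
      then have "(SUP F\<in>\<F>. ?f F J) = top" unfolding ennreal_SUP_of_nat_eq_top by (rule top_le)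
      then show ?thesis by (simp only: top_greatest)
    qed
  next
    show "(SUP F\<in>\<F>. ?f F J) \<le> emeasure (count_space UNIV) (Z J)"
    proof (rule SUP_least)
      fix F assume F: "F \<in> \<F>"
      have fF: "finite F" and dF: "disjoint F" using F by (auto simp: \<F>_def)
      let ?H = "{K \<in> F. Z J \<inter> K \<noteq> {}}"
      define z where "z = (\<lambda>K. SOME x. x \<in> Z J \<inter> K)"
      have z: "z K \<in> Z J \<inter> K" if "K \<in> ?H" for K
      proof -
        have "\<exists>x. x \<in> Z J \<inter> K" using that by auto
        then show ?thesis unfolding z_def by (rule someI_ex)
      qed
      have "inj_on z ?H"
      proof (rule inj_onI)
        fix K L assume KL: "K \<in> ?H" "L \<in> ?H" "z K = z L"
        have "z K \<in> K" "z K \<in> L" using z[OF KL(1)] z[OF KL(2)] KL(3) by auto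
        moreover have "K \<in> F" "L \<in> F" using KL by auto
        ultimately show "K = L" using disjointD[OF dF, of K L] by auto
      qed
      then have "card (z ` ?H) = card ?H" by (rule card_image)
      moreover have "?f F J = of_nat (card ?H)"
      proof -
        have "?f F J = (\<Sum>K\<in>F. if K \<in> ?H then 1 else 0)" by (intro sum.cong) (auto simp: indicator_def)
        also have "\<dots> = (\<Sum>K\<in>?H. 1)" using fF by (subst sum.inter_filter[symmetric]) (auto intro!: sum.cong)
        finally show ?thesis by simp
      qed
      moreover have "of_nat (card (z ` ?H)) = emeasure (count_space UNIV) (z ` ?H)" using fF by simp
      moreover have "emeasure (count_space UNIV) (z ` ?H) \<le> emeasure (count_space UNIV) (Z J)"
      proof (intro emeasure_mono image_subsetI)
        fix K assume "K \<in> ?H"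
        from z[OF this] show "z K \<in> Z J" by simp
      qed simp
      ultimately show "?f F J \<le> emeasure (count_space UNIV) (Z J)" by (simp only:)
    qed
  qed
  have "(\<lambda>J. indicator {J. Z J \<inter> K \<noteq> {}} J :: ennreal) \<in> borel_measurable M" if "K \<in> \<K>" for K
    using hit[OF Kc[OF that]] by (subst borel_measurable_indicator_iff) (simp add: Int_def conj_commute)
  then have "(\<lambda>J. ?f F J) \<in> borel_measurable M" if "F \<in> \<F>" for F
    using that by (intro borel_measurable_sum) (auto simp: \<F>_def)
  then have "(\<lambda>J. SUP F\<in>\<F>. ?f F J) \<in> borel_measurable M"
    using cF by (intro borel_measurable_SUP)
  then show ?thesis by (simp only: eq)
qed

text \<open>The projection of a closed set along a compact factor is closed. Sequences suffice since
  countable products of the line are first countable.\<close>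

lemma closed_hit:
  fixes G :: "('j::first_countable_topology \<times> 'a::euclidean_space) set"
  assumes K: "compact K" and G: "closed (G \<inter> UNIV \<times> K)"
  shows "closed {J. \<exists>y\<in>K. (J, y) \<in> G}"
  unfolding closed_sequential_limits
proof (intro allI impI, elim conjE)
  fix x l assume x: "\<forall>n. x n \<in> {J. \<exists>y\<in>K. (J, y) \<in> G}" and l: "x \<longlonglongrightarrow> l"
  then have "\<forall>n. \<exists>y. y \<in> K \<and> (x n, y) \<in> G" by blast
  then obtain y where y: "\<And>n. y n \<in> K \<and> (x n, y n) \<in> G" by metis
  obtain z r where z: "z \<in> K" "strict_mono r" "(y \<circ> r) \<longlonglongrightarrow> z"
    using K y unfolding compact_def by metis
  have "(x \<circ> r) \<longlonglongrightarrow> l" using l z(2) by (rule LIMSEQ_subseq_LIMSEQ)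
  then have t: "(\<lambda>n. ((x \<circ> r) n, (y \<circ> r) n)) \<longlonglongrightarrow> (l, z)" using z(3) by (rule tendsto_Pair)
  have "((x \<circ> r) n, (y \<circ> r) n) \<in> G \<inter> UNIV \<times> K" for n using y[of "r n"] by simp
  from closed_sequentially[OF G this t] have "(l, z) \<in> G \<inter> UNIV \<times> K" .
  then show "l \<in> {J. \<exists>y\<in>K. (J, y) \<in> G}" using z(1) by blast
qed

lemma count_integral_indicator:
  "(\<integral>\<^sup>+y. indicator X y \<partial>count_space A) = emeasure (count_space UNIV) (A \<inter> X)"
proof -
  have "(\<integral>\<^sup>+y. indicator X y \<partial>count_space A) = (\<integral>\<^sup>+y. indicator X y * indicator A y \<partial>count_space UNIV)"
    by (subst nn_integral_count_space_indicator) simp_all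
  also have "\<dots> = (\<integral>\<^sup>+y. indicator (A \<inter> X) y \<partial>count_space UNIV)"
    by (intro nn_integral_cong) (simp add: indicator_inter_arith mult.commute)
  finally show ?thesis by simp
qed

lemma continuous_on_fst_apply [continuous_intros]:
  "continuous_on X (\<lambda>x :: ('i::countable \<Rightarrow> real) \<times> 'a::topological_space. fst x l)"
  by (rule continuous_on_product_then_coordinatewise[OF continuous_on_fst[OF continuous_on_id]])

lemma count_closed_measurable:
  fixes G :: "(('i::countable \<Rightarrow> real) \<times> 'a::euclidean_space) set"
  assumes U: "open U" and G: "\<And>K. compact K \<Longrightarrow> K \<subseteq> U \<Longrightarrow> closed (G \<inter> UNIV \<times> K)"
  shows "(\<lambda>J. emeasure (count_space UNIV) {y \<in> U. (J, y) \<in> G}) \<in> borel_measurable borel"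
proof (rule count_measurable[OF U])
  fix K assume K: "compact K" "K \<subseteq> U"
  have "{J. \<exists>y\<in>K. (J, y) \<in> G} \<in> sets borel"
    by (rule borel_closed[OF closed_hit[OF K(1) G[OF K]]])
  moreover have "{J. \<exists>y\<in>K. (J, y) \<in> G} = {J \<in> space borel. {y \<in> U. (J, y) \<in> G} \<inter> K \<noteq> {}}"
    using K(2) by auto
  ultimately show "{J \<in> space borel. {y \<in> U. (J, y) \<in> G} \<inter> K \<noteq> {}} \<in> sets borel" by (simp only:)
qed simp

lemma closed_enc_crit:
  fixes K :: "(real^'n::finite) set"
  assumes "closed K" "0 \<notin> K"
  shows "closed {(J, y). y \<in> K \<and> y \<in> enc_crit p J}"
proof -
  let ?X = "UNIV \<times> K :: (('n list \<Rightarrow> real) \<times> (real^'n)) set"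
  have c: "closed ?X" using assms by (intro closed_Times) auto
  have "continuous_on ?X (\<lambda>x. pgrad p (fst x) (snd x) - lev p (snd x) *\<^sub>R snd x)"
    unfolding lev_def using assms(2) by (intro continuous_intros) auto
  from continuous_closed_preimage[OF this c closed_singleton[of 0]]
  have "closed (?X \<inter> (\<lambda>x. pgrad p (fst x) (snd x) - lev p (snd x) *\<^sub>R snd x) -` {0})" .
  also have "?X \<inter> (\<lambda>x. pgrad p (fst x) (snd x) - lev p (snd x) *\<^sub>R snd x) -` {0} = {(J, y). y \<in> K \<and> y \<in> enc_crit p J}"
    using assms(2) by (auto simp: enc_crit_def)
  finally show ?thesis .
qed

text \<open>Semicontinuity makes upper bounds on the index closed conditions; this is why counts are
  first treated for all indices up to \<open>k\<close>.\<close>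

lemma closed_enc_index_le:
  fixes K :: "(real^'n::finite) set"
  assumes "closed K" "0 \<notin> K"
  shows "closed {(J, y). y \<in> K \<and> enc_index p J y \<le> k}"
proof -
  let ?X = "UNIV \<times> K :: (('n list \<Rightarrow> real) \<times> (real^'n)) set"
  let ?f = "\<lambda>x::('n list \<Rightarrow> real) \<times> (real^'n). tmat (snd x) (phess p (fst x) (snd x)) (lev p (snd x))"
  obtain U where U: "open U" "\<And>M::real^'n^'n. transpose M = M \<Longrightarrow> (M \<in> U \<longleftrightarrow> k < ind M)"
    using ind_open[of k] by blast
  have c: "closed ?X" using assms by (intro closed_Times) auto
  have "continuous_on ?X ?f"
    unfolding lev_def using assms(2) by (intro continuous_intros) auto
  from continuous_closed_preimage[OF this c, of "- U"] U(1)
  have "closed (?X \<inter> ?f -` (- U))" by (simp add: closed_Compl)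
  also have "?X \<inter> ?f -` (- U) = {(J, y). y \<in> K \<and> enc_index p J y \<le> k}"
  proof -
    have "tmat y (phess p J y) (lev p y) \<in> U \<longleftrightarrow> k < enc_index p J y" if "y \<in> K" for J y
    proof -
      have "y \<noteq> 0" using that assms(2) by auto
      then show ?thesis unfolding enc_index_def by (intro U(2) transpose_tmat transpose_phess)
    qed
    then show ?thesis by (auto simp: not_less)
  qed
  finally show ?thesis .
qed

text \<open>Zeros with \<open>y $ i0 = 0\<close> are left out because the block based at
  \<open>i0\<close> fails there. Sets of indices and of energies are kept general to allow
  differences and unions later.\<close>

definition cnt :: "'n \<Rightarrow> nat \<Rightarrow> nat set \<Rightarrow> real set \<Rightarrow> ('n::finite list \<Rightarrow> real) \<Rightarrow> ennreal" where
  "cnt i0 p K B J = emeasure (count_space UNIV)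
     {y \<in> enc_crit p J. y $ i0 \<noteq> 0 \<and> en p TYPE('n) * ln (norm y) \<in> B \<and> enc_index p J y \<in> K}"

lemma cnt_measurable_closed:
  assumes B: "closed B"
  shows "cnt i0 p {..k} B \<in> borel_measurable (borel :: ('n::finite list \<Rightarrow> real) measure)"
proof -
  let ?U = "{y::real^'n. y $ i0 \<noteq> 0}"
  let ?G = "{(J, y). y \<in> enc_crit p J \<and> en p TYPE('n) * ln (norm (y::real^'n)) \<in> B \<and> enc_index p J y \<le> k}"
  have "(\<lambda>J. emeasure (count_space UNIV) {y \<in> ?U. (J, y) \<in> ?G}) \<in> borel_measurable borel"
  proof (rule count_closed_measurable)
    show "open ?U" by (intro open_Collect_neq continuous_intros)
    fix K assume K: "compact K" "K \<subseteq> ?U"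
    have K': "closed K" "0 \<notin> K" using K by (auto intro: compact_imp_closed)
    have "continuous_on K (\<lambda>y. en p TYPE('n) * ln (norm y))" using K'(2) by (intro continuous_intros) auto
    from continuous_closed_preimage[OF this K'(1) B]
    have "closed (UNIV \<times> (K \<inter> (\<lambda>y. en p TYPE('n) * ln (norm y)) -` B) :: (('n list \<Rightarrow> real) \<times> (real^'n)) set)"
      by (intro closed_Times) auto
    then have "closed ({(J, y). y \<in> K \<and> y \<in> enc_crit p J} \<inter> {(J, y). y \<in> K \<and> enc_index p J y \<le> k} \<inter>
        (UNIV \<times> (K \<inter> (\<lambda>y. en p TYPE('n) * ln (norm y)) -` B)))"
      by (intro closed_Int closed_enc_crit closed_enc_index_le K')
    also have "\<dots> = ?G \<inter> UNIV \<times> K" by auto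
    finally show "closed (?G \<inter> UNIV \<times> K)" .
  qed
  also have "(\<lambda>J. emeasure (count_space UNIV) {y \<in> ?U. (J, y) \<in> ?G}) = cnt i0 p {..k} B"
    unfolding cnt_def by (intro ext arg_cong[where f="emeasure (count_space UNIV)"]) auto
  finally show ?thesis .
qed

lemma kr_density_zero: "kr_density i0 p y (\<lambda>S. 0) = 0"
  by (simp add: kr_density_def dkern_def)

text \<open>A weight \<open>h\<close> in place of an energy set, so that an exponential factor
  depending on \<open>p\<close> can later be absorbed into it.\<close>

definition kr :: "'n::finite \<Rightarrow> nat \<Rightarrow> nat set \<Rightarrow> (real \<Rightarrow> ennreal) \<Rightarrow> ennreal" where
  "kr i0 p K h = (\<integral>\<^sup>+y. indicator {y. y $ i0 \<noteq> 0} y *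
     (h (ln (norm y)) * (ennreal (cst TYPE('n) p (norm y)) * Psi i0 K (ln (norm y)))) \<partial>(lborel :: (real^'n) measure))"

lemma nn_integral_cnt:
  fixes i0 :: "'n::finite"
  assumes p: "p \<ge> 2" and B: "B \<in> sets borel" and m: "cnt i0 p K B \<in> borel_measurable borel"
  shows "(\<integral>\<^sup>+J. cnt i0 p K B J \<partial>gam) = kr i0 p K (\<lambda>\<tau>. indicator B (en p TYPE('n) * \<tau>))"
proof -
  \<comment> \<open>The value 0 at the origin makes the mark jointly measurable; encoded zeros are
    never the origin.\<close>
  define \<Theta> :: "real^'n \<Rightarrow> real^'n^'n \<Rightarrow> ennreal" where
    "\<Theta> y S = indicator B (en p TYPE('n) * ln (norm y)) * indicator K (if y = 0 then 0 else idx p y S)" for y S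
  have C: "(\<integral>\<^sup>+y. \<Theta> y (phess p J y) \<partial>count_space (enc_crit p J \<inter> {y. y $ i0 \<noteq> 0})) = cnt i0 p K B J" for J
  proof -
    have "(\<integral>\<^sup>+y. \<Theta> y (phess p J y) \<partial>count_space (enc_crit p J \<inter> {y. y $ i0 \<noteq> 0})) =
      (\<integral>\<^sup>+y. indicator {y. en p TYPE('n) * ln (norm y) \<in> B \<and> enc_index p J y \<in> K} y \<partial>count_space (enc_crit p J \<inter> {y. y $ i0 \<noteq> 0}))"
      by (intro nn_integral_cong) (auto simp: \<Theta>_def indicator_def idx_phess)
    then show ?thesis unfolding count_integral_indicator cnt_def
      by (auto intro!: arg_cong[where f="emeasure (count_space UNIV)"])
  qed
  have [measurable]: "(\<lambda>(y, S). if y = 0 then 0 else idx p y (S :: real^'n^'n)) \<in> (borel \<Otimes>\<^sub>M borel) \<rightarrow>\<^sub>M count_space UNIV"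
    by (rule idx_measurable)
  have \<Theta>m: "(\<lambda>(y, S). \<Theta> y S) \<in> borel_measurable (borel \<Otimes>\<^sub>M borel)"
  proof -
    have "(\<lambda>(y, S). \<Theta> y S) = (\<lambda>x. indicator B (en p TYPE('n) * ln (norm (fst x))) *
        indicator K (case x of (y, S) \<Rightarrow> if y = 0 then 0 else idx p y S))"
      by (auto simp: \<Theta>_def fun_eq_iff)
    then show ?thesis using B by simp
  qed
  have "(\<integral>\<^sup>+J. cnt i0 p K B J \<partial>gam) = (\<integral>\<^sup>+y. indicator {y. y $ i0 \<noteq> 0} y * kr_density i0 p y (\<Theta> y) \<partial>lborel)"
    using kac_rice[OF p \<Theta>m, of i0] m unfolding C by blast
  also have "\<dots> = kr i0 p K (\<lambda>\<tau>. indicator B (en p TYPE('n) * \<tau>))"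
    unfolding kr_def
  proof (intro nn_integral_cong)
    fix y :: "real^'n"
    show "indicator {y. y $ i0 \<noteq> 0} y * kr_density i0 p y (\<Theta> y) = indicator {y. y $ i0 \<noteq> 0} y *
       (indicator B (en p TYPE('n) * ln (norm y)) * (ennreal (cst TYPE('n) p (norm y)) * Psi i0 K (ln (norm y))))"
    proof (cases "y $ i0 = 0")
      case False
      then have "y \<noteq> 0" by auto
      then have "\<Theta> y = (if en p TYPE('n) * ln (norm y) \<in> B then (\<lambda>S. indicator K (idx p y S)) else (\<lambda>S. 0))"
        by (auto simp: \<Theta>_def fun_eq_iff)
      then show ?thesis using kr_density_index[OF p False, of K] by (simp add: kr_density_zero)
    qed simp
  qed
  finally show ?thesis .
qed

text \<open>The Kac-Rice formula with the property \<open>Q\<close> as mark: if \<open>Q\<close>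
  forces a singular Jacobian at almost every \<open>y\<close>, the expected number of zeros with
  \<open>Q\<close> vanishes.\<close>

lemma AE_no_crit:
  fixes i0 :: "'n::finite"
  assumes p: "p \<ge> 2" and \<Theta>: "{(y, S). Q y S} \<in> sets (borel \<Otimes>\<^sub>M (borel :: (real^'n^'n) measure))"
    and cl: "\<And>K. compact K \<Longrightarrow> K \<subseteq> {y. y $ i0 \<noteq> 0} \<Longrightarrow> closed {(J :: 'n list \<Rightarrow> real, y). y \<in> K \<and> Q y (phess p J y)}"
    and z: "AE y in lborel. y $ i0 \<noteq> 0 \<longrightarrow> (\<forall>S. Q y S \<longrightarrow> absdet (kmat p y S) = 0)"
  shows "AE J in gam. \<forall>y\<in>enc_crit p J. y $ i0 \<noteq> 0 \<longrightarrow> \<not> Q y (phess p J y)"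
proof -
  let ?U = "{y::real^'n. y $ i0 \<noteq> 0}"
  let ?c = "\<lambda>J. emeasure (count_space UNIV) {y \<in> ?U. y \<in> enc_crit p J \<and> Q y (phess p J y)}"
  let ?G = "{(J, y). y \<in> enc_crit p J \<and> Q y (phess p J y)}"
  have m: "?c \<in> borel_measurable borel"
  proof -
    have "(\<lambda>J. emeasure (count_space UNIV) {y \<in> ?U. (J, y) \<in> ?G}) \<in> borel_measurable borel"
    proof (rule count_closed_measurable)
      show "open ?U" by (intro open_Collect_neq continuous_intros)
      fix K assume K: "compact K" "K \<subseteq> ?U"
      have K': "closed K" "0 \<notin> K" using K by (auto intro: compact_imp_closed)
      have "closed ({(J, y). y \<in> K \<and> y \<in> enc_crit p J} \<inter> {(J, y). y \<in> K \<and> Q y (phess p J y)})"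
        by (intro closed_Int closed_enc_crit K' cl K)
      also have "\<dots> = ?G \<inter> UNIV \<times> K" by auto
      finally show "closed (?G \<inter> UNIV \<times> K)" .
    qed
    then show ?thesis by simp
  qed
  have C: "(\<integral>\<^sup>+y. indicator {(y, S). Q y S} (y, phess p J y) \<partial>count_space (enc_crit p J \<inter> ?U)) = ?c J" for J
  proof -
    have "(\<integral>\<^sup>+y. indicator {(y, S). Q y S} (y, phess p J y) \<partial>count_space (enc_crit p J \<inter> ?U)) =
      (\<integral>\<^sup>+y. indicator {y. Q y (phess p J y)} y \<partial>count_space (enc_crit p J \<inter> ?U))"
      by (intro nn_integral_cong) (auto simp: indicator_def)
    then show ?thesis unfolding count_integral_indicator
      by (auto intro!: arg_cong[where f="emeasure (count_space UNIV)"])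
  qed
  have "(\<lambda>(y, S). indicator {(y, S). Q y S} (y, S)) \<in> borel_measurable (borel \<Otimes>\<^sub>M borel)"
    using \<Theta> by (simp add: split_def)
  from kac_rice[OF p this, of i0] m
  have "(\<integral>\<^sup>+J. ?c J \<partial>gam) = (\<integral>\<^sup>+y. indicator ?U y * kr_density i0 p y (\<lambda>S. indicator {(y, S). Q y S} (y, S)) \<partial>lborel)"
    unfolding C by blast
  also have "\<dots> = (\<integral>\<^sup>+y. 0 \<partial>(lborel :: (real^'n) measure))"
  proof (rule nn_integral_cong_AE, use z in eventually_elim)
    fix y assume *: "y $ i0 \<noteq> 0 \<longrightarrow> (\<forall>S. Q y S \<longrightarrow> absdet (kmat p y S) = 0)"
    show "indicator ?U y * kr_density i0 p y (\<lambda>S. indicator {(y, S). Q y S} (y, S)) = 0"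
    proof (cases "y $ i0 = 0")
      case False
      then have "(\<lambda>S. ennreal (absdet (kmat p y S)) * indicator {(y, S). Q y S} (y, S)) = (\<lambda>S. 0)"
        using * by (auto simp: fun_eq_iff indicator_def)
      then show ?thesis by (simp add: kr_density_def dkern_def)
    qed simp
  qed
  finally have "AE J in gam. ?c J = 0"
    using m by (simp add: nn_integral_0_iff_AE)
  then show ?thesis
  proof eventually_elim
    case (elim J)
    have "{y \<in> ?U. y \<in> enc_crit p J \<and> Q y (phess p J y)} = {}"
    proof (rule ccontr)
      assume "{y \<in> ?U. y \<in> enc_crit p J \<and> Q y (phess p J y)} \<noteq> {}"
      then show False using elim by (auto simp: emeasure_count_space_eq_0)
    qed
    then show ?case by auto
  qed
qed

text \<open>A zero in the hyperplane \<open>y $ i0 = 0\<close> is invisible to the block based at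
  \<open>i0\<close> but has some nonzero coordinate \<open>i\<close>. Counting with the block based
  at \<open>i\<close> gives expectation 0, since the hyperplane is a null set.\<close>

lemma AE_component_nonzero:
  fixes i0 :: "'n::finite"
  assumes p: "p \<ge> 2"
  shows "AE J in gam. \<forall>y\<in>enc_crit p J. y $ i0 \<noteq> 0"
proof -
  have "AE J in gam. \<forall>y\<in>enc_crit p J. y $ i \<noteq> 0 \<longrightarrow> \<not> y $ i0 = 0" for i
  proof (cases "i = i0")
    case False
    show ?thesis
    proof (rule AE_no_crit[OF p])
      have "{(y::real^'n, S::real^'n^'n). y $ i0 = 0} = {x \<in> space (borel \<Otimes>\<^sub>M borel). fst x $ i0 = 0}"
        by (auto simp: space_pair_measure)
      also have "\<dots> \<in> sets (borel \<Otimes>\<^sub>M borel)" by measurable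
      finally show "{(y::real^'n, S::real^'n^'n). y $ i0 = 0} \<in> sets (borel \<Otimes>\<^sub>M borel)" .
    next
      fix K :: "(real^'n) set" assume K: "compact K"
      have "{(J::'n list \<Rightarrow> real, y). y \<in> K \<and> y $ i0 = 0} = UNIV \<times> (K \<inter> {y. y $ i0 = 0})" by auto
      moreover have "closed {y::real^'n. y $ i0 = 0}" by (intro closed_Collect_eq continuous_intros)
      ultimately show "closed {(J::'n list \<Rightarrow> real, y). y \<in> K \<and> y $ i0 = 0}"
        using K by (simp add: closed_Times closed_Int compact_imp_closed)
    next
      have "negligible {y::real^'n. axis i0 1 \<bullet> y = 0}"
        by (rule negligible_hyperplane) (simp add: axis_eq_0_iff)
      then have "AE y in lebesgue. y \<notin> {y::real^'n. axis i0 1 \<bullet> y = 0}"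
        by (intro AE_not_in) (simp add: negligible_iff_null_sets)
      then have "AE y in lborel. y \<notin> {y::real^'n. axis i0 1 \<bullet> y = 0}" by (rule AE_completion_iff[THEN iffD1, rotated])
      then show "AE y in lborel. y $ i \<noteq> 0 \<longrightarrow> (\<forall>S. (y::real^'n) $ i0 = 0 \<longrightarrow> absdet (kmat p y S) = 0)"
        by eventually_elim (simp add: inner_axis')
    qed
  qed auto
  then have "AE J in gam. \<forall>i\<in>UNIV. \<forall>y\<in>enc_crit p J. y $ i \<noteq> 0 \<longrightarrow> \<not> y $ i0 = 0"
    by (intro AE_finite_allI) auto
  then show ?thesis
  proof eventually_elim
    case (elim J)
    show ?case
    proof
      fix y assume y: "y \<in> enc_crit p J"
      then have "y \<noteq> 0" by (simp add: enc_crit_def)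
      then obtain i where "y $ i \<noteq> 0" by (auto simp: vec_eq_iff)
      then show "y $ i0 \<noteq> 0" using elim y by blast
    qed
  qed
qed

lemma continuous_on_kmat:
  assumes "continuous_on X f" "continuous_on X g" "\<And>x. x \<in> X \<Longrightarrow> f x \<noteq> 0"
  shows "continuous_on X (\<lambda>x. kmat p (f x) (g x))"
  unfolding kmat_def lev_def dl_def outer_def using assms
  by (intro continuous_intros) auto

lemma AE_nondegenerate:
  fixes i0 :: "'n::finite"
  assumes p: "p \<ge> 2"
  shows "AE J in gam. \<forall>y\<in>enc_crit p J. y $ i0 \<noteq> 0 \<longrightarrow> absdet (kmat p (y::real^'n) (phess p J y)) \<noteq> 0"
proof (rule AE_no_crit[OF p])
  have [measurable]: "(\<lambda>x::(real^'n) \<times> (real^'n^'n). kmat p (fst x) (snd x)) \<in> borel_measurable (borel \<Otimes>\<^sub>M borel)"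
    by (rule kmat_measurable) measurable
  have "{(y::real^'n, S::real^'n^'n). absdet (kmat p y S) = 0} = {x \<in> space (borel \<Otimes>\<^sub>M borel). absdet (kmat p (fst x) (snd x)) = 0}"
    by (auto simp: space_pair_measure)
  also have "\<dots> \<in> sets (borel \<Otimes>\<^sub>M borel)" by measurable
  finally show "{(y::real^'n, S::real^'n^'n). absdet (kmat p y S) = 0} \<in> sets (borel \<Otimes>\<^sub>M borel)" .
next
  fix K :: "(real^'n) set" assume K: "compact K" "K \<subseteq> {y. y $ i0 \<noteq> 0}"
  let ?X = "UNIV \<times> K :: (('n list \<Rightarrow> real) \<times> (real^'n)) set"
  have c: "closed ?X" using K by (intro closed_Times) (auto intro: compact_imp_closed)
  have "continuous_on ?X (\<lambda>x. absdet (kmat p (snd x) (phess p (fst x) (snd x))))"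
    using K(2) by (intro continuous_intros continuous_on_kmat) auto
  from continuous_closed_preimage[OF this c closed_singleton[of 0]]
  have "closed (?X \<inter> (\<lambda>x. absdet (kmat p (snd x) (phess p (fst x) (snd x)))) -` {0})" .
  also have "\<dots> = {(J, y). y \<in> K \<and> absdet (kmat p y (phess p J y)) = 0}" by auto
  finally show "closed {(J, y). y \<in> K \<and> absdet (kmat p y (phess p J y)) = 0}" .
qed simp

section \<open>Quadratic forms: critical points are eigenvectors\<close>

section \<open>The quadratic case\<close>

lemma ordered_eigenvalue_scale:
  fixes S :: "real^'n::finite^'n"
  assumes S: "transpose S = S" and k: "k < CARD('n)" and a: "a > 0"
  shows "ordered_eigenvalue (a *\<^sub>R S) k = a * ordered_eigenvalue S k"
proof -
  obtain B where B: "eigenbasis UNIV ((*v) S) B" using ex_eigenbasis[OF selfadj_matrix[OF S]] by blast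
  have aS: "transpose (a *\<^sub>R S) = a *\<^sub>R S" using S by (simp add: transpose_def vec_eq_iff)
  have aB: "eigenbasis UNIV ((*v) (a *\<^sub>R S)) B"
    using B by (simp add: eigenbasis_def scaleR_matrix_vector_assoc[symmetric]) (metis scaleR_scaleR)
  have "c \<le> ordered_eigenvalue (a *\<^sub>R S) k \<longleftrightarrow> c \<le> a * ordered_eigenvalue S k" for c
  proof -
    have "c \<le> ordered_eigenvalue (a *\<^sub>R S) k \<longleftrightarrow> card {b \<in> B. b \<bullet> (S *v b) < c / a} \<le> k"
      unfolding ordered_eigenvalue_ge_iff[OF aS k] ind_diff_mat[OF aB aS]
      using a by (simp add: scaleR_matrix_vector_assoc[symmetric] pos_less_divide_eq mult.commute)
    also have "\<dots> \<longleftrightarrow> c / a \<le> ordered_eigenvalue S k"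
      unfolding ordered_eigenvalue_ge_iff[OF S k] ind_diff_mat[OF B S] ..
    finally show ?thesis using a by (simp add: pos_divide_le_eq mult.commute)
  qed
  then show ?thesis by (metis eq_iff)
qed

context
  fixes S :: "real^'n::finite^'n" and Bs :: "(real^'n) set"
  assumes S: "transpose S = S" and eb: "eigenbasis UNIV ((*v) S) Bs"
    and inj: "inj_on (\<lambda>b. b \<bullet> (S *v b)) Bs"
begin

abbreviation (input) "evl b \<equiv> b \<bullet> (S *v b)"

lemma eb_facts:
  shows fB: "finite Bs" and cB: "card Bs = CARD('n)" and nB: "b \<in> Bs \<Longrightarrow> norm b = 1"
    and eB: "b \<in> Bs \<Longrightarrow> S *v b = evl b *\<^sub>R b"
  using eb card_eigenbasis[OF eb S] by (auto simp: eigenbasis_def)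

text \<open>With a simple spectrum the position of an eigenvalue is the number of smaller ones, so
  rank labels the eigenvectors.\<close>

lemma ordered_eigenvalue_simple:
  assumes b: "b \<in> Bs"
  shows "ordered_eigenvalue S (card {b' \<in> Bs. evl b' < evl b}) = evl b"
proof -
  let ?k = "card {b' \<in> Bs. evl b' < evl b}"
  have "?k < card Bs" using b fB by (intro psubset_card_mono) auto
  then have k: "?k < CARD('n)" using cB by simp
  have iff: "c \<le> ordered_eigenvalue S ?k \<longleftrightarrow> card {b' \<in> Bs. evl b' < c} \<le> ?k" for c
    unfolding ordered_eigenvalue_ge_iff[OF S k] ind_diff_mat[OF eb S] ..
  have "\<not> evl b < ordered_eigenvalue S ?k"
  proof
    assume less: "evl b < ordered_eigenvalue S ?k"
    have "insert b {b' \<in> Bs. evl b' < evl b} \<subseteq> {b' \<in> Bs. evl b' < ordered_eigenvalue S ?k}"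
      using less b by auto
    then have "card (insert b {b' \<in> Bs. evl b' < evl b}) \<le> card {b' \<in> Bs. evl b' < ordered_eigenvalue S ?k}"
      using fB by (intro card_mono) auto
    moreover have "card (insert b {b' \<in> Bs. evl b' < evl b}) = Suc ?k"
      using fB by (subst card_insert_disjoint) auto
    ultimately show False using iff[of "ordered_eigenvalue S ?k"] by simp
  qed
  then show ?thesis using iff[of "evl b"] by auto
qed

lemma ex_eigenvector_rank:
  assumes k: "k < CARD('n)"
  shows "\<exists>b\<in>Bs. card {b' \<in> Bs. evl b' < evl b} = k"
proof -
  let ?r = "\<lambda>b. card {b' \<in> Bs. evl b' < evl b}"
  have i: "inj_on ?r Bs"
  proof (rule inj_onI)
    fix b b' assume b: "b \<in> Bs" "b' \<in> Bs" and r: "?r b = ?r b'"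
    have "evl b = evl b'"
      using ordered_eigenvalue_simple[OF b(1)] ordered_eigenvalue_simple[OF b(2)] unfolding r by simp
    from inj_onD[OF inj this b] show "b = b'" .
  qed
  have "?r ` Bs \<subseteq> {..<CARD('n)}"
  proof
    fix m assume "m \<in> ?r ` Bs"
    then obtain b where b: "b \<in> Bs" "m = ?r b" by auto
    have "?r b < card Bs" using b fB by (intro psubset_card_mono) auto
    then show "m \<in> {..<CARD('n)}" using cB b by simp
  qed
  moreover have "card (?r ` Bs) = card {..<CARD('n)}" using card_image[OF i] cB by simp
  ultimately have "?r ` Bs = {..<CARD('n)}" by (intro card_subset_eq) auto
  then have "k \<in> ?r ` Bs" using k by simp
  then show ?thesis by auto
qed

lemma rank_inj:
  assumes b: "b \<in> Bs" "b' \<in> Bs" and r: "card {x \<in> Bs. evl x < evl b} = card {x \<in> Bs. evl x < evl b'}"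
  shows "b = b'"
proof -
  have "evl b = evl b'"
    using ordered_eigenvalue_simple[OF b(1)] ordered_eigenvalue_simple[OF b(2)] unfolding r by simp
  from inj_onD[OF inj this b] show ?thesis .
qed

text \<open>For \<open>p = 2\<close> the encoded equation is an eigenvector equation whose
  eigenvalue fixes the norm as \<open>exp (evl b / sqrt 2)\<close>; each eigenline carries exactly
  two solutions.\<close>

lemma simple_crit_iff:
  "y \<noteq> 0 \<and> S *v y = (sqrt 2 * ln (norm y)) *\<^sub>R y \<longleftrightarrow>
   (\<exists>b\<in>Bs. y = exp (evl b / sqrt 2) *\<^sub>R b \<or> y = - exp (evl b / sqrt 2) *\<^sub>R b)"
proof
  assume y: "y \<noteq> 0 \<and> S *v y = (sqrt 2 * ln (norm y)) *\<^sub>R y"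
  let ?c = "sqrt 2 * ln (norm y)"
  have "y \<in> eigenspace_on UNIV ((*v) S) ?c" using y by (simp add: eigenspace_on_def)
  then have sp: "y \<in> span {b \<in> Bs. evl b = ?c}"
    unfolding eigenspace_eq_span[OF selfadj_matrix[OF S] eb] .
  have "{b \<in> Bs. evl b = ?c} \<noteq> {}"
  proof
    assume e: "{b \<in> Bs. evl b = ?c} = {}"
    from sp[unfolded e] y show False by simp
  qed
  then obtain b where b: "b \<in> Bs" "evl b = ?c" by auto
  have e: "{b \<in> Bs. evl b = ?c} = {b}"
  proof -
    have "x = b" if "x \<in> Bs" "evl x = ?c" for x
      using inj_onD[OF inj, of x b] that b by simp
    then show ?thesis using b by blast
  qed
  obtain t where t: "y = t *\<^sub>R b" using sp unfolding e span_singleton by blast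
  have "norm y = \<bar>t\<bar>" using t nB[OF b(1)] by simp
  moreover have "norm y = exp (evl b / sqrt 2)" using b(2) y by simp
  ultimately have "\<bar>t\<bar> = exp (evl b / sqrt 2)" by simp
  then have "t = exp (evl b / sqrt 2) \<or> t = - exp (evl b / sqrt 2)" by linarith
  then show "\<exists>b\<in>Bs. y = exp (evl b / sqrt 2) *\<^sub>R b \<or> y = - exp (evl b / sqrt 2) *\<^sub>R b"
    using t b(1) by blast
next
  assume "\<exists>b\<in>Bs. y = exp (evl b / sqrt 2) *\<^sub>R b \<or> y = - exp (evl b / sqrt 2) *\<^sub>R b"
  then obtain b t where b: "b \<in> Bs" "y = t *\<^sub>R b" "\<bar>t\<bar> = exp (evl b / sqrt 2)" by fastforce
  have n: "norm y = exp (evl b / sqrt 2)" using b nB[OF b(1)] by simp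
  then have y0: "y \<noteq> 0" by auto
  have "S *v y = evl b *\<^sub>R y" unfolding b(2) matrix_vector_mult_scaleR
    by (subst eB[OF b(1)]) (simp add: mult.commute)
  moreover have "sqrt 2 * ln (norm y) = evl b" unfolding n by simp
  ultimately show "y \<noteq> 0 \<and> S *v y = (sqrt 2 * ln (norm y)) *\<^sub>R y" using y0 by simp
qed

text \<open>The remaining eigenvectors form an eigenbasis of the tangent space, with eigenvalues
  shifted by that of \<open>b\<close>; the negative ones belong to the smaller eigenvalues.\<close>

lemma ind_tmat_eigenvector:
  assumes b: "b \<in> Bs" and t: "t \<noteq> 0"
  shows "ind (tmat (t *\<^sub>R b) S (evl b)) = card {b' \<in> Bs. evl b' < evl b}"
proof -
  let ?y = "t *\<^sub>R b"
  have b0: "b \<noteq> 0" using nB[OF b] by auto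
  have y: "?y \<noteq> 0" using b0 t by simp
  note inn = eigenbasis_inner[OF selfadj_matrix[OF S] eb]
  have f: "tform ?y S (evl b) b' = (evl b' - evl b) *\<^sub>R b'" if "b' \<in> Bs - {b}" for b'
  proof -
    have "?y \<bullet> (S *v b') = 0" using that inn[OF b, of b'] by (subst eB) auto
    then have "tangent_proj ?y (S *v b') = S *v b'" by (rule tangent_proj_id)
    then show ?thesis using eB[of b'] that by (simp add: tform_def scaleR_diff_left)
  qed
  have q: "b' \<bullet> tform ?y S (evl b) b' = evl b' - evl b" if "b' \<in> Bs - {b}" for b'
    unfolding f[OF that] using inn[of b' b'] that by simp
  have "eigenbasis (tangent_space ?y) (tform ?y S (evl b)) (Bs - {b})"
    unfolding eigenbasis_def
  proof (intro conjI ballI)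
    show "span (Bs - {b}) = tangent_space ?y"
    proof
      have "Bs - {b} \<subseteq> tangent_space ?y" using inn[OF b] by (auto simp: tangent_space_def)
      moreover have "subspace (tangent_space ?y)" using selfadj_tform[OF y S] by (simp add: selfadj_on_def)
      ultimately show "span (Bs - {b}) \<subseteq> tangent_space ?y" by (rule span_minimal)
      show "tangent_space ?y \<subseteq> span (Bs - {b})"
      proof
        fix v assume "v \<in> tangent_space ?y"
        then have vb: "v \<bullet> b = 0" using t by (simp add: tangent_space_def inner_commute)
        have "v \<in> span Bs" using eb by (simp add: eigenbasis_def)
        from eigenbasis_span_expand[OF selfadj_matrix[OF S] eb order_refl this]
        have "v = (\<Sum>x\<in>Bs. (v \<bullet> x) *\<^sub>R x)" .
        also have "\<dots> = (\<Sum>x\<in>Bs - {b}. (v \<bullet> x) *\<^sub>R x)"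
          using fB b vb by (simp add: sum.remove)
        also have "\<dots> \<in> span (Bs - {b})" by (intro span_sum span_scale span_base)
        finally show "v \<in> span (Bs - {b})" .
      qed
    qed
    fix b' assume b': "b' \<in> Bs - {b}"
    show "tform ?y S (evl b) b' = (b' \<bullet> tform ?y S (evl b) b') *\<^sub>R b'" unfolding q[OF b'] by (rule f[OF b'])
  qed (use eb in \<open>auto simp: eigenbasis_def pairwise_def\<close>)
  from index_on_eigenbasis[OF selfadj_tform[OF y S] this]
  have "index_on (tangent_space ?y) (tform ?y S (evl b)) = card {b' \<in> Bs - {b}. evl b' < evl b}"
    using q by (simp cong: conj_cong)
  also have "{b' \<in> Bs - {b}. evl b' < evl b} = {b' \<in> Bs. evl b' < evl b}" by auto
  finally show ?thesis by (simp add: ind_tmat[OF y S])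
qed

lemma simple_crit_count:
  assumes k: "k < CARD('n)"
  shows "emeasure (count_space UNIV) {y. y \<noteq> 0 \<and> S *v y = (sqrt 2 * ln (norm y)) *\<^sub>R y \<and>
      ln (norm y) \<in> B \<and> ind (tmat y S (sqrt 2 * ln (norm y))) = k} =
    2 * indicator B (ordered_eigenvalue S k / sqrt 2)"
proof -
  obtain b where b: "b \<in> Bs" "card {b' \<in> Bs. evl b' < evl b} = k" using ex_eigenvector_rank[OF k] by auto
  let ?v = "exp (evl b / sqrt 2) *\<^sub>R b"
  have oe: "ordered_eigenvalue S k = evl b" using ordered_eigenvalue_simple[OF b(1)] b(2) by simp
  have v0: "?v \<noteq> 0" using nB[OF b(1)] by auto
  have pr: "ln (norm y) = evl x / sqrt 2 \<and> ind (tmat y S (sqrt 2 * ln (norm y))) = card {b' \<in> Bs. evl b' < evl x}"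
    if x: "x \<in> Bs" and y: "y = exp (evl x / sqrt 2) *\<^sub>R x \<or> y = - exp (evl x / sqrt 2) *\<^sub>R x" for x y
  proof -
    have l: "ln (norm y) = evl x / sqrt 2" using y nB[OF x] by auto
    then have "sqrt 2 * ln (norm y) = evl x" by simp
    then show ?thesis using l y ind_tmat_eigenvector[OF x, of "exp (evl x / sqrt 2)"]
        ind_tmat_eigenvector[OF x, of "- exp (evl x / sqrt 2)"] by auto
  qed
  have "{y. y \<noteq> 0 \<and> S *v y = (sqrt 2 * ln (norm y)) *\<^sub>R y \<and> ln (norm y) \<in> B \<and> ind (tmat y S (sqrt 2 * ln (norm y))) = k} =
     (if evl b / sqrt 2 \<in> B then {?v, - ?v} else {})" (is "?L = ?R")
  proof (rule set_eqI)
    fix y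
    have "y \<in> ?L \<longleftrightarrow> (\<exists>x\<in>Bs. (y = exp (evl x / sqrt 2) *\<^sub>R x \<or> y = - exp (evl x / sqrt 2) *\<^sub>R x)) \<and>
        ln (norm y) \<in> B \<and> ind (tmat y S (sqrt 2 * ln (norm y))) = k"
      using simple_crit_iff[of y] by auto
    also have "\<dots> \<longleftrightarrow> (y = ?v \<or> y = - ?v) \<and> evl b / sqrt 2 \<in> B"
    proof
      assume L: "(\<exists>x\<in>Bs. (y = exp (evl x / sqrt 2) *\<^sub>R x \<or> y = - exp (evl x / sqrt 2) *\<^sub>R x)) \<and>
        ln (norm y) \<in> B \<and> ind (tmat y S (sqrt 2 * ln (norm y))) = k"
      then obtain x where x: "x \<in> Bs" "y = exp (evl x / sqrt 2) *\<^sub>R x \<or> y = - exp (evl x / sqrt 2) *\<^sub>R x" by blast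
      have "x = b" using pr[OF x] L b by (intro rank_inj x b) simp
      then show "(y = ?v \<or> y = - ?v) \<and> evl b / sqrt 2 \<in> B" using pr[OF x] L x by simp
    next
      assume R: "(y = ?v \<or> y = - ?v) \<and> evl b / sqrt 2 \<in> B"
      then have y: "y = exp (evl b / sqrt 2) *\<^sub>R b \<or> y = - exp (evl b / sqrt 2) *\<^sub>R b" by simp
      show "(\<exists>x\<in>Bs. (y = exp (evl x / sqrt 2) *\<^sub>R x \<or> y = - exp (evl x / sqrt 2) *\<^sub>R x)) \<and>
        ln (norm y) \<in> B \<and> ind (tmat y S (sqrt 2 * ln (norm y))) = k"
        using R pr[OF b(1) y, unfolded b(2)] b(1) y by metis
    qed
    finally show "y \<in> ?L \<longleftrightarrow> y \<in> ?R" by auto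
  qed
  moreover have "?v \<noteq> - ?v"
  proof
    assume "?v = - ?v"
    then have "2 *\<^sub>R ?v = 0" unfolding scaleR_2 by (simp only: eq_neg_iff_add_eq_0)
    then show False using v0 by simp
  qed
  ultimately show ?thesis using oe by simp
qed

text \<open>The uniform bound behind all finiteness: it passes from \<open>p = 2\<close> to every
  degree through the comparison of densities.\<close>

lemma simple_crit_finite:
  "emeasure (count_space UNIV) {y. y \<noteq> 0 \<and> S *v y = (sqrt 2 * ln (norm y)) *\<^sub>R y} \<le> ennreal (2 * real CARD('n))"
proof -
  let ?X = "(\<lambda>b. exp (evl b / sqrt 2) *\<^sub>R b) ` Bs \<union> (\<lambda>b. - exp (evl b / sqrt 2) *\<^sub>R b) ` Bs"
  have sub: "{y. y \<noteq> 0 \<and> S *v y = (sqrt 2 * ln (norm y)) *\<^sub>R y} \<subseteq> ?X"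
    using simple_crit_iff by auto
  have fX: "finite ?X" using fB by simp
  have "card ?X \<le> card Bs + card Bs"
    by (rule order_trans[OF card_Un_le add_mono]) (intro card_image_le fB)+
  then have "real (card ?X) \<le> 2 * real CARD('n)" using cB by simp
  then have "emeasure (count_space UNIV) ?X \<le> ennreal (2 * real CARD('n))"
    using fX by (subst emeasure_count_space_finite) (auto simp: ennreal_of_nat_eq_real_of_nat simp del: ennreal_mult ennreal_mult'')
  moreover have "emeasure (count_space UNIV) {y. y \<noteq> 0 \<and> S *v y = (sqrt 2 * ln (norm y)) *\<^sub>R y} \<le> emeasure (count_space UNIV) ?X"
    using sub by (intro emeasure_mono) auto
  ultimately show ?thesis by (rule order_trans[rotated])
qed

end

text \<open>If two basis vectors shared an eigenvalue, the second would lie in the kernel of the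
  Jacobian at the zero on the line of the first. Almost sure simplicity of the spectrum is thus a
  consequence of the Kac-Rice formula.\<close>

lemma nondegenerate_simple:
  fixes S :: "real^'n::finite^'n"
  assumes S: "transpose S = S" and eb: "eigenbasis UNIV ((*v) S) Bs"
    and nd: "\<And>y. y \<noteq> 0 \<Longrightarrow> S *v y = lev 2 y *\<^sub>R y \<Longrightarrow> absdet (kmat 2 y S) \<noteq> 0"
  shows "inj_on (\<lambda>b. b \<bullet> (S *v b)) Bs"
proof (rule inj_onI, rule ccontr)
  fix b b' assume b: "b \<in> Bs" "b' \<in> Bs" "b \<bullet> (S *v b) = b' \<bullet> (S *v b')" "b \<noteq> b'"
  let ?c = "b \<bullet> (S *v b)"
  define y where "y = exp (?c / sqrt 2) *\<^sub>R b"
  have n: "norm b = 1" "norm b' = 1" using eb b by (auto simp: eigenbasis_def)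
  have Sb: "S *v b = ?c *\<^sub>R b" "S *v b' = ?c *\<^sub>R b'" using eb b unfolding eigenbasis_def by metis+
  have lev: "lev 2 y = ?c" unfolding lev_def y_def by (simp add: n kap_def)
  have y0: "y \<noteq> 0" unfolding y_def using n by auto
  have Sy: "S *v y = lev 2 y *\<^sub>R y"
    unfolding lev unfolding y_def matrix_vector_mult_scaleR by (subst Sb) (simp add: mult.commute)
  have "b \<bullet> b' = 0" using eigenbasis_inner[OF selfadj_matrix[OF S] eb b(1,2)] b(4) by simp
  then have "y \<bullet> b' = 0" by (simp add: y_def)
  then have "kmat 2 y S *v b' = 0" unfolding kmat_mult lev Sb(2) by simp
  moreover have "b' \<noteq> 0" using n by auto
  ultimately have "absdet (kmat 2 y S) = 0" unfolding absdet_eq_0_iff by blast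
  then show False using nd[OF y0 Sy] by simp
qed

lemma phess_2_const: "phess 2 J y = phess 2 J 0"
  by (simp add: numeral_2_eq_2)

lemma enc_crit_2: "enc_crit 2 J = {y. y \<noteq> 0 \<and> phess 2 J 0 *v y = (sqrt 2 * ln (norm y)) *\<^sub>R y}"
proof -
  have "pgrad 2 J y = phess 2 J 0 *v y" for y
    using phess_mult_self[of 2 J y] unfolding phess_2_const[of J y] by simp
  then show ?thesis by (simp add: enc_crit_def lev_def kap_def)
qed

text \<open>One null set serves all \<open>k\<close>, \<open>K\<close> and \<open>B\<close>. The
  scale \<open>2 * sqrt N\<close> is \<open>sqrt 2 / en 2\<close>, since a zero for the eigenvalue
  \<open>\<lambda>\<close> has level \<open>\<lambda> / sqrt 2\<close>.\<close>

lemma AE_cnt_2: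
  fixes i0 :: "'n::finite"
  shows "AE J in gam. (\<forall>k<CARD('n). \<forall>B. cnt i0 2 {k} B J = 2 * indicator B (ordered_eigenvalue (phess 2 J 0) k / (2 * sqrt (real CARD('n))))) \<and>
     (\<forall>K B. cnt i0 2 K B J \<le> ennreal (2 * real CARD('n)))"
proof -
  have p: "(2::nat) \<ge> 2" by simp
  from AE_component_nonzero[OF p, of i0] AE_nondegenerate[OF p, of i0] show ?thesis
  proof eventually_elim
    case (elim J)
    let ?S = "phess 2 J 0"
    have S: "transpose ?S = ?S" by (rule transpose_phess)
    obtain Bs where eb: "eigenbasis UNIV ((*v) ?S) Bs" using ex_eigenbasis[OF selfadj_matrix[OF S]] by blast
    have inj: "inj_on (\<lambda>b. b \<bullet> (?S *v b)) Bs"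
    proof (rule nondegenerate_simple[OF S eb])
      fix y assume "y \<noteq> 0" "?S *v y = lev 2 y *\<^sub>R y"
      then have "y \<in> enc_crit 2 J" unfolding enc_crit_2 by (simp add: lev_def kap_def)
      then show "absdet (kmat 2 y ?S) \<noteq> 0" using elim phess_2_const[of J y] by metis
    qed
    have lev2: "lev 2 y = sqrt 2 * ln (norm y)" for y :: "real^'n" by (simp add: lev_def kap_def)
    show ?case
    proof (intro conjI allI impI)
      fix k B assume k: "k < CARD('n)"
      let ?e = "en 2 TYPE('n)"
      have "cnt i0 2 {k} B J = emeasure (count_space UNIV) {y. y \<noteq> 0 \<and> ?S *v y = (sqrt 2 * ln (norm y)) *\<^sub>R y \<and>
          ln (norm y) \<in> {\<tau>. ?e * \<tau> \<in> B} \<and> ind (tmat y ?S (sqrt 2 * ln (norm y))) = k}"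
        unfolding cnt_def
      proof (rule arg_cong[where f="emeasure (count_space UNIV)"], rule set_eqI)
        fix y
        have "y \<in> enc_crit 2 J \<Longrightarrow> y $ i0 \<noteq> 0" using elim by blast
        then show "y \<in> {y \<in> enc_crit 2 J. y $ i0 \<noteq> 0 \<and> ?e * ln (norm y) \<in> B \<and> enc_index 2 J y \<in> {k}} \<longleftrightarrow>
          y \<in> {y. y \<noteq> 0 \<and> ?S *v y = (sqrt 2 * ln (norm y)) *\<^sub>R y \<and>
          ln (norm y) \<in> {\<tau>. ?e * \<tau> \<in> B} \<and> ind (tmat y ?S (sqrt 2 * ln (norm y))) = k}"
          unfolding enc_crit_2 mem_Collect_eq enc_index_def lev2 phess_2_const[of J y] by blast
      qed
      also have "\<dots> = 2 * indicator {\<tau>. ?e * \<tau> \<in> B} (ordered_eigenvalue ?S k / sqrt 2)"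
        by (rule simple_crit_count[OF S eb inj k])
      also have "\<dots> = 2 * indicator B (ordered_eigenvalue ?S k / (2 * sqrt (real CARD('n))))"
      proof -
        have "?e * (ordered_eigenvalue ?S k / sqrt 2) = ordered_eigenvalue ?S k / (2 * sqrt (real CARD('n)))"
          by (simp add: en_def kap_def)
        then show ?thesis by (simp add: indicator_def)
      qed
      finally show "cnt i0 2 {k} B J = 2 * indicator B (ordered_eigenvalue ?S k / (2 * sqrt (real CARD('n))))" .
    next
      fix K B
      have "cnt i0 2 K B J \<le> emeasure (count_space UNIV) {y. y \<noteq> 0 \<and> ?S *v y = (sqrt 2 * ln (norm y)) *\<^sub>R y}"
        unfolding cnt_def enc_crit_2 by (intro emeasure_mono) auto
      also have "\<dots> \<le> ennreal (2 * real CARD('n))" by (rule simple_crit_finite[OF S eb inj])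
      finally show "cnt i0 2 K B J \<le> ennreal (2 * real CARD('n))" .
    qed
  qed
qed

section \<open>The ensemble as the quadratic case, and eigenvalues as measurable functions of a
  matrix\<close>

section \<open>The Gaussian orthogonal ensemble\<close>

lemma hmat_2: "hmat i0 2 g = (\<chi> j k. (if j = k then 2 else sqrt 2) * g {j, k})"
  by (auto simp: hmat_def mm_def vec_eq_iff)

definition goe_sd :: "'n::finite set \<Rightarrow> real" where
  "goe_sd e = sqrt ((1 + of_bool (is_singleton e)) / (2 * real CARD('n)))"

lemma goe_sd_pos: "goe_sd e > 0"
  by (simp add: goe_sd_def add_pos_nonneg)

lemma goe_sd_nonzero [simp]: "goe_sd e \<noteq> 0"
  using goe_sd_pos[of e] by simp

lemma goe_sd_pair: "goe_sd {j, k :: 'n::finite} = (if j = k then 2 else sqrt 2) / (2 * sqrt (real CARD('n)))"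
proof -
  have s: "is_singleton {j, k} \<longleftrightarrow> j = k" by (auto simp: is_singleton_def doubleton_eq_iff)
  show ?thesis
  proof (cases "j = k")
    case True
    have "(1 + of_bool True) / (2 * real CARD('n)) = 1 / real CARD('n)" by simp
    then show ?thesis unfolding goe_sd_def s using True by (simp add: real_sqrt_divide)
  next
    case False
    have "sqrt (1 / (2 * real CARD('n))) = sqrt 2 / (2 * sqrt (real CARD('n)))"
      by (simp add: real_sqrt_divide real_sqrt_mult field_simps)
    then show ?thesis unfolding goe_sd_def s using False by simp
  qed
qed

lemma goe_law:
  fixes F :: "real^'n::finite^'n \<Rightarrow> ennreal"
  assumes F: "F \<in> borel_measurable borel"
  shows "(\<integral>\<^sup>+A. F A \<partial>goe) = (\<integral>\<^sup>+g. F (\<chi> i j. goe_sd {i, j} * g {i, j}) \<partial>gam)"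
proof -
  let ?E = "{{i, j} | i j :: 'n. True}"
  let ?N = "\<lambda>e::'n set. density lborel (normal_density 0 (goe_sd e))"
  let ?P = "PiM ?E ?N"
  have N: "prob_space (?N e)" for e by (rule prob_space_normal_density[OF goe_sd_pos])
  interpret P: product_prob_space ?N ?E
    by (intro product_prob_spaceI N)
  have mc: "(\<lambda>g. g {i, j}) \<in> borel_measurable ?P" for i j
    using measurable_component_singleton[of "{i, j}" ?E ?N] by auto
  have m: "(\<lambda>g. \<chi> i j. g {i, j}) \<in> ?P \<rightarrow>\<^sub>M (borel :: (real^'n^'n) measure)"
  proof (subst borel_measurable_euclidean_space, intro ballI)
    fix b :: "real^'n^'n" assume "b \<in> Basis"
    then obtain i j where b: "b = axis i (axis j 1)" by (auto simp: Basis_vec_def)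
    show "(\<lambda>g. (\<chi> i j. g {i, j}) \<bullet> b) \<in> borel_measurable ?P" using mc by (simp add: b inner_axis)
  qed
  have "(\<integral>\<^sup>+A. F A \<partial>goe) = (\<integral>\<^sup>+g. F (\<chi> i j. g {i, j}) \<partial>?P)"
    unfolding goe_def goe_sd_def[symmetric] using m F by (intro nn_integral_distr) simp_all
  also have "\<dots> = (\<integral>\<^sup>+g. F (\<chi> i j. goe_sd {i, j} * (g {i, j} / goe_sd {i, j})) \<partial>?P)"
    by simp
  also have "\<dots> = (\<integral>\<^sup>+g. F (\<chi> i j. goe_sd {i, j} * g {i, j}) \<partial>gam)"
  proof (rule P.P.nn_integral_indep_gauss[where X="\<lambda>e g. g e / goe_sd e" and E="?E" and Y="\<lambda>g e. g e / goe_sd e"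
      and F="\<lambda>h. F (\<chi> i j. goe_sd {i, j} * h {i, j})"])
    have "P.P.indep_vars ?N (\<lambda>e g. g e) ?E"
    proof (subst P.P.indep_vars_iff_distr_eq_PiM')
      have "distr ?P ?P (\<lambda>x. \<lambda>i\<in>?E. x i) = distr ?P ?P (\<lambda>x. x)"
        by (intro distr_cong) (auto simp: space_PiM PiE_def extensional_restrict)
      also have "\<dots> = PiM ?E (\<lambda>i. distr ?P (?N i) (\<lambda>x. x i))"
        using N by (subst distr_id2) (auto intro!: PiM_cong distr_PiM_component[symmetric])
      finally show "distr ?P ?P (\<lambda>x. \<lambda>i\<in>?E. x i) = PiM ?E (\<lambda>i. distr ?P (?N i) (\<lambda>x. x i))" .
    qed (use mc in auto)
    from P.P.indep_vars_compose2[OF this, of "\<lambda>e x. x / goe_sd e" "\<lambda>_. borel"]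
    show "P.P.indep_vars (\<lambda>_. borel) (\<lambda>e g. g e / goe_sd e) ?E" by simp
    show "distributed ?P lborel (\<lambda>g. g e / goe_sd e) (\<lambda>x. ennreal (std_normal_density x))" if "e \<in> ?E" for e
    proof -
      have "distr ?P lborel (\<lambda>g. g e) = ?N e"
        using P.PiM_component[OF that] by (simp cong: distr_cong)
      then have "distributed ?P lborel (\<lambda>g. g e) (\<lambda>x. ennreal (normal_density 0 (goe_sd e) x))"
        using that mc by (auto simp: distributed_def)
      then show ?thesis
        using P.P.normal_standard_normal_convert[OF goe_sd_pos, of "\<lambda>g. g e" 0 e] by simp
    qed
    show "?E \<noteq> {}" by auto
    have "continuous_on UNIV (\<lambda>h. \<chi> i j. goe_sd {i, j} * h {i, j} :: real^'n^'n)"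
      by (intro continuous_intros continuous_on_product_coordinates)
    then show "(\<lambda>h. F (\<chi> i j. goe_sd {i, j} * h {i, j})) \<in> borel_measurable borel"
      by (intro measurable_compose[OF _ F] borel_measurable_continuous_onI)
    show "F (\<chi> i j. goe_sd {i, j} * h {i, j}) = F (\<chi> i j. goe_sd {i, j} * k {i, j})"
      if "\<And>e. e \<in> ?E \<Longrightarrow> h e = k e" for h k
    proof -
      have "h {i, j} = k {i, j}" for i j by (rule that) auto
      then show ?thesis by simp
    qed
  qed simp
  finally show ?thesis .
qed

text \<open>In degree 2 the index \<open>i0\<close> no longer plays a special role: all diagonal
  entries have standard deviation 2 and all others \<open>sqrt 2\<close>, proportional to those of
  the ensemble.\<close>

lemma phess_2_goe:
  fixes F :: "real^'n::finite^'n \<Rightarrow> ennreal"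
  assumes F: "F \<in> borel_measurable borel"
  shows "(\<integral>\<^sup>+J. F ((1 / (2 * sqrt (real CARD('n)))) *\<^sub>R phess 2 J 0) \<partial>gam) = (\<integral>\<^sup>+A. F A \<partial>goe)"
proof -
  let ?a = "1 / (2 * sqrt (real CARD('n)))"
  fix i0 :: 'n
  have "(\<integral>\<^sup>+J. F (?a *\<^sub>R phess 2 J (axis i0 1)) \<partial>gam) = (\<integral>\<^sup>+g. F (?a *\<^sub>R hmat i0 2 g) \<partial>gam)"
    using F by (intro phess_axis_law[where F="\<lambda>S. F (?a *\<^sub>R S)"]) simp_all
  also have "\<dots> = (\<integral>\<^sup>+g. F (\<chi> i j. goe_sd {i, j} * g {i, j}) \<partial>gam)"
  proof (intro nn_integral_cong arg_cong[where f=F])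
    fix g :: "'n set \<Rightarrow> real"
    show "?a *\<^sub>R hmat i0 2 g = (\<chi> i j. goe_sd {i, j} * g {i, j})"
      unfolding hmat_2 goe_sd_pair by (simp add: vec_eq_iff)
  qed
  finally show ?thesis unfolding goe_law[OF F] phess_2_const[of _ "axis i0 1"] .
qed

text \<open>The negative semidefinite matrix \<open>- (transpose M ** M)\<close> has the kernel of
  \<open>M\<close>, so its index is the rank of \<open>M\<close>. Semicontinuity of the index
  thereby extends to kernels of matrices that are not symmetric.\<close>

lemma dim_kernel:
  fixes M :: "real^'n::finite^'n"
  shows "dim {v. M *v v = 0} + ind (- (transpose M ** M)) = CARD('n)"
proof -
  let ?P = "- (transpose M ** M)"
  have tP: "transpose ?P = ?P"
    by (simp add: transpose_def matrix_matrix_mult_def vec_eq_iff mult.commute)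
  have neg: "?P *v v = - ((transpose M ** M) *v v)" for v
    by (simp add: matrix_vector_mult_def vec_eq_iff sum_negf)
  have q: "v \<bullet> (?P *v v) = - (norm (M *v v))\<^sup>2" for v
  proof -
    have "v \<bullet> ((transpose M ** M) *v v) = (norm (M *v v))\<^sup>2"
      unfolding matrix_vector_mul_assoc[symmetric] power2_norm_eq_inner
      by (metis dot_lmul_matrix inner_commute transpose_matrix_vector)
    then show ?thesis unfolding neg by simp
  qed
  obtain Bs where eb: "eigenbasis UNIV ((*v) ?P) Bs" using ex_eigenbasis[OF selfadj_matrix[OF tP]] by blast
  have fB: "finite Bs" using eb by (simp add: eigenbasis_def)
  have "{v. M *v v = 0} = eigenspace_on UNIV ((*v) ?P) 0"
  proof (intro set_eqI iffI)
    fix v assume "v \<in> {v. M *v v = 0}"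
    then have "?P *v v = 0"
      unfolding neg by (simp add: matrix_vector_mul_assoc[symmetric])
    then show "v \<in> eigenspace_on UNIV ((*v) ?P) 0" by (simp add: eigenspace_on_def)
  next
    fix v assume "v \<in> eigenspace_on UNIV ((*v) ?P) 0"
    then have "?P *v v = 0" by (simp add: eigenspace_on_def)
    then show "v \<in> {v. M *v v = 0}" using q[of v] by simp
  qed
  also have "\<dots> = span {b \<in> Bs. b \<bullet> (?P *v b) = 0}"
    by (rule eigenspace_eq_span[OF selfadj_matrix[OF tP] eb])
  finally have "dim {v. M *v v = 0} = card {b \<in> Bs. b \<bullet> (?P *v b) = 0}"
    using dim_eq_card_independent[OF eigenbasis_independent[OF selfadj_matrix[OF tP] eb], of "{b \<in> Bs. b \<bullet> (?P *v b) = 0}"]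
    by simp
  moreover have "ind ?P = card {b \<in> Bs. b \<bullet> (?P *v b) < 0}"
    unfolding ind_def by (rule index_on_eigenbasis[OF selfadj_matrix[OF tP] eb])
  moreover have "card {b \<in> Bs. b \<bullet> (?P *v b) = 0} + card {b \<in> Bs. b \<bullet> (?P *v b) < 0} =
      card ({b \<in> Bs. b \<bullet> (?P *v b) = 0} \<union> {b \<in> Bs. b \<bullet> (?P *v b) < 0})"
    using fB by (intro card_Un_disjoint[symmetric]) auto
  moreover have "{b \<in> Bs. b \<bullet> (?P *v b) = 0} \<union> {b \<in> Bs. b \<bullet> (?P *v b) < 0} = Bs"
    using q by auto
  ultimately show ?thesis using card_eigenbasis[OF eb tP] by simp
qed

lemma closed_dim_kernel: "closed {M::real^'n::finite^'n. j \<le> dim {v. M *v v = 0}}"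
proof (cases "j \<le> CARD('n)")
  case True
  obtain U where U: "open U" "\<And>M::real^'n^'n. transpose M = M \<Longrightarrow> (M \<in> U \<longleftrightarrow> CARD('n) - j < ind M)"
    using ind_open[of "CARD('n) - j"] by blast
  have "continuous_on UNIV (\<lambda>M::real^'n^'n. - (transpose M ** M))"
    unfolding transpose_def by (intro continuous_intros)
  then have "closed ((\<lambda>M::real^'n^'n. - (transpose M ** M)) -` (- U))"
    using U(1) by (intro closed_vimage) (auto simp: closed_Compl)
  also have "(\<lambda>M::real^'n^'n. - (transpose M ** M)) -` (- U) = {M. j \<le> dim {v. M *v v = 0}}"
  proof -
    have "- (transpose M ** M) \<in> U \<longleftrightarrow> CARD('n) - j < ind (- (transpose M ** M))" for M :: "real^'n^'n"
      by (rule U(2)) (simp add: transpose_def matrix_matrix_mult_def vec_eq_iff mult.commute)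
    moreover have "\<not> CARD('n) - j < ind (- (transpose M ** M)) \<longleftrightarrow> j \<le> dim {v. M *v v = 0}" for M :: "real^'n^'n"
      using dim_kernel[of M] True by linarith
    ultimately show ?thesis by auto
  qed
  finally show ?thesis .
next
  case False
  have "dim {v. M *v v = 0} \<le> CARD('n)" for M :: "real^'n^'n" using dim_kernel[of M] by simp
  then have "{M::real^'n^'n. j \<le> dim {v. M *v v = 0}} = {}" using False by (auto dest: order_trans)
  then show ?thesis by simp
qed

definition emult :: "real^'n::finite^'n \<Rightarrow> real \<Rightarrow> nat" where
  "emult A c = dim (eigenspace_on UNIV ((*v) A) c)"

lemma eigenspace_on_kernel:
  fixes A :: "real^'n::finite^'n"
  shows "eigenspace_on UNIV ((*v) A) c = {v. (A - mat c) *v v = 0}"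
proof -
  have "mat c *v v = c *\<^sub>R v" for v :: "real^'n"
    by (simp add: vec_eq_iff matrix_vector_mult_def mat_def if_distrib if_distribR cong: if_cong)
  then show ?thesis by (simp add: eigenspace_on_def matrix_vector_mult_diff_rdistrib)
qed

lemma emult_count_measurable:
  assumes U: "open U"
  shows "(\<lambda>A::real^'n::finite^'n. emeasure (count_space UNIV) {c \<in> U. j \<le> emult A c}) \<in> borel_measurable borel"
proof (rule count_measurable[OF U])
  fix K :: "real set" assume K: "compact K" "K \<subseteq> U"
  have "continuous_on UNIV (\<lambda>x::(real^'n^'n) \<times> real. fst x - mat (snd x))"
  proof -
    have "continuous_on UNIV (\<lambda>x::(real^'n^'n) \<times> real. snd x *\<^sub>R mat 1 :: real^'n^'n)" by (intro continuous_intros)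
    moreover have "c *\<^sub>R mat 1 = (mat c :: real^'n^'n)" for c by (simp add: mat_def vec_eq_iff)
    ultimately show ?thesis by (intro continuous_intros) simp
  qed
  from closed_vimage[OF closed_dim_kernel[of j] this]
  have c: "closed {(A::real^'n^'n, c). j \<le> emult A c}"
    by (simp add: emult_def eigenspace_on_kernel vimage_def case_prod_unfold)
  have "{A. \<exists>c\<in>K. (A, c) \<in> {(A::real^'n^'n, c). j \<le> emult A c}} \<in> sets borel"
  proof (rule borel_closed[OF closed_hit[OF K(1)]])
    have "closed (UNIV \<times> K :: ((real^'n^'n) \<times> real) set)"
      using K(1) by (intro closed_Times) (auto intro: compact_imp_closed)
    then show "closed ({(A::real^'n^'n, c). j \<le> emult A c} \<inter> UNIV \<times> K)" using c by (intro closed_Int)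
  qed
  moreover have "{A. \<exists>c\<in>K. (A, c) \<in> {(A::real^'n^'n, c). j \<le> emult A c}} = {A \<in> space borel. {c \<in> U. j \<le> emult A c} \<inter> K \<noteq> {}}"
    using K(2) by auto
  ultimately show "{A::real^'n^'n \<in> space borel. {c \<in> U. j \<le> emult A c} \<inter> K \<noteq> {}} \<in> sets borel" by (simp only:)
qed auto

text \<open>The integrand over the ensemble must be measurable on all matrices. A non-symmetric matrix can have
  fewer than \<open>N\<close> eigenvalues in the list, and then \<open>!\<close> returns the unspecified value \<open>[] ! _\<close>.\<close>

lemma nth_beyond: "length xs \<le> k \<Longrightarrow> xs ! k = [] ! (k - length xs)"
proof (induction xs arbitrary: k)
  case (Cons x xs)
  then show ?case by (cases k) auto
qed simp

text \<open>Counts the eigenvalues in \<open>U\<close> with multiplicity, by layers: an eigenvalue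
  of multiplicity \<open>m\<close> is counted once for each \<open>j \<le> m\<close>. Each layer is
  a closed condition on matrix and eigenvalue.\<close>

definition ncnt :: "real set \<Rightarrow> real^'n::finite^'n \<Rightarrow> ennreal" where
  "ncnt U A = (\<Sum>j=1..CARD('n). emeasure (count_space UNIV) {c \<in> U. j \<le> emult A c})"

lemma ncnt_measurable: "open U \<Longrightarrow> ncnt U \<in> borel_measurable borel"
  unfolding ncnt_def[abs_def] by (intro borel_measurable_sum emult_count_measurable)

lemma emult_le: "emult (A :: real^'n::finite^'n) c \<le> CARD('n)"
  using dim_kernel[of "A - mat c"] unfolding emult_def eigenspace_on_kernel by simp

lemma spectrum_eq: "{c. \<exists>v \<in> eigenspace_on UNIV ((*v) A) c. v \<noteq> 0} = {c. 1 \<le> emult (A :: real^'n::finite^'n) c}"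
proof -
  have "1 \<le> emult A c \<longleftrightarrow> \<not> eigenspace_on UNIV ((*v) A) c \<subseteq> {0}" for c
    unfolding emult_def dim_eq_0[symmetric] by linarith
  then show ?thesis by auto
qed

lemma ncnt_eq_length:
  fixes A :: "real^'n::finite^'n"
  assumes fin: "finite {c. 1 \<le> emult A c}"
  shows "ncnt U A = of_nat (length (filter (\<lambda>x. x \<in> U) (eigenvalues_on UNIV ((*v) A))))"
proof -
  let ?S = "{c. 1 \<le> emult A c}"
  have "length (filter (\<lambda>x. x \<in> U) (eigenvalues_on UNIV ((*v) A))) = (\<Sum>c\<in>?S. if c \<in> U then emult A c else 0)"
    unfolding eigenvalues_on_def spectrum_eq length_filter_concat_replicate emult_def[symmetric]
    using fin by (subst sum_list_distinct_conv_sum_set) auto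
  also have "\<dots> = (\<Sum>c\<in>?S. \<Sum>j=1..CARD('n). if c \<in> U \<and> j \<le> emult A c then 1 else 0)"
  proof (intro sum.cong refl)
    fix c
    have "{j \<in> {1..CARD('n)}. c \<in> U \<and> j \<le> emult A c} = (if c \<in> U then {1..emult A c} else {})"
      using emult_le[of A c] by auto
    then show "(if c \<in> U then emult A c else 0) = (\<Sum>j=1..CARD('n). if c \<in> U \<and> j \<le> emult A c then 1 else 0)"
      by (simp add: sum.inter_filter[symmetric])
  qed
  also have "\<dots> = (\<Sum>j=1..CARD('n). \<Sum>c\<in>?S. if c \<in> U \<and> j \<le> emult A c then 1 else 0)"
    by (rule sum.swap)
  also have "\<dots> = (\<Sum>j=1..CARD('n). card {c \<in> U. j \<le> emult A c})"
  proof (intro sum.cong refl)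
    fix j assume j: "j \<in> {1..CARD('n)}"
    have "{c \<in> ?S. c \<in> U \<and> j \<le> emult A c} = {c \<in> U. j \<le> emult A c}" using j by auto
    then show "(\<Sum>c\<in>?S. if c \<in> U \<and> j \<le> emult A c then 1 else 0) = card {c \<in> U. j \<le> emult A c}"
      using fin by (simp add: sum.inter_filter[symmetric])
  qed
  finally have "of_nat (length (filter (\<lambda>x. x \<in> U) (eigenvalues_on UNIV ((*v) A)))) =
      (\<Sum>j=1..CARD('n). of_nat (card {c \<in> U. j \<le> emult A c}) :: ennreal)" by simp
  also have "\<dots> = ncnt U A"
    unfolding ncnt_def
  proof (intro sum.cong refl)
    fix j assume j: "j \<in> {1..CARD('n)}"
    have "finite {c \<in> U. j \<le> emult A c}" using j by (intro finite_subset[OF _ fin]) auto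
    then show "of_nat (card {c \<in> U. j \<le> emult A c}) = emeasure (count_space UNIV) {c \<in> U. j \<le> emult A c}" by simp
  qed
  finally show ?thesis by simp
qed

lemma ncnt_UNIV_infinite:
  fixes A :: "real^'n::finite^'n"
  assumes inf: "infinite {c. 1 \<le> emult A c}"
  shows "ncnt UNIV A = top"
proof -
  have "emeasure (count_space UNIV) {c. 1 \<le> emult A c} \<le> ncnt UNIV A"
    unfolding ncnt_def using member_le_sum[of 1 "{1..CARD('n)}" "\<lambda>j. emeasure (count_space UNIV) {c \<in> UNIV. j \<le> emult A c}"]
    by (simp add: Suc_le_eq)
  then show ?thesis using inf by (simp add: top_unique)
qed

text \<open>The three cases are an infinite set of eigenvalues, for which
  \<open>sorted_list_of_set\<close> returns the empty list, a position inside the list, and a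
  position beyond its end. All are expressed through the measurable counts
  \<open>ncnt\<close>.\<close>

lemma ordered_eigenvalue_less_iff:
  fixes A :: "real^'n::finite^'n"
  shows "ordered_eigenvalue A k < c \<longleftrightarrow>
     (ncnt UNIV A = top \<and> [] ! k < c) \<or>
     (ncnt UNIV A \<noteq> top \<and> of_nat k < ncnt UNIV A \<and> of_nat k < ncnt {..<c} A) \<or>
     (\<exists>l\<le>k. ncnt UNIV A = of_nat l \<and> [] ! (k - l) < c)"
proof (cases "finite {c. 1 \<le> emult A c}")
  case False
  have "eigenvalues_on UNIV ((*v) A) = []"
    unfolding eigenvalues_on_def spectrum_eq using False by simp
  then have "ordered_eigenvalue A k = [] ! k" by (simp add: ordered_eigenvalue_def)
  moreover have "(top :: ennreal) \<noteq> of_nat l" for l using of_nat_less_top[of l] by auto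
  ultimately show ?thesis using ncnt_UNIV_infinite[OF False] by simp
next
  case True
  let ?L = "eigenvalues_on UNIV ((*v) A)"
  have s: "sorted ?L" unfolding eigenvalues_on_def by (intro sorted_concat_replicate) simp
  have n: "ncnt UNIV A = of_nat (length ?L)" using ncnt_eq_length[OF True, of UNIV] by simp
  have nc: "ncnt {..<c} A = of_nat (length (filter (\<lambda>x. x < c) ?L))" using ncnt_eq_length[OF True, of "{..<c}"] by simp
  show ?thesis
  proof (cases "k < length ?L")
    case k: True
    have "?L ! k < c \<longleftrightarrow> k < length (filter (\<lambda>x. x < c) ?L)"
      using sorted_nth_ge_iff[OF k s, of c] by linarith
    then show ?thesis unfolding ordered_eigenvalue_def n nc using k by auto
  next
    case k: False
    then have "?L ! k = [] ! (k - length ?L)" by (intro nth_beyond) simp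
    then show ?thesis unfolding ordered_eigenvalue_def n nc using k by auto
  qed
qed

lemma ordered_eigenvalue_measurable [measurable]:
  "(\<lambda>A::real^'n::finite^'n. ordered_eigenvalue A k) \<in> borel_measurable borel"
proof (subst borel_measurable_iff_less, intro allI)
  fix c :: real
  have [measurable]: "ncnt UNIV \<in> borel_measurable (borel :: (real^'n^'n) measure)"
    "ncnt {..<c} \<in> borel_measurable (borel :: (real^'n^'n) measure)"
    by (intro ncnt_measurable; simp)+
  show "{A \<in> space borel. ordered_eigenvalue (A::real^'n^'n) k < c} \<in> sets borel"
    unfolding ordered_eigenvalue_less_iff by measurable
qed

section \<open>Comparison of degree p with degree 2, and passage from closed to Borel sets\<close>

section \<open>Energies in a Borel set\<close>

text \<open>The quotient of \<open>cst\<close> in degrees \<open>p\<close> and 2, apart from the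
  exponential in the level.\<close>

definition ratio :: "'n::finite itself \<Rightarrow> nat \<Rightarrow> real" where
  "ratio _ p = sqrt (real p - 1) ^ CARD('n) / sqrt (real p) * sqrt 2"

lemma ratio_nonneg: "p \<ge> 2 \<Longrightarrow> ratio TYPE('n::finite) p \<ge> 0"
  by (simp add: ratio_def)

lemma cst_eq_2:
  assumes p: "p \<ge> 2" and r: "r > 0"
  shows "cst TYPE('n::finite) p r =
    ratio TYPE('n) p * exp (- ((real p - 2) / (4 * real p) * (ln r)\<^sup>2)) * cst TYPE('n) 2 r"
proof -
  let ?L = "ln r"
  \<comment> \<open>The exponents are compared through
    \<open>(p - 1) / (2 p) = (p - 2) / (4 p) + 1 / 4\<close>.\<close>
  have "- ((real p - 1) / real p * ?L\<^sup>2) / 2 = - ((real p - 2) / (4 * real p) * ?L\<^sup>2) + - ((real 2 - 1) / real 2 * ?L\<^sup>2) / 2"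
    using p by (simp add: field_simps)
  then have e: "exp (- ((real p - 1) / real p * ?L\<^sup>2) / 2) = exp (- ((real p - 2) / (4 * real p) * ?L\<^sup>2)) * exp (- ((real 2 - 1) / real 2 * ?L\<^sup>2) / 2)"
    by (metis exp_add)
  show ?thesis unfolding cst_def ratio_def e by (simp add: field_simps)
qed

lemma cst_nonneg: "p \<ge> 2 \<Longrightarrow> r > 0 \<Longrightarrow> cst TYPE('n::finite) p r \<ge> 0"
  by (simp add: cst_def)

text \<open>\<open>Psi\<close> is common to all degrees, so the whole dependence on \<open>p\<close>
  becomes a weight in the level.\<close>

lemma kr_eq_2:
  fixes i0 :: "'n::finite"
  assumes p: "p \<ge> 2"
  shows "kr i0 p K h = kr i0 2 K (\<lambda>\<tau>. ennreal (ratio TYPE('n) p * exp (- ((real p - 2) / (4 * real p) * \<tau>\<^sup>2))) * h \<tau>)"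
  unfolding kr_def
proof (intro nn_integral_cong)
  fix y :: "real^'n"
  show "indicator {y. y $ i0 \<noteq> 0} y * (h (ln (norm y)) * (ennreal (cst TYPE('n) p (norm y)) * Psi i0 K (ln (norm y)))) =
    indicator {y. y $ i0 \<noteq> 0} y * (ennreal (ratio TYPE('n) p * exp (- ((real p - 2) / (4 * real p) * (ln (norm y))\<^sup>2))) *
      h (ln (norm y)) * (ennreal (cst TYPE('n) 2 (norm y)) * Psi i0 K (ln (norm y))))"
  proof (cases "y $ i0 = 0")
    case False
    then have n: "norm y > 0" by auto
    have "ennreal (cst TYPE('n) p (norm y)) =
      ennreal (ratio TYPE('n) p * exp (- ((real p - 2) / (4 * real p) * (ln (norm y))\<^sup>2))) * ennreal (cst TYPE('n) 2 (norm y))"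
      unfolding cst_eq_2[OF p n] using ratio_nonneg[OF p, where 'n='n] cst_nonneg[OF _ n, of 2] by (intro ennreal_mult) auto
    then show ?thesis by (simp add: mult_ac)
  qed simp
qed

definition krd :: "'n::finite \<Rightarrow> nat \<Rightarrow> nat set \<Rightarrow> real^'n \<Rightarrow> ennreal" where
  "krd i0 p K y = indicator {y. y $ i0 \<noteq> 0} y * (ennreal (cst TYPE('n) p (norm y)) * Psi i0 K (ln (norm y)))"

lemma krd_measurable [measurable]: "krd i0 p K \<in> borel_measurable borel"
proof -
  have [measurable]: "{y::real^'n::finite. y $ i0 \<noteq> 0} \<in> sets borel" for i0
    by (intro borel_open open_Collect_neq continuous_intros)
  show ?thesis unfolding krd_def[abs_def] cst_def by measurable
qed

lemma kr_krd: "kr i0 p K h = (\<integral>\<^sup>+y. krd i0 p K y * h (ln (norm y)) \<partial>lborel)"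
  unfolding kr_def krd_def by (simp add: mult_ac)

lemma kr_distr:
  assumes h: "h \<in> borel_measurable borel"
  shows "kr i0 p K (\<lambda>\<tau>. h (a * \<tau>)) = (\<integral>\<^sup>+x. h x \<partial>distr (density lborel (krd i0 p K)) borel (\<lambda>y. a * ln (norm y)))"
  using h unfolding kr_krd by (subst nn_integral_distr) (auto simp: nn_integral_density)

lemma kr_mono: "(\<And>\<tau>. h \<tau> \<le> h' \<tau>) \<Longrightarrow> kr i0 p K h \<le> kr i0 p K h'"
  unfolding kr_krd by (intro nn_integral_mono mult_left_mono) auto

lemma kr_cmult: "h \<in> borel_measurable borel \<Longrightarrow> kr i0 p K (\<lambda>\<tau>. c * h \<tau>) = c * kr i0 p K h"
  unfolding kr_krd by (subst nn_integral_cmult[symmetric]) (auto simp: mult_ac)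

lemma kr_Un:
  assumes "K \<inter> L = {}" and h: "h \<in> borel_measurable borel"
  shows "kr i0 p (K \<union> L) h = kr i0 p K h + kr i0 p L h"
proof -
  have "Psi i0 (K \<union> L) \<tau> = Psi i0 K \<tau> + Psi i0 L \<tau>" for \<tau>
  proof -
    have "(\<lambda>g. (\<tau>, g)) \<in> borel \<rightarrow>\<^sub>M borel \<Otimes>\<^sub>M (borel :: ('a set \<Rightarrow> real) measure)" by measurable
    from measurable_compose[OF this Psi_integrand_measurable[of i0]]
    have m: "(\<lambda>g. ennreal (absdet (dmat i0 \<tau> g)) * indicator K (ind (tmat (axis i0 1) (wmat i0 g 0) \<tau>))) \<in> borel_measurable gam" for K
      by simp
    show ?thesis
      unfolding Psi_def using assms(1)
      by (subst nn_integral_add[symmetric, OF m m]) (auto intro!: nn_integral_cong simp: indicator_def)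
  qed
  then have "krd i0 p (K \<union> L) y = krd i0 p K y + krd i0 p L y" for y
    by (simp add: krd_def distrib_left)
  then show ?thesis unfolding kr_krd using h by (simp add: distrib_right nn_integral_add)
qed

text \<open>In degree 2 the count is almost surely at most \<open>2 * N\<close>; for larger
  \<open>p\<close> the additional exponential weight is at most 1.\<close>

lemma kr_atMost_finite:
  fixes i0 :: "'n::finite"
  assumes p: "p \<ge> 2"
  shows "kr i0 p {..k} (\<lambda>\<tau>. 1) < \<infinity>"
proof -
  have "kr i0 2 {..k} (\<lambda>\<tau>. 1) = (\<integral>\<^sup>+J. cnt i0 2 {..k} UNIV J \<partial>gam)"
    using nn_integral_cnt[of 2 UNIV i0 "{..k}"] cnt_measurable_closed[of UNIV i0 2 k] by simp
  also have "\<dots> \<le> (\<integral>\<^sup>+J. ennreal (2 * real CARD('n)) \<partial>(gam :: ('n list \<Rightarrow> real) measure))"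
    by (rule nn_integral_mono_AE) (use AE_cnt_2[of i0] in eventually_elim, auto)
  also have "\<dots> < \<infinity>"
  proof -
    have "emeasure (gam :: ('n list \<Rightarrow> real) measure) (space gam) = 1" by (rule gam.emeasure_space_1)
    then show ?thesis by (simp add: ennreal_mult_less_top)
  qed
  finally have 2: "kr i0 2 {..k} (\<lambda>\<tau>. 1) < \<infinity>" .
  have "kr i0 p {..k} (\<lambda>\<tau>. 1) \<le> kr i0 2 {..k} (\<lambda>\<tau>. ennreal (ratio TYPE('n) p) * 1)"
    unfolding kr_eq_2[OF p]
  proof (intro kr_mono mult_right_mono ennreal_leI)
    fix \<tau> :: real
    have "exp (- ((real p - 2) / (4 * real p) * \<tau>\<^sup>2)) \<le> 1" using p by simp
    then show "ratio TYPE('n) p * exp (- ((real p - 2) / (4 * real p) * \<tau>\<^sup>2)) \<le> ratio TYPE('n) p"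
      using ratio_nonneg[OF p, where 'n='n] mult_left_le by blast
  qed simp
  also have "\<dots> = ennreal (ratio TYPE('n) p) * kr i0 2 {..k} (\<lambda>\<tau>. 1)" by (rule kr_cmult) simp
  also have "\<dots> < \<infinity>" using 2 by (simp add: ennreal_mult_less_top)
  finally show ?thesis .
qed

text \<open>Closed sets generate the Borel sets, but complements require differences of finite counts.\<close>

definition good :: "'n \<Rightarrow> nat \<Rightarrow> ('n::finite list \<Rightarrow> real) set" where
  "good i0 p = {J. cnt i0 p {..CARD('n)} UNIV J < \<infinity>}"

text \<open>Replaces the count by 0 where the total is infinite, since subtraction in
  \<open>ennreal\<close> cancels only finite values.\<close>

definition gcnt :: "'n \<Rightarrow> nat \<Rightarrow> nat set \<Rightarrow> real set \<Rightarrow> ('n::finite list \<Rightarrow> real) \<Rightarrow> ennreal" where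
  "gcnt i0 p K B J = indicator (good i0 p) J * cnt i0 p K B J"

lemma good_measurable [measurable]: "good i0 p \<in> sets borel"
proof -
  have [measurable]: "cnt i0 p {..CARD('n)} UNIV \<in> borel_measurable (borel :: ('n::finite list \<Rightarrow> real) measure)" for i0
    by (rule cnt_measurable_closed) simp
  have "{J \<in> space borel. cnt i0 p {..CARD('n)} UNIV J < \<infinity>} \<in> sets (borel :: ('n::finite list \<Rightarrow> real) measure)" for i0
    by measurable
  then show ?thesis by (simp add: good_def)
qed

lemma AE_good:
  assumes p: "p \<ge> 2"
  shows "AE J in gam. J \<in> good i0 p"
proof -
  let ?c = "cnt i0 p {..CARD('a)} UNIV"
  have m: "?c \<in> borel_measurable borel" by (rule cnt_measurable_closed) simp
  have "(\<integral>\<^sup>+J. ?c J \<partial>gam) \<noteq> \<infinity>"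
    using nn_integral_cnt[OF p _ m] kr_atMost_finite[OF p, of i0 "CARD('a)"] by simp
  then have "AE J in gam. ?c J \<noteq> \<infinity>" using m by (intro nn_integral_PInf_AE) simp_all
  then show ?thesis by eventually_elim (simp add: good_def less_top)
qed

lemma nn_integral_gcnt_cong:
  assumes p: "p \<ge> 2"
  shows "(\<integral>\<^sup>+J. gcnt i0 p K B J \<partial>gam) = (\<integral>\<^sup>+J. cnt i0 p K B J \<partial>gam)"
  by (rule nn_integral_cong_AE, use AE_good[OF p, of i0] in eventually_elim, simp add: gcnt_def)

lemma cnt_mono: "K \<subseteq> L \<Longrightarrow> B \<subseteq> C \<Longrightarrow> cnt i0 p K B J \<le> cnt i0 p L C J"
  unfolding cnt_def by (intro emeasure_mono) auto

lemma cnt_Un: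
  assumes "(B \<inter> C = {} \<and> K = L \<and> K' = K \<and> B' = B \<union> C) \<or> (K \<inter> L = {} \<and> B = C \<and> K' = K \<union> L \<and> B' = B)"
  shows "cnt i0 p K' B' J = cnt i0 p K B J + cnt i0 p L C J"
  unfolding cnt_def using assms by (subst plus_emeasure) (auto intro!: arg_cong[where f="emeasure (count_space UNIV)"])

lemma gcnt_Un:
  assumes "(B \<inter> C = {} \<and> K = L \<and> K' = K \<and> B' = B \<union> C) \<or> (K \<inter> L = {} \<and> B = C \<and> K' = K \<union> L \<and> B' = B)"
  shows "gcnt i0 p K' B' J = gcnt i0 p K B J + gcnt i0 p L C J"
  unfolding gcnt_def cnt_Un[OF assms] by (rule distrib_left)

lemma gcnt_finite: "K \<subseteq> {..CARD('n)} \<Longrightarrow> gcnt i0 p K B J < \<infinity>" for i0 :: "'n::finite"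
  using cnt_mono[of K "{..CARD('n)}" B UNIV i0 p J] by (auto simp: gcnt_def good_def indicator_def)

lemma measurable_gam: "f \<in> measurable borel N \<Longrightarrow> f \<in> measurable gam N"
  by (simp cong: measurable_cong_sets)

text \<open>Measurability and the Kac-Rice identity as one property of a pair of sets, so that both
  pass together through differences and unions.\<close>

definition krok :: "'n::finite \<Rightarrow> nat \<Rightarrow> nat set \<Rightarrow> real set \<Rightarrow> bool" where
  "krok i0 p K B \<longleftrightarrow> gcnt i0 p K B \<in> borel_measurable borel \<and>
     (\<integral>\<^sup>+J. gcnt i0 p K B J \<partial>gam) = kr i0 p K (\<lambda>\<tau>. indicator B (en p TYPE('n) * \<tau>))"

text \<open>Both the count and the integral are additive and finite, hence can be subtracted. The
  disjunction covers a difference of energy sets and a difference of index sets by one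
  argument.\<close>

lemma krok_diff:
  fixes i0 :: "'n::finite"
  assumes p: "p \<ge> 2" and K: "K' \<subseteq> {..CARD('n)}" and a: "krok i0 p K' B'" and b: "krok i0 p K B"
    and d: "(B \<inter> C = {} \<and> K = L \<and> K' = K \<and> B' = B \<union> C) \<or> (K \<inter> L = {} \<and> B = C \<and> K' = K \<union> L \<and> B' = B)"
    and B: "B \<in> sets borel" "C \<in> sets borel"
  shows "krok i0 p L C"
proof -
  let ?h = "\<lambda>B \<tau>. indicator B (en p TYPE('n) * \<tau>) :: ennreal"
  have sum: "gcnt i0 p K' B' J = gcnt i0 p K B J + gcnt i0 p L C J" for J by (rule gcnt_Un[OF d])
  have KK: "K \<subseteq> {..CARD('n)}" using d K by auto
  have eq: "gcnt i0 p L C J = gcnt i0 p K' B' J - gcnt i0 p K B J" for J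
    unfolding sum using gcnt_finite[OF KK, of i0 p B J] by (simp add: ennreal_add_diff_cancel_left)
  have m: "gcnt i0 p L C \<in> borel_measurable borel"
    using a b unfolding krok_def eq[abs_def] by auto
  have "kr i0 p K' (?h B') = kr i0 p K (?h B) + kr i0 p L (?h C)"
  proof (cases "K \<inter> L = {} \<and> B = C \<and> K' = K \<union> L \<and> B' = B")
    case True
    then show ?thesis using B by (auto intro!: kr_Un)
  next
    case False
    then have "B \<inter> C = {}" "K = L" "K' = K" "B' = B \<union> C" using d by auto
    then have h: "indicator B' x = (indicator B x + indicator C x :: ennreal)" for x by (auto simp: indicator_def)
    show ?thesis unfolding kr_krd h \<open>K' = K\<close> unfolding \<open>K = L\<close> distrib_left
      using B by (intro nn_integral_add) auto
  qed
  moreover have "(\<integral>\<^sup>+J. gcnt i0 p K' B' J \<partial>gam) = (\<integral>\<^sup>+J. gcnt i0 p K B J \<partial>gam) + (\<integral>\<^sup>+J. gcnt i0 p L C J \<partial>gam)"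
    unfolding sum using b m by (intro nn_integral_add measurable_gam) (auto simp: krok_def)
  moreover have "kr i0 p K (?h B) < \<infinity>"
  proof -
    have "kr i0 p K (?h B) = (\<integral>\<^sup>+J. cnt i0 p K B J \<partial>gam)"
      using b unfolding krok_def nn_integral_gcnt_cong[OF p] by simp
    also have "\<dots> \<le> (\<integral>\<^sup>+J. cnt i0 p {..CARD('n)} UNIV J \<partial>gam)"
      using KK by (intro nn_integral_mono cnt_mono) auto
    also have "\<dots> = kr i0 p {..CARD('n)} (\<lambda>\<tau>. 1)"
      using nn_integral_cnt[OF p, of UNIV i0 "{..CARD('n)}"] cnt_measurable_closed[of UNIV i0 p "CARD('n)"] by simp
    also have "\<dots> < \<infinity>" by (rule kr_atMost_finite[OF p])
    finally show ?thesis .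
  qed
  ultimately have "(\<integral>\<^sup>+J. gcnt i0 p L C J \<partial>gam) = kr i0 p L (?h C)"
    using a b unfolding krok_def by (metis ennreal_add_left_cancel infinity_ennreal_def less_irrefl)
  then show ?thesis using m by (simp add: krok_def)
qed

text \<open>Closed sets are stable under intersection and generate the Borel sets; complements are
  differences from the whole line, countable disjoint unions are series.\<close>

lemma krok_atMost:
  fixes i0 :: "'n::finite"
  assumes p: "p \<ge> 2" and k: "k \<le> CARD('n)" and B: "B \<in> sets borel"
  shows "krok i0 p {..k} B"
proof -
  have cl: "krok i0 p {..k} C" if "closed C" for C
  proof -
    have m: "cnt i0 p {..k} C \<in> borel_measurable borel" by (rule cnt_measurable_closed[OF that])
    then have "gcnt i0 p {..k} C \<in> borel_measurable borel" unfolding gcnt_def[abs_def] by measurable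
    then show ?thesis
      unfolding krok_def nn_integral_gcnt_cong[OF p]
      using nn_integral_cnt[OF p borel_closed[OF that] m] by blast
  qed
  have sb: "sets borel = sigma_sets UNIV {C::real set. closed C}" by (simp add: borel_eq_closed)
  have st: "Int_stable {C::real set. closed C}" by (auto simp: Int_stable_def)
  have pw: "{C::real set. closed C} \<subseteq> Pow UNIV" by simp
  have "B \<in> sigma_sets UNIV {C::real set. closed C}" using B by (simp add: sb)
  then show ?thesis
  proof (induction rule: sigma_sets_induct_disjoint[OF st pw, consumes 1, case_names basic empty compl union])
    case (basic A)
    then show ?case using cl by simp
  next
    case empty
    show ?case by (rule cl) simp
  next
    case (compl A)
    have A: "A \<in> sets borel" using compl(1) by (simp add: sb)
    show ?case
      by (rule krok_diff[OF p _ cl[OF closed_UNIV] compl(2)]) (use k A in auto)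
  next
    case (union A)
    have A: "A i \<in> sets borel" for i using union(2) by (auto simp: sb)
    have s: "gcnt i0 p {..k} (\<Union>i. A i) J = (\<Sum>i. gcnt i0 p {..k} (A i) J)" for J
    proof -
      have "cnt i0 p {..k} (\<Union>i. A i) J = (\<Sum>i. cnt i0 p {..k} (A i) J)"
        unfolding cnt_def using union(1)
        by (subst suminf_emeasure) (auto simp: disjoint_family_on_def intro!: arg_cong[where f="emeasure (count_space UNIV)"])
      then show ?thesis unfolding gcnt_def by simp
    qed
    have h: "indicator (\<Union>i. A i) x = (\<Sum>i. indicator (A i) x :: ennreal)" for x
      using union(1) by (rule suminf_indicator[symmetric])
    have m: "gcnt i0 p {..k} (A i) \<in> borel_measurable borel" for i using union(3) by (simp add: krok_def)
    have "(\<integral>\<^sup>+J. (\<Sum>i. gcnt i0 p {..k} (A i) J) \<partial>gam) = (\<Sum>i. kr i0 p {..k} (\<lambda>\<tau>. indicator (A i) (en p TYPE('n) * \<tau>)))"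
      using union(3) m by (subst nn_integral_suminf) (auto simp: krok_def)
    also have "\<dots> = kr i0 p {..k} (\<lambda>\<tau>. indicator (\<Union>i. A i) (en p TYPE('n) * \<tau>))"
      unfolding kr_krd h using A by (subst nn_integral_suminf[symmetric]) auto
    finally show ?case unfolding krok_def s[abs_def] using m by auto
  qed
qed

lemma krok_single:
  fixes i0 :: "'n::finite"
  assumes p: "p \<ge> 2" and k: "k \<le> CARD('n)" and B: "B \<in> sets borel"
  shows "krok i0 p {k} B"
proof (cases k)
  case 0
  then show ?thesis using krok_atMost[OF p k B, of i0] by simp
next
  case (Suc m)
  show ?thesis
    by (rule krok_diff[OF p _ krok_atMost[OF p k B] krok_atMost[OF p _ B, of m]]) (use Suc k B in auto)
qed

section \<open>Identification of the level measure with an eigenvalue law, and conclusion\<close>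

section \<open>The expected number of critical points\<close>

lemma en_2: "en 2 TYPE('n::finite) = 1 / sqrt (2 * real CARD('n))"
  by (simp add: en_def kap_def real_sqrt_mult real_div_sqrt field_simps)

lemma kr_2_indicator:
  fixes i0 :: "'n::finite"
  assumes k: "k < CARD('n)" and B: "B \<in> sets borel"
  shows "kr i0 2 {k} (\<lambda>\<tau>. indicator B (en 2 TYPE('n) * \<tau>)) =
    2 * (\<integral>\<^sup>+A. indicator B (ordered_eigenvalue (A :: real^'n^'n) k) \<partial>goe)"
proof -
  let ?a = "1 / (2 * sqrt (real CARD('n)))"
  have a: "?a > 0" by simp
  let ?F = "\<lambda>A :: real^'n^'n. indicator B (ordered_eigenvalue A k) :: ennreal"
  have F: "?F \<in> borel_measurable borel" using B by simp
  have "kr i0 2 {k} (\<lambda>\<tau>. indicator B (en 2 TYPE('n) * \<tau>)) = (\<integral>\<^sup>+J. cnt i0 2 {k} B J \<partial>gam)"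
    using krok_single[of 2 k B i0] k B unfolding krok_def by (simp add: nn_integral_gcnt_cong[symmetric])
  also have "\<dots> = (\<integral>\<^sup>+J. 2 * ?F (?a *\<^sub>R phess 2 J 0) \<partial>gam)"
  proof (rule nn_integral_cong_AE, use AE_cnt_2[of i0] in eventually_elim)
    case (elim J)
    then have "cnt i0 2 {k} B J = 2 * indicator B (ordered_eigenvalue (phess 2 J 0) k / (2 * sqrt (real CARD('n))))"
      using k by blast
    also have "ordered_eigenvalue (phess 2 J 0) k / (2 * sqrt (real CARD('n))) = ordered_eigenvalue (?a *\<^sub>R phess 2 J 0) k"
      unfolding ordered_eigenvalue_scale[OF transpose_phess k a] by simp
    finally show ?case .
  qed
  also have "\<dots> = 2 * (\<integral>\<^sup>+A. ?F A \<partial>goe)"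
    using phess_2_goe[of "\<lambda>A. 2 * ?F A"] F by (simp add: nn_integral_cmult goe_def)
  finally show ?thesis .
qed

text \<open>The count in degree 2 identifies, set by set, the image of the Kac-Rice measure on the
  line with twice the law of the eigenvalue. The identity then holds for all measurable weights, in
  particular for the exponential one that encodes degree \<open>p\<close>.\<close>

lemma kr_2_goe:
  fixes i0 :: "'n::finite"
  assumes k: "k < CARD('n)" and h: "h \<in> borel_measurable borel"
  shows "kr i0 2 {k} (\<lambda>\<tau>. h (en 2 TYPE('n) * \<tau>)) = 2 * (\<integral>\<^sup>+A. h (ordered_eigenvalue (A :: real^'n^'n) k) \<partial>goe)"
proof -
  let ?D = "distr (density lborel (krd i0 2 {k})) borel (\<lambda>y. en 2 TYPE('n) * ln (norm y))"
  let ?G = "distr goe borel (\<lambda>A :: real^'n^'n. ordered_eigenvalue A k)"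
  have sg: "sets (goe :: (real^'n^'n) measure) = sets borel" by (simp add: goe_def)
  have m: "(\<lambda>A :: real^'n^'n. ordered_eigenvalue A k) \<in> borel_measurable goe"
    using ordered_eigenvalue_measurable by (simp cong: measurable_cong_sets add: sg)
  have "?D = scale_measure 2 ?G"
  proof (rule measure_eqI)
    fix B assume "B \<in> sets ?D"
    then have B: "B \<in> sets borel" by simp
    have "emeasure ?D B = (\<integral>\<^sup>+x. indicator B x \<partial>?D)" using B by simp
    also have "\<dots> = kr i0 2 {k} (\<lambda>\<tau>. indicator B (en 2 TYPE('n) * \<tau>))"
      using B by (intro kr_distr[symmetric]) simp
    also have "\<dots> = 2 * (\<integral>\<^sup>+x. indicator B x \<partial>?G)"
      unfolding kr_2_indicator[OF k B] using B by (subst nn_integral_distr[OF m]) simp_all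
    finally show "emeasure ?D B = emeasure (scale_measure 2 ?G) B" using B by simp
  qed simp
  then have "kr i0 2 {k} (\<lambda>\<tau>. h (en 2 TYPE('n) * \<tau>)) = (\<integral>\<^sup>+x. h x \<partial>scale_measure 2 ?G)"
    using kr_distr[OF h, of i0 2 "{k}" "en 2 TYPE('n)"] by (simp only:)
  also have "\<dots> = 2 * (\<integral>\<^sup>+x. h x \<partial>?G)" using h by (intro nn_integral_scale_measure) simp
  finally show ?thesis using h by (subst (asm) nn_integral_distr[OF m]) simp_all
qed

lemma scaled_mem_iff:
  assumes p: "p \<ge> (2::nat)"
  shows "x \<in> (\<lambda>x. sqrt (real p / (2 * (real p - 1))) * x) ` B \<longleftrightarrow> sqrt (2 * (real p - 1) / real p) * x \<in> B"
proof -
  have c: "sqrt (real p / (2 * (real p - 1))) * sqrt (2 * (real p - 1) / real p) = 1"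
    using p by (simp add: real_sqrt_mult[symmetric])
  show ?thesis
  proof
    assume "x \<in> (\<lambda>x. sqrt (real p / (2 * (real p - 1))) * x) ` B"
    then obtain b where "b \<in> B" "x = sqrt (real p / (2 * (real p - 1))) * b" by auto
    then show "sqrt (2 * (real p - 1) / real p) * x \<in> B" using c by (metis mult.assoc mult.commute mult_1)
  next
    assume "sqrt (2 * (real p - 1) / real p) * x \<in> B"
    moreover have "x = sqrt (real p / (2 * (real p - 1))) * (sqrt (2 * (real p - 1) / real p) * x)"
      using c by (metis mult.assoc mult_1)
    ultimately show "x \<in> (\<lambda>x. sqrt (real p / (2 * (real p - 1))) * x) ` B" by blast
  qed
qed

lemma nn_integral_cnt_goe:
  fixes i0 :: "'n::finite"
  assumes p: "p \<ge> 2" and k: "k < CARD('n)" and B: "B \<in> sets borel"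
  shows "(\<integral>\<^sup>+J. cnt i0 p {k} B J \<partial>gam) = 2 * (\<integral>\<^sup>+A. ennreal (ratio TYPE('n) p *
      exp (- real CARD('n) * ((real p - 2) / (2 * real p)) * (ordered_eigenvalue (A :: real^'n^'n) k)\<^sup>2)) *
      indicator ((\<lambda>x. sqrt (real p / (2 * (real p - 1))) * x) ` B) (ordered_eigenvalue A k) \<partial>goe)"
proof -
  let ?B = "(\<lambda>x. sqrt (real p / (2 * (real p - 1))) * x) ` B"
  define h :: "real \<Rightarrow> ennreal" where
    "h x = ennreal (ratio TYPE('n) p * exp (- real CARD('n) * ((real p - 2) / (2 * real p)) * x\<^sup>2)) * indicator ?B x" for x
  have "?B = (\<lambda>x. sqrt (2 * (real p - 1) / real p) * x) -` B \<inter> space borel"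
    using scaled_mem_iff[OF p] by auto
  also have "\<dots> \<in> sets borel" using B by (intro measurable_sets[of _ borel borel]) auto
  finally have [measurable]: "?B \<in> sets borel" .
  have hm: "h \<in> borel_measurable borel" unfolding h_def[abs_def] by measurable
  have "(\<integral>\<^sup>+J. cnt i0 p {k} B J \<partial>gam) = kr i0 p {k} (\<lambda>\<tau>. indicator B (en p TYPE('n) * \<tau>))"
    using krok_single[OF p _ B, of k i0] k unfolding krok_def by (simp add: nn_integral_gcnt_cong[OF p])
  also have "\<dots> = kr i0 2 {k} (\<lambda>\<tau>. h (en 2 TYPE('n) * \<tau>))"
    unfolding kr_eq_2[OF p]
  proof (intro arg_cong[where f="kr i0 2 {k}"] ext)
    fix \<tau> :: real
    \<comment> \<open>In the eigenvalue variable \<open>x = en 2 * \<tau>\<close> the weight becomes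
      the exponential of the theorem, because
      \<open>\<tau>\<^sup>2 = 2 * N * x\<^sup>2\<close>.\<close>
    have sq: "(en 2 TYPE('n) * \<tau>)\<^sup>2 = \<tau>\<^sup>2 / (2 * real CARD('n))"
      by (simp add: en_2 power_mult_distrib power_divide)
    have e: "- real CARD('n) * ((real p - 2) / (2 * real p)) * (en 2 TYPE('n) * \<tau>)\<^sup>2 = - ((real p - 2) / (4 * real p) * \<tau>\<^sup>2)"
      unfolding sq using p by (simp add: field_simps)
    \<comment> \<open>The ratio of the energy scales in degrees \<open>p\<close> and 2 is the
      inverse of the factor by which \<open>B\<close> is dilated.\<close>
    have "sqrt (2 * (real p - 1) / real p) * en 2 TYPE('n) = en p TYPE('n)"
    proof -
      have "kap p / real p = sqrt ((real p - 1) / real p)"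
      proof -
        have "sqrt (real p) * sqrt (real p - 1) * sqrt (real p) = sqrt (real p - 1) * (sqrt (real p) * sqrt (real p))"
          by (simp only: mult_ac)
        then have "sqrt (real p) * sqrt (real p - 1) * sqrt (real p) = sqrt (real p - 1) * real p" by simp
        then show ?thesis
          unfolding kap_def real_sqrt_mult real_sqrt_divide using p by (subst frac_eq_eq) auto
      qed
      then have "en p TYPE('n) = sqrt ((real p - 1) / real p) / sqrt (real CARD('n))"
        by (simp add: en_def divide_divide_eq_left[symmetric])
      moreover have "sqrt (2 * (real p - 1) / real p) = sqrt 2 * sqrt ((real p - 1) / real p)"
        by (simp add: real_sqrt_mult[symmetric])
      ultimately show ?thesis by (simp add: en_2 real_sqrt_mult)
    qed
    then have "en 2 TYPE('n) * \<tau> \<in> ?B \<longleftrightarrow> en p TYPE('n) * \<tau> \<in> B"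
      unfolding scaled_mem_iff[OF p] by (simp add: mult.assoc[symmetric])
    then show "ennreal (ratio TYPE('n) p * exp (- ((real p - 2) / (4 * real p) * \<tau>\<^sup>2))) * indicator B (en p TYPE('n) * \<tau>) = h (en 2 TYPE('n) * \<tau>)"
      unfolding h_def e by (simp add: indicator_def)
  qed
  also have "\<dots> = 2 * (\<integral>\<^sup>+A. h (ordered_eigenvalue (A :: real^'n^'n) k) \<partial>goe)" by (rule kr_2_goe[OF k hm])
  finally show ?thesis unfolding h_def .
qed

lemma cnt_cong:
  assumes "\<And>l. length l = p \<Longrightarrow> J l = K l"
  shows "cnt i0 p L B J = cnt i0 p L B K"
proof -
  have "pgrad p J = pgrad p K" "phess p J = phess p K"
    by (intro ext pgrad_cong phess_cong assms; assumption)+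
  then show ?thesis by (simp add: cnt_def enc_crit_def enc_index_def)
qed

lemma crt_eq_cnt:
  fixes J :: "'n::finite list \<Rightarrow> real"
  assumes p: "p \<ge> 2" and nz: "\<And>y. y \<in> enc_crit p J \<Longrightarrow> y $ i0 \<noteq> 0"
  shows "crt (spin_hamiltonian p J) k B = cnt i0 p {k} B J"
  unfolding crt_eq_enc_crit[OF p] cnt_def using nz by (auto intro!: arg_cong[where f="emeasure (count_space UNIV)"])

text \<open>Nothing is known about \<open>J\<close> off length \<open>p\<close>, so \<open>X\<close>
  puts 0 there. The count agrees with \<open>cnt\<close> outside two null events: a zero on the
  hyperplane \<open>y $ i0 = 0\<close>, and an infinite total.\<close>

lemma (in prob_space) nn_integral_crt:
  fixes J :: "'n::finite list \<Rightarrow> 'a \<Rightarrow> real" and i0 :: 'n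
  assumes p: "p \<ge> 2" and k: "k < CARD('n)" and B: "B \<in> sets borel"
    and ind: "indep_vars (\<lambda>_. borel) J {is. length is = p}"
    and g: "\<And>is. length is = p \<Longrightarrow> distributed M lborel (J is) std_normal_density"
  shows "(\<integral>\<^sup>+\<omega>. crt (spin_hamiltonian p (\<lambda>is. J is \<omega>)) k B \<partial>M) = (\<integral>\<^sup>+J. cnt i0 p {k} B J \<partial>gam)"
proof -
  define X :: "'a \<Rightarrow> 'n list \<Rightarrow> real" where "X \<omega> l = (if length l = p then J l \<omega> else 0)" for \<omega> l
  have X [measurable]: "X \<in> borel_measurable M"
  proof (rule borel_measurable_funI)
    fix l
    have "J l \<in> borel_measurable M" if "length l = p" using g[OF that] by (auto simp: distributed_def)
    then show "(\<lambda>\<omega>. X \<omega> l) \<in> borel_measurable M" by (cases "length l = p") (simp_all add: X_def)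
  qed
  have law: "(\<integral>\<^sup>+\<omega>. F (X \<omega>) \<partial>M) = (\<integral>\<^sup>+J. F J \<partial>gam)"
    if F: "F \<in> borel_measurable borel" and dep: "\<And>J K. (\<And>l. length l = p \<Longrightarrow> J l = K l) \<Longrightarrow> F J = F K" for F
  proof (rule nn_integral_indep_gauss[OF ind _ _ F])
    show "distributed M lborel (J e) (\<lambda>x. ennreal (std_normal_density x))" if "e \<in> {is. length is = p}" for e
      using g that by simp
    have "replicate p i0 \<in> {is. length is = p}" by simp
    then show "{is :: 'n list. length is = p} \<noteq> {}" by (metis empty_iff)
    show "F h = F k" if "\<And>e. e \<in> {is. length is = p} \<Longrightarrow> h e = k e" for h k using that by (intro dep) simp
    show "X x e = J e x" if "e \<in> {is. length is = p}" for e x using that by (simp add: X_def)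
  qed
  \<comment> \<open>Only integrals of functionals of the coefficients of length \<open>p\<close> are
    known to agree; an almost sure statement is moved as the vanishing of such a functional.\<close>
  have transfer: "AE \<omega> in M. F (X \<omega>) = 0"
    if F: "F \<in> borel_measurable borel" and dep: "\<And>J K. (\<And>l. length l = p \<Longrightarrow> J l = K l) \<Longrightarrow> F J = F K"
      and z: "AE J in gam. F J = 0" for F :: "_ \<Rightarrow> ennreal"
  proof -
    have "(\<integral>\<^sup>+\<omega>. F (X \<omega>) \<partial>M) = (\<integral>\<^sup>+J. F J \<partial>gam)" by (rule law[OF F dep])
    also have "\<dots> = 0" using z measurable_gam[OF F] by (simp add: nn_integral_0_iff_AE)
    finally have "(\<integral>\<^sup>+\<omega>. F (X \<omega>) \<partial>M) = 0" .
    moreover have "(\<lambda>\<omega>. F (X \<omega>)) \<in> borel_measurable M" by (rule measurable_compose[OF X F])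
    ultimately show ?thesis by (simp add: nn_integral_0_iff_AE)
  qed
  \<comment> \<open>The number of zeros that the block based at \<open>i0\<close> misses.\<close>
  let ?T = "\<lambda>J. emeasure (count_space UNIV) {y \<in> {y. y \<noteq> 0}. (J, y) \<in> {(J, y). y \<in> enc_crit p J \<and> y $ i0 = 0}}"
  have "AE \<omega> in M. ?T (X \<omega>) = 0"
  proof (rule transfer)
    show "?T \<in> borel_measurable borel"
    proof (rule count_closed_measurable)
      show "open {y::real^'n. y \<noteq> 0}" by (intro open_Collect_neq continuous_intros)
      fix K :: "(real^'n) set" assume K: "compact K" "K \<subseteq> {y. y \<noteq> 0}"
      have K': "closed K" "0 \<notin> K" using K by (auto intro: compact_imp_closed)
      have "closed {y::real^'n. y $ i0 = 0}" by (intro closed_Collect_eq continuous_intros)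
      then have "closed ({(J, y). y \<in> K \<and> y \<in> enc_crit p J} \<inter> UNIV \<times> {y. y $ i0 = 0})"
        by (intro closed_Int closed_enc_crit K' closed_Times) auto
      also have "\<dots> = {(J, y). y \<in> enc_crit p J \<and> y $ i0 = 0} \<inter> UNIV \<times> K" by auto
      finally show "closed ({(J, y). y \<in> enc_crit p J \<and> y $ i0 = 0} \<inter> UNIV \<times> K)" .
    qed
    show "?T J = ?T K" if "\<And>l. length l = p \<Longrightarrow> J l = K l" for J K
    proof -
      have "pgrad p J = pgrad p K" by (intro ext pgrad_cong that)
      then show ?thesis by (simp add: enc_crit_def)
    qed
    show "AE J in gam. ?T J = 0"
      using AE_component_nonzero[OF p, of i0] by eventually_elim (auto simp: emeasure_count_space_eq_0)
  qed
  moreover have "AE \<omega> in M. indicator (- good i0 p) (X \<omega>) = (0::ennreal)"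
  proof (rule transfer)
    show "indicator (- good i0 p) \<in> borel_measurable borel" by simp
    show "indicator (- good i0 p) J = (indicator (- good i0 p) K :: ennreal)" if "\<And>l. length l = p \<Longrightarrow> J l = K l" for J K
      proof -
      have "cnt i0 p L C J = cnt i0 p L C K" for L C by (rule cnt_cong) (rule that)
      then show ?thesis unfolding indicator_def good_def by simp
    qed
    show "AE J in gam. indicator (- good i0 p) J = (0::ennreal)"
      using AE_good[OF p, of i0] by eventually_elim simp
  qed
  ultimately have "AE \<omega> in M. crt (spin_hamiltonian p (\<lambda>is. J is \<omega>)) k B = gcnt i0 p {k} B (X \<omega>)"
  proof eventually_elim
    case (elim \<omega>)
    have "y $ i0 \<noteq> 0" if "y \<in> enc_crit p (X \<omega>)" for y
    proof
      assume "y $ i0 = 0"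
      then have "y \<in> {y \<in> {y. y \<noteq> 0}. (X \<omega>, y) \<in> {(J, y). y \<in> enc_crit p J \<and> y $ i0 = 0}}"
        using that by (auto simp: enc_crit_def)
      then show False using elim(1) by (auto simp: emeasure_count_space_eq_0)
    qed
    from crt_eq_cnt[OF p this] have "crt (spin_hamiltonian p (X \<omega>)) k B = cnt i0 p {k} B (X \<omega>)" .
    moreover have "spin_hamiltonian p (X \<omega>) = spin_hamiltonian p (\<lambda>is. J is \<omega>)"
      by (simp add: spin_hamiltonian_def X_def fun_eq_iff)
    ultimately show ?case using elim(2) by (simp add: gcnt_def indicator_def split: if_splits)
  qed
  then have "(\<integral>\<^sup>+\<omega>. crt (spin_hamiltonian p (\<lambda>is. J is \<omega>)) k B \<partial>M) = (\<integral>\<^sup>+\<omega>. gcnt i0 p {k} B (X \<omega>) \<partial>M)"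
    by (rule nn_integral_cong_AE)
  also have "\<dots> = (\<integral>\<^sup>+J. gcnt i0 p {k} B J \<partial>gam)"
  proof (rule law)
    show "gcnt i0 p {k} B \<in> borel_measurable borel"
      using krok_single[OF p _ B, of k i0] k by (simp add: krok_def)
    show "gcnt i0 p {k} B J = gcnt i0 p {k} B K" if "\<And>l. length l = p \<Longrightarrow> J l = K l" for J K
      proof -
      have "cnt i0 p L C J = cnt i0 p L C K" for L C by (rule cnt_cong) (rule that)
      then show ?thesis unfolding gcnt_def indicator_def good_def by simp
    qed
  qed
  finally show ?thesis unfolding nn_integral_gcnt_cong[OF p] .
qed

lemma prob_space_goe: "prob_space (goe :: (real^'n::finite^'n) measure)"
proof (rule prob_spaceI)
  have "emeasure (goe :: (real^'n^'n) measure) (space goe) = (\<integral>\<^sup>+A. 1 \<partial>(goe :: (real^'n^'n) measure))" by simp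
  also have "\<dots> = (\<integral>\<^sup>+g. 1 \<partial>(gam :: ('n set \<Rightarrow> real) measure))" by (rule goe_law) simp
  also have "\<dots> = 1" using gam.emeasure_space_1 by simp
  finally show "emeasure (goe :: (real^'n^'n) measure) (space goe) = 1" .
qed

theorem theorem2p1:
  fixes M :: "'a measure"
    and J :: "'n::finite list \<Rightarrow> 'a \<Rightarrow> real"
    and p k :: nat
    and B :: "real set"
  assumes "prob_space M"
    and "p \<ge> 2"
    and "k < CARD('n)"
    and "B \<in> sets borel"
    and "prob_space.indep_vars M (\<lambda>_. borel) J {is. length is = p}"
    and "\<And>is. length is = p \<Longrightarrow> distributed M lborel (J is) std_normal_density"
  shows "(\<integral>\<^sup>+ \<omega>. crt (spin_hamiltonian p (\<lambda>is. J is \<omega>)) k B \<partial>M) =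
    ennreal (2 * sqrt (2 / real p) * (real p - 1) powr (real CARD('n) / 2) *
      (\<integral>A. exp (- real CARD('n) * ((real p - 2) / (2 * real p)) *
                 (ordered_eigenvalue (A :: real ^ 'n ^ 'n) k)\<^sup>2) *
            indicator ((\<lambda>x. sqrt (real p / (2 * (real p - 1))) * x) ` B)
              (ordered_eigenvalue A k) \<partial>goe))"
proof -
  interpret prob_space M by fact
  interpret goe: prob_space "goe :: (real^'n^'n) measure" by (rule prob_space_goe)
  note p = \<open>p \<ge> 2\<close>
  define i0 :: 'n where "i0 = undefined"
  let ?B = "(\<lambda>x. sqrt (real p / (2 * (real p - 1))) * x) ` B"
  define f where "f A = exp (- real CARD('n) * ((real p - 2) / (2 * real p)) * (ordered_eigenvalue A k)\<^sup>2) *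
    indicator ?B (ordered_eigenvalue A k)" for A :: "real^'n^'n"
  have fe: "f = (\<lambda>A. exp (- real CARD('n) * ((real p - 2) / (2 * real p)) * (ordered_eigenvalue A k)\<^sup>2) *
      indicator ?B (ordered_eigenvalue A k))"
    by (rule ext) (rule f_def)
  have sg: "sets (goe :: (real^'n^'n) measure) = sets borel" by (simp add: goe_def)
  have "?B = (\<lambda>x. sqrt (2 * (real p - 1) / real p) * x) -` B \<inter> space borel"
    using scaled_mem_iff[OF p] by auto
  also have "\<dots> \<in> sets borel" using \<open>B \<in> sets borel\<close> by (intro measurable_sets[of _ borel borel]) auto
  finally have [measurable]: "?B \<in> sets borel" .
  have "f \<in> borel_measurable borel" unfolding f_def[abs_def] by measurable
  then have fm: "f \<in> borel_measurable goe" by (simp cong: measurable_cong_sets add: sg)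
  have f01: "0 \<le> f A" "f A \<le> 1" for A
  proof -
    have "exp (- real CARD('n) * ((real p - 2) / (2 * real p)) * (ordered_eigenvalue A k)\<^sup>2) \<le> 1"
      using p by simp
    then show "0 \<le> f A" "f A \<le> 1" by (auto simp: f_def indicator_def)
  qed
  have int: "integrable goe f"
    using f01 fm by (intro goe.integrable_const_bound[where B=1]) auto
  have I: "(\<integral>\<^sup>+A. ennreal (f A) \<partial>goe) = ennreal (integral\<^sup>L goe f)"
    using f01 by (intro nn_integral_eq_integral int) auto
  \<comment> \<open>The remaining factor 2 of the theorem is carried separately: it counts the two
    antipodal points on each eigenline in degree 2.\<close>
  have r: "ratio TYPE('n) p = sqrt (2 / real p) * (real p - 1) powr (real CARD('n) / 2)"
  proof -
    have "(real p - 1) powr (real CARD('n) / 2) = sqrt (real p - 1) ^ CARD('n)"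
      using p by (simp add: powr_half_sqrt[symmetric] powr_realpow[symmetric] powr_powr)
    then show ?thesis by (simp add: ratio_def real_sqrt_divide)
  qed
  have "(\<integral>\<^sup>+ \<omega>. crt (spin_hamiltonian p (\<lambda>is. J is \<omega>)) k B \<partial>M) = (\<integral>\<^sup>+J. cnt i0 p {k} B J \<partial>gam)"
    by (rule nn_integral_crt) fact+
  also have "\<dots> = 2 * (\<integral>\<^sup>+A. ennreal (ratio TYPE('n) p) * ennreal (f A) \<partial>goe)"
    unfolding nn_integral_cnt_goe[OF assms(2-4)]
  proof (intro arg_cong[where f="(*) 2"] nn_integral_cong)
    fix A :: "real^'n^'n"
    show "ennreal (ratio TYPE('n) p * exp (- real CARD('n) * ((real p - 2) / (2 * real p)) * (ordered_eigenvalue A k)\<^sup>2)) *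
      indicator ?B (ordered_eigenvalue A k) = ennreal (ratio TYPE('n) p) * ennreal (f A)"
      using ratio_nonneg[OF p, where 'n='n] by (simp add: f_def ennreal_mult' indicator_def)
  qed
  also have "\<dots> = 2 * (ennreal (ratio TYPE('n) p) * ennreal (integral\<^sup>L goe f))"
    using fm by (simp add: nn_integral_cmult I)
  also have "\<dots> = ennreal (2 * (ratio TYPE('n) p * integral\<^sup>L goe f))"
    using ratio_nonneg[OF p, where 'n='n] f01 by (simp add: ennreal_mult' integral_nonneg_AE)
  finally show ?thesis unfolding r fe by (simp only: mult.assoc)
qed

end
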